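(* Let $X$ be a non-singular complex surface and let $k,m$ be positive integers. Fix a total ordering of the index set $$\mathcal{I}_{km}=\{I=(i_1,\dots,i_k)\mid i_j\in\mathbf{Z}_{\ge 0},\ i_1+2i_2+\cdots+ki_k=m\},$$ and for $I\in\mathcal{I}_{km}$ put $\mathcal{S}_I=\odot^{i_1}T^*X\otimes\cdots\otimes\odot^{i_k}T^*X$. Then $$c_1(\mathcal{J}_k^mX)=\sum_{I\in\mathcal{I}_{km}}c_1(\mathcal{S}_I),$$ $$c_2(\mathcal{J}_k^mX)=\sum_{I\in\mathcal{I}_{km}}c_2(\mathcal{S}_I)+\sum_{I<J,\ I,J\in\mathcal{I}_{km}}c_1(\mathcal{S}_I)\,c_1(\mathcal{S}_J).$$
   Context: $\odot^i$ denotes the $i$-fold symmetric product. Restricted jet bundle: $J^kX$ is the set of equivalence classes $j^kf(0)$ of germs of holomorphic maps $f:(\mathbf{C},0)\to X$, where $f\sim_k g$ iff $f(0)=g(0)$ and, in local coordinates, $f^{(p)}(0)=g^{(p)}(0)$ for $1\le p\le k$; it carries the $\mathbf{C}^*$-action $\lambda\cdot j^kf(0)=(f(0),\lambda f'(0),\dots,\lambda^kf^{(k)}(0))$. $\mathcal{J}_k^mX$ is the (locally free) sheaf of $k$-jet differentials of weight $m$: germs of functions on $J^kX$ of the form $\omega(j^kf)=\sum_{|I_1|+2|I_2|+\cdots+k|I_k|=m}a_{I_1,\dots,I_k}(f)(f')^{I_1}\cdots(f^{(k)})^{I_k}$ with holomorphic coefficients, so that $\omega(\lambda\cdot j^kf)=\lambda^m\omega(j^kf)$.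 *)

theory Defs
  imports "HOL-Analysis.Analysis" "HOL-Algebra.QuotRing"
begin

section \<open>Complex surfaces\<close>

text \<open>A chart is an open set together with a coordinate map to \<open>\<complex>\<^sup>2\<close>; values of the map outside the
  set are irrelevant. The surface is the whole space of type \<open>'a\<close>.\<close>

type_synonym 'a chart = "'a set \<times> ('a \<Rightarrow> complex ^ 2)"

definition holo_on :: "(complex ^ 2 \<Rightarrow> complex) \<Rightarrow> (complex ^ 2) set \<Rightarrow> bool" where
  "holo_on f S \<longleftrightarrow>
     (\<forall>z\<in>S. \<exists>f'. (f has_derivative f') (at z) \<and> (\<forall>c v. f' (c *s v) = c * f' v))"

definition complex_surface ::
    "('a::{t2_space,second_countable_topology}) chart set \<Rightarrow> bool" where
  "complex_surface A \<longleftrightarrow>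
     (\<Union>(U, \<phi>)\<in>A. U) = UNIV \<and>
     (\<forall>(U, \<phi>)\<in>A. open U \<and> open (\<phi> ` U) \<and> homeomorphism U (\<phi> ` U) \<phi> (inv_into U \<phi>)) \<and>
     (\<forall>(U, \<phi>)\<in>A. \<forall>(V, \<psi>)\<in>A. \<forall>i. holo_on (\<lambda>z. \<psi> (inv_into U \<phi> z) $ i) (\<phi> ` (U \<inter> V)))"

definition holo_fun :: "'a chart set \<Rightarrow> 'a set \<Rightarrow> ('a \<Rightarrow> complex) \<Rightarrow> bool" where
  "holo_fun A W h \<longleftrightarrow> (\<forall>(U, \<phi>)\<in>A. holo_on (\<lambda>z. h (inv_into U \<phi> z)) (\<phi> ` (U \<inter> W)))"


section \<open>Jets of holomorphic curves\<close>

text \<open>Germs are represented by arbitrary functions on \<open>\<complex>\<close> that are holomorphic near \<open>0\<close>;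
  everything below only depends on their behaviour near \<open>0\<close>.\<close>

definition holo_germ :: "('a::topological_space) chart set \<Rightarrow> (complex \<Rightarrow> 'a) \<Rightarrow> bool" where
  "holo_germ A f \<longleftrightarrow>
     (\<forall>(U, \<phi>)\<in>A. f 0 \<in> U \<longrightarrow>
        (\<forall>\<^sub>F t in nhds 0. f t \<in> U) \<and> (\<forall>i. (\<lambda>t. \<phi> (f t) $ i) analytic_on {0}))"

definition jet_coord :: "('a \<Rightarrow> complex ^ 2) \<Rightarrow> nat \<Rightarrow> 2 \<Rightarrow> (complex \<Rightarrow> 'a) \<Rightarrow> complex" where
  "jet_coord \<phi> p i f = (deriv ^^ p) (\<lambda>t. \<phi> (f t) $ i) 0"

definition jet_rel ::
    "('a::topological_space) chart set \<Rightarrow> nat \<Rightarrow> ((complex \<Rightarrow> 'a) \<times> (complex \<Rightarrow> 'a)) set" where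
  "jet_rel A k =
     {(f, g). holo_germ A f \<and> holo_germ A g \<and> f 0 = g 0 \<and>
        (\<forall>(U, \<phi>)\<in>A. f 0 \<in> U \<longrightarrow>
           (\<forall>p\<in>{1..k}. \<forall>i. jet_coord \<phi> p i f = jet_coord \<phi> p i g))}"

definition jet ::
    "('a::topological_space) chart set \<Rightarrow> nat \<Rightarrow> (complex \<Rightarrow> 'a) \<Rightarrow> (complex \<Rightarrow> 'a) set" where
  "jet A k f = jet_rel A k `` {f}"

text \<open>The fibre of \<open>J\<^sup>kX\<close> over \<open>x\<close>. For \<open>k = 1\<close> this is the tangent space \<open>T\<^sub>xX\<close>, with linear
  coordinates \<open>jet_coord \<phi> 1\<close>.\<close>

definition jets_at ::
    "('a::topological_space) chart set \<Rightarrow> nat \<Rightarrow> 'a \<Rightarrow> (complex \<Rightarrow> 'a) set set" where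
  "jets_at A k x = {f. holo_germ A f \<and> f 0 = x} // jet_rel A k"


section \<open>Sheaves of modules\<close>

text \<open>All sheaves are sheaves of \<open>\<O>\<^sub>X\<close>-modules whose sections are functions: the value of a section
  \<open>s\<close> at \<open>x\<close> is a complex-valued function \<open>s x\<close> on a fibre over \<open>x\<close>. A section over \<open>W\<close> is
  normalised to be zero at points outside \<open>W\<close> and at arguments outside the fibre, so that
  equality of sections is equality of functions.\<close>

type_synonym ('a, 't) sheaf = "'a set \<Rightarrow> ('a \<Rightarrow> 't \<Rightarrow> complex) set"

definition cotangent :: "('a::topological_space) chart set \<Rightarrow> ('a, (complex \<Rightarrow> 'a) set) sheaf" where
  "cotangent A W =
     {s. (\<forall>x v. x \<notin> W \<or> v \<notin> jets_at A 1 x \<longrightarrow> s x v = 0) \<and>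
         (\<forall>(U, \<phi>)\<in>A. \<exists>a. (\<forall>i. holo_fun A (U \<inter> W) (a i)) \<and>
            (\<forall>f. holo_germ A f \<and> f 0 \<in> U \<inter> W \<longrightarrow>
               s (f 0) (jet A 1 f) = (\<Sum>i\<in>UNIV. a i (f 0) * jet_coord \<phi> 1 i f)))}"

text \<open>\<open>K p i\<close> is the exponent of the \<open>p\<close>-th derivative of the \<open>i\<close>-th coordinate, so \<open>K p\<close> is the
  multi-index \<open>I\<^sub>p\<close>.\<close>

definition jet_exponents :: "nat \<Rightarrow> nat \<Rightarrow> (nat \<Rightarrow> 2 \<Rightarrow> nat) set" where
  "jet_exponents k m =
     {K. (\<forall>p. p \<notin> {1..k} \<longrightarrow> K p = (\<lambda>i. 0)) \<and> (\<Sum>p=1..k. p * (\<Sum>i\<in>UNIV. K p i)) = m}"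

definition jet_differentials ::
    "('a::topological_space) chart set \<Rightarrow> nat \<Rightarrow> nat \<Rightarrow> ('a, (complex \<Rightarrow> 'a) set) sheaf" where
  "jet_differentials A k m W =
     {s. (\<forall>x j. x \<notin> W \<or> j \<notin> jets_at A k x \<longrightarrow> s x j = 0) \<and>
         (\<forall>(U, \<phi>)\<in>A. \<exists>a. (\<forall>K\<in>jet_exponents k m. holo_fun A (U \<inter> W) (a K)) \<and>
            (\<forall>f. holo_germ A f \<and> f 0 \<in> U \<inter> W \<longrightarrow>
               s (f 0) (jet A k f) =
                 (\<Sum>K\<in>jet_exponents k m.
                    a K (f 0) * (\<Prod>p=1..k. \<Prod>i\<in>UNIV. jet_coord \<phi> p i f ^ K p i))))}"

text \<open>The sheaf of all functions that are locally \<open>\<O>\<^sub>X\<close>-linear combinations of generators.\<close>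

definition generated_sheaf ::
    "('a::topological_space) chart set \<Rightarrow> ('a, 't) sheaf \<Rightarrow> ('a, 't) sheaf" where
  "generated_sheaf A G W =
     {s. (\<forall>x. x \<notin> W \<longrightarrow> s x = (\<lambda>t. 0)) \<and>
         (\<forall>x\<in>W. \<exists>V. open V \<and> x \<in> V \<and> V \<subseteq> W \<and>
            (\<exists>(n::nat) h g. (\<forall>l<n. holo_fun A V (h l) \<and> g l \<in> G V) \<and>
               (\<forall>y\<in>V. \<forall>t. s y t = (\<Sum>l<n. h l y * g l y t))))}"

text \<open>If \<open>V\<close> is a space of functions on a set \<open>T\<close>, then the tensor power \<open>V\<^sup>\<otimes>\<^sup>n\<close> is the space of
  functions on \<open>T\<^sup>n\<close> spanned by the products \<open>v\<^sub>1(t\<^sub>1) \<cdots> v\<^sub>n(t\<^sub>n)\<close>, and the symmetric power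
  is its subspace spanned by the symmetrised products. Elements of \<open>T\<^sup>n\<close> are lists.\<close>

definition sym_product :: "('a \<Rightarrow> 't \<Rightarrow> complex) list \<Rightarrow> 'a \<Rightarrow> 't list \<Rightarrow> complex" where
  "sym_product ss x ts =
     (if length ts = length ss
      then \<Sum>\<sigma> | \<sigma> permutes {..<length ss}. \<Prod>l<length ss. (ss ! \<sigma> l) x (ts ! l) else 0)"

definition sym_power ::
    "('a::topological_space) chart set \<Rightarrow> nat \<Rightarrow> ('a, 't) sheaf \<Rightarrow> ('a, 't list) sheaf" where
  "sym_power A n F =
     generated_sheaf A (\<lambda>V. {sym_product ss |ss. length ss = n \<and> set ss \<subseteq> F V})"

definition tensor_product :: "('a \<Rightarrow> 't \<Rightarrow> complex) list \<Rightarrow> 'a \<Rightarrow> 't list \<Rightarrow> complex" where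
  "tensor_product ss x ts =
     (if length ts = length ss then \<Prod>l<length ss. (ss ! l) x (ts ! l) else 0)"

definition tensor_sheaf ::
    "('a::topological_space) chart set \<Rightarrow> ('a, 't) sheaf list \<Rightarrow> ('a, 't list) sheaf" where
  "tensor_sheaf A Fs =
     generated_sheaf A
       (\<lambda>V. {tensor_product ss |ss. length ss = length Fs \<and> (\<forall>l<length Fs. ss ! l \<in> (Fs ! l) V)})"

text \<open>The list \<open>I\<close> is the tuple \<open>(i\<^sub>1, \<dots>, i\<^sub>k)\<close>; list positions start at \<open>0\<close>.\<close>

definition weighted_indices :: "nat \<Rightarrow> nat \<Rightarrow> nat list set" where
  "weighted_indices k m = {I. length I = k \<and> (\<Sum>j<k. Suc j * I ! j) = m}"

definition S_sheaf ::
    "('a::topological_space) chart set \<Rightarrow> nat list \<Rightarrow> ('a, (complex \<Rightarrow> 'a) set list list) sheaf" where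
  "S_sheaf A I = tensor_sheaf A (map (\<lambda>i. sym_power A i (cotangent A)) I)"


section \<open>Local frames\<close>

text \<open>\<open>\<O>\<^sub>X(W)\<^sup>r\<close>, normalised to be zero outside \<open>W\<close>.\<close>

definition free_sections :: "'a chart set \<Rightarrow> nat \<Rightarrow> 'a set \<Rightarrow> (nat \<Rightarrow> 'a \<Rightarrow> complex) set" where
  "free_sections A r W =
     {h. (\<forall>i<r. holo_fun A W (h i)) \<and> (\<forall>i x. r \<le> i \<or> x \<notin> W \<longrightarrow> h i x = 0)}"

text \<open>\<open>e\<^sub>0, \<dots>, e\<^sub>r\<^sub>-\<^sub>1\<close> define an isomorphism from \<open>\<O>\<^sub>X\<^sup>r\<close> to the sheaf \<open>F\<close> over \<open>V\<close>.\<close>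

definition local_frame ::
    "('a::topological_space) chart set \<Rightarrow> ('a, 't) sheaf \<Rightarrow> nat \<Rightarrow> 'a set
       \<Rightarrow> (nat \<Rightarrow> 'a \<Rightarrow> 't \<Rightarrow> complex) \<Rightarrow> bool" where
  "local_frame A F r V e \<longleftrightarrow>
     open V \<and>
     (\<forall>W. open W \<and> W \<subseteq> V \<longrightarrow>
        bij_betw (\<lambda>h x t. if x \<in> W then \<Sum>i<r. h i x * e i x t else 0)
          (free_sections A r W) (F W))"

definition sheaf_rank :: "('a::topological_space) chart set \<Rightarrow> ('a, 't) sheaf \<Rightarrow> nat" where
  "sheaf_rank A F = (THE r. \<forall>x. \<exists>V e. x \<in> V \<and> local_frame A F r V e)"


section \<open>Differential forms and de Rham cohomology\<close>

text \<open>Complex-valued \<open>C\<^sup>\<infinity>\<close> forms of mixed degree. A form is given by its expressions in all the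
  charts: \<open>\<omega> (U, \<phi>) z vs\<close> is the value at \<open>z \<in> \<phi> ` U\<close> on the real tangent vectors \<open>vs\<close> of
  \<open>\<complex>\<^sup>2 = \<real>\<^sup>4\<close>, and the component of degree \<open>p\<close> is the restriction to lists of length \<open>p\<close>.\<close>

type_synonym local_form = "complex ^ 2 \<Rightarrow> (complex ^ 2) list \<Rightarrow> complex"
type_synonym 'a form = "'a chart \<Rightarrow> local_form"

coinductive smooth_on :: "(complex ^ 2) set \<Rightarrow> (complex ^ 2 \<Rightarrow> complex) \<Rightarrow> bool" for S where
  "(\<And>z. z \<in> S \<Longrightarrow> f differentiable (at z)) \<Longrightarrow>
   (\<And>v. smooth_on S (\<lambda>z. frechet_derivative f (at z) v)) \<Longrightarrow> smooth_on S f"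

text \<open>The last condition is that expressions in different charts correspond under pullback.\<close>

definition forms :: "('a::topological_space) chart set \<Rightarrow> 'a set \<Rightarrow> 'a form set" where
  "forms A W =
     {\<omega>. (\<forall>(U, \<phi>)\<in>A.
            (\<forall>vs. smooth_on (\<phi> ` (U \<inter> W)) (\<lambda>z. \<omega> (U, \<phi>) z vs)) \<and>
            (\<forall>z\<in>\<phi> ` (U \<inter> W). \<forall>vs.
               (\<forall>i<length vs. linear (\<lambda>v. \<omega> (U, \<phi>) z (vs[i := v]))) \<and>
               (\<not> distinct vs \<longrightarrow> \<omega> (U, \<phi>) z vs = 0))) \<and>
         (\<forall>(U, \<phi>)\<in>A. \<forall>(V, \<psi>)\<in>A. \<forall>z\<in>\<phi> ` (U \<inter> V \<inter> W). \<forall>vs.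
            \<omega> (U, \<phi>) z vs =
              \<omega> (V, \<psi>) (\<psi> (inv_into U \<phi> z))
                (map (frechet_derivative (\<lambda>y. \<psi> (inv_into U \<phi> y)) (at z)) vs))}"

definition form_eq :: "'a chart set \<Rightarrow> 'a set \<Rightarrow> 'a form \<Rightarrow> 'a form \<Rightarrow> bool" where
  "form_eq A W \<omega> \<eta> \<longleftrightarrow>
     (\<forall>(U, \<phi>)\<in>A. \<forall>z\<in>\<phi> ` (U \<inter> W). \<forall>vs. \<omega> (U, \<phi>) z vs = \<eta> (U, \<phi>) z vs)"

definition has_degree :: "'a chart set \<Rightarrow> 'a set \<Rightarrow> nat \<Rightarrow> 'a form \<Rightarrow> bool" where
  "has_degree A W p \<omega> \<longleftrightarrow>
     (\<forall>(U, \<phi>)\<in>A. \<forall>z\<in>\<phi> ` (U \<inter> W). \<forall>vs. length vs \<noteq> p \<longrightarrow> \<omega> (U, \<phi>) z vs = 0)"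

text \<open>The shuffle formula, without factorials: \<open>S\<close> is the set of positions of the vectors passed to
  \<open>\<alpha>\<close>, and the exponent counts the inversions of the corresponding shuffle.\<close>

definition wedge :: "'a form \<Rightarrow> 'a form \<Rightarrow> 'a form" where
  "wedge \<alpha> \<beta> = (\<lambda>c z vs. \<Sum>S\<in>Pow {..<length vs}.
     (-1) ^ card {(i, j). i \<in> S \<and> j < i \<and> j \<notin> S} * \<alpha> c z (nths vs S) * \<beta> c z (nths vs (- S)))"

definition unit_form :: "'a form" where
  "unit_form = (\<lambda>c z vs. if vs = [] then 1 else 0)"

definition ext_deriv :: "'a form \<Rightarrow> 'a form" where
  "ext_deriv \<omega> = (\<lambda>c z vs. \<Sum>i<length vs.
     (-1) ^ i * frechet_derivative (\<lambda>y. \<omega> c y (nths vs (- {i}))) (at z) (vs ! i))"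

definition closed_forms :: "('a::topological_space) chart set \<Rightarrow> 'a form ring" where
  "closed_forms A =
     \<lparr>carrier = {\<omega> \<in> forms A UNIV. form_eq A UNIV (ext_deriv \<omega>) (\<lambda>c z vs. 0)},
      monoid.mult = wedge,
      one = unit_form,
      zero = (\<lambda>c z vs. 0),
      add = (\<lambda>\<alpha> \<beta> c z vs. \<alpha> c z vs + \<beta> c z vs)\<rparr>"

definition exact_forms :: "('a::topological_space) chart set \<Rightarrow> 'a form set" where
  "exact_forms A = {\<omega> \<in> forms A UNIV. \<exists>\<tau>\<in>forms A UNIV. form_eq A UNIV \<omega> (ext_deriv \<tau>)}"

text \<open>The cohomology ring \<open>H\<^sup>*(X; \<complex>) = \<Oplus>\<^sub>p H\<^sup>p(X; \<complex>)\<close>, with the cup product.\<close>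

definition deRham :: "('a::topological_space) chart set \<Rightarrow> 'a form set ring" where
  "deRham A = closed_forms A Quot exact_forms A"


section \<open>Chern classes\<close>

text \<open>A connection \<open>\<nabla>\<close> on the vector bundle of a locally free sheaf is given by its matrices of
  smooth 1-forms with respect to the holomorphic frames: \<open>\<nabla>e\<^sub>j = \<Sum>\<^sub>i \<theta>\<^sub>i\<^sub>j e\<^sub>i\<close>. For frames related
  by \<open>e'\<^sub>j = \<Sum>\<^sub>i g\<^sub>i\<^sub>j e\<^sub>i\<close> the Leibniz rule is the transformation law \<open>g \<theta>' = dg + \<theta> g\<close>.\<close>

type_synonym ('a, 't) connection_forms =
  "'a set \<Rightarrow> (nat \<Rightarrow> 'a \<Rightarrow> 't \<Rightarrow> complex) \<Rightarrow> nat \<Rightarrow> nat \<Rightarrow> 'a form"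

definition connection ::
    "('a::topological_space) chart set \<Rightarrow> ('a, 't) sheaf \<Rightarrow> nat \<Rightarrow> ('a, 't) connection_forms \<Rightarrow> bool"
  where
  "connection A F r \<theta> \<longleftrightarrow>
     (\<forall>V e. local_frame A F r V e \<longrightarrow>
        (\<forall>i<r. \<forall>j<r. \<theta> V e i j \<in> forms A V \<and> has_degree A V 1 (\<theta> V e i j))) \<and>
     (\<forall>V e V' e' g.
        local_frame A F r V e \<and> local_frame A F r V' e' \<and>
        (\<forall>i<r. \<forall>j<r. holo_fun A (V \<inter> V') (g i j)) \<and>
        (\<forall>x\<in>V \<inter> V'. \<forall>j<r. \<forall>t. e' j x t = (\<Sum>i<r. g i j x * e i x t)) \<longrightarrow>
        (\<forall>(U, \<phi>)\<in>A. \<forall>z\<in>\<phi> ` (U \<inter> V \<inter> V'). \<forall>v. \<forall>i<r. \<forall>j<r.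
           (\<Sum>l<r. g i l (inv_into U \<phi> z) * \<theta> V' e' l j (U, \<phi>) z [v]) =
             frechet_derivative (\<lambda>y. g i j (inv_into U \<phi> y)) (at z) v +
             (\<Sum>l<r. \<theta> V e i l (U, \<phi>) z [v] * g l j (inv_into U \<phi> z))))"

definition curvature :: "nat \<Rightarrow> (nat \<Rightarrow> nat \<Rightarrow> 'a form) \<Rightarrow> nat \<Rightarrow> nat \<Rightarrow> 'a form" where
  "curvature r \<theta> i j =
     (\<lambda>c z vs. ext_deriv (\<theta> i j) c z vs + (\<Sum>l<r. wedge (\<theta> i l) (\<theta> l j) c z vs))"

text \<open>The part of degree \<open>2n\<close> of \<open>det (1 + (i/2\<pi>) \<Omega>)\<close> for an \<open>r \<times> r\<close> matrix \<open>\<Omega>\<close> of 2-forms: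
  the sum of the principal \<open>n \<times> n\<close> minors of \<open>(i/2\<pi>) \<Omega>\<close>.\<close>

definition chern_poly :: "nat \<Rightarrow> nat \<Rightarrow> (nat \<Rightarrow> nat \<Rightarrow> 'a form) \<Rightarrow> 'a form" where
  "chern_poly r n \<Omega> = (\<lambda>c z vs.
     (\<i> / (2 * of_real pi)) ^ n *
     (\<Sum>S | S \<subseteq> {..<r} \<and> card S = n. \<Sum>\<sigma> | \<sigma> permutes S.
        of_int (sign \<sigma>) *
        foldr wedge (map (\<lambda>j. \<Omega> j (\<sigma> j)) (sorted_list_of_set S)) unit_form c z vs))"

text \<open>The global form \<open>\<eta>\<close> is the \<open>n\<close>-th Chern form of the connection.\<close>

definition chern_form ::
    "('a::topological_space) chart set \<Rightarrow> ('a, 't) sheaf \<Rightarrow> nat \<Rightarrow> ('a, 't) connection_forms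
       \<Rightarrow> nat \<Rightarrow> 'a form \<Rightarrow> bool" where
  "chern_form A F r \<theta> n \<eta> \<longleftrightarrow>
     \<eta> \<in> forms A UNIV \<and>
     (\<forall>V e. local_frame A F r V e \<longrightarrow> form_eq A V \<eta> (chern_poly r n (curvature r (\<theta> V e))))"

definition chern_class ::
    "('a::topological_space) chart set \<Rightarrow> nat \<Rightarrow> ('a, 't) sheaf \<Rightarrow> 'a form set" where
  "chern_class A n F =
     (THE C. \<exists>\<theta> \<eta>. connection A F (sheaf_rank A F) \<theta> \<and>
        chern_form A F (sheaf_rank A F) \<theta> n \<eta> \<and> C = exact_forms A +>\<^bsub>closed_forms A\<^esub> \<eta>)"

end

theory Submission
  imports Defs "HOL-Complex_Analysis.Cauchy_Integral_Formula" "HOL-Algebra.UnivPoly"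
begin

text \<open>The Chern classes are computed by Chern--Weil forms of the connections \<open>\<Sum>\<^sub>n \<rho>\<^sub>n G\<^sub>n dG\<^sub>n\<^sup>-\<^sup>1\<close>, where \<open>\<rho>\<^sub>n\<close> is a
  partition of unity and \<open>G\<^sub>n\<close> the change to a holomorphic frame on the \<open>n\<close>-th chart; a transgression formula shows
  that the connection does not matter. The monomials in the jet coordinates of a chart form a frame of the jet
  differentials. In other coordinates \<open>f\<^sup>(\<^sup>p\<^sup>)\<close> becomes a linear expression in \<open>f\<^sup>(\<^sup>p\<^sup>)\<close> plus monomials for which
  \<open>\<Sum>\<^sub>q q\<^sup>2 \<bar>I\<^sub>q\<bar>\<close> is smaller than \<open>p\<^sup>2\<close>. Hence the changes of frames are block triangular with respect to the
  types \<open>(\<bar>I\<^sub>1\<bar>, \<dots>, \<bar>I\<^sub>k\<bar>)\<close>, and the diagonal blocks are those of the bundles \<open>S\<^sub>I\<close>, as one sees by evaluating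
  symmetric tensors on diagonals. The same holds for the curvatures \<open>\<Omega>\<close>, so \<open>tr \<Omega>\<close> and \<open>tr \<Omega>\<^sup>2\<close> are sums over \<open>I\<close>,
  and the formulas follow from \<open>c\<^sub>1 = tr (i\<Omega>/2\<pi>)\<close> and \<open>2 c\<^sub>2 = c\<^sub>1\<^sup>2 - tr (i\<Omega>/2\<pi>)\<^sup>2\<close>.\<close>

text \<open>The S_I are the graded pieces of a filtration of the jet differentials, and for these
  one would invoke the Whitney formula for exact sequences. Here the filtration appears only as the
  block shape of matrices. All bundles get their connections by one recipe from one partition of
  unity; the recipe consists of sums, products and derivatives of frame changes, and these preserve
  the shape. So the two formulas hold pointwise for the chosen Chern forms. Cohomology enters only
  through \<open>chern_class\<close>, a definite description that requires a connection to exist and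
  the class not to depend on it.

  All monomials have the same weight \<open>m\<close>, so the order of the blocks must come from
  another statistic. Squares serve because they are strictly superadditive on positive numbers: a
  product of several lower derivatives has a smaller sum of squares than one derivative of the same
  total order. The sum of squares is additive on products, so the estimate passes from coordinates
  to monomials.

  Smoothness has to be earned: \<open>holo_on\<close> asks for one complex linear derivative at each
  point, while curvature and its closedness involve higher ones.\<close>

type_synonym 'a mat = "nat \<Rightarrow> nat \<Rightarrow> 'a"
type_synonym ('a, 't) frame = "nat \<Rightarrow> 'a \<Rightarrow> 't \<Rightarrow> complex"
type_synonym jvec = "nat \<Rightarrow> 2 \<Rightarrow> complex"
type_synonym expo = "nat \<Rightarrow> 2 \<Rightarrow> nat"

section \<open>Smooth functions of two complex variables\<close>

abbreviation dir_deriv :: "(complex ^ 2 \<Rightarrow> complex) \<Rightarrow> complex ^ 2 \<Rightarrow> complex ^ 2 \<Rightarrow> complex" where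
  "dir_deriv f v \<equiv> \<lambda>z. frechet_derivative f (at z) v"

text \<open>Sums, products and compositions of smooth functions have derivatives of a mixed shape,
  which a coinduction would have to anticipate. Differentiability of finite order permits plain
  induction on the order.\<close>

fun times_diff :: "nat \<Rightarrow> (complex ^ 2) set \<Rightarrow> (complex ^ 2 \<Rightarrow> complex) \<Rightarrow> bool" where
  "times_diff 0 S f = True"
| "times_diff (Suc n) S f =
     ((\<forall>z\<in>S. f differentiable at z) \<and> (\<forall>v. times_diff n S (dir_deriv f v)))"

lemma smooth_on_iff_times_diff: "smooth_on S f \<longleftrightarrow> (\<forall>n. times_diff n S f)"
proof
  assume "smooth_on S f"
  have "smooth_on S f \<Longrightarrow> times_diff n S f" for n f
    by (induction n arbitrary: f) (auto elim: smooth_on.cases)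
  then show "\<forall>n. times_diff n S f" using \<open>smooth_on S f\<close> by blast
next
  assume *: "\<forall>n. times_diff n S f"
  show "smooth_on S f" using *
  proof (coinduction arbitrary: f rule: smooth_on.coinduct)
    case smooth_on
    have "f differentiable at z" if "z \<in> S" for z
      using smooth_on[rule_format, of 1] that by simp
    moreover have "times_diff n S (dir_deriv f v)" for n v
      using smooth_on[rule_format, of "Suc n"] by simp
    ultimately show ?case by auto
  qed
qed

lemma smooth_on_differentiable: "smooth_on S f \<Longrightarrow> z \<in> S \<Longrightarrow> f differentiable at z"
  by (auto elim: smooth_on.cases)

lemma smooth_on_dir_deriv: "smooth_on S f \<Longrightarrow> smooth_on S (dir_deriv f v)"
  by (auto elim: smooth_on.cases)

lemma smooth_on_has_derivative:
  "smooth_on S f \<Longrightarrow> z \<in> S \<Longrightarrow> (f has_derivative frechet_derivative f (at z)) (at z)"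
  using frechet_derivative_works smooth_on_differentiable by blast

lemma frechet_derivative_eqI: "(f has_derivative f') (at z) \<Longrightarrow> frechet_derivative f (at z) = f'"
  using frechet_derivative_at by metis

lemma frechet_derivative_cong_open:
  assumes "open S" "z \<in> S" "\<And>y. y \<in> S \<Longrightarrow> f y = g y"
  shows "frechet_derivative f (at z) = frechet_derivative g (at z)"
proof -
  have "(f has_derivative D) (at z) \<longleftrightarrow> (g has_derivative D) (at z)" for D
    using assms has_derivative_transform_within_open[of _ D z UNIV S] by metis
  then show ?thesis by (simp add: frechet_derivative_def)
qed

lemma differentiable_cong_open:
  assumes "open S" "z \<in> S" "\<And>y. y \<in> S \<Longrightarrow> f y = g y" "f differentiable at z"
  shows "g differentiable at z"
  using assms has_derivative_transform_within_open unfolding differentiable_def by metis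

lemma times_diff_cong:
  assumes "open S" "\<And>z. z \<in> S \<Longrightarrow> f z = g z" "times_diff n S f"
  shows "times_diff n S g"
  using assms(2,3)
proof (induction n arbitrary: f g)
  case (Suc n)
  have "g differentiable at z" if "z \<in> S" for z
    using differentiable_cong_open[OF assms(1) that] Suc.prems that by (metis times_diff.simps(2))
  moreover have "times_diff n S (dir_deriv g v)" for v
    using Suc.IH[of "dir_deriv f v" "dir_deriv g v"] Suc.prems
      frechet_derivative_cong_open[OF assms(1)] by (metis times_diff.simps(2))
  ultimately show ?case by simp
qed simp

lemma smooth_on_cong:
  assumes "open S" "\<And>z. z \<in> S \<Longrightarrow> f z = g z" "smooth_on S f"
  shows "smooth_on S g"
  using times_diff_cong[OF assms(1,2)] assms(3) by (simp add: smooth_on_iff_times_diff)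

lemma times_diff_antimono: "times_diff n T f \<Longrightarrow> S \<subseteq> T \<Longrightarrow> times_diff n S f"
  by (induction n arbitrary: f) auto

lemma smooth_on_subset: "smooth_on T f \<Longrightarrow> S \<subseteq> T \<Longrightarrow> smooth_on S f"
  unfolding smooth_on_iff_times_diff using times_diff_antimono by blast

lemma times_diff_Union:
  "(\<And>z. z \<in> S \<Longrightarrow> \<exists>T. z \<in> T \<and> times_diff n T f) \<Longrightarrow> times_diff n S f"
proof (induction n arbitrary: f)
  case (Suc n)
  then show ?case by (simp, meson)
qed simp

lemma smooth_on_locally:
  assumes "\<And>z. z \<in> S \<Longrightarrow> \<exists>T. z \<in> T \<and> smooth_on T f"
  shows "smooth_on S f"
  using assms times_diff_Union by (metis smooth_on_iff_times_diff)

text \<open>The Leibniz rule leaves one factor undifferentiated, so order \<open>Suc n\<close> of a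
  factor must be usable as order \<open>n\<close>.\<close>

lemma times_diff_Suc_imp: "times_diff (Suc n) S f \<Longrightarrow> times_diff n S f"
  by (induction n arbitrary: f) auto

lemma times_diff_const: "times_diff n S (\<lambda>z. c)"
  by (induction n arbitrary: c) (auto simp: frechet_derivative_const)

lemma frechet_derivative_works': "f differentiable at z \<Longrightarrow> (f has_derivative frechet_derivative f (at z)) (at z)"
  using frechet_derivative_works by blast

lemma times_diff_add:
  assumes "open S" shows "times_diff n S f \<Longrightarrow> times_diff n S g \<Longrightarrow> times_diff n S (\<lambda>z. f z + g z)"
proof (induction n arbitrary: f g)
  case (Suc n)
  have *: "frechet_derivative f (at z) v + frechet_derivative g (at z) v
             = frechet_derivative (\<lambda>z. f z + g z) (at z) v" if "z \<in> S" for z v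
    using Suc.prems that by (subst frechet_derivative_eqI[OF has_derivative_add]) (auto intro!: frechet_derivative_works')
  have "times_diff n S (dir_deriv (\<lambda>z. f z + g z) v)" for v
    by (rule times_diff_cong[OF assms *]) (use Suc in auto)
  then show ?case using Suc.prems by auto
qed simp

lemma times_diff_mult:
  assumes "open S" shows "times_diff n S f \<Longrightarrow> times_diff n S g \<Longrightarrow> times_diff n S (\<lambda>z. f z * g z)"
proof (induction n arbitrary: f g)
  case (Suc n)
  have *: "f z * frechet_derivative g (at z) v + frechet_derivative f (at z) v * g z
             = frechet_derivative (\<lambda>z. f z * g z) (at z) v" if "z \<in> S" for z v
    using Suc.prems that by (subst frechet_derivative_eqI[OF has_derivative_mult]) (auto intro!: frechet_derivative_works')
  have "times_diff n S (dir_deriv (\<lambda>z. f z * g z) v)" for v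
    by (rule times_diff_cong[OF assms *], assumption)
      (intro times_diff_add[OF assms] Suc.IH, use Suc.prems Suc.prems[THEN times_diff_Suc_imp] in auto)
  then show ?case using Suc.prems by (auto intro: differentiable_mult)
qed simp

lemma times_diff_bounded_linear:
  assumes "open S" "bounded_linear L"
  shows "times_diff n S f \<Longrightarrow> times_diff n S (\<lambda>z. L (f z))"
proof (induction n arbitrary: f)
  case (Suc n)
  have D: "((\<lambda>z. L (f z)) has_derivative (\<lambda>v. L (frechet_derivative f (at z) v))) (at z)" if "z \<in> S" for z
    using Suc.prems that
    by (intro bounded_linear.has_derivative[OF assms(2)]) (auto intro!: frechet_derivative_works')
  have *: "L (frechet_derivative f (at z) v) = frechet_derivative (\<lambda>z. L (f z)) (at z) v" if "z \<in> S" for z v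
    using frechet_derivative_eqI[OF D[OF that]] by simp
  have "times_diff n S (dir_deriv (\<lambda>z. L (f z)) v)" for v
    by (rule times_diff_cong[OF assms(1) *]) (use Suc in auto)
  then show ?case using D by (auto simp: differentiable_def)
qed simp

lemma times_diff_inverse:
  assumes "open S" "\<And>z. z \<in> S \<Longrightarrow> f z \<noteq> 0"
  shows "times_diff n S f \<Longrightarrow> times_diff n S (\<lambda>z. inverse (f z))"
proof (induction n)
  case (Suc n)
  have D: "((\<lambda>z. inverse (f z)) has_derivative (\<lambda>v. - (inverse (f z) * frechet_derivative f (at z) v * inverse (f z)))) (at z)"
    if "z \<in> S" for z
    using Suc.prems that assms(2) by (intro Deriv.has_derivative_inverse frechet_derivative_works') auto
  \<comment> \<open>The derivative contains only the inverse itself, which the induction hypothesis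
    covers, and the derivative of \<open>f\<close>.\<close>
  have *: "(- 1) * (inverse (f z) * frechet_derivative f (at z) v * inverse (f z)) = frechet_derivative (\<lambda>z. inverse (f z)) (at z) v"
    if "z \<in> S" for z v
    using frechet_derivative_eqI[OF D[OF that]] by simp
  have "times_diff n S (dir_deriv (\<lambda>z. inverse (f z)) v)" for v
    by (rule times_diff_cong[OF assms(1) *], assumption)
      (intro times_diff_mult[OF assms(1)] times_diff_const, use Suc.IH Suc.prems Suc.prems[THEN times_diff_Suc_imp] in auto)
  then show ?case using D by (auto simp: differentiable_def)
qed simp

lemma smooth_on_const: "smooth_on S (\<lambda>z. c)"
  by (simp add: smooth_on_iff_times_diff times_diff_const)

lemma smooth_on_add: "open S \<Longrightarrow> smooth_on S f \<Longrightarrow> smooth_on S g \<Longrightarrow> smooth_on S (\<lambda>z. f z + g z)"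
  by (simp add: smooth_on_iff_times_diff times_diff_add)

lemma smooth_on_mult: "open S \<Longrightarrow> smooth_on S f \<Longrightarrow> smooth_on S g \<Longrightarrow> smooth_on S (\<lambda>z. f z * g z)"
  by (simp add: smooth_on_iff_times_diff times_diff_mult)

lemma smooth_on_inverse:
  "open S \<Longrightarrow> (\<And>z. z \<in> S \<Longrightarrow> f z \<noteq> 0) \<Longrightarrow> smooth_on S f \<Longrightarrow> smooth_on S (\<lambda>z. inverse (f z))"
  by (simp add: smooth_on_iff_times_diff times_diff_inverse)

lemma smooth_on_bounded_linear:
  "open S \<Longrightarrow> bounded_linear L \<Longrightarrow> smooth_on S f \<Longrightarrow> smooth_on S (\<lambda>z. L (f z))"
  by (simp add: smooth_on_iff_times_diff times_diff_bounded_linear)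

lemma smooth_on_uminus: "open S \<Longrightarrow> smooth_on S f \<Longrightarrow> smooth_on S (\<lambda>z. - f z)"
  by (rule smooth_on_bounded_linear) (simp_all add: bounded_linear_minus bounded_linear_ident)

lemma smooth_on_diff: "open S \<Longrightarrow> smooth_on S f \<Longrightarrow> smooth_on S g \<Longrightarrow> smooth_on S (\<lambda>z. f z - g z)"
  using smooth_on_add[OF _ _ smooth_on_uminus, of S f g] by simp

lemma smooth_on_sum:
  assumes "open S" "\<And>i. i \<in> I \<Longrightarrow> smooth_on S (f i)"
  shows "smooth_on S (\<lambda>z. \<Sum>i\<in>I. f i z)"
  using assms(2) by (induction I rule: infinite_finite_induct) (auto intro: assms(1) smooth_on_const smooth_on_add)

lemma smooth_on_prod:
  assumes "open S" "\<And>i. i \<in> I \<Longrightarrow> smooth_on S (f i)"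
  shows "smooth_on S (\<lambda>z. \<Prod>i\<in>I. f i z)"
  using assms(2) by (induction I rule: infinite_finite_induct) (auto intro: assms(1) smooth_on_const smooth_on_mult)

text \<open>A Frechet derivative is in general only real linear, so a vector is expanded along four
  real directions.\<close>

lemma vec2_expand: "(w :: complex ^ 2) = (\<Sum>i\<in>UNIV. Re (w $ i) *\<^sub>R axis i 1 + Im (w $ i) *\<^sub>R axis i \<i>)"
  by (simp add: vec_eq_iff axis_def UNIV_2 forall_2 complex_eq_iff)

lemma has_derivative_vec:
  fixes F :: "'b::real_normed_vector \<Rightarrow> complex ^ 'n"
  assumes "\<And>i. ((\<lambda>z. F z $ i) has_derivative (\<lambda>v. F' v $ i)) (at z within T)"
  shows "(F has_derivative F') (at z within T)"
proof -
  have "((\<lambda>z. F z \<bullet> b) has_derivative (\<lambda>v. F' v \<bullet> b)) (at z within T)" if "b \<in> Basis" for b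
  proof -
    obtain i u where b: "b = axis i u" using \<open>b \<in> Basis\<close> by (auto simp: Basis_vec_def)
    show ?thesis unfolding b inner_axis
      by (intro bounded_linear.has_derivative[OF bounded_linear_inner_left] assms)
  qed
  then show ?thesis using has_derivative_componentwise_within[of F F' z T] by blast
qed

text \<open>The chain rule writes the derivative as a sum of derivatives of \<open>F\<close> times
  partial derivatives of \<open>f\<close>, the latter again composed with \<open>F\<close>; the
  induction hypothesis is therefore needed for all \<open>f\<close>.\<close>

lemma times_diff_compose:
  assumes "open S" "open T" "\<And>z. z \<in> S \<Longrightarrow> F z \<in> T"
  shows "times_diff n T f \<Longrightarrow> (\<And>i. times_diff n S (\<lambda>z. F z $ i)) \<Longrightarrow> times_diff n S (\<lambda>z. f (F z))"
proof (induction n arbitrary: f)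
  case (Suc n)
  define F' where "F' z v = (\<chi> i. frechet_derivative (\<lambda>z. F z $ i) (at z) v)" for z v
  have F: "(F has_derivative F' z) (at z)" if "z \<in> S" for z
    by (rule has_derivative_vec) (use Suc.prems that in \<open>auto simp: F'_def intro!: frechet_derivative_works'\<close>)
  have f: "(f has_derivative frechet_derivative f (at (F z))) (at (F z))" if "z \<in> S" for z
    using Suc.prems that assms(3) by (auto intro!: frechet_derivative_works')
  have D: "((\<lambda>z. f (F z)) has_derivative (\<lambda>v. frechet_derivative f (at (F z)) (F' z v))) (at z)" if "z \<in> S" for z
    using has_derivative_compose[OF F f] that by blast
  have *: "(\<Sum>i\<in>UNIV. complex_of_real (Re (dir_deriv (\<lambda>z. F z $ i) v z)) * dir_deriv f (axis i 1) (F z)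
                  + complex_of_real (Im (dir_deriv (\<lambda>z. F z $ i) v z)) * dir_deriv f (axis i \<i>) (F z))
      = dir_deriv (\<lambda>z. f (F z)) v z" if "z \<in> S" for z v
  proof -
    interpret bounded_linear "frechet_derivative f (at (F z))"
      using f[OF that] by (rule has_derivative_bounded_linear)
    have "dir_deriv (\<lambda>z. f (F z)) v z = frechet_derivative f (at (F z)) (F' z v)"
      using frechet_derivative_eqI[OF D[OF that]] by simp
    also have "\<dots> = (\<Sum>i\<in>UNIV. Re (F' z v $ i) *\<^sub>R frechet_derivative f (at (F z)) (axis i 1)
                  + Im (F' z v $ i) *\<^sub>R frechet_derivative f (at (F z)) (axis i \<i>))"
      by (subst vec2_expand[of "F' z v"]) (simp only: sum add scaleR)
    finally show ?thesis by (simp add: F'_def scaleR_conv_of_real)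
  qed
  have "bounded_linear (\<lambda>z. complex_of_real (Re z))" "bounded_linear (\<lambda>z. complex_of_real (Im z))"
    by (intro bounded_linear_compose[OF bounded_linear_of_real] bounded_linear_Re bounded_linear_Im)+
  note L = this[THEN times_diff_bounded_linear[OF assms(1)]]
  have F'': "times_diff n S (\<lambda>z. F z $ i)" "times_diff n S (dir_deriv (\<lambda>z. F z $ i) v)" for i v
    using Suc.prems(2)[of i] Suc.prems(2)[of i, THEN times_diff_Suc_imp] by auto
  have "times_diff n S (dir_deriv (\<lambda>z. f (F z)) v)" for v
    by (rule times_diff_cong[OF assms(1) *], assumption)
      (simp add: UNIV_2, intro times_diff_add times_diff_mult assms(1) L F'' Suc.IH, use Suc.prems in auto)
  then show ?case using D by (auto simp: differentiable_def)
qed simp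

lemma smooth_on_compose:
  assumes "open S" "open T" "\<And>z. z \<in> S \<Longrightarrow> F z \<in> T" "smooth_on T f" "\<And>i. smooth_on S (\<lambda>z. F z $ i)"
  shows "smooth_on S (\<lambda>z. f (F z))"
  unfolding smooth_on_iff_times_diff
proof
  fix n
  show "times_diff n S (\<lambda>z. f (F z))"
  proof (rule times_diff_compose[where F = F and f = f, OF assms(1,2,3)])
    show "times_diff n T f" using assms(4) unfolding smooth_on_iff_times_diff ..
    show "times_diff n S (\<lambda>z. F z $ i)" for i using assms(5)[of i] unfolding smooth_on_iff_times_diff ..
  qed
qed

lemma smooth_on_component: "smooth_on S (\<lambda>z. z $ i)"
proof -
  have D: "((\<lambda>z. z $ i) has_derivative (\<lambda>v. v $ i)) (at z)" for z :: "complex ^ 2"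
    by (rule bounded_linear.has_derivative[OF bounded_linear_vec_nth]) (rule has_derivative_ident)
  have "times_diff n S (\<lambda>z. z $ i)" for n
    by (cases n) (auto simp: differentiable_def times_diff_const frechet_derivative_eqI[OF D] intro: D)
  then show ?thesis by (simp add: smooth_on_iff_times_diff)
qed

subsection \<open>Bump functions\<close>

text \<open>\<open>flat 0\<close> is the classical exp(-1/x). The powers of \<open>inverse x\<close>
  collect what differentiation produces, so that derivatives of the family are combinations of its
  members.\<close>

definition flat :: "nat \<Rightarrow> real \<Rightarrow> real" where
  "flat k x = (if x > 0 then exp (- inverse x) * inverse x ^ k else 0)"

lemma power_le_fact_exp: "0 \<le> (x::real) \<Longrightarrow> x ^ n \<le> fact n * exp x"
proof -
  assume "0 \<le> x"
  then have "(\<Sum>k\<in>{n}. x ^ k /\<^sub>R fact k) \<le> exp x"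
    using exp_converges[of x, THEN sums_unique] sum_le_suminf[OF exp_converges[of x, THEN sums_summable], of "{n}"]
    by auto
  then show ?thesis by (simp add: field_simps)
qed

text \<open>A quadratic bound makes the difference quotient at 0 tend to 0, the only point where
  differentiability is not obvious.\<close>

lemma flat_bounds: "0 \<le> flat k x" "flat k x \<le> fact (k + 2) * x\<^sup>2"
proof -
  show "0 \<le> flat k x" by (simp add: flat_def)
  show "flat k x \<le> fact (k + 2) * x\<^sup>2"
  proof (cases "x > 0")
    case True
    define y where "y = inverse x"
    have y: "y > 0" "y * x = 1" using True by (auto simp: y_def)
    \<comment> \<open>Inserting \<open>(y * x)\<^sup>2\<close>, which is 1, trades two more powers
      of \<open>y\<close> for \<open>x\<^sup>2\<close>; the factorial then comes from bounding
      \<open>y ^ (k + 2)\<close> by the exponential series.\<close>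
    have "flat k x = y ^ k * exp (- y) * (y * x)\<^sup>2"
      using True y(2) by (simp add: flat_def flip: y_def)
    also have "\<dots> = y ^ (k + 2) * (exp (- y) * x\<^sup>2)"
      by (simp add: power_add power_mult_distrib power2_eq_square)
    also have "\<dots> \<le> fact (k + 2) * exp y * (exp (- y) * x\<^sup>2)"
      using y by (intro mult_right_mono power_le_fact_exp) auto
    also have "\<dots> = fact (k + 2) * x\<^sup>2 * (exp y * exp (- y))"
      by (simp only: mult_ac)
    also have "exp y * exp (- y) = 1" by (simp flip: exp_add)
    finally show ?thesis by simp
  qed (simp add: flat_def)
qed

lemma DERIV_flat: "(flat k has_real_derivative (flat (k + 2) x - real k * flat (k + 1) x)) (at x)"
proof -
  consider "x > 0" | "x < 0" | "x = 0" by linarith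
  then show ?thesis
  proof cases
    case 1
    have "((\<lambda>x. exp (- inverse x) * inverse x ^ k) has_real_derivative (flat (k + 2) x - real k * flat (k + 1) x)) (at x)"
    proof -
      have "((\<lambda>x. inverse x ^ k) has_real_derivative (of_nat k * (- (inverse x ^ Suc (Suc 0)) * inverse x ^ (k - Suc 0)))) (at x)"
        by (rule DERIV_power, rule DERIV_inverse) (use 1 in simp)
      then have D1: "((\<lambda>x. inverse x ^ k) has_real_derivative - (real k * inverse x ^ (k + 1))) (at x)"
        by (rule DERIV_cong) (cases k, auto)
      have D2: "((\<lambda>x. exp (- inverse x)) has_real_derivative exp (- inverse x) * inverse x ^ 2) (at x)"
        using 1 by (auto intro!: derivative_eq_intros simp: power2_eq_square)
      have "((\<lambda>x. exp (- inverse x) * inverse x ^ k) has_real_derivative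
          (exp (- inverse x) * inverse x ^ 2 * inverse x ^ k + - (real k * inverse x ^ (k + 1)) * exp (- inverse x))) (at x)"
        by (rule DERIV_mult[OF D2 D1])
      then show ?thesis
        using 1 by (simp add: flat_def power_add power2_eq_square mult_ac)
    qed
    then show ?thesis
      by (rule has_field_derivative_transform_within_open[where S = "{0<..}"]) (use 1 in \<open>auto simp: flat_def\<close>)
  next
    case 2
    have "((\<lambda>x. 0) has_real_derivative (flat (k + 2) x - real k * flat (k + 1) x)) (at x)"
      using 2 by (simp add: flat_def)
    then show ?thesis
      by (rule has_field_derivative_transform_within_open[where S = "{..<0}"]) (use 2 in \<open>auto simp: flat_def\<close>)
  next
    case 3
    have lim: "(\<lambda>h. fact (k + 2) * \<bar>h\<bar>) \<midarrow>0\<rightarrow> (0::real)"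
      by (intro tendsto_mult_right_zero tendsto_rabs_zero tendsto_ident_at)
    have le: "\<bar>flat k h / h\<bar> \<le> fact (k + 2) * \<bar>h\<bar>" if "h \<noteq> 0" for h
    proof -
      have "\<bar>flat k h / h\<bar> = flat k h / \<bar>h\<bar>"
        using flat_bounds(1)[of k h] by (simp add: abs_divide)
      also have "\<dots> \<le> fact (k + 2) * h\<^sup>2 / \<bar>h\<bar>"
        by (intro divide_right_mono flat_bounds) auto
      also have "\<dots> = fact (k + 2) * \<bar>h\<bar>"
        using that by (auto simp: abs_if power2_eq_square)
      finally show ?thesis .
    qed
    have "(\<lambda>h. flat k h / h) \<midarrow>0\<rightarrow> 0"
      by (rule Lim_null_comparison[OF _ lim]) (use le in \<open>auto simp: eventually_at_filter simp del: fact_Suc\<close>)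
    then show ?thesis using 3 by (simp add: DERIV_def flat_def)
  qed
qed

lemma times_diff_flat:
  assumes "open S"
  shows "times_diff n S u \<Longrightarrow> times_diff n S (\<lambda>z. complex_of_real (flat k (Re (u z))))"
proof (induction n arbitrary: k)
  case (Suc n)
  have D: "((\<lambda>z. complex_of_real (flat k (Re (u z)))) has_derivative
      (\<lambda>v. complex_of_real (Re (frechet_derivative u (at z) v) * (flat (k + 2) (Re (u z)) - real k * flat (k + 1) (Re (u z)))))) (at z)"
    if "z \<in> S" for z
  proof -
    have "((\<lambda>z. Re (u z)) has_derivative (\<lambda>v. Re (frechet_derivative u (at z) v))) (at z)"
      using Suc.prems that by (intro bounded_linear.has_derivative[OF bounded_linear_Re] frechet_derivative_works') auto
    then have "((\<lambda>z. flat k (Re (u z))) has_derivative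
      (\<lambda>v. Re (frechet_derivative u (at z) v) * (flat (k + 2) (Re (u z)) - real k * flat (k + 1) (Re (u z))))) (at z)"
      using has_derivative_compose[OF _ DERIV_flat[unfolded has_field_derivative_def]] by (simp add: mult.commute)
    then show ?thesis by (rule bounded_linear.has_derivative[OF bounded_linear_of_real])
  qed
  have *: "complex_of_real (Re (dir_deriv u v z)) * (complex_of_real (flat (k + 2) (Re (u z)))
             + (- of_nat k) * complex_of_real (flat (k + 1) (Re (u z))))
      = dir_deriv (\<lambda>z. complex_of_real (flat k (Re (u z)))) v z" if "z \<in> S" for z v
    using frechet_derivative_eqI[OF D[OF that]] by simp
  have L: "bounded_linear (\<lambda>z. complex_of_real (Re z))"
    by (intro bounded_linear_compose[OF bounded_linear_of_real] bounded_linear_Re)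
  have "times_diff n S (dir_deriv (\<lambda>z. complex_of_real (flat k (Re (u z)))) v)" for v
    by (rule times_diff_cong[OF assms *], assumption)
      (intro times_diff_mult times_diff_add times_diff_const Suc.IH assms times_diff_bounded_linear[OF assms L],
        use Suc.prems Suc.prems[THEN times_diff_Suc_imp] in auto)
  then show ?case using D by (auto simp: differentiable_def)
qed simp

lemma smooth_on_flat: "open S \<Longrightarrow> smooth_on S u \<Longrightarrow> smooth_on S (\<lambda>z. complex_of_real (flat k (Re (u z))))"
  by (simp add: smooth_on_iff_times_diff times_diff_flat)

lemma norm_vec2: "(norm z)\<^sup>2 = (\<Sum>i\<in>UNIV. Re (z $ i) ^ 2 + Im (z $ i) ^ 2)" for z :: "complex ^ 2"
  by (simp add: norm_vec_def L2_set_def cmod_power2 sum_nonneg)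

text \<open>A quotient of flat functions of the squared distance, which unlike the distance is
  smooth at the centre.\<close>

lemma smooth_on_bump: 
  fixes a :: "complex ^ 2"
  assumes "d > 0"
  obtains b where "smooth_on UNIV b" "\<And>z. dist z a \<le> d \<Longrightarrow> b z = 1" "\<And>z. dist z a \<ge> 2 * d \<Longrightarrow> b z = 0"
proof -
  define q :: "complex ^ 2 \<Rightarrow> complex" where "q z = of_real ((dist z a)\<^sup>2)" for z
  have q: "q = (\<lambda>z. (\<Sum>i\<in>UNIV. of_real (Re (z $ i - a $ i)) * of_real (Re (z $ i - a $ i)) + of_real (Im (z $ i - a $ i)) * of_real (Im (z $ i - a $ i))))"
    unfolding q_def dist_norm norm_vec2 fun_eq_iff by (simp add: power2_eq_square)
  have L: "bounded_linear (\<lambda>z. complex_of_real (Re z))" "bounded_linear (\<lambda>z. complex_of_real (Im z))"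
    by (intro bounded_linear_compose[OF bounded_linear_of_real] bounded_linear_Re bounded_linear_Im)+
  have sq: "smooth_on UNIV q"
    unfolding q by (intro smooth_on_sum smooth_on_add smooth_on_mult open_UNIV L[THEN smooth_on_bounded_linear[rotated]]
      smooth_on_diff smooth_on_const smooth_on_component)
  define f g where "f z = complex_of_real (flat 0 (Re (4 * d\<^sup>2 - q z)))" and "g z = complex_of_real (flat 0 (Re (q z - d\<^sup>2)))" for z
  have s: "smooth_on UNIV f" "smooth_on UNIV g" unfolding f_def g_def
    by (intro smooth_on_flat smooth_on_diff smooth_on_const sq open_UNIV)+
  have ne: "f z + g z \<noteq> 0" for z
  proof -
    have "d\<^sup>2 > 0" using assms by simp
    \<comment> \<open>One summand vanishes only outside radius \<open>2 * d\<close>, the other only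
      inside radius \<open>d\<close>; these regions are disjoint.\<close>
    then have "4 * d\<^sup>2 - (dist z a)\<^sup>2 > 0 \<or> (dist z a)\<^sup>2 - d\<^sup>2 > 0" by linarith
    moreover have pos: "flat 0 t > 0" if "t > 0" for t using that by (simp add: flat_def)
    ultimately have "flat 0 (4 * d\<^sup>2 - (dist z a)\<^sup>2) + flat 0 ((dist z a)\<^sup>2 - d\<^sup>2) > 0"
      using flat_bounds(1) add_nonneg_pos add_pos_nonneg by blast
    moreover have "f z + g z = of_real (flat 0 (4 * d\<^sup>2 - (dist z a)\<^sup>2) + flat 0 ((dist z a)\<^sup>2 - d\<^sup>2))"
      by (simp add: f_def g_def q_def del: of_real_power)
    ultimately show ?thesis by (metis of_real_eq_0_iff less_irrefl)
  qed
  show thesis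
  proof (rule that)
    show "smooth_on UNIV (\<lambda>z. f z * inverse (f z + g z))"
      by (intro smooth_on_mult smooth_on_inverse smooth_on_add s ne open_UNIV)
    show "f z * inverse (f z + g z) = 1" if "dist z a \<le> d" for z
    proof -
      have "(dist z a)\<^sup>2 \<le> d\<^sup>2" using that by (intro power_mono) auto
      then have "g z = 0" by (simp add: g_def q_def flat_def)
      then show ?thesis using ne[of z] by simp
    qed
    show "f z * inverse (f z + g z) = 0" if "dist z a \<ge> 2 * d" for z
    proof -
      have "(2 * d)\<^sup>2 \<le> (dist z a)\<^sup>2" using that assms by (intro power_mono) auto
      then show ?thesis by (simp add: f_def q_def flat_def power_mult_distrib)
    qed
  qed
qed

subsection \<open>Holomorphic functions\<close>

lemma norm_scale_vec: "norm (c *s v) = norm c * norm v" for v :: "complex ^ 'n"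
  by (simp add: norm_vec_def norm_mult L2_set_right_distrib)

lemma bounded_linear_scale_vec: "bounded_linear (\<lambda>c. c *s v)" for v :: "complex ^ 'n"
  by (rule bounded_linear_intro[where K = "norm v"])
    (auto simp: norm_scale_vec vec_eq_iff algebra_simps)

lemma holo_onD:
  assumes "holo_on f S" "z \<in> S"
  shows "f differentiable at z" "(f has_derivative frechet_derivative f (at z)) (at z)"
    "frechet_derivative f (at z) (c *s v) = c * frechet_derivative f (at z) v"
proof -
  obtain f' where f': "(f has_derivative f') (at z)" "\<And>c v. f' (c *s v) = c * f' v"
    using assms by (auto simp: holo_on_def)
  show "f differentiable at z" using f' by (auto simp: differentiable_def)
  show "(f has_derivative frechet_derivative f (at z)) (at z)"
    "frechet_derivative f (at z) (c *s v) = c * frechet_derivative f (at z) v"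
    using f' by (simp_all add: frechet_derivative_eqI[OF f'(1)])
qed

lemma holo_onI:
  assumes "\<And>z. z \<in> S \<Longrightarrow> f differentiable at z"
    "\<And>z c v. z \<in> S \<Longrightarrow> frechet_derivative f (at z) (c *s v) = c * frechet_derivative f (at z) v"
  shows "holo_on f S"
  unfolding holo_on_def using assms frechet_derivative_works by metis

text \<open>Restriction to a complex line gives a holomorphic function of one variable. This is
  where the condition on \<open>c *s v\<close> enters and where Cauchy's formula becomes
  available.\<close>

lemma holo_on_line:
  assumes "holo_on f S" "z + t *s v \<in> S"
  shows "((\<lambda>t. f (z + t *s v)) has_field_derivative frechet_derivative f (at (z + t *s v)) v) (at t)"
proof -
  have "((\<lambda>t. z + t *s v) has_derivative (\<lambda>t. t *s v)) (at t)"
    using has_derivative_add[OF has_derivative_const bounded_linear_imp_has_derivative[OF bounded_linear_scale_vec]]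
    by simp
  from has_derivative_compose[OF this holo_onD(2)[OF assms]]
  show ?thesis
    unfolding has_field_derivative_def by (rule has_derivative_eq_rhs) (simp add: fun_eq_iff holo_onD(3)[OF assms] mult.commute)
qed

text \<open>Cauchy's formula on circles in the complex line through \<open>z\<close> with direction \<open>v\<close>; the contour and
  the kernel \<open>w\<close> do not depend on \<open>z\<close>.\<close>

lemma dir_deriv_integral:
  assumes "open S" "holo_on f S" "z0 \<in> S"
  obtains d \<gamma> w where "d > 0" "ball z0 d \<subseteq> S" "continuous_on {0..1::real} \<gamma>" "continuous_on {0..1} w"
    "\<And>z x. z \<in> ball z0 d \<Longrightarrow> x \<in> {0..1} \<Longrightarrow> z + \<gamma> x *s v \<in> S"
    "\<And>z. z \<in> ball z0 d \<Longrightarrow> frechet_derivative f (at z) v = integral {0..1} (\<lambda>x. f (z + \<gamma> x *s v) * w x)"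
proof -
  obtain e where e: "e > 0" "ball z0 e \<subseteq> S"
    using assms openE by blast
  \<comment> \<open>Adding 1 keeps \<open>N\<close> positive for \<open>v = 0\<close>. Half of the
    radius \<open>e\<close> is left for \<open>z\<close>, the other half for the circle around
    it.\<close>
  define N where "N = norm v + 1"
  define r where "r = e / (2 * N)"
  have "N > 0" by (simp add: N_def add_nonneg_pos)
  then have r: "r > 0" "r * N = e / 2" using e by (auto simp: r_def)
  have rv: "r * norm v < e / 2" using r by (simp add: N_def algebra_simps)
  have inS: "z + t *s v \<in> S" if "z \<in> ball z0 (e / 2)" "norm t \<le> r" for z t
  proof -
    have "norm (t *s v) \<le> r * norm v" using that by (simp add: norm_scale_vec mult_right_mono)
    then have "dist z0 z + dist z (z + t *s v) < e" using rv that by (simp add: dist_norm)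
    then have "z + t *s v \<in> ball z0 e" using dist_triangle[of z0 "z + t *s v" z] by simp
    then show ?thesis using e by blast
  qed
  \<comment> \<open>The Cauchy kernel of the first derivative, multiplied by the velocity of the
    parametrised circle.\<close>
  define w where "w x = 1 / (2 * of_real pi * \<i>) * (1 / (circlepath 0 r x)\<^sup>2 * vector_derivative (circlepath 0 r) (at x))" for x
  have nz: "circlepath 0 r x \<noteq> 0" for x using r by (simp add: circlepath)
  show thesis
  proof (rule that[of "e / 2" "circlepath 0 r" w])
    show "ball z0 (e / 2) \<subseteq> S" using e by (auto intro!: set_mp[OF e(2)])
    show "continuous_on {0..1} (circlepath 0 r)" using path_circlepath[of 0 r] by (simp add: path_def)
    then show "continuous_on {0..1} w" unfolding w_def vector_derivative_circlepath
      by (intro continuous_intros) (auto simp: nz)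
    fix z assume z: "z \<in> ball z0 (e / 2)"
    show "z + circlepath 0 r x *s v \<in> S" for x
      using z r by (intro inS) (auto simp: circlepath norm_mult)
    have D: "((\<lambda>t. f (z + t *s v)) has_field_derivative frechet_derivative f (at (z + t *s v)) v) (at t)" if "norm t \<le> r" for t
      by (rule holo_on_line[OF assms(2) inS[OF z that]])
    have "((\<lambda>t. f (z + t *s v)) has_field_derivative (1 / (2 * of_real pi * \<i>) *
        contour_integral (circlepath 0 r) (\<lambda>u. f (z + u *s v) / (u - 0)\<^sup>2))) (at 0)"
    proof (rule Cauchy_derivative_integral_circlepath)
      show "continuous_on (cball 0 r) (\<lambda>t. f (z + t *s v))"
        using D by (intro continuous_at_imp_continuous_on ballI) (auto intro!: DERIV_isCont)
      show "(\<lambda>t. f (z + t *s v)) holomorphic_on ball 0 r"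
        using D by (intro holomorphic_onI) (auto simp: field_differentiable_def intro: has_field_derivative_at_within less_imp_le)
    qed (use r in auto)
    with D[of 0] r have "frechet_derivative f (at z) v = 1 / (2 * of_real pi * \<i>) *
        contour_integral (circlepath 0 r) (\<lambda>u. f (z + u *s v) / u\<^sup>2)"
      using DERIV_unique by (fastforce simp: vec_eq_iff)
    also have "\<dots> = integral {0..1} (\<lambda>x. f (z + circlepath 0 r x *s v) * w x)"
      unfolding contour_integral_integral w_def by (subst integral_mult_right[symmetric]) (simp add: mult_ac)
    finally show "frechet_derivative f (at z) v = integral {0..1} (\<lambda>x. f (z + circlepath 0 r x *s v) * w x)" .
  qed (use e in auto)
qed

lemma holo_on_continuous: "holo_on f S \<Longrightarrow> continuous_on S f"
  by (intro continuous_at_imp_continuous_on ballI differentiable_imp_continuous_within holo_onD(1))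

lemma continuous_on_add_scale_vec:
  fixes v :: "complex ^ 'n"
  assumes "continuous_on T g" "continuous_on T h"
  shows "continuous_on T (\<lambda>x. g x + h x *s v)"
  using bounded_linear.continuous_on[OF bounded_linear_scale_vec assms(2)] assms(1) by (intro continuous_intros)

text \<open>\<open>holo_on\<close> does not ask for continuous derivatives. The integral
  representation supplies the continuity that differentiation under the integral sign requires
  below.\<close>

lemma continuous_on_dir_deriv:
  assumes "open S" "holo_on f S"
  shows "continuous_on S (dir_deriv f v)"
proof -
  have "isCont (dir_deriv f v) z0" if "z0 \<in> S" for z0
  proof -
    obtain d \<gamma> w where *: "d > 0" "ball z0 d \<subseteq> S" "continuous_on {0..1::real} \<gamma>" "continuous_on {0..1} w"
      "\<And>z x. z \<in> ball z0 d \<Longrightarrow> x \<in> {0..1} \<Longrightarrow> z + \<gamma> x *s v \<in> S"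
      "\<And>z. z \<in> ball z0 d \<Longrightarrow> frechet_derivative f (at z) v = integral {0..1} (\<lambda>x. f (z + \<gamma> x *s v) * w x)"
      using dir_deriv_integral[OF assms \<open>z0 \<in> S\<close>, where v = v] by blast
    have "continuous_on (ball z0 d \<times> {0..1}) (\<lambda>p. fst p + \<gamma> (snd p) *s v)"
      by (intro continuous_on_add_scale_vec continuous_intros continuous_on_compose2[OF *(3)]) auto
    then have "continuous_on (ball z0 d \<times> {0..1}) (\<lambda>p. f (fst p + \<gamma> (snd p) *s v))"
      by (rule continuous_on_compose2[OF holo_on_continuous[OF assms(2)]]) (use *(5) in auto)
    then have "continuous_on (ball z0 d \<times> {0..1}) (\<lambda>(z, x). f (z + \<gamma> x *s v) * w x)"
      unfolding split_beta by (intro continuous_intros continuous_on_compose2[OF *(4)]) auto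
    then have "continuous_on (ball z0 d) (\<lambda>z. integral (cbox 0 1) (\<lambda>x. f (z + \<gamma> x *s v) * w x))"
      by (intro integral_continuous_on_param) simp
    then have "continuous_on (ball z0 d) (dir_deriv f v)"
      by (rule continuous_on_eq) (simp add: *(6))
    then show ?thesis using *(1) by (simp add: continuous_on_eq_continuous_at)
  qed
  then show ?thesis by (simp add: continuous_at_imp_continuous_on)
qed

text \<open>The integral formula is differentiated under the integral sign, and complex linearity
  passes from the integrand to the integral. Iteration gives derivatives of all orders.\<close>

lemma holo_on_dir_deriv:
  assumes "open S" "holo_on f S"
  shows "holo_on (dir_deriv f v) S"
  unfolding holo_on_def
proof
  fix z0 assume "z0 \<in> S"
  obtain d \<gamma> w where *: "d > 0" "ball z0 d \<subseteq> S" "continuous_on {0..1::real} \<gamma>" "continuous_on {0..1} w"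
    "\<And>z x. z \<in> ball z0 d \<Longrightarrow> x \<in> {0..1} \<Longrightarrow> z + \<gamma> x *s v \<in> S"
    "\<And>z. z \<in> ball z0 d \<Longrightarrow> frechet_derivative f (at z) v = integral {0..1} (\<lambda>x. f (z + \<gamma> x *s v) * w x)"
    using dir_deriv_integral[OF assms \<open>z0 \<in> S\<close>, where v = v] by blast
  define Df where "Df z = Blinfun (frechet_derivative f (at z))" for z
  have Df: "blinfun_apply (Df z) = frechet_derivative f (at z)" if "z \<in> S" for z
    unfolding Df_def by (intro bounded_linear_Blinfun_apply has_derivative_bounded_linear[OF holo_onD(2)[OF assms(2) that]])
  \<comment> \<open>The derivative of the integrand as a bounded operator, the form in which the
    Leibniz rule for parameter integrals takes it.\<close>
  define W where "W z x = blinfun_mult_left (w x) o\<^sub>L Df (z + \<gamma> x *s v)" for z x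
  have W: "blinfun_apply (W z x) u = frechet_derivative f (at (z + \<gamma> x *s v)) u * w x"
    if "z \<in> ball z0 d" "x \<in> {0..1}" for z x u
    using Df[OF *(5)[OF that]] by (simp add: W_def)
  have cont0: "continuous_on (ball z0 d \<times> {0..1}) (\<lambda>p. fst p + \<gamma> (snd p) *s v)"
    by (intro continuous_on_add_scale_vec continuous_intros continuous_on_compose2[OF *(3)]) auto
  have contg: "continuous_on (ball z0 d \<times> {0..1}) (\<lambda>p. g (fst p + \<gamma> (snd p) *s v) * w (snd p))" if "continuous_on S g" for g
    by (intro continuous_intros continuous_on_compose2[OF *(4)] continuous_on_compose2[OF that cont0]) (use *(5) in auto)
  have contW: "continuous_on (ball z0 d \<times> {0..1}) (\<lambda>(z, x). W z x)"
  proof (rule continuous_on_blinfun_componentwise)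
    fix u :: "complex ^ 2"
    show "continuous_on (ball z0 d \<times> {0..1}) (\<lambda>p. blinfun_apply (case p of (z, x) \<Rightarrow> W z x) u)"
      by (rule continuous_on_eq[OF contg[OF continuous_on_dir_deriv[OF assms, of u]]]) (auto simp: W)
  qed
  have D: "((\<lambda>z. integral (cbox 0 1) (\<lambda>x. f (z + \<gamma> x *s v) * w x)) has_derivative
      blinfun_apply (integral (cbox 0 1) (W z0))) (at z0 within ball z0 d)"
  proof (rule leibniz_rule)
    fix z and t :: real assume zt: "z \<in> ball z0 d" "t \<in> cbox 0 1"
    have "z + \<gamma> t *s v \<in> S" using *(5) zt by simp
    from holo_onD(2)[OF assms(2) this]
    have "((\<lambda>z. f (z + \<gamma> t *s v)) has_derivative frechet_derivative f (at (z + \<gamma> t *s v))) (at z)"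
      by (rule has_derivative_compose[rotated]) (auto intro!: derivative_eq_intros)
    then have "((\<lambda>z. f (z + \<gamma> t *s v) * w t) has_derivative (\<lambda>u. frechet_derivative f (at (z + \<gamma> t *s v)) u * w t)) (at z)"
      by (rule has_derivative_mult_left)
    moreover have "(\<lambda>u. frechet_derivative f (at (z + \<gamma> t *s v)) u * w t) = blinfun_apply (W z t)"
      using W zt by auto
    ultimately show "((\<lambda>z. f (z + \<gamma> t *s v) * w t) has_derivative blinfun_apply (W z t)) (at z within ball z0 d)"
      by (simp add: has_derivative_at_withinI)
  next
    fix z assume z: "z \<in> ball z0 d"
    have "continuous_on {0..1} (Pair z)" by (intro continuous_intros)
    from continuous_on_compose2[OF contg[OF holo_on_continuous[OF assms(2)]] this] z
    have "continuous_on {0..1} (\<lambda>x. f (z + \<gamma> x *s v) * w x)" by fastforce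
    then show "(\<lambda>x. f (z + \<gamma> x *s v) * w x) integrable_on cbox 0 1"
      by (simp add: integrable_continuous_real)
  next
    show "continuous_on (ball z0 d \<times> cbox 0 1) (\<lambda>(z, x). W z x)" using contW unfolding box_real .
    show "z0 \<in> ball z0 d" using *(1) by simp
  qed (rule convex_ball)
  have "((\<lambda>z. integral {0..1} (\<lambda>x. f (z + \<gamma> x *s v) * w x)) has_derivative
      blinfun_apply (integral {0..1} (W z0))) (at z0)"
  proof -
    have "at z0 within ball z0 d = at z0" using *(1) by (intro at_within_open) auto
    then show ?thesis using D unfolding box_real by (simp only:)
  qed
  then have "(dir_deriv f v has_derivative blinfun_apply (integral {0..1} (W z0))) (at z0)"
    by (rule has_derivative_transform_within_open[of _ _ _ _ "ball z0 d"]) (simp_all add: *(1,6))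
  moreover have "blinfun_apply (integral {0..1} (W z0)) (c *s u) = c * blinfun_apply (integral {0..1} (W z0)) u" for c u
  proof -
    have "continuous_on {0..1} (W z0)"
    proof -
      have "continuous_on {0..1} (Pair z0)" by (intro continuous_intros)
      from continuous_on_compose2[OF contW this] show ?thesis using *(1) by fastforce
    qed
    then have int: "W z0 integrable_on {0..1}" by (rule integrable_continuous_real)
    have ap: "blinfun_apply (integral {0..1} (W z0)) u = integral {0..1} (\<lambda>x. frechet_derivative f (at (z0 + \<gamma> x *s v)) u * w x)" for u
      unfolding blinfun_apply_integral[OF int] using W *(1) by (intro integral_cong) auto
    have "integral {0..1} (\<lambda>x. frechet_derivative f (at (z0 + \<gamma> x *s v)) (c *s u) * w x)
        = integral {0..1} (\<lambda>x. c * (frechet_derivative f (at (z0 + \<gamma> x *s v)) u * w x))"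
      using *(1,5) by (intro integral_cong) (auto simp: holo_onD(3)[OF assms(2)])
    then show ?thesis unfolding ap by simp
  qed
  ultimately show "\<exists>f'. (dir_deriv f v has_derivative f') (at z0) \<and> (\<forall>c v. f' (c *s v) = c * f' v)"
    by blast
qed

lemma holo_on_imp_smooth_on:
  assumes "open S" "holo_on f S"
  shows "smooth_on S f"
proof -
  have "times_diff n S f" for n
    using assms(2)
  proof (induction n arbitrary: f)
    case (Suc n)
    show ?case
      using holo_onD(1)[OF Suc.prems] Suc.IH[OF holo_on_dir_deriv[OF assms(1) Suc.prems]] by simp
  qed simp
  then show ?thesis by (simp add: smooth_on_iff_times_diff)
qed

lemma holo_on_const: "holo_on (\<lambda>z. c) S"
  by (rule holo_onI) (auto simp: frechet_derivative_const)

lemma holo_on_add: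
  assumes "holo_on f S" "holo_on g S"
  shows "holo_on (\<lambda>z. f z + g z) S"
  unfolding holo_on_def
proof
  fix z assume z: "z \<in> S"
  note f = holo_onD[OF assms(1) z] and g = holo_onD[OF assms(2) z]
  show "\<exists>f'. ((\<lambda>z. f z + g z) has_derivative f') (at z) \<and> (\<forall>c v. f' (c *s v) = c * f' v)"
    by (intro exI conjI, rule has_derivative_add[OF f(2) g(2)]) (simp add: f(3) g(3) distrib_left)
qed

lemma holo_on_mult:
  assumes "holo_on f S" "holo_on g S"
  shows "holo_on (\<lambda>z. f z * g z) S"
  unfolding holo_on_def
proof
  fix z assume z: "z \<in> S"
  note f = holo_onD[OF assms(1) z] and g = holo_onD[OF assms(2) z]
  show "\<exists>f'. ((\<lambda>z. f z * g z) has_derivative f') (at z) \<and> (\<forall>c v. f' (c *s v) = c * f' v)"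
    by (intro exI conjI, rule has_derivative_mult[OF f(2) g(2)]) (simp add: f(3) g(3) distrib_left mult_ac)
qed

lemma holo_on_sum: "(\<And>i. i \<in> I \<Longrightarrow> holo_on (f i) S) \<Longrightarrow> holo_on (\<lambda>z. \<Sum>i\<in>I. f i z) S"
  by (induction I rule: infinite_finite_induct) (simp_all add: holo_on_const holo_on_add)

lemma holo_on_subset: "holo_on f T \<Longrightarrow> S \<subseteq> T \<Longrightarrow> holo_on f S"
  by (auto simp: holo_on_def)

lemma holo_on_cong:
  assumes "open S" "\<And>z. z \<in> S \<Longrightarrow> f z = g z" "holo_on f S"
  shows "holo_on g S"
  using assms unfolding holo_on_def by (metis has_derivative_transform_within_open)

lemma holo_on_locally:
  assumes "\<And>z. z \<in> S \<Longrightarrow> \<exists>T. z \<in> T \<and> holo_on f T"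
  shows "holo_on f S"
  using assms unfolding holo_on_def by blast

text \<open>Formed from the components, since the calculus so far is for scalar functions; for maps
  with holomorphic components it is the Frechet derivative.\<close>

definition vec_deriv :: "(complex ^ 2 \<Rightarrow> complex ^ 2) \<Rightarrow> complex ^ 2 \<Rightarrow> complex ^ 2 \<Rightarrow> complex ^ 2" where
  "vec_deriv F z v = (\<chi> i. frechet_derivative (\<lambda>z. F z $ i) (at z) v)"

lemma holo_on_vec:
  assumes "\<And>i. holo_on (\<lambda>z. F z $ i) S" "z \<in> S"
  shows "(F has_derivative vec_deriv F z) (at z)" "vec_deriv F z (c *s v) = c *s vec_deriv F z v"
    "frechet_derivative F (at z) = vec_deriv F z"
proof -
  show "(F has_derivative vec_deriv F z) (at z)"
    by (rule has_derivative_vec) (simp add: vec_deriv_def holo_onD(2)[OF assms])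
  then show "frechet_derivative F (at z) = vec_deriv F z"
    by (rule frechet_derivative_at[symmetric])
  show "vec_deriv F z (c *s v) = c *s vec_deriv F z v"
    by (simp add: vec_eq_iff vec_deriv_def holo_onD(3)[OF assms])
qed

lemma holo_on_compose:
  assumes "\<And>i. holo_on (\<lambda>z. F z $ i) S" "holo_on f T" "\<And>z. z \<in> S \<Longrightarrow> F z \<in> T"
  shows "holo_on (\<lambda>z. f (F z)) S"
  unfolding holo_on_def
proof
  fix z assume z: "z \<in> S"
  note F = holo_on_vec[of F, OF assms(1) z] and f = holo_onD[OF assms(2) assms(3)[OF z]]
  show "\<exists>f'. ((\<lambda>z. f (F z)) has_derivative f') (at z) \<and> (\<forall>c v. f' (c *s v) = c * f' v)"
    by (rule exI, rule conjI, rule has_derivative_compose[OF F(1) f(2)]) (simp only: F(2) f(3) simp_thms)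
qed

subsection \<open>Symmetry of second derivatives\<close>

text \<open>The mean value theorem needs real values, whence the functional \<open>L\<close>, later
  the real or the imaginary part. It is applied along \<open>v\<close> to the difference in
  direction \<open>w\<close>, and then along \<open>w\<close>.\<close>

lemma second_difference_mvt:
  fixes v w :: "complex ^ 2"
  assumes L: "bounded_linear (L :: complex \<Rightarrow> real)" and "t > 0"
    and f: "\<And>a b. 0 \<le> a \<Longrightarrow> a \<le> t \<Longrightarrow> 0 \<le> b \<Longrightarrow> b \<le> t \<Longrightarrow> f differentiable at (z + a *\<^sub>R v + b *\<^sub>R w)"
    and Df: "\<And>a b. 0 \<le> a \<Longrightarrow> a \<le> t \<Longrightarrow> 0 \<le> b \<Longrightarrow> b \<le> t \<Longrightarrow> dir_deriv f v differentiable at (z + a *\<^sub>R v + b *\<^sub>R w)"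
  obtains a b where "0 < a" "a < t" "0 < b" "b < t"
    "L (f (z + t *\<^sub>R v + t *\<^sub>R w)) - L (f (z + t *\<^sub>R v)) - L (f (z + t *\<^sub>R w)) + L (f z)
       = t * t * L (dir_deriv (dir_deriv f v) w (z + a *\<^sub>R v + b *\<^sub>R w))"
proof -
  let ?p = "\<lambda>a b. z + a *\<^sub>R v + b *\<^sub>R w"
  have D1: "((\<lambda>a. L (f (?p a b))) has_real_derivative L (dir_deriv f v (?p a b))) (at a)"
    if "0 \<le> a" "a \<le> t" "0 \<le> b" "b \<le> t" for a b
  proof -
    have "(f has_derivative frechet_derivative f (at (?p a b))) (at (?p a b))"
      using f that frechet_derivative_works by blast
    moreover have "((\<lambda>a. z + a *\<^sub>R v + b *\<^sub>R w) has_derivative (\<lambda>h. h *\<^sub>R v)) (at a)"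
      by (auto intro!: derivative_eq_intros)
    ultimately have "((\<lambda>a. f (?p a b)) has_derivative (\<lambda>h. frechet_derivative f (at (?p a b)) (h *\<^sub>R v))) (at a)"
      using has_derivative_compose by blast
    from bounded_linear.has_derivative[OF L this]
    have "((\<lambda>a. L (f (?p a b))) has_derivative (\<lambda>h. L (frechet_derivative f (at (?p a b)) (h *\<^sub>R v)))) (at a)" .
    moreover have "L (frechet_derivative f (at (?p a b)) (h *\<^sub>R v)) = L (dir_deriv f v (?p a b)) * h" for h
      using linear_frechet_derivative[OF f[OF that]] bounded_linear.linear[OF L] by (simp add: linear_cmul)
    ultimately show ?thesis by (simp add: has_field_derivative_def)
  qed
  have D2: "((\<lambda>b. L (dir_deriv f v (?p a b))) has_real_derivative L (dir_deriv (dir_deriv f v) w (?p a b))) (at b)"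
    if "0 \<le> a" "a \<le> t" "0 \<le> b" "b \<le> t" for a b
  proof -
    let ?g = "dir_deriv f v"
    have "(?g has_derivative frechet_derivative ?g (at (?p a b))) (at (?p a b))"
      using Df that frechet_derivative_works by blast
    moreover have "((\<lambda>b. z + a *\<^sub>R v + b *\<^sub>R w) has_derivative (\<lambda>h. h *\<^sub>R w)) (at b)"
      by (auto intro!: derivative_eq_intros)
    ultimately have "((\<lambda>b. ?g (?p a b)) has_derivative (\<lambda>h. frechet_derivative ?g (at (?p a b)) (h *\<^sub>R w))) (at b)"
      using has_derivative_compose[of _ _ b UNIV ?g] by blast
    from bounded_linear.has_derivative[OF L this]
    have "((\<lambda>b. L (?g (?p a b))) has_derivative (\<lambda>h. L (frechet_derivative ?g (at (?p a b)) (h *\<^sub>R w)))) (at b)" .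
    moreover have "L (frechet_derivative ?g (at (?p a b)) (h *\<^sub>R w)) = L (dir_deriv ?g w (?p a b)) * h" for h
      using linear_frechet_derivative[OF Df[OF that]] bounded_linear.linear[OF L] by (simp add: linear_cmul)
    ultimately show ?thesis by (simp add: has_field_derivative_def)
  qed
  define g where "g a = L (f (z + a *\<^sub>R v + t *\<^sub>R w)) - L (f (z + a *\<^sub>R v + 0 *\<^sub>R w))" for a
  have "\<exists>a. 0 < a \<and> a < t \<and> g t - g 0 = (t - 0) * (L (dir_deriv f v (z + a *\<^sub>R v + t *\<^sub>R w)) - L (dir_deriv f v (z + a *\<^sub>R v + 0 *\<^sub>R w)))"
    unfolding g_def by (rule MVT2[OF \<open>t > 0\<close>]) (intro DERIV_diff D1; use \<open>t > 0\<close> in simp)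
  then obtain a where a: "0 < a" "a < t"
    "g t - g 0 = (t - 0) * (L (dir_deriv f v (z + a *\<^sub>R v + t *\<^sub>R w)) - L (dir_deriv f v (z + a *\<^sub>R v + 0 *\<^sub>R w)))" by blast
  have "\<exists>b. 0 < b \<and> b < t \<and> L (dir_deriv f v (z + a *\<^sub>R v + t *\<^sub>R w)) - L (dir_deriv f v (z + a *\<^sub>R v + 0 *\<^sub>R w))
      = (t - 0) * L (dir_deriv (dir_deriv f v) w (?p a b))"
    by (rule MVT2[OF \<open>t > 0\<close>, where f = "\<lambda>b. L (dir_deriv f v (?p a b))"])
      (rule D2; use a in simp)
  then obtain b where b: "0 < b" "b < t" "L (dir_deriv f v (z + a *\<^sub>R v + t *\<^sub>R w)) - L (dir_deriv f v (z + a *\<^sub>R v + 0 *\<^sub>R w))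
      = (t - 0) * L (dir_deriv (dir_deriv f v) w (?p a b))" by blast
  show thesis
    by (rule that[OF a(1,2) b(1,2)]) (use a(3) b(3) in \<open>simp add: g_def\<close>)
qed

text \<open>The second difference over a parallelogram is symmetric in \<open>v\<close> and
  \<open>w\<close>, and it equals \<open>t * t\<close> times either mixed derivative at some point
  of the parallelogram. Continuity then forces equality at \<open>z\<close>.\<close>

lemma dir_deriv_commute:
  assumes "open S" "smooth_on S f" "z \<in> S"
  shows "dir_deriv (dir_deriv f v) w z = dir_deriv (dir_deriv f w) v z"
proof -
  have "L (dir_deriv (dir_deriv f v) w z) = L (dir_deriv (dir_deriv f w) v z)" if L: "bounded_linear L" for L :: "complex \<Rightarrow> real"
  proof (rule ccontr)
    assume ne: "\<not> ?thesis"
    define e where "e = \<bar>L (dir_deriv (dir_deriv f v) w z) - L (dir_deriv (dir_deriv f w) v z)\<bar>"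
    have "e > 0" using ne by (simp add: e_def)
    have cont: "isCont (\<lambda>z. L (dir_deriv (dir_deriv f v) w z)) z" for v w
    proof -
      have "isCont (dir_deriv (dir_deriv f v) w) z"
        by (intro differentiable_imp_continuous_within smooth_on_differentiable[OF _ assms(3)] smooth_on_dir_deriv assms(2))
      then show ?thesis by (rule bounded_linear.isCont[OF L])
    qed
    obtain d0 where d0: "d0 > 0" "ball z d0 \<subseteq> S" using assms openE by blast
    obtain d1 where d1: "d1 > 0" "\<And>y. dist y z < d1 \<Longrightarrow> dist (L (dir_deriv (dir_deriv f v) w y)) (L (dir_deriv (dir_deriv f v) w z)) < e / 2"
      using cont[of v w] \<open>e > 0\<close> unfolding continuous_at_eps_delta by (meson half_gt_zero)
    obtain d2 where d2: "d2 > 0" "\<And>y. dist y z < d2 \<Longrightarrow> dist (L (dir_deriv (dir_deriv f w) v y)) (L (dir_deriv (dir_deriv f w) v z)) < e / 2"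
      using cont[of w v] \<open>e > 0\<close> unfolding continuous_at_eps_delta by (meson half_gt_zero)
    define d where "d = min d0 (min d1 d2)"
    define N where "N = norm v + norm w + 1"
    \<comment> \<open>With this size every point of the parallelogram is closer than
      \<open>d\<close> to \<open>z\<close>.\<close>
    define t where "t = d / (2 * N)"
    have "d > 0" "N > 0" using d0 d1 d2 by (auto simp: d_def N_def add_nonneg_pos)
    then have t: "t > 0" "t * N < d" by (auto simp: t_def)
    have near: "dist (z + a *\<^sub>R v + b *\<^sub>R w) z < d" "dist (z + a *\<^sub>R w + b *\<^sub>R v) z < d"
      if "0 \<le> a" "a \<le> t" "0 \<le> b" "b \<le> t" for a b
    proof -
      have 1: "norm (a *\<^sub>R x) \<le> t * norm x" "norm (b *\<^sub>R x) \<le> t * norm x" for x :: "complex ^ 2"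
        using that by (auto intro: mult_right_mono)
      have "t * norm v + t * norm w < d" using t by (simp add: N_def algebra_simps)
      then show "dist (z + a *\<^sub>R v + b *\<^sub>R w) z < d" "dist (z + a *\<^sub>R w + b *\<^sub>R v) z < d"
        using norm_triangle_ineq[of "a *\<^sub>R v" "b *\<^sub>R w"] norm_triangle_ineq[of "a *\<^sub>R w" "b *\<^sub>R v"] 1[of v] 1[of w]
        by (auto simp: dist_norm)
    qed
    have inS: "z + a *\<^sub>R v + b *\<^sub>R w \<in> S" "z + a *\<^sub>R w + b *\<^sub>R v \<in> S" if "0 \<le> a" "a \<le> t" "0 \<le> b" "b \<le> t" for a b
      using near[OF that] d0(2) by (auto simp: d_def dist_commute subset_iff)
    obtain a b where ab: "0 < a" "a < t" "0 < b" "b < t"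
      "L (f (z + t *\<^sub>R v + t *\<^sub>R w)) - L (f (z + t *\<^sub>R v)) - L (f (z + t *\<^sub>R w)) + L (f z)
         = t * t * L (dir_deriv (dir_deriv f v) w (z + a *\<^sub>R v + b *\<^sub>R w))"
      by (rule second_difference_mvt[OF L t(1), of f z v w]; (assumption | rule smooth_on_differentiable[OF assms(2) inS(1)]
        smooth_on_differentiable[OF smooth_on_dir_deriv[OF assms(2)] inS(1)])?; assumption?)
    obtain a' b' where ab': "0 < a'" "a' < t" "0 < b'" "b' < t"
      "L (f (z + t *\<^sub>R w + t *\<^sub>R v)) - L (f (z + t *\<^sub>R w)) - L (f (z + t *\<^sub>R v)) + L (f z)
         = t * t * L (dir_deriv (dir_deriv f w) v (z + a' *\<^sub>R w + b' *\<^sub>R v))"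
      by (rule second_difference_mvt[OF L t(1), of f z w v]; (assumption | rule smooth_on_differentiable[OF assms(2) inS(2)]
        smooth_on_differentiable[OF smooth_on_dir_deriv[OF assms(2)] inS(2)])?; assumption?)
    have "z + t *\<^sub>R w + t *\<^sub>R v = z + t *\<^sub>R v + t *\<^sub>R w" by simp
    then have "L (f (z + t *\<^sub>R w + t *\<^sub>R v)) = L (f (z + t *\<^sub>R v + t *\<^sub>R w))" by (simp only:)
    then have "t * t * L (dir_deriv (dir_deriv f v) w (z + a *\<^sub>R v + b *\<^sub>R w))
        = t * t * L (dir_deriv (dir_deriv f w) v (z + a' *\<^sub>R w + b' *\<^sub>R v))"
      using ab(5) ab'(5) by linarith
    then have eq: "L (dir_deriv (dir_deriv f v) w (z + a *\<^sub>R v + b *\<^sub>R w)) = L (dir_deriv (dir_deriv f w) v (z + a' *\<^sub>R w + b' *\<^sub>R v))"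
      using t by simp
    have "dist (L (dir_deriv (dir_deriv f v) w (z + a *\<^sub>R v + b *\<^sub>R w))) (L (dir_deriv (dir_deriv f v) w z)) < e / 2"
      using near(1)[of a b] ab by (intro d1) (auto simp: d_def)
    moreover have "dist (L (dir_deriv (dir_deriv f w) v (z + a' *\<^sub>R w + b' *\<^sub>R v))) (L (dir_deriv (dir_deriv f w) v z)) < e / 2"
      using near(2)[of a' b'] ab' by (intro d2) (auto simp: d_def)
    ultimately have "dist (L (dir_deriv (dir_deriv f v) w z)) (L (dir_deriv (dir_deriv f w) v z)) < e"
      unfolding eq by (rule dist_triangle_half_r)
    then show False by (simp add: e_def dist_real_def)
  qed
  from this[OF bounded_linear_Re] this[OF bounded_linear_Im] show ?thesis
    by (simp add: complex_eq_iff)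
qed

section \<open>The algebra of functionals on lists of vectors\<close>

text \<open>The wedge product of the definitions is a ring multiplication on arbitrary functions of lists;
  it is characterised by the rule \<open>\<iota>\<^sub>v (a b) = (\<iota>\<^sub>v a) b + (\<epsilon> a) (\<iota>\<^sub>v b)\<close> for the contraction \<open>\<iota>\<^sub>v\<close>
  (prefixing \<open>v\<close> to the list) and the grading involution \<open>\<epsilon>\<close>. All identities are proved from this rule
  by induction on the list.\<close>

datatype 'v ext = Ext (app: "'v list \<Rightarrow> complex")

lemma ext_eqI: "(\<And>vs. app a vs = app b vs) \<Longrightarrow> a = b"
  by (cases a; cases b) auto

text \<open>The first vector goes to the left factor, or it moves past all arguments of the left
  factor to the right one; the sign of that move is stored in the left factor.\<close>

fun shuffle_prod :: "('v list \<Rightarrow> complex) \<Rightarrow> ('v list \<Rightarrow> complex) \<Rightarrow> 'v list \<Rightarrow> complex" where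
  "shuffle_prod a b [] = a [] * b []"
| "shuffle_prod a b (v # vs) = shuffle_prod (\<lambda>ws. a (v # ws)) b vs
     + shuffle_prod (\<lambda>ws. (-1) ^ length ws * a ws) (\<lambda>ws. b (v # ws)) vs"

definition scal :: "complex \<Rightarrow> 'v ext" where
  "scal c = Ext (\<lambda>vs. if vs = [] then c else 0)"

definition contr :: "'v \<Rightarrow> 'v ext \<Rightarrow> 'v ext" where
  "contr v a = Ext (\<lambda>vs. app a (v # vs))"

definition grade :: "'v ext \<Rightarrow> 'v ext" where
  "grade a = Ext (\<lambda>vs. (-1) ^ length vs * app a vs)"

instantiation ext :: (type) "{one,times,ab_group_add}"
begin
definition "1 = scal 1"
definition "0 = Ext (\<lambda>vs. 0)"
definition "a + b = Ext (\<lambda>vs. app a vs + app b vs)"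
definition "a - b = Ext (\<lambda>vs. app a vs - app b vs)"
definition "- a = Ext (\<lambda>vs. - app a vs)"
definition "a * b = Ext (shuffle_prod (app a) (app b))"
instance
  by standard (auto simp: zero_ext_def plus_ext_def minus_ext_def uminus_ext_def)
end

lemma app_simps [simp]:
  "app 0 vs = 0" "app (a + b) vs = app a vs + app b vs" "app (a - b) vs = app a vs - app b vs"
  "app (- a) vs = - app a vs" "app (contr v a) vs = app a (v # vs)"
  "app (grade a) vs = (-1) ^ length vs * app a vs"
  "app (scal c) [] = c" "app (scal c) (v # vs) = 0"
  "app 1 [] = 1" "app 1 (v # vs) = 0"
  by (simp_all add: zero_ext_def plus_ext_def minus_ext_def uminus_ext_def contr_def grade_def scal_def one_ext_def)

lemma app_mult [simp]:
  "app (a * b) [] = app a [] * app b []"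
  "app (a * b) (v # vs) = app (contr v a * b) vs + app (grade a * contr v b) vs"
  by (simp_all add: times_ext_def contr_def grade_def)

lemma contr_simps [simp]:
  "contr v 0 = 0" "contr v (a + b) = contr v a + contr v b" "contr v (a - b) = contr v a - contr v b"
  "contr v (- a) = - contr v a" "contr v (scal c) = 0" "contr v 1 = 0"
  "contr v (a * b) = contr v a * b + grade a * contr v b"
  "contr v (grade a) = - grade (contr v a)"
  by (intro ext_eqI; simp)+

lemma grade_linear_simps [simp]:
  "grade 0 = 0" "grade (a + b) = grade a + grade b" "grade (a - b) = grade a - grade b"
  "grade (- a) = - grade a" "grade (grade a) = a"
  by (intro ext_eqI; simp add: algebra_simps flip: power_add mult.assoc)+

lemma grade_scal [simp]: "grade (scal c) = (scal c :: 'v ext)" "grade 1 = (1 :: 'v ext)"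
proof -
  show *: "grade (scal c) = (scal c :: 'v ext)" for c
  proof (rule ext_eqI)
    fix vs :: "'v list" show "app (grade (scal c)) vs = app (scal c) vs" by (cases vs) auto
  qed
  show "grade 1 = (1 :: 'v ext)" unfolding one_ext_def by (rule *)
qed

lemma ext_mult_add_left: "(a + b) * c = a * c + b * (c :: 'v ext)"
proof (rule ext_eqI)
  fix vs show "app ((a + b) * c) vs = app (a * c + b * c) vs"
    by (induction vs arbitrary: a b c) (simp_all add: algebra_simps)
qed

lemma ext_mult_add_right: "c * (a + b) = c * a + c * (b :: 'v ext)"
proof (rule ext_eqI)
  fix vs show "app (c * (a + b)) vs = app (c * a + c * b) vs"
    by (induction vs arbitrary: a b c) (simp_all add: algebra_simps)
qed

lemma ext_mult_zero: "0 * a = (0 :: 'v ext)" "a * 0 = (0 :: 'v ext)"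
  using ext_mult_add_left[of 0 0 a] ext_mult_add_right[of a 0 0] by simp_all

lemma ext_mult_minus: "(- a) * b = - (a * b :: 'v ext)" "a * (- b) = - (a * b :: 'v ext)"
  using ext_mult_add_left[of a "- a" b] ext_mult_add_right[of a b "- b"]
  by (simp_all add: ext_mult_zero eq_neg_iff_add_eq_0 add.commute)

lemma grade_mult [simp]: "grade (a * b) = grade a * grade b"
proof (rule ext_eqI)
  fix vs show "app (grade (a * b)) vs = app (grade a * grade b) vs"
  proof (induction vs arbitrary: a b)
    case (Cons v vs)
    have "app (grade (a * b)) (v # vs) = - (app (grade (contr v a * b)) vs + app (grade (grade a * contr v b)) vs)"
      by (simp add: algebra_simps)
    also have "\<dots> = app (grade a * grade b) (v # vs)"
      unfolding Cons.IH by (simp add: ext_mult_minus)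
    finally show ?case .
  qed simp
qed

lemma ext_mult_assoc: "(a * b) * c = a * (b * c :: 'v ext)"
proof (rule ext_eqI)
  fix vs show "app ((a * b) * c) vs = app (a * (b * c)) vs"
    by (induction vs arbitrary: a b c) (simp_all add: ext_mult_add_left ext_mult_add_right)
qed

lemma app_scal_mult: "app (scal k * a) vs = k * app a vs" "app (a * scal k) vs = k * app a vs"
  by (induction vs arbitrary: a) (simp_all add: ext_mult_zero algebra_simps)

instance ext :: (type) ring_1
proof
  fix a b c :: "'a ext"
  have "app (1 * a) vs = app a vs" "app (a * 1) vs = app a vs" for vs
    unfolding one_ext_def using app_scal_mult[where k = 1 and a = a] by simp_all
  then show "1 * a = a" "a * 1 = a" by (metis ext_eqI)+
  have "app (0 :: 'a ext) [] \<noteq> app 1 []" by simp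
  then show "(0 :: 'a ext) \<noteq> 1" by metis
qed (simp_all add: ext_mult_assoc ext_mult_add_left ext_mult_add_right)

lemma app_sum [simp]: "app (\<Sum>i\<in>I. f i) vs = (\<Sum>i\<in>I. app (f i) vs)"
  by (induction I rule: infinite_finite_induct) auto

lemma grade_sum [simp]: "grade (\<Sum>i\<in>I. f i) = (\<Sum>i\<in>I. grade (f i))"
  by (induction I rule: infinite_finite_induct) auto

lemma scal_simps:
  "scal (a + b) = scal a + (scal b :: 'v ext)" "scal (a * b) = scal a * (scal b :: 'v ext)"
  "scal 0 = (0 :: 'v ext)" "scal 1 = (1 :: 'v ext)"
  "scal (- a) = - (scal a :: 'v ext)" "scal (a - b) = scal a - (scal b :: 'v ext)"
  unfolding one_ext_def
  by (rule ext_eqI, (rename_tac vs, case_tac vs)?; simp add: app_scal_mult)+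

lemma scal_sum: "scal (\<Sum>i\<in>I. f i) = (\<Sum>i\<in>I. scal (f i))"
  by (induction I rule: infinite_finite_induct) (auto simp: scal_simps)

lemma scal_commute: "scal k * a = a * scal k"
  by (rule ext_eqI) (simp add: app_scal_mult)

text \<open>Graded commutativity does not need any alternation.\<close>

lemma ext_commute_parity:
  fixes a b :: "'v ext"
  shows "grade a = (if p then - a else a) \<Longrightarrow> grade b = (if q then - b else b) \<Longrightarrow>
    app (a * b) vs = app (if p \<and> q then - (b * a) else b * a) vs"
proof (induction vs arbitrary: a b p q)
  case Nil
  have "app x [] = 0" if "grade x = - x" for x :: "'v ext"
    using arg_cong[OF that, of "\<lambda>x. app x []"] by (simp add: eq_neg_iff_add_eq_0)
  then show ?case using Nil by auto
next
  case (Cons v vs)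
  \<comment> \<open>Contraction reverses parity, so the induction hypothesis is used with one of
    \<open>p\<close> and \<open>q\<close> flipped.\<close>
  have c: "grade (contr v x) = (if \<not> r then - contr v x else contr v x)"
    if "grade x = (if r then - x else x)" for x :: "'v ext" and r
    using arg_cong[OF that, of "contr v"] by (cases r) (simp_all add: minus_equation_iff[of "grade _"])
  note IH = Cons.IH[OF c[OF Cons.prems(1)] Cons.prems(2)] Cons.IH[OF Cons.prems(1) c[OF Cons.prems(2)]]
  show ?case
  proof (cases p; cases q)
    assume "p" "q"
    then show ?case using IH Cons.prems by simp
  next
    assume "p" "\<not> q"
    then show ?case using IH Cons.prems by simp
  next
    assume "\<not> p" "q"
    then show ?case using IH Cons.prems by simp
  next
    assume "\<not> p" "\<not> q"
    then show ?case using IH Cons.prems by simp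
  qed
qed

lemma ext_commute_even: "grade a = a \<Longrightarrow> grade b = b \<Longrightarrow> a * b = (b * a :: 'v ext)"
  using ext_commute_parity[of a False b False] by (intro ext_eqI) simp

lemma ext_commute_odd_even: "grade a = - a \<Longrightarrow> grade b = b \<Longrightarrow> a * b = (b * a :: 'v ext)"
  using ext_commute_parity[of a True b False] by (intro ext_eqI) simp

lemma ext_commute_odd: "grade a = - a \<Longrightarrow> grade b = - b \<Longrightarrow> a * b = - (b * a :: 'v ext)"
  using ext_commute_parity[of a True b True] by (intro ext_eqI) simp

subsection \<open>Alternating multilinear functionals\<close>

text \<open>Exchange of neighbours is inherited by contractions and therefore by products. Vanishing
  on repeated arguments, the condition in \<open>forms\<close>, is equivalent for multilinear
  functionals, as shown below.\<close>

definition skew :: "'v ext \<Rightarrow> bool" where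
  "skew a \<longleftrightarrow> (\<forall>xs u v ys. app a (xs @ u # v # ys) = - app a (xs @ v # u # ys))"

definition multilin :: "'v::real_vector ext \<Rightarrow> bool" where
  "multilin a \<longleftrightarrow> (\<forall>xs ys. linear (\<lambda>v. app a (xs @ v # ys)))"

lemma skewD:
  assumes "skew a" shows "app a (xs @ u # v # ys) = - app a (xs @ v # u # ys)"
  by (rule assms[unfolded skew_def, rule_format])

lemma skewI: "(\<And>xs u v ys. app a (xs @ u # v # ys) = - app a (xs @ v # u # ys)) \<Longrightarrow> skew a"
  unfolding skew_def by (intro allI)

lemma skew_simps: "skew 0" "skew (scal c)"
  by (rule skewI; simp add: scal_def)+

lemma skew_add: "skew a \<Longrightarrow> skew b \<Longrightarrow> skew (a + b)"
proof (rule skewI)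
  fix xs u v ys assume "skew a" "skew b"
  from skewD[OF this(1), of xs u v ys] skewD[OF this(2), of xs u v ys]
  show "app (a + b) (xs @ u # v # ys) = - app (a + b) (xs @ v # u # ys)" by simp
qed

lemma skew_minus: "skew a \<Longrightarrow> skew (- a)"
proof (rule skewI)
  fix xs u v ys assume "skew a"
  from skewD[OF this, of xs u v ys] show "app (- a) (xs @ u # v # ys) = - app (- a) (xs @ v # u # ys)" by simp
qed

lemma skew_grade: "skew a \<Longrightarrow> skew (grade a)"
proof (rule skewI)
  fix xs u v ys assume "skew a"
  from skewD[OF this, of xs u v ys] show "app (grade a) (xs @ u # v # ys) = - app (grade a) (xs @ v # u # ys)" by simp
qed

lemma skew_contr: "skew a \<Longrightarrow> skew (contr w a)"
proof (rule skewI)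
  fix xs u v ys assume "skew a"
  from skewD[OF this, of "w # xs" u v ys] show "app (contr w a) (xs @ u # v # ys) = - app (contr w a) (xs @ v # u # ys)" by simp
qed

lemma skew_mult: "skew a \<Longrightarrow> skew b \<Longrightarrow> skew (a * b)"
proof -
  have *: "app (a * b) (xs @ u # v # ys) = - app (a * b) (xs @ v # u # ys)" if "skew a" "skew b" for xs u v ys a b
    using that
  proof (induction xs arbitrary: a b)
    case Nil
    \<comment> \<open>Skewness in the first two arguments means that contractions anticommute, which
      can be tested on a product by the rule for \<open>contr\<close>.\<close>
    have c: "contr u (contr v x) = - contr v (contr u x)" if "skew x" for x
    proof (rule ext_eqI)
      fix vs show "app (contr u (contr v x)) vs = app (- contr v (contr u x)) vs"
        using skewD[OF that, of "[]" v u vs] by simp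
    qed
    have "contr v (contr u (a * b)) = - contr u (contr v (a * b))"
      by (simp only: contr_simps c[OF Nil(1)] c[OF Nil(2)] grade_linear_simps) (simp add: algebra_simps)
    then have "app (contr v (contr u (a * b))) ys = app (- contr u (contr v (a * b))) ys" by (simp only:)
    then show ?case by (simp only: app_simps append_Nil)
  next
    case (Cons x xs)
    show ?case
      using Cons.IH[OF skew_contr[OF Cons.prems(1)] Cons.prems(2)]
        Cons.IH[OF skew_grade[OF Cons.prems(1)] skew_contr[OF Cons.prems(2)]] by simp
  qed
  show "skew a \<Longrightarrow> skew b \<Longrightarrow> skew (a * b)" unfolding skew_def[of "a * b"] by (intro allI *)
qed

lemma skew_imp_zero:
  assumes "skew a" "\<not> distinct vs"
  shows "app a vs = 0"
proof -
  obtain xs ys zs y where vs: "vs = xs @ [y] @ ys @ [y] @ zs"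
    using not_distinct_decomp[OF assms(2)] by blast
  \<comment> \<open>Exchanges of neighbours carry the first copy of \<open>y\<close> to the
    second.\<close>
  have "app a (xs @ y # ys @ y # zs) = 0"
  proof (induction ys arbitrary: xs)
    case Nil
    have "app a (xs @ y # y # zs) = - app a (xs @ y # y # zs)" by (rule skewD[OF assms(1)])
    then show ?case by (simp add: eq_neg_iff_add_eq_0)
  next
    case (Cons w ys)
    have "app a (xs @ y # w # ys @ y # zs) = - app a ((xs @ [w]) @ y # ys @ y # zs)"
      using skewD[OF assms(1), of xs y w "ys @ y # zs"] by simp
    then show ?case using Cons[of "xs @ [w]"] by simp
  qed
  then show ?thesis by (simp add: vs)
qed

lemma zero_imp_skew:
  assumes "multilin a" "\<And>vs. \<not> distinct vs \<Longrightarrow> app a vs = 0"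
  shows "skew a"
proof (rule skewI)
  fix xs u v ys
  have l1: "linear (\<lambda>u. app a (xs @ u # w # ys))" and l2: "linear (\<lambda>w. app a (xs @ u # w # ys))" for u w
    using assms(1)[unfolded multilin_def, rule_format, of xs "w # ys"]
      assms(1)[unfolded multilin_def, rule_format, of "xs @ [u]" ys] by simp_all
  have z: "app a (xs @ w # w # ys) = 0" for w by (rule assms(2)) simp
  have "0 = app a (xs @ (u + v) # (u + v) # ys)" using z[of "u + v"] by simp
  also have "\<dots> = app a (xs @ u # v # ys) + app a (xs @ v # u # ys)"
    by (simp only: linear_add[OF l1] linear_add[OF l2]) (simp add: z)
  finally have "app a (xs @ u # v # ys) + app a (xs @ v # u # ys) = 0" ..
  then show "app a (xs @ u # v # ys) = - app a (xs @ v # u # ys)"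
    by (rule eq_neg_iff_add_eq_0[THEN iffD2])
qed

lemma multilin_simps: "multilin 0" "multilin a \<Longrightarrow> multilin b \<Longrightarrow> multilin (a + b)" "multilin a \<Longrightarrow> multilin (- a)"
  "multilin a \<Longrightarrow> multilin (grade a)" "multilin (scal c)"
  by (auto simp: multilin_def scal_def intro!: linear_compose_add linear_compose_neg linear_zero linear_compose[OF _ linear_times, unfolded o_def])

text \<open>The linear parameter is kept apart from the argument list, because after a contraction
  it sits inside one of the factors.\<close>

lemma linear_app_mult:
  fixes f :: "'a::real_vector \<Rightarrow> 'v ext"
  shows
  "(\<And>ws. linear (\<lambda>v. app (f v) ws)) \<Longrightarrow> linear (\<lambda>v. app (f v * b) ys)"
  "(\<And>ws. linear (\<lambda>v. app (f v) ws)) \<Longrightarrow> linear (\<lambda>v. app (b * f v) ys)"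
proof -
  have times: "linear (\<lambda>v. h v * c)" "linear (\<lambda>v. c * h v)" if "linear h" for h :: "'a \<Rightarrow> complex" and c
    using that by (auto simp: linear_iff algebra_simps)
  show "(\<And>ws. linear (\<lambda>v. app (f v) ws)) \<Longrightarrow> linear (\<lambda>v. app (f v * b) ys)"
  proof (induction ys arbitrary: f b)
    case (Cons y ys)
    show ?case unfolding app_mult
      by (intro linear_compose_add Cons.IH) (simp_all add: Cons.prems times)
  qed (simp add: times)
  show "(\<And>ws. linear (\<lambda>v. app (f v) ws)) \<Longrightarrow> linear (\<lambda>v. app (b * f v) ys)"
  proof (induction ys arbitrary: f b)
    case (Cons y ys)
    show ?case unfolding app_mult
      by (intro linear_compose_add Cons.IH) (simp_all add: Cons.prems)
  qed (simp add: times)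
qed

lemma multilin_contr: "multilin a \<Longrightarrow> multilin (contr v a)"
  unfolding multilin_def by (simp flip: append_Cons)

lemma multilin_mult:
  assumes "multilin a" "multilin b"
  shows "multilin (a * b)"
  unfolding multilin_def
proof (intro allI)
  fix xs ys
  show "linear (\<lambda>v. app (a * b) (xs @ v # ys))"
    using assms
  proof (induction xs arbitrary: a b)
    case Nil
    have "linear (\<lambda>v. app (contr v a) ws)" "linear (\<lambda>v. app (contr v b) ws)" for ws
      using Nil[unfolded multilin_def, rule_format, of "[]"] by simp_all
    then show ?case by (simp add: linear_compose_add linear_app_mult)
  next
    case (Cons x xs)
    show ?case unfolding append_Cons app_mult
      by (intro linear_compose_add Cons.IH multilin_contr multilin_simps Cons.prems)
  qed
qed

lemma app_mult_map: "app (a * b) (map L vs) = app (Ext (\<lambda>ws. app a (map L ws)) * Ext (\<lambda>ws. app b (map L ws))) vs"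
proof (induction vs arbitrary: a b)
  case (Cons v vs)
  have "grade (Ext (\<lambda>ws. app x (map L ws))) = Ext (\<lambda>ws. app (grade x) (map L ws))"
    "contr v (Ext (\<lambda>ws. app x (map L ws))) = Ext (\<lambda>ws. app (contr (L v) x) (map L ws))" for x
    by (intro ext_eqI; simp)+
  then show ?case by (simp add: Cons)
qed simp

text \<open>A set of positions of the longer list is a shifted set with or without position 0. If 0
  is selected it is the smallest element and causes no inversion; otherwise every selected position
  passes it once, which gives the sign of the grading involution.\<close>

lemma wedge_sum_Cons:
  fixes v :: 'v
  shows "(\<Sum>S\<in>Pow {..<length (v # vs)}.
     (-1) ^ card {(i, j). i \<in> S \<and> j < i \<and> j \<notin> S} * a (nths (v # vs) S) * b (nths (v # vs) (- S))) =
   (\<Sum>S\<in>Pow {..<length vs}. (-1) ^ card {(i, j). i \<in> S \<and> j < i \<and> j \<notin> S} * a (v # nths vs S) * b (nths vs (- S))) +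
   (\<Sum>S\<in>Pow {..<length vs}. (-1) ^ card {(i, j). i \<in> S \<and> j < i \<and> j \<notin> S} * ((-1) ^ length (nths vs S) * a (nths vs S)) * b (v # nths vs (- S)) :: complex)"
    (is "?L = ?R1 + ?R2")
proof -
  let ?n = "length vs"
  let ?P = "Pow {..<?n}"
  let ?t = "\<lambda>S. (-1) ^ card {(i, j). i \<in> S \<and> j < i \<and> j \<notin> S} * a (nths (v # vs) S) * b (nths (v # vs) (- S))"
  let ?inv = "\<lambda>S. {(i, j). i \<in> S \<and> j < i \<and> j \<notin> S}"
  have ins: "insert 0 (Suc ` {..<?n}) = {..<Suc ?n}" by (rule lessThan_Suc_eq_insert_0[symmetric])
  have Pow: "Pow {..<length (v # vs)} = (\<lambda>S. Suc ` S) ` ?P \<union> (\<lambda>S. insert 0 (Suc ` S)) ` ?P"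
    unfolding list.size(4) add.commute[of _ "Suc 0"] plus_1_eq_Suc[unfolded One_nat_def] add_Suc add_0
    by (subst ins[symmetric], subst Pow_insert, simp only: image_Pow_surj[OF refl, of Suc "{..<?n}", symmetric] image_image)
  have inj1: "inj_on (\<lambda>S. Suc ` S) ?P" by (simp add: inj_on_def inj_image_eq_iff)
  have inj2: "inj_on (\<lambda>S. insert 0 (Suc ` S)) ?P"
  proof (rule inj_onI)
    fix S T assume "insert 0 (Suc ` S) = insert 0 (Suc ` T)"
    then have "Suc ` S = Suc ` T" by (auto simp: set_eq_iff)
    then show "S = T" by (simp add: inj_image_eq_iff)
  qed
  have disj: "(\<lambda>S. Suc ` S) ` ?P \<inter> (\<lambda>S. insert 0 (Suc ` S)) ` ?P = {}"
    by auto
  have c2: "card (?inv (insert 0 (Suc ` S))) = card (?inv S)" for S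
  proof -
    have "?inv (insert 0 (Suc ` S)) = map_prod Suc Suc ` ?inv S"
    proof (intro equalityI subsetI)
      fix p assume "p \<in> ?inv (insert 0 (Suc ` S))"
      then obtain i j where p: "p = (Suc i, j)" "i \<in> S" "j < Suc i" "j \<noteq> 0" "j \<notin> Suc ` S" by auto
      then obtain j' where "j = Suc j'" by (cases j) auto
      with p show "p \<in> map_prod Suc Suc ` ?inv S" by (auto intro!: image_eqI[of _ _ "(i, j')"])
    qed auto
    moreover have "inj_on (map_prod Suc Suc) (?inv S)" by (auto simp: inj_on_def)
    ultimately show ?thesis by (simp only: card_image)
  qed
  \<comment> \<open>Besides the shifted old inversions there is one new inversion with position 0
    for each element of \<open>S\<close>.\<close>
  have c1: "card (?inv (Suc ` S)) = card (?inv S) + card S" if "S \<in> ?P" for S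
  proof -
    have fin: "finite S" "finite (?inv S)"
    proof -
      show "finite S" using that finite_subset by auto
      have "?inv S \<subseteq> {..<?n} \<times> {..<?n}" using that by auto
      then show "finite (?inv S)" by (rule finite_subset) simp
    qed
    have "?inv (Suc ` S) = map_prod Suc Suc ` ?inv S \<union> (\<lambda>i. (Suc i, 0)) ` S"
    proof (intro equalityI subsetI)
      fix p assume "p \<in> ?inv (Suc ` S)"
      then obtain i j where p: "p = (Suc i, j)" "i \<in> S" "j < Suc i" "j \<notin> Suc ` S" by auto
      show "p \<in> map_prod Suc Suc ` ?inv S \<union> (\<lambda>i. (Suc i, 0)) ` S"
      proof (cases j)
        case (Suc j')
        with p show ?thesis by (auto intro!: image_eqI[of _ _ "(i, j')"])
      qed (use p in auto)
    qed auto
    moreover have "map_prod Suc Suc ` ?inv S \<inter> (\<lambda>i. (Suc i, 0)) ` S = {}" by auto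
    moreover have "inj_on (map_prod Suc Suc) (?inv S)" by (auto simp: inj_on_def)
    moreover have "inj_on (\<lambda>i. (Suc i, 0::nat)) S" by (simp add: inj_on_def)
    ultimately show ?thesis using fin by (simp only: card_Un_disjoint card_image finite_imageI)
  qed
  have n1: "nths (v # vs) (Suc ` S) = nths vs S" "nths (v # vs) (- Suc ` S) = v # nths vs (- S)"
    "nths (v # vs) (insert 0 (Suc ` S)) = v # nths vs S" "nths (v # vs) (- insert 0 (Suc ` S)) = nths vs (- S)" for S
  proof -
    have "{j. Suc j \<in> - Suc ` S} = - S" "{j. Suc j \<in> - insert 0 (Suc ` S)} = - S" "{j. Suc j \<in> Suc ` S} = S" by auto
    moreover have "{j. Suc j \<in> insert 0 (Suc ` S)} = S" by auto
    ultimately show "nths (v # vs) (Suc ` S) = nths vs S" "nths (v # vs) (- Suc ` S) = v # nths vs (- S)"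
      "nths (v # vs) (insert 0 (Suc ` S)) = v # nths vs S" "nths (v # vs) (- insert 0 (Suc ` S)) = nths vs (- S)"
      by (simp_all only: nths_Cons) auto
  qed
  have len: "length (nths vs S) = card S" if "S \<in> ?P" for S
  proof -
    have "{i. i < ?n \<and> i \<in> S} = S" using that by auto
    then show ?thesis by (simp add: length_nths)
  qed
  have "?L = (\<Sum>S\<in>?P. ?t (Suc ` S)) + (\<Sum>S\<in>?P. ?t (insert 0 (Suc ` S)))"
    unfolding Pow by (subst sum.union_disjoint) (simp_all add: disj sum.reindex[OF inj1] sum.reindex[OF inj2] o_def del: length_Cons)
  also have "(\<Sum>S\<in>?P. ?t (Suc ` S)) = ?R2"
    by (rule sum.cong) (simp_all only: n1 c1 len power_add mult.assoc)
  also have "(\<Sum>S\<in>?P. ?t (insert 0 (Suc ` S))) = ?R1"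
    by (rule sum.cong) (simp_all only: n1 c2)
  finally show ?thesis by simp
qed

lemma wedge_eq_shuffle_prod:
  "(\<Sum>S\<in>Pow {..<length vs}. (-1) ^ card {(i, j). i \<in> S \<and> j < i \<and> j \<notin> S} * a (nths vs S) * b (nths vs (- S)))
     = shuffle_prod a b vs"
proof (induction vs arbitrary: a b)
  case (Cons v vs)
  show ?case
    unfolding wedge_sum_Cons shuffle_prod.simps
    by (simp only: Cons.IH[of "\<lambda>ws. a (v # ws)" b] Cons.IH[of "\<lambda>ws. (-1) ^ length ws * a ws" "\<lambda>ws. b (v # ws)"])
qed simp

text \<open>Fixing the chart and the point turns a form into a ring element, so that identities
  between forms become ring computations.\<close>

definition at_pt :: "'a form \<Rightarrow> 'a chart \<Rightarrow> complex ^ 2 \<Rightarrow> (complex ^ 2) ext" where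
  "at_pt \<omega> c z = Ext (\<omega> c z)"

lemma app_at_pt [simp]: "app (at_pt \<omega> c z) vs = \<omega> c z vs"
  by (simp add: at_pt_def)

lemma at_pt_wedge: "at_pt (wedge \<alpha> \<beta>) c z = at_pt \<alpha> c z * at_pt \<beta> c z"
  by (simp add: at_pt_def wedge_def wedge_eq_shuffle_prod times_ext_def)

lemma at_pt_unit_form: "at_pt unit_form c z = 1"
  by (simp add: at_pt_def unit_form_def one_ext_def scal_def)

subsection \<open>The exterior derivative\<close>

definition ddir :: "(complex ^ 2 \<Rightarrow> (complex ^ 2) ext) \<Rightarrow> complex ^ 2 \<Rightarrow> complex ^ 2 \<Rightarrow> (complex ^ 2) ext" where
  "ddir a v z = Ext (\<lambda>ws. dir_deriv (\<lambda>y. app (a y) ws) v z)"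

definition dext :: "(complex ^ 2 \<Rightarrow> (complex ^ 2) ext) \<Rightarrow> complex ^ 2 \<Rightarrow> (complex ^ 2) ext" where
  "dext a z = Ext (\<lambda>vs. \<Sum>i<length vs. (-1) ^ i * dir_deriv (\<lambda>y. app (a y) (nths vs (- {i}))) (vs ! i) z)"

lemma at_pt_ext_deriv: "at_pt (ext_deriv \<omega>) c z = dext (at_pt \<omega> c) z"
  by (simp add: at_pt_def ext_deriv_def dext_def)

lemma app_ddir: "app (ddir a v z) ws = dir_deriv (\<lambda>y. app (a y) ws) v z"
  by (simp add: ddir_def)

lemma app_dext_Nil: "app (dext a z) [] = 0"
  by (simp add: dext_def)

definition diff_at :: "(complex ^ 2 \<Rightarrow> (complex ^ 2) ext) \<Rightarrow> complex ^ 2 \<Rightarrow> bool" where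
  "diff_at a z \<longleftrightarrow> (\<forall>ws. (\<lambda>y. app (a y) ws) differentiable at z)"

lemma dir_deriv_add: "f differentiable at z \<Longrightarrow> g differentiable at z \<Longrightarrow> dir_deriv (\<lambda>y. f y + g y) v z = dir_deriv f v z + dir_deriv g v z"
  by (subst frechet_derivative_eqI[OF has_derivative_add]) (auto intro!: frechet_derivative_works')

lemma dir_deriv_diff: "f differentiable at z \<Longrightarrow> g differentiable at z \<Longrightarrow> dir_deriv (\<lambda>y. f y - g y) v z = dir_deriv f v z - dir_deriv g v z"
  by (subst frechet_derivative_eqI[OF has_derivative_diff]) (auto intro!: frechet_derivative_works')

lemma dir_deriv_mult: "f differentiable at z \<Longrightarrow> g differentiable at z \<Longrightarrow> dir_deriv (\<lambda>y. f y * g y) v z = dir_deriv f v z * g z + f z * dir_deriv g v z"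
  by (subst frechet_derivative_eqI[OF has_derivative_mult]) (auto intro!: frechet_derivative_works')

lemma dir_deriv_cmult: "f differentiable at z \<Longrightarrow> dir_deriv (\<lambda>y. c * f y) v z = c * dir_deriv f v z"
  by (subst frechet_derivative_eqI[OF has_derivative_mult_right]) (auto intro!: frechet_derivative_works')

lemma dir_deriv_minus: "f differentiable at z \<Longrightarrow> dir_deriv (\<lambda>y. - f y) v z = - dir_deriv f v z"
  by (subst frechet_derivative_eqI[OF has_derivative_minus]) (auto intro!: frechet_derivative_works')

lemma dir_deriv_const [simp]: "dir_deriv (\<lambda>y. c) v z = 0"
  by (simp add: frechet_derivative_const)

lemma dir_deriv_sum:
  "(\<And>i. i \<in> I \<Longrightarrow> f i differentiable at z) \<Longrightarrow> dir_deriv (\<lambda>y. \<Sum>i\<in>I. f i y) v z = (\<Sum>i\<in>I. dir_deriv (f i) v z)"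
  by (induction I rule: infinite_finite_induct) (simp_all add: dir_deriv_add)

text \<open>The summand \<open>i = 0\<close> differentiates along \<open>v\<close>. In all others
  \<open>v\<close> stays first in the list and the index is shifted by one, which reverses the
  sign.\<close>

lemma app_dext_Cons: "app (dext a z) (v # vs) = app (ddir a v z) vs - app (dext (\<lambda>y. contr v (a y)) z) vs"
proof -
  have n: "nths (v # vs) (- {Suc i}) = v # nths vs (- {i})" for i
  proof -
    have "{j. Suc j \<in> - {Suc i}} = - {i}" by auto
    then show ?thesis by (simp add: nths_Cons)
  qed
  have "{j. Suc j \<in> - {0}} = UNIV" by auto
  then have n0: "nths (v # vs) (- {0}) = vs" by (simp add: nths_Cons nths_all)
  have "app (dext a z) (v # vs) = (\<Sum>i<Suc (length vs). (-1) ^ i * dir_deriv (\<lambda>y. app (a y) (nths (v # vs) (- {i}))) ((v # vs) ! i) z)"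
    by (simp add: dext_def del: sum.lessThan_Suc)
  also have "\<dots> = dir_deriv (\<lambda>y. app (a y) vs) v z + (\<Sum>i<length vs. - ((-1) ^ i * dir_deriv (\<lambda>y. app (a y) (v # nths vs (- {i}))) (vs ! i) z))"
    unfolding sum.lessThan_Suc_shift by (simp add: n n0)
  finally show ?thesis by (simp add: dext_def ddir_def sum_negf)
qed

lemma diff_at_simps:
  "diff_at a z \<Longrightarrow> diff_at b z \<Longrightarrow> diff_at (\<lambda>y. a y + b y) z"
  "diff_at a z \<Longrightarrow> diff_at b z \<Longrightarrow> diff_at (\<lambda>y. a y - b y) z"
  "diff_at a z \<Longrightarrow> diff_at (\<lambda>y. - a y) z"
  "diff_at a z \<Longrightarrow> diff_at (\<lambda>y. contr v (a y)) z"
  "diff_at a z \<Longrightarrow> diff_at (\<lambda>y. grade (a y)) z"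
  by (simp_all add: diff_at_def)

lemma diff_at_scal: "f differentiable at z \<Longrightarrow> diff_at (\<lambda>y. scal (f y)) z"
  unfolding diff_at_def by (rule allI, rename_tac ws, case_tac ws) simp_all

lemma diff_at_mult: "diff_at a z \<Longrightarrow> diff_at b z \<Longrightarrow> diff_at (\<lambda>y. a y * b y) z"
proof -
  have "(\<lambda>y. app (a y * b y) ws) differentiable at z" if "diff_at a z" "diff_at b z" for ws a b
    using that
  proof (induction ws arbitrary: a b)
    case Nil then show ?case by (simp add: diff_at_def)
  next
    case (Cons w ws)
    show ?case unfolding app_mult
      by (intro differentiable_add Cons.IH diff_at_simps(4,5) Cons.prems)
  qed
  then show "diff_at a z \<Longrightarrow> diff_at b z \<Longrightarrow> diff_at (\<lambda>y. a y * b y) z" by (simp add: diff_at_def)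
qed

lemma diff_at_sum: "(\<And>i. i \<in> I \<Longrightarrow> diff_at (f i) z) \<Longrightarrow> diff_at (\<lambda>y. \<Sum>i\<in>I. f i y) z"
  by (induction I rule: infinite_finite_induct) (simp_all add: diff_at_simps(1), simp_all add: diff_at_def)

lemma ddir_add: "diff_at a z \<Longrightarrow> diff_at b z \<Longrightarrow> ddir (\<lambda>y. a y + b y) v z = ddir a v z + ddir b v z"
  by (rule ext_eqI) (simp add: app_ddir diff_at_def dir_deriv_add)

lemma ddir_contr: "ddir (\<lambda>y. contr w (a y)) v z = contr w (ddir a v z)"
  by (rule ext_eqI) (simp add: app_ddir)

lemma ddir_grade: "diff_at a z \<Longrightarrow> ddir (\<lambda>y. grade (a y)) v z = grade (ddir a v z)"
  by (rule ext_eqI) (simp add: app_ddir diff_at_def dir_deriv_cmult)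

lemma ddir_mult:
  assumes "diff_at a z" "diff_at b z"
  shows "ddir (\<lambda>y. a y * b y) v z = ddir a v z * b z + a z * ddir b v z"
proof (rule ext_eqI)
  fix ws
  show "app (ddir (\<lambda>y. a y * b y) v z) ws = app (ddir a v z * b z + a z * ddir b v z) ws"
    using assms
  proof (induction ws arbitrary: a b)
    case Nil
    then show ?case by (simp add: app_ddir diff_at_def dir_deriv_mult)
  next
    case (Cons w ws)
    let ?D = "\<lambda>a. ddir a v z"
    have "app (?D (\<lambda>y. a y * b y)) (w # ws) = app (contr w (?D (\<lambda>y. a y * b y))) ws" by simp
    also have "contr w (?D (\<lambda>y. a y * b y)) = ?D (\<lambda>y. contr w (a y) * b y + grade (a y) * contr w (b y))"
      by (simp flip: ddir_contr)
    also have "\<dots> = ?D (\<lambda>y. contr w (a y) * b y) + ?D (\<lambda>y. grade (a y) * contr w (b y))"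
      by (intro ddir_add diff_at_mult diff_at_simps(4,5) Cons.prems)
    also have "app \<dots> ws = app (?D (\<lambda>y. contr w (a y) * b y)) ws + app (?D (\<lambda>y. grade (a y) * contr w (b y))) ws"
      by simp
    also have "app (?D (\<lambda>y. contr w (a y) * b y)) ws = app (?D (\<lambda>y. contr w (a y)) * b z + contr w (a z) * ?D b) ws"
      by (intro Cons.IH diff_at_simps(4,5) Cons.prems)
    also have "app (?D (\<lambda>y. grade (a y) * contr w (b y))) ws = app (?D (\<lambda>y. grade (a y)) * contr w (b z) + grade (a z) * ?D (\<lambda>y. contr w (b y))) ws"
      by (intro Cons.IH diff_at_simps(4,5) Cons.prems)
    finally show ?case
      by (simp add: ddir_contr ddir_grade Cons.prems)
  qed
qed

lemma dext_add: "diff_at a z \<Longrightarrow> diff_at b z \<Longrightarrow> dext (\<lambda>y. a y + b y) z = dext a z + dext b z"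
  by (rule ext_eqI) (simp add: dext_def diff_at_def dir_deriv_add distrib_left sum.distrib)

lemma dext_diff: "diff_at a z \<Longrightarrow> diff_at b z \<Longrightarrow> dext (\<lambda>y. a y - b y) z = dext a z - dext b z"
  by (rule ext_eqI) (simp add: dext_def diff_at_def dir_deriv_diff right_diff_distrib sum_subtractf)

lemma dext_minus: "diff_at a z \<Longrightarrow> dext (\<lambda>y. - a y) z = - dext a z"
  by (rule ext_eqI) (simp add: dext_def diff_at_def dir_deriv_minus sum_negf)

lemma dext_zero: "dext (\<lambda>y. 0) z = 0"
  by (rule ext_eqI) (simp add: dext_def)

lemma dext_sum: "(\<And>i. i \<in> I \<Longrightarrow> diff_at (f i) z) \<Longrightarrow> dext (\<lambda>y. \<Sum>i\<in>I. f i y) z = (\<Sum>i\<in>I. dext (f i) z)"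
  by (induction I rule: infinite_finite_induct) (simp_all add: dext_zero dext_add diff_at_sum)

text \<open>The exterior derivative evaluates \<open>a\<close> on lists that are one vector shorter,
  whence one sign; on the empty list both sides are 0.\<close>

lemma dext_grade:
  assumes "diff_at a z" shows "dext (\<lambda>y. grade (a y)) z = - grade (dext a z)"
proof (rule ext_eqI)
  fix vs :: "(complex ^ 2) list"
  have "length (nths vs (- {i})) = length vs - 1" if "i < length vs" for i
  proof -
    have "{j. j < length vs \<and> j \<in> - {i}} = {..<length vs} - {i}" by auto
    then show ?thesis using that by (simp add: length_nths)
  qed
  then have "app (dext (\<lambda>y. grade (a y)) z) vs = (\<Sum>i<length vs. (-1) ^ i * ((-1) ^ (length vs - 1) * dir_deriv (\<lambda>y. app (a y) (nths vs (- {i}))) (vs ! i) z))"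
    using assms by (simp add: dext_def diff_at_def dir_deriv_cmult)
  then show "app (dext (\<lambda>y. grade (a y)) z) vs = app (- grade (dext a z)) vs"
    by (cases "length vs") (simp_all add: dext_def sum_distrib_left sum_negf mult_ac del: sum.lessThan_Suc)
qed

text \<open>By Cartan's formula \<open>\<iota>\<^sub>v d + d \<iota>\<^sub>v = D\<^sub>v\<close> for constant \<open>v\<close>.\<close>

lemma dext_mult:
  assumes "diff_at a z" "diff_at b z"
  shows "dext (\<lambda>y. a y * b y) z = dext a z * b z + grade (a z) * dext b z"
proof (rule ext_eqI)
  fix vs
  show "app (dext (\<lambda>y. a y * b y) z) vs = app (dext a z * b z + grade (a z) * dext b z) vs"
    using assms
  proof (induction vs arbitrary: a b)
    case Nil
    then show ?case by (simp add: app_dext_Nil)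
  next
    case (Cons v vs)
    let ?D = "\<lambda>a. ddir a v z" and ?d = "\<lambda>a. dext a z"
    have cd: "contr v (?d x) = ?D x - ?d (\<lambda>y. contr v (x y))" for x
      by (rule ext_eqI) (simp add: app_dext_Cons)
    have "app (?d (\<lambda>y. a y * b y)) (v # vs) = app (?D (\<lambda>y. a y * b y)) vs - app (?d (\<lambda>y. contr v (a y * b y))) vs"
      by (rule app_dext_Cons)
    also have "?d (\<lambda>y. contr v (a y * b y)) = ?d (\<lambda>y. contr v (a y) * b y) + ?d (\<lambda>y. grade (a y) * contr v (b y))"
      unfolding contr_simps by (intro dext_add diff_at_mult diff_at_simps(4,5) Cons.prems)
    also have "app \<dots> vs = app (?d (\<lambda>y. contr v (a y) * b y)) vs + app (?d (\<lambda>y. grade (a y) * contr v (b y))) vs"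
      by simp
    also have "app (?d (\<lambda>y. contr v (a y) * b y)) vs = app (?d (\<lambda>y. contr v (a y)) * b z + grade (contr v (a z)) * ?d b) vs"
      by (intro Cons.IH diff_at_simps(4,5) Cons.prems)
    also have "app (?d (\<lambda>y. grade (a y) * contr v (b y))) vs = app (?d (\<lambda>y. grade (a y)) * contr v (b z) + grade (grade (a z)) * ?d (\<lambda>y. contr v (b y))) vs"
      by (intro Cons.IH diff_at_simps(4,5) Cons.prems)
    also have "?D (\<lambda>y. a y * b y) = ?D a * b z + a z * ?D b"
      by (intro ddir_mult Cons.prems)
    also have "?d (\<lambda>y. grade (a y)) = - grade (?d a)"
      by (rule dext_grade[OF Cons.prems(1)])
    finally show ?case
      by (simp add: cd algebra_simps)
  qed
qed

definition smooth_field :: "(complex ^ 2) set \<Rightarrow> (complex ^ 2 \<Rightarrow> (complex ^ 2) ext) \<Rightarrow> bool" where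
  "smooth_field S a \<longleftrightarrow> (\<forall>ws. smooth_on S (\<lambda>y. app (a y) ws))"

lemma smooth_field_diff_at: "smooth_field S a \<Longrightarrow> z \<in> S \<Longrightarrow> diff_at a z"
  unfolding smooth_field_def diff_at_def using smooth_on_differentiable by blast

lemma smooth_field_simps:
  assumes "open S"
  shows "smooth_field S a \<Longrightarrow> smooth_field S b \<Longrightarrow> smooth_field S (\<lambda>y. a y + b y)"
  "smooth_field S a \<Longrightarrow> smooth_field S b \<Longrightarrow> smooth_field S (\<lambda>y. a y - b y)"
  "smooth_field S a \<Longrightarrow> smooth_field S (\<lambda>y. - a y)"
  "smooth_field S a \<Longrightarrow> smooth_field S (\<lambda>y. contr v (a y))"
  "smooth_field S a \<Longrightarrow> smooth_field S (\<lambda>y. grade (a y))"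
  by (simp_all add: smooth_field_def smooth_on_add smooth_on_diff smooth_on_uminus smooth_on_mult smooth_on_const assms)

lemma smooth_field_scal: "smooth_on S f \<Longrightarrow> smooth_field S (\<lambda>y. scal (f y))"
  unfolding smooth_field_def by (rule allI, rename_tac ws, case_tac ws) (simp_all add: smooth_on_const)

lemma smooth_field_mult:
  assumes "open S" "smooth_field S a" "smooth_field S b"
  shows "smooth_field S (\<lambda>y. a y * b y)"
proof -
  have "smooth_on S (\<lambda>y. app (a y * b y) ws)" if "smooth_field S a" "smooth_field S b" for ws a b
    using that
  proof (induction ws arbitrary: a b)
    case Nil then show ?case by (simp add: smooth_field_def smooth_on_mult assms(1))
  next
    case (Cons w ws)
    show ?case unfolding app_mult
      by (intro smooth_on_add Cons.IH smooth_field_simps(4,5) Cons.prems assms(1))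
  qed
  then show ?thesis using assms(2,3) by (simp add: smooth_field_def)
qed

lemma smooth_field_sum:
  "open S \<Longrightarrow> (\<And>i. i \<in> I \<Longrightarrow> smooth_field S (f i)) \<Longrightarrow> smooth_field S (\<lambda>y. \<Sum>i\<in>I. f i y)"
  by (simp add: smooth_field_def smooth_on_sum)

lemma smooth_field_ddir: "smooth_field S a \<Longrightarrow> smooth_field S (ddir a v)"
  by (simp add: smooth_field_def app_ddir smooth_on_dir_deriv)

lemma smooth_field_dext: "open S \<Longrightarrow> smooth_field S a \<Longrightarrow> smooth_field S (dext a)"
  by (simp add: smooth_field_def dext_def smooth_on_sum smooth_on_mult smooth_on_const smooth_on_dir_deriv)

lemma smooth_field_cong:
  "open S \<Longrightarrow> (\<And>z. z \<in> S \<Longrightarrow> a z = b z) \<Longrightarrow> smooth_field S a \<Longrightarrow> smooth_field S b"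
  unfolding smooth_field_def
proof (rule allI)
  fix ws assume "open S" and eq: "\<And>z. z \<in> S \<Longrightarrow> a z = b z" and a: "\<forall>ws. smooth_on S (\<lambda>y. app (a y) ws)"
  show "smooth_on S (\<lambda>y. app (b y) ws)"
    by (rule smooth_on_cong[OF \<open>open S\<close> _ a[rule_format, of ws]]) (simp add: eq)
qed

lemma smooth_field_subset: "smooth_field T a \<Longrightarrow> S \<subseteq> T \<Longrightarrow> smooth_field S a"
  unfolding smooth_field_def using smooth_on_subset by blast

lemma dext_cong:
  assumes "open S" "z \<in> S" "\<And>y. y \<in> S \<Longrightarrow> a y = b y"
  shows "dext a z = dext b z"
proof -
  have "dir_deriv (\<lambda>y. app (a y) ws) v z = dir_deriv (\<lambda>y. app (b y) ws) v z" for ws v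
    by (subst frechet_derivative_cong_open[OF assms(1,2), of "\<lambda>y. app (a y) ws" "\<lambda>y. app (b y) ws"]) (simp_all add: assms(3))
  then show ?thesis by (simp add: dext_def)
qed

text \<open>Contracting with \<open>v\<close> leaves the commutator of the derivative along
  \<open>v\<close> with \<open>dext\<close>, and \<open>dext\<close> applied twice to
  \<open>contr v a\<close>. The commutator vanishes by symmetry of second derivatives, the rest by
  induction on the list.\<close>

lemma dext_dext:
  assumes "open S" "z \<in> S" "smooth_field S a"
  shows "dext (dext a) z = 0"
proof (rule ext_eqI)
  fix vs
  show "app (dext (dext a) z) vs = app 0 vs"
    using assms(3)
  proof (induction vs arbitrary: a)
    case Nil show ?case by (simp add: app_dext_Nil)
  next
    case (Cons v vs)
    have sm: "smooth_field S (\<lambda>y. contr v (a y))" "smooth_field S (ddir a v)"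
      by (intro smooth_field_simps(4) smooth_field_ddir assms Cons.prems)+
    have comm: "ddir (dext a) v z = dext (ddir a v) z"
    proof (rule ext_eqI)
      fix vs :: "(complex ^ 2) list"
      have s: "smooth_on S (\<lambda>y. app (a y) ws)" for ws using Cons.prems by (simp add: smooth_field_def)
      note d = smooth_on_differentiable[OF smooth_on_dir_deriv[OF s] assms(2)]
      have "app (ddir (dext a) v z) vs
          = dir_deriv (\<lambda>y. \<Sum>i<length vs. (-1) ^ i * dir_deriv (\<lambda>y. app (a y) (nths vs (- {i}))) (vs ! i) y) v z"
        by (simp add: app_ddir dext_def)
      also have "\<dots> = (\<Sum>i<length vs. (-1) ^ i * dir_deriv (dir_deriv (\<lambda>y. app (a y) (nths vs (- {i}))) (vs ! i)) v z)"
        by (subst dir_deriv_sum) (simp_all add: d dir_deriv_cmult)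
      also have "\<dots> = (\<Sum>i<length vs. (-1) ^ i * dir_deriv (dir_deriv (\<lambda>y. app (a y) (nths vs (- {i}))) v) (vs ! i) z)"
        by (simp only: dir_deriv_commute[OF assms(1) s assms(2), of _ v])
      finally show "app (ddir (dext a) v z) vs = app (dext (ddir a v) z) vs"
        by (simp add: dext_def app_ddir)
    qed
    have "(\<lambda>y. contr v (dext a y)) = (\<lambda>y. ddir a v y - dext (\<lambda>y. contr v (a y)) y)"
      by (intro HOL.ext ext_eqI) (simp add: app_dext_Cons)
    then have "app (dext (dext a) z) (v # vs) = app (ddir (dext a) v z) vs - app (dext (\<lambda>y. ddir a v y - dext (\<lambda>y. contr v (a y)) y) z) vs"
      by (simp add: app_dext_Cons)
    also have "dext (\<lambda>y. ddir a v y - dext (\<lambda>y. contr v (a y)) y) z = dext (ddir a v) z - dext (dext (\<lambda>y. contr v (a y))) z"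
      by (intro dext_diff smooth_field_diff_at[OF _ assms(2)] sm smooth_field_dext assms)
    finally show ?case using Cons.IH[OF sm(1)] by (simp add: comm)
  qed
qed

section \<open>Matrices of forms\<close>

text \<open>Matrices are total functions of two indices; the size is a parameter of product and
  trace alone, and entries beyond it are unconstrained.\<close>

definition mmul :: "nat \<Rightarrow> (nat \<Rightarrow> nat \<Rightarrow> 'a::ring) \<Rightarrow> (nat \<Rightarrow> nat \<Rightarrow> 'a) \<Rightarrow> nat \<Rightarrow> nat \<Rightarrow> 'a" where
  "mmul r A B = (\<lambda>i j. \<Sum>l<r. A i l * B l j)"

definition mtr :: "nat \<Rightarrow> (nat \<Rightarrow> nat \<Rightarrow> 'a::ring) \<Rightarrow> 'a" where
  "mtr r A = (\<Sum>i<r. A i i)"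

definition madd :: "(nat \<Rightarrow> nat \<Rightarrow> 'a::ring) \<Rightarrow> (nat \<Rightarrow> nat \<Rightarrow> 'a) \<Rightarrow> nat \<Rightarrow> nat \<Rightarrow> 'a" where
  "madd A B = (\<lambda>i j. A i j + B i j)"

definition msub :: "(nat \<Rightarrow> nat \<Rightarrow> 'a::ring) \<Rightarrow> (nat \<Rightarrow> nat \<Rightarrow> 'a) \<Rightarrow> nat \<Rightarrow> nat \<Rightarrow> 'a" where
  "msub A B = (\<lambda>i j. A i j - B i j)"

lemma mmul_assoc: "mmul r (mmul r A B) C = mmul r A (mmul r B C)"
proof (intro HOL.ext)
  fix i j
  have "mmul r (mmul r A B) C i j = (\<Sum>l<r. \<Sum>n<r. A i n * B n l * C l j)"
    by (simp add: mmul_def sum_distrib_right)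
  also have "\<dots> = (\<Sum>n<r. \<Sum>l<r. A i n * B n l * C l j)" by (rule sum.swap)
  finally show "mmul r (mmul r A B) C i j = mmul r A (mmul r B C) i j"
    by (simp add: mmul_def sum_distrib_left mult.assoc)
qed

lemma mmul_distrib:
  "mmul r (madd A B) C = madd (mmul r A C) (mmul r B C)" "mmul r A (madd B C) = madd (mmul r A B) (mmul r A C)"
  "mmul r (msub A B) C = msub (mmul r A C) (mmul r B C)" "mmul r A (msub B C) = msub (mmul r A B) (mmul r A C)"
  by (simp_all add: mmul_def madd_def msub_def algebra_simps sum.distrib sum_subtractf)

lemma mtr_distrib: "mtr r (madd A B) = mtr r A + mtr r B" "mtr r (msub A B) = mtr r A - mtr r B"
  by (simp_all add: mtr_def madd_def msub_def sum.distrib sum_subtractf)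

definition meven :: "nat \<Rightarrow> 'v ext mat \<Rightarrow> bool" where
  "meven r A \<longleftrightarrow> (\<forall>i<r. \<forall>j<r. grade (A i j) = A i j)"

definition modd :: "nat \<Rightarrow> 'v ext mat \<Rightarrow> bool" where
  "modd r A \<longleftrightarrow> (\<forall>i<r. \<forall>j<r. grade (A i j) = - A i j)"

lemma parity_mmul:
  "meven r A \<Longrightarrow> meven r B \<Longrightarrow> meven r (mmul r A B)" "modd r A \<Longrightarrow> meven r B \<Longrightarrow> modd r (mmul r A B)"
  "meven r A \<Longrightarrow> modd r B \<Longrightarrow> modd r (mmul r A B)" "modd r A \<Longrightarrow> modd r B \<Longrightarrow> meven r (mmul r A B)"
  by (simp_all add: meven_def modd_def mmul_def sum_negf)

lemma parity_msub: "meven r A \<Longrightarrow> meven r B \<Longrightarrow> meven r (msub A B)" "modd r A \<Longrightarrow> modd r B \<Longrightarrow> modd r (msub A B)"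
  by (simp_all add: meven_def modd_def msub_def)

lemma mtr_mmul_swap: "mtr r (mmul r A B) = (\<Sum>i<r. \<Sum>j<r. A j i * B i j)"
  unfolding mtr_def mmul_def by (rule sum.swap)

lemma mtr_cyclic_even: "meven r A \<Longrightarrow> meven r B \<Longrightarrow> mtr r (mmul r A B) = mtr r (mmul r B A)"
  unfolding mtr_mmul_swap[of r A B] unfolding mtr_def mmul_def meven_def
  by (intro sum.cong refl) (simp add: ext_commute_even)

lemma mtr_cyclic_odd_even: "modd r A \<Longrightarrow> meven r B \<Longrightarrow> mtr r (mmul r A B) = mtr r (mmul r B A)"
  unfolding mtr_mmul_swap[of r A B] unfolding mtr_def mmul_def meven_def modd_def
  by (intro sum.cong refl) (rule ext_commute_odd_even; simp)

lemma mtr_cyclic_odd: "modd r A \<Longrightarrow> modd r B \<Longrightarrow> mtr r (mmul r A B) = - mtr r (mmul r B A)"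
  unfolding mtr_mmul_swap[of r A B] unfolding mtr_def mmul_def modd_def sum_negf[symmetric]
  by (intro sum.cong refl) (rule ext_commute_odd; simp)

lemma ext_eq_neg_self: "x = - x \<Longrightarrow> x = (0 :: 'v ext)"
proof (rule ext_eqI)
  fix vs assume "x = - x"
  then have "app x vs = - app x vs" by (metis app_simps(4))
  then show "app x vs = app 0 vs" by (simp add: eq_neg_iff_add_eq_0)
qed

text \<open>The transgression of \<open>tr \<Omega>\<^sup>2\<close>: with \<open>\<alpha> = \<theta>' - \<theta>\<close> one has
  \<open>tr \<Omega>'\<^sup>2 - tr \<Omega>\<^sup>2 = d (tr (\<alpha> (\<Omega> + \<Omega>')) - 1/3 tr \<alpha>\<^sup>3)\<close>. Here \<open>dW\<close>, \<open>dW'\<close> and \<open>da\<close> are the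
  derivatives as given by the Bianchi identities.\<close>

lemma transgression:
  fixes \<theta> a W W' :: "'v ext mat"
  assumes odd: "modd r \<theta>" "modd r a" and even: "meven r W" "meven r W'"
  defines "da \<equiv> msub (msub (msub (msub W' W) (mmul r \<theta> a)) (mmul r a \<theta>)) (mmul r a a)"
    and "dW \<equiv> msub (mmul r W \<theta>) (mmul r \<theta> W)" and "dW' \<equiv> msub (mmul r W' (madd \<theta> a)) (mmul r (madd \<theta> a) W')"
  shows "mtr r (msub (mmul r da (madd W W')) (mmul r a (madd dW dW')))
      = mtr r (mmul r W' W') - mtr r (mmul r W W) + mtr r (mmul r (mmul r a a) (msub W' W))" (is "?L1 = _")
    and "mtr r (madd (msub (mmul r da (mmul r a a)) (mmul r a (mmul r da a))) (mmul r (mmul r a a) da)) =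
      mtr r (mmul r (mmul r a a) (msub W' W)) + mtr r (mmul r (mmul r a a) (msub W' W)) + mtr r (mmul r (mmul r a a) (msub W' W))"
proof -
  note dist = mmul_distrib[of r] mtr_distrib[of r] mmul_assoc[of r]
  note par = parity_mmul[of r]
  note cyc = mtr_cyclic_even[of r] mtr_cyclic_odd[of r] mtr_cyclic_odd_even[of r]
  \<comment> \<open>\<open>mmul r a X\<close> and \<open>\<theta>\<close> are both odd, so moving
    \<open>\<theta>\<close> around the trace costs a sign.\<close>
  have c1: "mtr r (mmul r a (mmul r X \<theta>)) = - mtr r (mmul r \<theta> (mmul r a X))" if "meven r X" for X
    using cyc(2)[of "mmul r a X" \<theta>] par(2)[OF odd(2) that] odd by (simp add: dist)
  have c2: "mtr r (mmul r a (mmul r X a)) = - mtr r (mmul r a (mmul r a X))" if "meven r X" for X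
    using cyc(2)[of "mmul r a X" a] par(2)[OF odd(2) that] odd by (simp add: dist)
  have c3: "mtr r (mmul r W W') = mtr r (mmul r W' W)" by (rule cyc(1)[OF even])
  show "?L1 = mtr r (mmul r W' W') - mtr r (mmul r W W) + mtr r (mmul r (mmul r a a) (msub W' W))"
    unfolding da_def dW_def dW'_def
    by (simp only: dist c1[OF even(1)] c1[OF even(2)] c2[OF even(1)] c2[OF even(2)] c3) (simp add: algebra_simps)
  have aa: "meven r (mmul r a a)" by (intro par odd)
  have da: "meven r da"
    unfolding da_def by (intro parity_msub par odd even)
  have x1: "mtr r (mmul r a (mmul r da a)) = - mtr r (mmul r da (mmul r a a))"
    using cyc(2)[OF odd(2) par(3)[OF da odd(2)]] by (simp add: dist)
  have x2: "mtr r (mmul r (mmul r a a) da) = mtr r (mmul r da (mmul r a a))"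
    by (rule cyc(1)[OF aa da])
  \<comment> \<open>Multiplied by the square of \<open>a\<close>, only \<open>W' - W\<close>
    survives in \<open>da\<close>: the fourth power of \<open>a\<close> has trace 0, being a product
    of two odd matrices in either order, and the two terms with \<open>\<theta>\<close> cancel by
    cyclicity.\<close>
  have x3: "mtr r (mmul r da (mmul r a a)) = mtr r (mmul r (mmul r a a) (msub W' W))"
  proof -
    have 4: "mtr r (mmul r a (mmul r a (mmul r a a))) = 0"
      using cyc(2)[OF odd(2) par(2)[OF odd(2) aa]] by (intro ext_eq_neg_self) (simp add: dist)
    have 5: "mtr r (mmul r a (mmul r \<theta> (mmul r a a))) = - mtr r (mmul r \<theta> (mmul r a (mmul r a a)))"
      using cyc(2)[OF odd(2) par(2)[OF odd(1) aa]] by (simp add: dist)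
    have 6: "mtr r (mmul r X (mmul r a a)) = mtr r (mmul r a (mmul r a X))" if "meven r X" for X
      using cyc(1)[OF that aa] by (simp add: dist)
    show ?thesis unfolding da_def
      by (simp only: dist 4 5 6[OF even(1)] 6[OF even(2)]) simp
  qed
  show "mtr r (madd (msub (mmul r da (mmul r a a)) (mmul r a (mmul r da a))) (mmul r (mmul r a a) da)) =
      mtr r (mmul r (mmul r a a) (msub W' W)) + mtr r (mmul r (mmul r a a) (msub W' W)) + mtr r (mmul r (mmul r a a) (msub W' W))"
    by (simp only: mtr_distrib x1 x2 x3) simp
qed

subsection \<open>Conjugation invariance\<close>

text \<open>The relation \<open>A' = g\<^sup>-\<^sup>1 A g\<close> cleared of the inverse; in this
  form it passes to products by associativity alone.\<close>

definition conjugate :: "nat \<Rightarrow> (nat \<Rightarrow> nat \<Rightarrow> complex) \<Rightarrow> 'v ext mat \<Rightarrow> 'v ext mat \<Rightarrow> bool" where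
  "conjugate r g A A' \<longleftrightarrow> (\<forall>i<r. \<forall>j<r. (\<Sum>l<r. scal (g i l) * A' l j) = (\<Sum>l<r. A i l * scal (g l j)))"

lemma conjugate_mmul:
  assumes "conjugate r g A A'" "conjugate r g B B'"
  shows "conjugate r g (mmul r A B) (mmul r A' B')"
  unfolding conjugate_def
proof (intro allI impI)
  fix i j assume ij: "i < r" "j < r"
  let ?g = "\<lambda>i j. scal (g i j)"
  have A: "mmul r ?g A' i l = mmul r A ?g i l" and B: "mmul r ?g B' l j = mmul r B ?g l j" if "l < r" for l
    using assms ij that by (simp_all add: conjugate_def mmul_def)
  have "mmul r ?g (mmul r A' B') i j = mmul r (mmul r ?g A') B' i j" by (simp add: mmul_assoc)
  also have "\<dots> = mmul r (mmul r A ?g) B' i j" unfolding mmul_def[of r _ B'] by (simp add: A)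
  also have "\<dots> = mmul r A (mmul r ?g B') i j" by (simp add: mmul_assoc)
  also have "\<dots> = mmul r A (mmul r B ?g) i j" unfolding mmul_def[of r A] by (simp add: B)
  also have "\<dots> = mmul r (mmul r A B) ?g i j" by (simp add: mmul_assoc)
  finally show "(\<Sum>l<r. scal (g i l) * mmul r A' B' l j) = (\<Sum>l<r. mmul r A B i l * scal (g l j))"
    by (simp add: mmul_def[of r "?g"] mmul_def[of r _ ?g])
qed

lemma conjugate_madd: "conjugate r g A A' \<Longrightarrow> conjugate r g B B' \<Longrightarrow> conjugate r g (madd A B) (madd A' B')"
  by (simp add: conjugate_def madd_def distrib_left distrib_right sum.distrib)

text \<open>Scalars commute with everything, so moving \<open>g\<close> and \<open>h\<close> around
  the trace costs no sign: the trace of \<open>A'\<close>, which is \<open>h g A'\<close>, is that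
  of \<open>h A g\<close> and hence that of \<open>A g h\<close>.\<close>

lemma conjugate_mtr:
  assumes "conjugate r g A A'"
    and gh: "\<And>i j. i < r \<Longrightarrow> j < r \<Longrightarrow> (\<Sum>l<r. g i l * h l j) = (if i = j then 1 else 0)"
    and hg: "\<And>i j. i < r \<Longrightarrow> j < r \<Longrightarrow> (\<Sum>l<r. h i l * g l j) = (if i = j then 1 else 0)"
  shows "mtr r A' = mtr r A"
proof -
  have d: "scal (if P then 1 else 0) * x = (if P then x else 0)" "x * scal (if P then 1 else 0) = (if P then x else 0)" for P and x :: "'v ext"
    by (simp_all add: scal_simps)
  have "mtr r A' = (\<Sum>i<r. \<Sum>l<r. scal (if i = l then 1 else 0) * A' l i)"
    by (simp add: mtr_def d)
  also have "\<dots> = (\<Sum>i<r. \<Sum>l<r. scal (\<Sum>n<r. h i n * g n l) * A' l i)"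
    by (intro sum.cong refl) (simp add: hg)
  also have "\<dots> = (\<Sum>i<r. \<Sum>l<r. \<Sum>n<r. scal (h i n) * (scal (g n l) * A' l i))"
    by (simp add: scal_sum scal_simps sum_distrib_right mult.assoc)
  also have "\<dots> = (\<Sum>i<r. \<Sum>n<r. \<Sum>l<r. scal (h i n) * (scal (g n l) * A' l i))"
    by (intro sum.cong refl sum.swap)
  also have "\<dots> = (\<Sum>i<r. \<Sum>n<r. scal (h i n) * (\<Sum>l<r. A n l * scal (g l i)))"
    using assms(1) by (simp add: conjugate_def flip: sum_distrib_left)
  also have "\<dots> = (\<Sum>i<r. \<Sum>n<r. \<Sum>l<r. A n l * scal (g l i * h i n))"
    by (simp add: sum_distrib_left scal_simps scal_commute[of "h _ _"] mult.assoc)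
  also have "\<dots> = (\<Sum>n<r. \<Sum>i<r. \<Sum>l<r. A n l * scal (g l i * h i n))"
    by (rule sum.swap)
  also have "\<dots> = (\<Sum>n<r. \<Sum>l<r. \<Sum>i<r. A n l * scal (g l i * h i n))"
    by (intro sum.cong refl sum.swap)
  also have "\<dots> = (\<Sum>n<r. \<Sum>l<r. A n l * scal (if l = n then 1 else 0))"
    by (intro sum.cong refl) (simp add: gh flip: sum_distrib_left scal_sum)
  also have "\<dots> = mtr r A"
    by (simp add: mtr_def d)
  finally show ?thesis .
qed

subsection \<open>Chern polynomials\<close>

lemma at_pt_foldr_wedge: "at_pt (foldr wedge (map f js) unit_form) c z = prod_list (map (\<lambda>j. at_pt (f j) c z) js)"
  by (induction js) (simp_all add: at_pt_wedge at_pt_unit_form)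

lemma at_pt_chern_poly:
  "at_pt (chern_poly r n \<Omega>) c z = scal ((\<i> / (2 * of_real pi)) ^ n) *
     (\<Sum>S | S \<subseteq> {..<r} \<and> card S = n. \<Sum>\<sigma> | \<sigma> permutes S.
        scal (of_int (sign \<sigma>)) * prod_list (map (\<lambda>j. at_pt (\<Omega> j (\<sigma> j)) c z) (sorted_list_of_set S)))"
proof (rule ext_eqI)
  fix vs
  have "foldr wedge (map (\<lambda>j. \<Omega> j (\<sigma> j)) js) unit_form c z vs = app (prod_list (map (\<lambda>j. at_pt (\<Omega> j (\<sigma> j)) c z) js)) vs" for \<sigma> js
    by (simp flip: at_pt_foldr_wedge)
  then show "app (at_pt (chern_poly r n \<Omega>) c z) vs = app (scal ((\<i> / (2 * of_real pi)) ^ n) *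
     (\<Sum>S | S \<subseteq> {..<r} \<and> card S = n. \<Sum>\<sigma> | \<sigma> permutes S.
        scal (of_int (sign \<sigma>)) * prod_list (map (\<lambda>j. at_pt (\<Omega> j (\<sigma> j)) c z) (sorted_list_of_set S)))) vs"
    by (simp only: app_at_pt chern_poly_def app_scal_mult app_sum)
qed

lemma at_pt_chern_poly_1:
  "at_pt (chern_poly r 1 \<Omega>) c z = scal (\<i> / (2 * of_real pi)) * mtr r (\<lambda>i j. at_pt (\<Omega> i j) c z)"
proof -
  have S: "{S. S \<subseteq> {..<r} \<and> card S = 1} = (\<lambda>j. {j}) ` {..<r}"
    by (auto simp: card_1_singleton_iff)
  have "{\<sigma>. \<sigma> permutes {j}} = {id}" for j :: nat
    by (auto simp: permutes_sing)
  then show ?thesis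
    unfolding at_pt_chern_poly S
    by (subst sum.reindex) (simp_all add: inj_on_def mtr_def sign_id scal_simps)
qed

lemma permutes_pair: "i \<noteq> j \<Longrightarrow> {\<sigma>. \<sigma> permutes {i, j}} = {id, Transposition.transpose i j}" for i j :: 'b
proof -
  assume "i \<noteq> j"
  have "card {\<sigma>. \<sigma> permutes {i, j}} = 2" using \<open>i \<noteq> j\<close> by (subst card_permutations[where n = 2]) (auto simp: numeral_2_eq_2)
  moreover have "{id, Transposition.transpose i j} \<subseteq> {\<sigma>. \<sigma> permutes {i, j}}"
    by (auto intro: permutes_id permutes_swap_id)
  moreover have "id \<noteq> Transposition.transpose i j" using \<open>i \<noteq> j\<close> by (metis id_apply transpose_apply_first)
  ultimately show ?thesis
    by (intro card_subset_eq[symmetric]) (auto intro!: finite_permutations)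
qed

text \<open>Newton's identity for the second elementary symmetric polynomial. Even elements commute,
  so the minors \<open>T i j\<close> are symmetric in the indices; the sum over all pairs counts
  each of them twice and the diagonal as 0.\<close>

lemma at_pt_chern_poly_2:
  assumes "meven r (\<lambda>i j. at_pt (\<Omega> i j) c z)"
  shows "at_pt (chern_poly r 2 \<Omega>) c z = scal ((\<i> / (2 * of_real pi))\<^sup>2 / 2) *
    (mtr r (\<lambda>i j. at_pt (\<Omega> i j) c z) * mtr r (\<lambda>i j. at_pt (\<Omega> i j) c z)
       - mtr r (mmul r (\<lambda>i j. at_pt (\<Omega> i j) c z) (\<lambda>i j. at_pt (\<Omega> i j) c z)))"
proof -
  define W where "W i j = at_pt (\<Omega> i j) c z" for i j
  define T where "T i j = W i i * W j j - W i j * W j i" for i j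
  have W: "W i j * W k l = W k l * W i j" if "i < r" "j < r" "k < r" "l < r" for i j k l
    using assms that by (intro ext_commute_even) (simp_all add: W_def meven_def)
  have sym: "T i j = T j i" if "i < r" "j < r" for i j
    using that W[of i i j j] W[of i j j i] by (simp add: T_def)
  define P where "P = {(i, j). i < j \<and> j < r}"
  have P: "P \<subseteq> {..<r} \<times> {..<r}" "finite P"
    by (auto simp: P_def intro: finite_subset[of _ "{..<r} \<times> {..<r}"])
  have S: "{S. S \<subseteq> {..<r} \<and> card S = 2} = (\<lambda>(i, j). {i, j}) ` P"
  proof (intro equalityI subsetI)
    fix S assume "S \<in> {S. S \<subseteq> {..<r} \<and> card S = 2}"
    then have S: "S \<subseteq> {..<r}" "card S = 2" by auto
    then obtain i j where ij: "S = {i, j}" "i \<noteq> j" by (meson card_2_iff)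
    show "S \<in> (\<lambda>(i, j). {i, j}) ` P"
    proof (cases "i < j")
      case True
      then have "(i, j) \<in> P" using ij S by (simp add: P_def)
      then show ?thesis using ij by (intro image_eqI[of _ _ "(i, j)"]) auto
    next
      case False
      then have "(j, i) \<in> P" using ij S by (simp add: P_def)
      then show ?thesis using ij by (intro image_eqI[of _ _ "(j, i)"]) auto
    qed
  qed (auto simp: P_def card_2_iff)
  have inj: "inj_on (\<lambda>(i, j). {i, j}) P"
    by (auto simp: inj_on_def P_def doubleton_eq_iff)
  have t: "(\<Sum>\<sigma> | \<sigma> permutes {i, j}. scal (of_int (sign \<sigma>)) * prod_list (map (\<lambda>j. W j (\<sigma> j)) (sorted_list_of_set {i, j}))) = T i j"
    if "i < j" for i j
  proof -
    have ne: "id \<noteq> Transposition.transpose i j" using that by (metis id_apply less_irrefl transpose_apply_first)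
    have srt: "sorted_list_of_set {i, j} = [i, j]" 
      by (rule sorted_distinct_set_unique) (use that in auto)
    show ?thesis
      using that ne unfolding permutes_pair[OF less_imp_neq[OF that]] srt
      by (simp add: sign_id sign_swap_id scal_simps T_def)
  qed
  have "(\<Sum>S | S \<subseteq> {..<r} \<and> card S = 2. \<Sum>\<sigma> | \<sigma> permutes S.
        scal (of_int (sign \<sigma>)) * prod_list (map (\<lambda>j. W j (\<sigma> j)) (sorted_list_of_set S))) = (\<Sum>(i, j)\<in>P. T i j)"
    unfolding S
    by (subst sum.reindex[OF inj], rule sum.cong, rule refl, rename_tac p, case_tac p, simp only: o_def split, rule t)
      (simp add: P_def)
  moreover have "(\<Sum>(i, j)\<in>P. T i j) + (\<Sum>(i, j)\<in>P. T i j) = mtr r W * mtr r W - mtr r (mmul r W W)"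
  proof -
    have "(\<Sum>(i, j)\<in>P. T i j) = (\<Sum>(i, j)\<in>prod.swap ` P. T i j)"
      by (subst sum.reindex) (auto intro!: sum.cong sym simp: P_def)
    moreover have "(\<Sum>(i, j)\<in>P. T i j) + (\<Sum>(i, j)\<in>prod.swap ` P. T i j) = (\<Sum>(i, j)\<in>P \<union> prod.swap ` P. T i j)"
      by (rule sum.union_disjoint[symmetric]) (use P in \<open>auto simp: P_def\<close>)
    moreover have "(\<Sum>(i, j)\<in>P \<union> prod.swap ` P. T i j) = (\<Sum>(i, j)\<in>{..<r} \<times> {..<r}. T i j)"
    proof (rule sum.mono_neutral_left)
      show "\<forall>p\<in>{..<r} \<times> {..<r} - (P \<union> prod.swap ` P). (case p of (i, j) \<Rightarrow> T i j) = 0"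
      proof
        fix p assume p: "p \<in> {..<r} \<times> {..<r} - (P \<union> prod.swap ` P)"
        obtain i j where p': "p = (i, j)" by (cases p)
        have ij: "(i, j) \<notin> P \<union> prod.swap ` P" "i \<in> {..<r}" "j \<in> {..<r}" using p unfolding p' by auto
        have "i = j"
        proof (rule ccontr)
          assume "i \<noteq> j"
          then have "(i, j) \<in> P \<or> (j, i) \<in> P" using ij(2,3) by (auto simp: P_def)
          then show False using ij(1) by (auto simp: image_iff)
        qed
        then show "(case p of (i, j) \<Rightarrow> T i j) = 0" by (simp add: p' T_def)
      qed
    qed (use P in auto)
    moreover have "(\<Sum>(i, j)\<in>{..<r} \<times> {..<r}. T i j) = mtr r W * mtr r W - mtr r (mmul r W W)"
      by (simp add: T_def mtr_def mmul_def sum_product sum_subtractf sum.cartesian_product[symmetric])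
    ultimately show ?thesis by simp
  qed
  moreover have "x = scal (1 / 2) * (x + x)" for x :: "(complex ^ 2) ext"
  proof -
    have "scal (1 / 2) * (x + x) = (scal (1 / 2) + scal (1 / 2)) * x" by (simp add: algebra_simps)
    also have "scal (1 / 2) + scal (1 / 2) = (1 :: (complex ^ 2) ext)" by (simp flip: scal_simps)
    finally show ?thesis by simp
  qed
  ultimately show ?thesis
    unfolding at_pt_chern_poly W_def[symmetric]
    by (metis (no_types, lifting) mult.assoc scal_simps(2) times_divide_eq_right mult.right_neutral)
qed

section \<open>Curvature of matrix-valued fields\<close>

lemma app_dext_scal:
  "app (dext (\<lambda>y. scal (f y)) z) [v] = dir_deriv f v z"
  "length vs \<noteq> 1 \<Longrightarrow> app (dext (\<lambda>y. scal (f y)) z) vs = 0"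
proof -
  show "app (dext (\<lambda>y. scal (f y)) z) [v] = dir_deriv f v z"
    by (simp add: dext_def)
  show "app (dext (\<lambda>y. scal (f y)) z) vs = 0" if "length vs \<noteq> 1"
  proof (cases "length vs")
    case (Suc n)
    have "app (scal c) (nths vs (- {i})) = 0" if "i < length vs" for i c
    proof -
      have "{j. j < length vs \<and> j \<in> - {i}} = {..<length vs} - {i}" by auto
      then have "length (nths vs (- {i})) = n" using that Suc by (simp add: length_nths)
      then have "nths vs (- {i}) \<noteq> []" using Suc \<open>length vs \<noteq> 1\<close> by auto
      then show ?thesis by (simp add: scal_def)
    qed
    then show ?thesis by (simp add: dext_def)
  qed (simp add: dext_def)
qed

definition dmat :: "(complex ^ 2 \<Rightarrow> (complex ^ 2) ext mat) \<Rightarrow> complex ^ 2 \<Rightarrow> (complex ^ 2) ext mat" where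
  "dmat A z = (\<lambda>i j. dext (\<lambda>y. A y i j) z)"

definition curv :: "nat \<Rightarrow> (complex ^ 2 \<Rightarrow> (complex ^ 2) ext mat) \<Rightarrow> complex ^ 2 \<Rightarrow> (complex ^ 2) ext mat" where
  "curv r \<theta> z = madd (dmat \<theta> z) (mmul r (\<theta> z) (\<theta> z))"

definition smooth_mat :: "(complex ^ 2) set \<Rightarrow> (complex ^ 2 \<Rightarrow> (complex ^ 2) ext mat) \<Rightarrow> bool" where
  "smooth_mat S A \<longleftrightarrow> (\<forall>i j. smooth_field S (\<lambda>y. A y i j))"

definition mgrade :: "'v ext mat \<Rightarrow> 'v ext mat" where
  "mgrade A = (\<lambda>i j. grade (A i j))"

definition mneg :: "(nat \<Rightarrow> nat \<Rightarrow> 'a::ring) \<Rightarrow> nat \<Rightarrow> nat \<Rightarrow> 'a" where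
  "mneg A = (\<lambda>i j. - A i j)"

lemma mneg_simps: "mmul r (mneg A) B = mneg (mmul r A B)" "mmul r A (mneg B) = mneg (mmul r A B)"
  "mtr r (mneg A) = - mtr r A" "madd A (mneg B) = msub A B"
  by (simp_all add: mneg_def mmul_def mtr_def madd_def msub_def sum_negf)

lemma smooth_matD: "smooth_mat S A \<Longrightarrow> smooth_field S (\<lambda>y. A y i j)"
  by (simp add: smooth_mat_def)

lemma smooth_mat_diff_at: "smooth_mat S A \<Longrightarrow> z \<in> S \<Longrightarrow> diff_at (\<lambda>y. A y i j) z"
  by (rule smooth_field_diff_at[OF smooth_matD])

lemma smooth_mat_simps:
  assumes "open S"
  shows "smooth_mat S A \<Longrightarrow> smooth_mat S B \<Longrightarrow> smooth_mat S (\<lambda>y. madd (A y) (B y))"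
    "smooth_mat S A \<Longrightarrow> smooth_mat S B \<Longrightarrow> smooth_mat S (\<lambda>y. msub (A y) (B y))"
    "smooth_mat S A \<Longrightarrow> smooth_mat S B \<Longrightarrow> smooth_mat S (\<lambda>y. mmul r (A y) (B y))"
    "smooth_mat S A \<Longrightarrow> smooth_mat S (dmat A)"
  unfolding smooth_mat_def madd_def msub_def mmul_def dmat_def
  by (simp_all add: smooth_field_simps smooth_field_sum smooth_field_mult smooth_field_dext assms)

lemma smooth_mat_curv: "open S \<Longrightarrow> smooth_mat S \<theta> \<Longrightarrow> smooth_mat S (curv r \<theta>)"
  unfolding curv_def by (intro smooth_mat_simps)

lemma smooth_field_mtr: "open S \<Longrightarrow> smooth_mat S A \<Longrightarrow> smooth_field S (\<lambda>y. mtr r (A y))"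
  unfolding mtr_def by (intro smooth_field_sum smooth_matD)

lemma dext_mtr: "smooth_mat S A \<Longrightarrow> z \<in> S \<Longrightarrow> dext (\<lambda>y. mtr r (A y)) z = mtr r (dmat A z)"
  unfolding mtr_def dmat_def by (rule dext_sum) (rule smooth_mat_diff_at)

lemma dmat_mmul:
  assumes "smooth_mat S A" "smooth_mat S B" "z \<in> S"
  shows "dmat (\<lambda>y. mmul r (A y) (B y)) z = madd (mmul r (dmat A z) (B z)) (mmul r (mgrade (A z)) (dmat B z))"
proof (intro HOL.ext)
  fix i j
  have "dmat (\<lambda>y. mmul r (A y) (B y)) z i j = (\<Sum>l<r. dext (\<lambda>y. A y i l * B y l j) z)"
    unfolding dmat_def mmul_def
    by (rule dext_sum) (intro diff_at_mult smooth_mat_diff_at[OF assms(1,3)] smooth_mat_diff_at[OF assms(2,3)])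
  also have "\<dots> = (\<Sum>l<r. dext (\<lambda>y. A y i l) z * B z l j + grade (A z i l) * dext (\<lambda>y. B y l j) z)"
    by (intro sum.cong refl dext_mult smooth_mat_diff_at[OF assms(1,3)] smooth_mat_diff_at[OF assms(2,3)])
  finally show "dmat (\<lambda>y. mmul r (A y) (B y)) z i j = madd (mmul r (dmat A z) (B z)) (mmul r (mgrade (A z)) (dmat B z)) i j"
    by (simp add: madd_def mmul_def dmat_def mgrade_def sum.distrib)
qed

lemma dmat_madd:
  assumes "smooth_mat S A" "smooth_mat S B" "z \<in> S"
  shows "dmat (\<lambda>y. madd (A y) (B y)) z = madd (dmat A z) (dmat B z)"
  unfolding dmat_def madd_def
  by (intro HOL.ext dext_add smooth_mat_diff_at[OF assms(1,3)] smooth_mat_diff_at[OF assms(2,3)])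

lemma dmat_msub:
  assumes "smooth_mat S A" "smooth_mat S B" "z \<in> S"
  shows "dmat (\<lambda>y. msub (A y) (B y)) z = msub (dmat A z) (dmat B z)"
  unfolding dmat_def msub_def
  by (intro HOL.ext dext_diff smooth_mat_diff_at[OF assms(1,3)] smooth_mat_diff_at[OF assms(2,3)])

lemma dmat_dmat: "open S \<Longrightarrow> smooth_mat S A \<Longrightarrow> z \<in> S \<Longrightarrow> dmat (dmat A) z = (\<lambda>i j. 0)"
  unfolding dmat_def by (intro HOL.ext dext_dext smooth_matD)

lemma dmat_cong:
  "open S \<Longrightarrow> z \<in> S \<Longrightarrow> (\<And>y. y \<in> S \<Longrightarrow> A y = B y) \<Longrightarrow> dmat A z = dmat B z"
  unfolding dmat_def by (intro HOL.ext dext_cong[where S = S]) simp_all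

definition odd_mat :: "(complex ^ 2) set \<Rightarrow> (complex ^ 2 \<Rightarrow> (complex ^ 2) ext mat) \<Rightarrow> bool" where
  "odd_mat S A \<longleftrightarrow> (\<forall>z\<in>S. mgrade (A z) = mneg (A z))"

definition even_mat :: "(complex ^ 2) set \<Rightarrow> (complex ^ 2 \<Rightarrow> (complex ^ 2) ext mat) \<Rightarrow> bool" where
  "even_mat S A \<longleftrightarrow> (\<forall>z\<in>S. mgrade (A z) = A z)"

lemma odd_matD: "odd_mat S A \<Longrightarrow> z \<in> S \<Longrightarrow> mgrade (A z) = mneg (A z)" "odd_mat S A \<Longrightarrow> z \<in> S \<Longrightarrow> modd r (A z)"
proof -
  show 1: "odd_mat S A \<Longrightarrow> z \<in> S \<Longrightarrow> mgrade (A z) = mneg (A z)" by (simp add: odd_mat_def)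
  show "modd r (A z)" if "odd_mat S A" "z \<in> S"
    using fun_cong[OF fun_cong[OF 1[OF that]]] by (simp add: modd_def mgrade_def mneg_def)
qed

lemma even_matD: "even_mat S A \<Longrightarrow> z \<in> S \<Longrightarrow> mgrade (A z) = A z" "even_mat S A \<Longrightarrow> z \<in> S \<Longrightarrow> meven r (A z)"
proof -
  show 1: "even_mat S A \<Longrightarrow> z \<in> S \<Longrightarrow> mgrade (A z) = A z" by (simp add: even_mat_def)
  show "meven r (A z)" if "even_mat S A" "z \<in> S"
    using fun_cong[OF fun_cong[OF 1[OF that]]] by (simp add: meven_def mgrade_def)
qed

lemma mgrade_mmul: "mgrade (mmul r A B) = mmul r (mgrade A) (mgrade B)"
  by (simp add: mgrade_def mmul_def)

lemma mgrade_dmat: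
  assumes "smooth_mat S A" "z \<in> S"
  shows "mgrade (dmat A z) = mneg (dmat (\<lambda>y. mgrade (A y)) z)"
  by (simp add: mgrade_def dmat_def mneg_def dext_grade smooth_mat_diff_at[OF assms])

lemma even_mat_curv:
  assumes "open S" "smooth_mat S \<theta>" "odd_mat S \<theta>"
  shows "even_mat S (curv r \<theta>)"
  unfolding even_mat_def
proof
  fix z assume z: "z \<in> S"
  have "dmat (\<lambda>y. mgrade (\<theta> y)) z = dmat (\<lambda>y. mneg (\<theta> y)) z"
    by (rule dmat_cong[OF assms(1) z]) (rule odd_matD[OF assms(3)])
  also have "\<dots> = mneg (dmat \<theta> z)"
    by (simp add: dmat_def mneg_def dext_minus smooth_mat_diff_at[OF assms(2) z])
  finally have "mgrade (dmat \<theta> z) = dmat \<theta> z"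
    using mgrade_dmat[OF assms(2) z] by (simp add: mneg_def)
  moreover have "mgrade (mmul r (\<theta> z) (\<theta> z)) = mmul r (\<theta> z) (\<theta> z)"
    unfolding mgrade_mmul odd_matD(1)[OF assms(3) z] mneg_simps by (simp add: mneg_def)
  ultimately show "mgrade (curv r \<theta> z) = curv r \<theta> z"
    unfolding curv_def by (simp add: mgrade_def madd_def fun_eq_iff)
qed

text \<open>As \<open>d\<close> applied twice is 0, only the derivative of the square of
  \<open>\<theta>\<close> remains. Expressing \<open>d\<theta>\<close> by the curvature adds two
  cubic terms, which cancel.\<close>

lemma bianchi:
  assumes "open S" "smooth_mat S \<theta>" "odd_mat S \<theta>" "z \<in> S"
  shows "dmat (curv r \<theta>) z = msub (mmul r (curv r \<theta> z) (\<theta> z)) (mmul r (\<theta> z) (curv r \<theta> z))"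
proof -
  have "dmat (curv r \<theta>) z = madd (dmat (dmat \<theta>) z) (dmat (\<lambda>y. mmul r (\<theta> y) (\<theta> y)) z)"
    unfolding curv_def by (rule dmat_madd[OF smooth_mat_simps(4)[OF assms(1,2)] smooth_mat_simps(3)[OF assms(1,2,2)] assms(4)])
  also have "\<dots> = dmat (\<lambda>y. mmul r (\<theta> y) (\<theta> y)) z"
    by (simp add: dmat_dmat[OF assms(1,2,4)] madd_def)
  also have "\<dots> = msub (mmul r (dmat \<theta> z) (\<theta> z)) (mmul r (\<theta> z) (dmat \<theta> z))"
    by (simp only: dmat_mmul[OF assms(2,2,4)] odd_matD(1)[OF assms(3,4)] mneg_simps)
  finally show ?thesis
    unfolding curv_def mmul_distrib mmul_assoc by (simp add: madd_def msub_def)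
qed

text \<open>By the Bianchi identity the derivative is the trace of a commutator of an odd with an
  even matrix.\<close>

lemma dext_mtr_curv:
  assumes "open S" "smooth_mat S \<theta>" "odd_mat S \<theta>" "z \<in> S"
  shows "dext (\<lambda>y. mtr r (curv r \<theta> y)) z = 0"
  using mtr_cyclic_odd_even[OF odd_matD(2)[OF assms(3,4)] even_matD(2)[OF even_mat_curv[OF assms(1-3)] assms(4)], of r r]
  by (simp add: dext_mtr[OF smooth_mat_curv[OF assms(1,2)] assms(4)] bianchi[OF assms] mtr_distrib)

lemma dext_mtr_curv_curv:
  assumes "open S" "smooth_mat S \<theta>" "odd_mat S \<theta>" "z \<in> S"
  shows "dext (\<lambda>y. mtr r (mmul r (curv r \<theta> y) (curv r \<theta> y))) z = 0"
proof -
  let ?K = "curv r \<theta> z"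
  note sK = smooth_mat_curv[OF assms(1,2), of r] and eK = even_mat_curv[OF assms(1-3), of r]
  note K = even_matD(2)[OF eK assms(4), of r] and \<theta> = odd_matD(2)[OF assms(3,4), of r]
  have "dext (\<lambda>y. mtr r (mmul r (curv r \<theta> y) (curv r \<theta> y))) z
      = mtr r (madd (mmul r (dmat (curv r \<theta>) z) ?K) (mmul r ?K (dmat (curv r \<theta>) z)))"
    using dext_mtr[OF smooth_mat_simps(3)[OF assms(1) sK sK] assms(4)]
    by (simp only: dmat_mmul[OF sK sK assms(4)] even_matD(1)[OF eK assms(4)])
  also have "\<dots> = 0"
    using mtr_cyclic_odd_even[OF \<theta> parity_mmul(1)[OF K K]]
    by (simp add: bianchi[OF assms] mmul_distrib mtr_distrib mmul_assoc)
  finally show ?thesis .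
qed

text \<open>The square of an odd matrix has trace 0, so only the exterior derivative of the
  connection matrix contributes.\<close>

lemma mtr_curv_diff:
  assumes "open S" "smooth_mat S \<theta>" "odd_mat S \<theta>" "smooth_mat S \<theta>'" "odd_mat S \<theta>'" "z \<in> S"
  shows "mtr r (curv r \<theta>' z) - mtr r (curv r \<theta> z) = dext (\<lambda>y. mtr r (msub (\<theta>' y) (\<theta> y))) z"
proof -
  have "mtr r (mmul r (\<theta> z) (\<theta> z)) = 0" if "odd_mat S \<theta>" for \<theta>
    using mtr_cyclic_odd[OF odd_matD(2)[OF that assms(6)] odd_matD(2)[OF that assms(6)]] by (intro ext_eq_neg_self) simp
  then have "mtr r (curv r \<theta> z) = mtr r (dmat \<theta> z)" if "odd_mat S \<theta>" for \<theta>
    using that by (simp add: curv_def mtr_distrib)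
  moreover have "dext (\<lambda>y. mtr r (msub (\<theta>' y) (\<theta> y))) z = mtr r (dmat \<theta>' z) - mtr r (dmat \<theta> z)"
    unfolding dext_mtr[OF smooth_mat_simps(2)[OF assms(1,4,2)] assms(6)] dmat_msub[OF assms(4,2,6)] by (rule mtr_distrib(2))
  ultimately show ?thesis using assms(3,5) by simp
qed

text \<open>The derivative of tr (\<alpha> (\<Omega> + \<Omega>')) misses the wanted difference by
  the term called \<open>Y\<close> in the proof, and the derivative of tr \<alpha>^3 is three times
  \<open>Y\<close>. This is the origin of the factor 1/3.\<close>

lemma mtr_curv_curv_diff:
  assumes "open S" "smooth_mat S \<theta>" "odd_mat S \<theta>" "smooth_mat S \<theta>'" "odd_mat S \<theta>'" "z \<in> S"
  defines "\<alpha> \<equiv> \<lambda>y. msub (\<theta>' y) (\<theta> y)"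
  shows "mtr r (mmul r (curv r \<theta>' z) (curv r \<theta>' z)) - mtr r (mmul r (curv r \<theta> z) (curv r \<theta> z)) =
    dext (\<lambda>y. mtr r (mmul r (\<alpha> y) (madd (curv r \<theta> y) (curv r \<theta>' y)))
      - scal (1 / 3) * mtr r (mmul r (mmul r (\<alpha> y) (\<alpha> y)) (\<alpha> y))) z"
proof -
  let ?W = "curv r \<theta>" and ?W' = "curv r \<theta>'"
  note sm = smooth_mat_curv[OF assms(1,2), of r] smooth_mat_curv[OF assms(1,4), of r]
  note ev = even_mat_curv[OF assms(1-3), of r] even_mat_curv[OF assms(1,4,5), of r]
  have s\<alpha>: "smooth_mat S \<alpha>" unfolding \<alpha>_def by (intro smooth_mat_simps assms)
  have o\<alpha>: "odd_mat S \<alpha>"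
    unfolding odd_mat_def
  proof
    fix z assume "z \<in> S"
    then show "mgrade (\<alpha> z) = mneg (\<alpha> z)"
      using odd_matD(1)[OF assms(3)] odd_matD(1)[OF assms(5)]
      by (simp add: \<alpha>_def mgrade_def mneg_def msub_def fun_eq_iff)
  qed
  have \<theta>': "\<theta>' y = madd (\<theta> y) (\<alpha> y)" for y by (simp add: \<alpha>_def madd_def msub_def)
  have da: "dmat \<alpha> z = msub (msub (msub (msub (?W' z) (?W z)) (mmul r (\<theta> z) (\<alpha> z))) (mmul r (\<alpha> z) (\<theta> z))) (mmul r (\<alpha> z) (\<alpha> z))"
  proof -
    have "dmat \<alpha> z = msub (dmat \<theta>' z) (dmat \<theta> z)" unfolding \<alpha>_def by (rule dmat_msub[OF assms(4,2,6)])
    moreover have "mmul r (\<theta>' z) (\<theta>' z) = madd (madd (mmul r (\<theta> z) (\<theta> z)) (mmul r (\<alpha> z) (\<theta> z))) (madd (mmul r (\<theta> z) (\<alpha> z)) (mmul r (\<alpha> z) (\<alpha> z)))"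
      unfolding \<theta>' mmul_distrib by (simp add: madd_def)
    ultimately show ?thesis by (simp add: curv_def madd_def msub_def fun_eq_iff)
  qed
  note odd_even = odd_matD(2)[OF assms(3,6)] odd_matD(2)[OF o\<alpha> assms(6)] even_matD(2)[OF ev(1) assms(6)] even_matD(2)[OF ev(2) assms(6)]
  define P where "P y = mmul r (\<alpha> y) (madd (?W y) (?W' y))" for y
  define Q where "Q y = mmul r (mmul r (\<alpha> y) (\<alpha> y)) (\<alpha> y)" for y
  define Y where "Y = mtr r (mmul r (mmul r (\<alpha> z) (\<alpha> z)) (msub (?W' z) (?W z)))"
  have sPQ: "smooth_mat S P" "smooth_mat S Q" "smooth_mat S (\<lambda>y. mmul r (\<alpha> y) (\<alpha> y))" "smooth_mat S (\<lambda>y. madd (?W y) (?W' y))"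
    unfolding P_def Q_def by (intro smooth_mat_simps s\<alpha> sm assms(1))+
  have dP: "dext (\<lambda>y. mtr r (P y)) z = mtr r (msub (mmul r (dmat \<alpha> z) (madd (?W z) (?W' z))) (mmul r (\<alpha> z) (madd (dmat ?W z) (dmat ?W' z))))"
    unfolding dext_mtr[OF sPQ(1) assms(6)] unfolding P_def
      dmat_mmul[OF s\<alpha> sPQ(4) assms(6)] odd_matD(1)[OF o\<alpha> assms(6)] mneg_simps dmat_madd[OF sm assms(6)] by (rule refl)
  have dQ: "dext (\<lambda>y. mtr r (Q y)) z = mtr r (madd (msub (mmul r (dmat \<alpha> z) (mmul r (\<alpha> z) (\<alpha> z))) (mmul r (\<alpha> z) (mmul r (dmat \<alpha> z) (\<alpha> z))))
      (mmul r (mmul r (\<alpha> z) (\<alpha> z)) (dmat \<alpha> z)))"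
  proof -
    have "mgrade (mmul r (\<alpha> z) (\<alpha> z)) = mmul r (\<alpha> z) (\<alpha> z)"
      unfolding mgrade_mmul odd_matD(1)[OF o\<alpha> assms(6)] mneg_simps by (simp add: mneg_def)
    then show ?thesis
      unfolding dext_mtr[OF sPQ(2) assms(6)] unfolding Q_def
        dmat_mmul[OF sPQ(3) s\<alpha> assms(6)] dmat_mmul[OF s\<alpha> s\<alpha> assms(6)] odd_matD(1)[OF o\<alpha> assms(6)]
      by (simp only: mneg_simps mmul_distrib mmul_assoc)
  qed
  have tr1: "mtr r (msub (mmul r (dmat \<alpha> z) (madd (?W z) (?W' z))) (mmul r (\<alpha> z) (madd (dmat ?W z) (dmat ?W' z))))
      = mtr r (mmul r (?W' z) (?W' z)) - mtr r (mmul r (?W z) (?W z)) + Y"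
    unfolding bianchi[OF assms(1-3,6)] bianchi[OF assms(1,4,5,6)] da \<theta>'[of z] Y_def
    by (rule transgression(1)[OF odd_even])
  have tr2: "mtr r (madd (msub (mmul r (dmat \<alpha> z) (mmul r (\<alpha> z) (\<alpha> z))) (mmul r (\<alpha> z) (mmul r (dmat \<alpha> z) (\<alpha> z))))
      (mmul r (mmul r (\<alpha> z) (\<alpha> z)) (dmat \<alpha> z))) = Y + Y + Y"
    unfolding da Y_def by (rule transgression(2)[OF odd_even])
  have "scal (1 / 3) * (Y + Y + Y) = (scal (1 / 3) + scal (1 / 3) + scal (1 / 3)) * Y" by (simp add: algebra_simps)
  also have "scal (1 / 3) + scal (1 / 3) + scal (1 / 3) = (1 :: (complex ^ 2) ext)" by (simp flip: scal_simps)
  finally have third: "scal (1 / 3) * (Y + Y + Y) = Y" by simp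
  have "diff_at (\<lambda>y. mtr r (P y)) z" "diff_at (\<lambda>y. mtr r (Q y)) z"
    by (rule smooth_field_diff_at[OF smooth_field_mtr[OF assms(1)] assms(6)], rule sPQ)+
  moreover have sc: "diff_at (\<lambda>y. scal (1 / 3)) z" by (rule diff_at_scal) simp
  moreover have "dext (\<lambda>y. scal (1 / 3)) z = 0"
    by (rule ext_eqI) (simp add: dext_def)
  ultimately have "dext (\<lambda>y. mtr r (P y) - scal (1 / 3) * mtr r (Q y)) z
      = dext (\<lambda>y. mtr r (P y)) z - scal (1 / 3) * dext (\<lambda>y. mtr r (Q y)) z"
    by (simp add: dext_diff dext_mult diff_at_mult)
  also have "\<dots> = mtr r (mmul r (?W' z) (?W' z)) - mtr r (mmul r (?W z) (?W z)) + Y - scal (1 / 3) * (Y + Y + Y)"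
    unfolding dP dQ tr1 tr2 ..
  finally show ?thesis unfolding third P_def Q_def by simp
qed

text \<open>Differentiating the transformation law and using it once more eliminates
  \<open>dG\<close>; the curvatures are related without inverting \<open>G\<close>.\<close>

lemma conjugate_curv:
  assumes "open S" "smooth_mat S \<theta>" "odd_mat S \<theta>" "smooth_mat S \<theta>'" "odd_mat S \<theta>'" "smooth_mat S G" "even_mat S G" "z \<in> S"
    and law: "\<And>y. y \<in> S \<Longrightarrow> mmul r (G y) (\<theta>' y) = madd (dmat G y) (mmul r (\<theta> y) (G y))"
  shows "mmul r (G z) (curv r \<theta>' z) = mmul r (curv r \<theta> z) (G z)"
proof -
  have e1: "dmat (\<lambda>y. mmul r (G y) (\<theta>' y)) z = dmat (\<lambda>y. madd (dmat G y) (mmul r (\<theta> y) (G y))) z"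
    by (rule dmat_cong[OF assms(1,8) law])
  have e2: "dmat (\<lambda>y. mmul r (G y) (\<theta>' y)) z = madd (mmul r (dmat G z) (\<theta>' z)) (mmul r (G z) (dmat \<theta>' z))"
    by (simp only: dmat_mmul[OF assms(6,4,8)] even_matD(1)[OF assms(7,8)])
  have e3: "dmat (\<lambda>y. madd (dmat G y) (mmul r (\<theta> y) (G y))) z = madd (dmat (dmat G) z) (dmat (\<lambda>y. mmul r (\<theta> y) (G y)) z)"
    by (rule dmat_madd[OF smooth_mat_simps(4)[OF assms(1,6)] smooth_mat_simps(3)[OF assms(1,2,6)] assms(8)])
  have e4: "dmat (\<lambda>y. mmul r (\<theta> y) (G y)) z = msub (mmul r (dmat \<theta> z) (G z)) (mmul r (\<theta> z) (dmat G z))"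
    by (simp only: dmat_mmul[OF assms(2,6,8)] odd_matD(1)[OF assms(3,8)] mneg_simps)
  have e5: "madd (mmul r (dmat G z) (\<theta>' z)) (mmul r (G z) (dmat \<theta>' z)) = madd (\<lambda>i j. 0) (msub (mmul r (dmat \<theta> z) (G z)) (mmul r (\<theta> z) (dmat G z)))"
    by (simp only: e2[symmetric] e1 e3 e4 dmat_dmat[OF assms(1,6,8)])
  have 1: "mmul r (G z) (dmat \<theta>' z) = msub (msub (mmul r (dmat \<theta> z) (G z)) (mmul r (\<theta> z) (dmat G z))) (mmul r (dmat G z) (\<theta>' z))"
  proof (intro HOL.ext)
    fix i j
    from fun_cong[OF fun_cong[OF e5], of i j]
    show "mmul r (G z) (dmat \<theta>' z) i j = msub (msub (mmul r (dmat \<theta> z) (G z)) (mmul r (\<theta> z) (dmat G z))) (mmul r (dmat G z) (\<theta>' z)) i j"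
      by (simp add: madd_def msub_def algebra_simps)
  qed
  have 2: "mmul r (G z) (mmul r (\<theta>' z) (\<theta>' z)) = madd (mmul r (dmat G z) (\<theta>' z)) (madd (mmul r (\<theta> z) (dmat G z)) (mmul r (\<theta> z) (mmul r (\<theta> z) (G z))))"
    by (simp only: mmul_assoc[of r "G z", symmetric] law[OF assms(8)] mmul_distrib mmul_assoc)
  show ?thesis
    unfolding curv_def mmul_distrib mmul_assoc 1 2 by (simp add: madd_def msub_def)
qed

section \<open>Tensors and pullback\<close>

definition tensor_at :: "'v::real_vector ext \<Rightarrow> bool" where
  "tensor_at a \<longleftrightarrow> skew a \<and> multilin a"

lemma tensor_at_iff:
  "tensor_at a \<longleftrightarrow> (\<forall>vs. (\<forall>i<length vs. linear (\<lambda>v. app a (vs[i := v]))) \<and> (\<not> distinct vs \<longrightarrow> app a vs = 0))"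
proof
  assume a: "tensor_at a"
  show "\<forall>vs. (\<forall>i<length vs. linear (\<lambda>v. app a (vs[i := v]))) \<and> (\<not> distinct vs \<longrightarrow> app a vs = 0)"
    using a skew_imp_zero by (auto simp: tensor_at_def multilin_def upd_conv_take_nth_drop)
next
  assume a: "\<forall>vs. (\<forall>i<length vs. linear (\<lambda>v. app a (vs[i := v]))) \<and> (\<not> distinct vs \<longrightarrow> app a vs = 0)"
  \<comment> \<open>\<open>vs[i := v]\<close> overwrites the slot, so its previous content is
    arbitrary.\<close>
  have "linear (\<lambda>v. app a (xs @ v # ys))" for xs ys
    using a[rule_format, of "xs @ undefined # ys", THEN conjunct1, rule_format, of "length xs"] by simp
  then have m: "multilin a" by (simp add: multilin_def)
  then show "tensor_at a" using zero_imp_skew[OF m] a by (simp add: tensor_at_def)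
qed

definition pull :: "('v \<Rightarrow> 'w) \<Rightarrow> 'w ext \<Rightarrow> 'v ext" where
  "pull L a = Ext (\<lambda>vs. app a (map L vs))"

lemma app_pull [simp]: "app (pull L a) vs = app a (map L vs)"
  by (simp add: pull_def)

lemma pull_simps: "pull L (a + b) = pull L a + pull L b" "pull L (a - b) = pull L a - pull L b" "pull L (- a) = - pull L a"
  "pull L 0 = 0" "pull L (scal k) = scal k" "pull L (a * b) = pull L a * pull L b" "pull L (grade a) = grade (pull L a)" "pull L 1 = 1"
proof -
  show s: "pull L (scal k) = scal k" for k by (rule ext_eqI) (simp add: scal_def)
  show "pull L 1 = 1" unfolding one_ext_def by (rule s)
qed (rule ext_eqI; simp add: app_mult_map flip: pull_def)+

lemma pull_sum: "pull L (\<Sum>i\<in>I. f i) = (\<Sum>i\<in>I. pull L (f i))"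
  by (induction I rule: infinite_finite_induct) (simp_all add: pull_simps)

lemma tensor_at_simps: "tensor_at a \<Longrightarrow> tensor_at b \<Longrightarrow> tensor_at (a + b)" "tensor_at a \<Longrightarrow> tensor_at b \<Longrightarrow> tensor_at (a * b)"
  "tensor_at a \<Longrightarrow> tensor_at (- a)" "tensor_at (scal k)" "tensor_at a \<Longrightarrow> tensor_at (grade a)" "tensor_at 0"
  by (simp_all add: tensor_at_def skew_simps skew_add skew_minus skew_grade skew_mult multilin_simps multilin_mult)

section \<open>Charts\<close>

abbreviation cinv :: "'a chart \<Rightarrow> complex ^ 2 \<Rightarrow> 'a" where
  "cinv c \<equiv> inv_into (fst c) (snd c)"

abbreviation cimg :: "'a chart \<Rightarrow> 'a set \<Rightarrow> (complex ^ 2) set" where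
  "cimg c W \<equiv> snd c ` (fst c \<inter> W)"

abbreviation trans_map :: "'a chart \<Rightarrow> 'a chart \<Rightarrow> complex ^ 2 \<Rightarrow> complex ^ 2" where
  "trans_map c d \<equiv> \<lambda>z. snd d (cinv c z)"

locale surface =
  fixes A :: "('a::{t2_space,second_countable_topology}) chart set"
  assumes surface: "complex_surface A"
begin

lemma chart_at: obtains c where "c \<in> A" "x \<in> fst c"
proof -
  have "x \<in> (\<Union>(U, \<phi>)\<in>A. U)" using surface by (auto simp: complex_surface_def)
  then obtain U \<phi> where c: "(U, \<phi>) \<in> A" "x \<in> U" by blast
  show thesis by (rule that[of "(U, \<phi>)"]) (simp_all add: c)
qed

lemma chart_open: "c \<in> A \<Longrightarrow> open (fst c)"
  and chart_homeo: "c \<in> A \<Longrightarrow> homeomorphism (fst c) (snd c ` fst c) (snd c) (cinv c)"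
  and chart_img_open: "c \<in> A \<Longrightarrow> open (snd c ` fst c)"
proof -
  note * = surface[unfolded complex_surface_def case_prod_unfold, THEN conjunct2, THEN conjunct1]
  show "c \<in> A \<Longrightarrow> open (fst c)" "c \<in> A \<Longrightarrow> homeomorphism (fst c) (snd c ` fst c) (snd c) (cinv c)"
    "c \<in> A \<Longrightarrow> open (snd c ` fst c)"
    by (drule *[rule_format], simp only:)+
qed

lemma cinv_coord: "c \<in> A \<Longrightarrow> x \<in> fst c \<Longrightarrow> cinv c (snd c x) = x"
  using homeomorphism_apply1[OF chart_homeo] .

lemma cimgD:
  assumes "c \<in> A" "z \<in> cimg c W"
  shows "cinv c z \<in> fst c" "cinv c z \<in> W" "snd c (cinv c z) = z"
proof -
  obtain x where x: "x \<in> fst c" "x \<in> W" "z = snd c x" using assms(2) by blast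
  show "cinv c z \<in> fst c" "cinv c z \<in> W" "snd c (cinv c z) = z"
    unfolding x(3) cinv_coord[OF assms(1) x(1)] by (rule x refl)+
qed

lemma cimgI: "x \<in> fst c \<Longrightarrow> x \<in> W \<Longrightarrow> snd c x \<in> cimg c W" by blast

lemma cimg_iff:
  assumes "c \<in> A" "z \<in> cimg c V"
  shows "z \<in> cimg c W \<longleftrightarrow> cinv c z \<in> W"
proof
  show "z \<in> cimg c W \<Longrightarrow> cinv c z \<in> W" by (rule cimgD(2)[OF assms(1)])
  show "cinv c z \<in> W \<Longrightarrow> z \<in> cimg c W" using cimgI[OF cimgD(1)[OF assms]] cimgD(3)[OF assms] by metis
qed

lemma open_cimg:
  assumes "c \<in> A" "open W" shows "open (cimg c W)"
proof -
  have "openin (top_of_set (fst c)) (fst c \<inter> W)" using assms(2) by (auto simp: openin_open)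
  then have "openin (top_of_set (snd c ` fst c)) (cimg c W)"
    by (rule homeomorphism_imp_open_map[OF chart_homeo[OF assms(1)]])
  then show ?thesis using chart_img_open[OF assms(1)] by (simp add: openin_open_eq)
qed

lemma continuous_on_cinv: "c \<in> A \<Longrightarrow> continuous_on (snd c ` fst c) (cinv c)"
  using homeomorphism_cont2[OF chart_homeo] .

lemma continuous_on_coord: "c \<in> A \<Longrightarrow> continuous_on (fst c) (snd c)"
  using homeomorphism_cont1[OF chart_homeo] .

lemma trans_map_holo:
  assumes "c \<in> A" "d \<in> A" shows "holo_on (\<lambda>z. trans_map c d z $ i) (cimg c (fst d))"
  by (rule surface[unfolded complex_surface_def case_prod_unfold, THEN conjunct2, THEN conjunct2, rule_format, OF assms])

lemma trans_mapD:
  assumes "c \<in> A" "d \<in> A" "z \<in> cimg c (fst d \<inter> W)"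
  shows "trans_map c d z \<in> cimg d (fst c \<inter> W)" "cinv d (trans_map c d z) = cinv c z"
  using cimgD[OF assms(1,3)] cinv_coord[OF assms(2)] by auto

lemma trans_map_deriv:
  assumes "c \<in> A" "d \<in> A" "z \<in> cimg c (fst d)"
  shows "(trans_map c d has_derivative vec_deriv (trans_map c d) z) (at z)"
    "frechet_derivative (trans_map c d) (at z) = vec_deriv (trans_map c d) z"
    "vec_deriv (trans_map c d) z (k *s v) = k *s vec_deriv (trans_map c d) z v"
proof -
  note H = holo_on_vec[of "trans_map c d", OF trans_map_holo[OF assms(1,2)] assms(3)]
  show "(trans_map c d has_derivative vec_deriv (trans_map c d) z) (at z)"
    "frechet_derivative (trans_map c d) (at z) = vec_deriv (trans_map c d) z"
    "vec_deriv (trans_map c d) z (k *s v) = k *s vec_deriv (trans_map c d) z v"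
    by (rule H(1) H(3) H(2))+
qed

lemma trans_map_smooth: "c \<in> A \<Longrightarrow> d \<in> A \<Longrightarrow> smooth_on (cimg c (fst d)) (\<lambda>z. trans_map c d z $ i)"
  by (intro holo_on_imp_smooth_on open_cimg chart_open trans_map_holo)

subsection \<open>Holomorphic and smooth functions\<close>

lemma holo_fun_iff: "holo_fun A W h \<longleftrightarrow> (\<forall>c\<in>A. holo_on (\<lambda>z. h (cinv c z)) (cimg c W))"
  unfolding holo_fun_def by (simp add: case_prod_unfold)

lemma holo_funD: "holo_fun A W h \<Longrightarrow> c \<in> A \<Longrightarrow> holo_on (\<lambda>z. h (cinv c z)) (cimg c W)"
  by (simp add: holo_fun_iff)

definition smooth_fun :: "'a set \<Rightarrow> ('a \<Rightarrow> complex) \<Rightarrow> bool" where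
  "smooth_fun W h \<longleftrightarrow> (\<forall>c\<in>A. smooth_on (cimg c W) (\<lambda>z. h (cinv c z)))"

lemma holo_fun_imp_smooth_fun: "open W \<Longrightarrow> holo_fun A W h \<Longrightarrow> smooth_fun W h"
  unfolding smooth_fun_def by (intro ballI holo_on_imp_smooth_on open_cimg holo_funD)

lemma holo_fun_const: "holo_fun A W (\<lambda>x. k)"
  and holo_fun_mult: "holo_fun A W f \<Longrightarrow> holo_fun A W g \<Longrightarrow> holo_fun A W (\<lambda>x. f x * g x)"
  unfolding holo_fun_iff by (simp_all add: holo_on_const holo_on_mult)

lemma holo_fun_sum: "(\<And>i. i \<in> I \<Longrightarrow> holo_fun A W (f i)) \<Longrightarrow> holo_fun A W (\<lambda>x. \<Sum>i\<in>I. f i x)"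
  unfolding holo_fun_iff by (simp add: holo_on_sum)

lemma holo_fun_subset: "holo_fun A W f \<Longrightarrow> V \<subseteq> W \<Longrightarrow> holo_fun A V f"
proof (unfold holo_fun_iff, rule ballI)
  fix c assume *: "\<forall>c\<in>A. holo_on (\<lambda>z. f (cinv c z)) (cimg c W)" "V \<subseteq> W" "c \<in> A"
  have "cimg c V \<subseteq> cimg c W" using *(2) by blast
  then show "holo_on (\<lambda>z. f (cinv c z)) (cimg c V)" by (rule holo_on_subset[OF bspec[OF *(1,3)]])
qed

lemma holo_fun_cong:
  assumes "open W" "\<And>x. x \<in> W \<Longrightarrow> f x = g x" "holo_fun A W f"
  shows "holo_fun A W g"
  unfolding holo_fun_iff
proof
  fix c assume c: "c \<in> A"
  show "holo_on (\<lambda>z. g (cinv c z)) (cimg c W)"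
    by (rule holo_on_cong[OF open_cimg[OF c assms(1)] _ holo_funD[OF assms(3) c]])
      (rule assms(2), rule cimgD(2)[OF c])
qed

lemma holo_fun_locally:
  assumes "\<And>x. x \<in> W \<Longrightarrow> \<exists>V. x \<in> V \<and> holo_fun A V f"
  shows "holo_fun A W f"
  unfolding holo_fun_iff
proof
  fix c assume c: "c \<in> A"
  show "holo_on (\<lambda>z. f (cinv c z)) (cimg c W)"
  proof (rule holo_on_locally)
    fix z assume z: "z \<in> cimg c W"
    obtain V where "cinv c z \<in> V" "holo_fun A V f" using assms[OF cimgD(2)[OF c z]] by blast
    then have "z \<in> cimg c V" "holo_on (\<lambda>z. f (cinv c z)) (cimg c V)"
      using cimg_iff[OF c z, of V] holo_funD[OF _ c, of V f] by simp_all
    then show "\<exists>T. z \<in> T \<and> holo_on (\<lambda>z. f (cinv c z)) T" by (intro exI conjI)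
  qed
qed

text \<open>Composition with the transition map carries holomorphy in one chart that contains
  \<open>W\<close> over to every other chart.\<close>

lemma holo_fun_chart:
  assumes "c \<in> A" "W \<subseteq> fst c" "holo_on (\<lambda>z. h (cinv c z)) (snd c ` W)"
  shows "holo_fun A W h"
  unfolding holo_fun_iff
proof
  fix d assume d: "d \<in> A"
  have sub: "cimg d W \<subseteq> cimg d (fst c)" using assms(2) by blast
  have in_c: "trans_map d c z \<in> snd c ` W" if "z \<in> cimg d W" for z
    using cimgD(2)[OF d that] by simp
  have holo: "holo_on (\<lambda>z. h (cinv c (trans_map d c z))) (cimg d W)"
    by (rule holo_on_compose[where T = "snd c ` W" and F = "trans_map d c" and f = "\<lambda>z. h (cinv c z)",
          OF holo_on_subset[OF trans_map_holo[OF d assms(1)] sub] assms(3) in_c])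
  show "holo_on (\<lambda>z. h (cinv d z)) (cimg d W)"
    unfolding holo_on_def
  proof
    fix z assume z: "z \<in> cimg d W"
    then have zc: "z \<in> cimg d (fst c)" using sub by blast
    have eq: "h (cinv c (trans_map d c y)) = h (cinv d y)" if "y \<in> cimg d (fst c)" for y
      using trans_mapD(2)[OF d assms(1), of y UNIV] that by simp
    obtain f' where f': "((\<lambda>z. h (cinv c (trans_map d c z))) has_derivative f') (at z)" "\<forall>c v. f' (c *s v) = c * f' v"
      using bspec[OF holo[unfolded holo_on_def] z] by blast
    have "((\<lambda>z. h (cinv d z)) has_derivative f') (at z)"
      by (rule has_derivative_transform_within_open[OF f'(1) open_cimg[OF d chart_open[OF assms(1)]] zc eq])
    then show "\<exists>f'. ((\<lambda>z. h (cinv d z)) has_derivative f') (at z) \<and> (\<forall>c v. f' (c *s v) = c * f' v)"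
      using f'(2) by (intro exI conjI)
  qed
qed

lemma smooth_fun_mult: "open W \<Longrightarrow> smooth_fun W f \<Longrightarrow> smooth_fun W g \<Longrightarrow> smooth_fun W (\<lambda>x. f x * g x)"
  unfolding smooth_fun_def by (intro ballI smooth_on_mult open_cimg) simp_all

lemma smooth_fun_diff: "open W \<Longrightarrow> smooth_fun W f \<Longrightarrow> smooth_fun W g \<Longrightarrow> smooth_fun W (\<lambda>x. f x - g x)"
  unfolding smooth_fun_def by (intro ballI smooth_on_diff open_cimg) simp_all

lemma smooth_fun_const: "smooth_fun W (\<lambda>x. k)"
  unfolding smooth_fun_def by (simp add: smooth_on_const)

lemma smooth_fun_prod: "open W \<Longrightarrow> (\<And>i. i \<in> I \<Longrightarrow> smooth_fun W (f i)) \<Longrightarrow> smooth_fun W (\<lambda>x. \<Prod>i\<in>I. f i x)"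
  unfolding smooth_fun_def by (intro ballI smooth_on_prod open_cimg) simp_all

subsection \<open>Forms\<close>

text \<open>The conditions are restated for ring elements at each point, with the componentwise
  derivative of the transition map, for which the calculus of pullbacks is available.\<close>

lemma forms_iff:
  "\<omega> \<in> forms A W \<longleftrightarrow>
    (\<forall>c\<in>A. smooth_field (cimg c W) (at_pt \<omega> c) \<and> (\<forall>z\<in>cimg c W. tensor_at (at_pt \<omega> c z))) \<and>
    (\<forall>c\<in>A. \<forall>d\<in>A. \<forall>z\<in>cimg c (fst d \<inter> W). at_pt \<omega> c z = pull (vec_deriv (trans_map c d) z) (at_pt \<omega> d (trans_map c d z)))"
proof -
  have 1: "smooth_field S (at_pt \<omega> c) \<longleftrightarrow> (\<forall>vs. smooth_on S (\<lambda>z. \<omega> c z vs))" for c S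
    by (simp add: smooth_field_def)
  have 2: "at_pt \<omega> c z = pull (vec_deriv (trans_map c d) z) (at_pt \<omega> d (trans_map c d z)) \<longleftrightarrow>
      (\<forall>vs. \<omega> c z vs = \<omega> d (trans_map c d z) (map (frechet_derivative (trans_map c d) (at z)) vs))"
    if "c \<in> A" "d \<in> A" "z \<in> cimg c (fst d \<inter> W)" for c d z
  proof -
    have "z \<in> cimg c (fst d)" using that(3) by blast
    note D = trans_map_deriv(2)[OF that(1,2) this]
    show ?thesis unfolding D by (simp add: at_pt_def pull_def fun_eq_iff)
  qed
  show ?thesis
    unfolding forms_def mem_Collect_eq case_prod_unfold prod.collapse tensor_at_iff 1 app_at_pt Int_assoc
    by (intro arg_cong2[where f = "(\<and>)"] ball_cong refl) (simp only: 2)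
qed

lemma formsD:
  assumes "\<omega> \<in> forms A W"
  shows "c \<in> A \<Longrightarrow> smooth_field (cimg c W) (at_pt \<omega> c)"
    "c \<in> A \<Longrightarrow> z \<in> cimg c W \<Longrightarrow> tensor_at (at_pt \<omega> c z)"
    "c \<in> A \<Longrightarrow> d \<in> A \<Longrightarrow> z \<in> cimg c (fst d \<inter> W) \<Longrightarrow>
      at_pt \<omega> c z = pull (vec_deriv (trans_map c d) z) (at_pt \<omega> d (trans_map c d z))"
  using assms unfolding forms_iff by blast+

lemma formsI:
  assumes "\<And>c. c \<in> A \<Longrightarrow> smooth_field (cimg c W) (at_pt \<omega> c)"
    "\<And>c z. c \<in> A \<Longrightarrow> z \<in> cimg c W \<Longrightarrow> tensor_at (at_pt \<omega> c z)"
    "\<And>c d z. c \<in> A \<Longrightarrow> d \<in> A \<Longrightarrow> z \<in> cimg c (fst d \<inter> W) \<Longrightarrow>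
      at_pt \<omega> c z = pull (vec_deriv (trans_map c d) z) (at_pt \<omega> d (trans_map c d z))"
  shows "\<omega> \<in> forms A W"
  using assms unfolding forms_iff by blast

lemma form_eq_iff: "form_eq A W \<omega> \<eta> \<longleftrightarrow> (\<forall>c\<in>A. \<forall>z\<in>cimg c W. at_pt \<omega> c z = at_pt \<eta> c z)"
  unfolding form_eq_def by (auto simp: case_prod_unfold at_pt_def fun_eq_iff)

definition form_of :: "('a chart \<Rightarrow> complex ^ 2 \<Rightarrow> (complex ^ 2) ext) \<Rightarrow> 'a form" where
  "form_of E = (\<lambda>c z vs. app (E c z) vs)"

lemma at_pt_form_of [simp]: "at_pt (form_of E) c z = E c z"
  by (simp add: at_pt_def form_of_def)

lemma form_eqI': "(\<And>c z. at_pt \<omega> c z = at_pt \<eta> c z) \<Longrightarrow> \<omega> = \<eta>"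
  by (simp add: at_pt_def fun_eq_iff)

abbreviation fadd :: "'a form \<Rightarrow> 'a form \<Rightarrow> 'a form" where
  "fadd \<alpha> \<beta> \<equiv> (\<lambda>c z vs. \<alpha> c z vs + \<beta> c z vs)"

abbreviation fzero :: "'a form" where "fzero \<equiv> (\<lambda>c z vs. 0)"

lemma at_pt_fadd: "at_pt (fadd \<alpha> \<beta>) c z = at_pt \<alpha> c z + at_pt \<beta> c z"
  by (rule ext_eqI) simp

lemma at_pt_fzero: "at_pt fzero c z = 0"
  by (rule ext_eqI) simp

lemma at_pt_fun: "at_pt (wedge \<alpha> \<beta>) c = (\<lambda>z. at_pt \<alpha> c z * at_pt \<beta> c z)"
  "at_pt (fadd \<alpha> \<beta>) c = (\<lambda>z. at_pt \<alpha> c z + at_pt \<beta> c z)" "at_pt (form_of E) c = E c"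
  by (auto simp: at_pt_wedge at_pt_fadd)

lemma forms_add:
  assumes "open W" "\<alpha> \<in> forms A W" "\<beta> \<in> forms A W"
  shows "fadd \<alpha> \<beta> \<in> forms A W"
proof (rule formsI)
  show "smooth_field (cimg c W) (at_pt (fadd \<alpha> \<beta>) c)" if "c \<in> A" for c
    unfolding at_pt_fun by (intro smooth_field_simps open_cimg formsD(1)[OF assms(2)] formsD(1)[OF assms(3)] assms(1) that)
  show "tensor_at (at_pt (fadd \<alpha> \<beta>) c z)" if "c \<in> A" "z \<in> cimg c W" for c z
    unfolding at_pt_fun by (intro tensor_at_simps formsD(2)[OF assms(2)] formsD(2)[OF assms(3)] that)
  show "at_pt (fadd \<alpha> \<beta>) c z = pull (vec_deriv (trans_map c d) z) (at_pt (fadd \<alpha> \<beta>) d (trans_map c d z))"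
    if "c \<in> A" "d \<in> A" "z \<in> cimg c (fst d \<inter> W)" for c d z
    unfolding at_pt_fun by (simp only: formsD(3)[OF assms(2) that] formsD(3)[OF assms(3) that] pull_simps)
qed

lemma forms_wedge:
  assumes "open W" "\<alpha> \<in> forms A W" "\<beta> \<in> forms A W"
  shows "wedge \<alpha> \<beta> \<in> forms A W"
proof (rule formsI)
  show "smooth_field (cimg c W) (at_pt (wedge \<alpha> \<beta>) c)" if "c \<in> A" for c
    unfolding at_pt_fun by (intro smooth_field_mult open_cimg formsD(1)[OF assms(2)] formsD(1)[OF assms(3)] assms(1) that)
  show "tensor_at (at_pt (wedge \<alpha> \<beta>) c z)" if "c \<in> A" "z \<in> cimg c W" for c z
    unfolding at_pt_fun by (intro tensor_at_simps formsD(2)[OF assms(2)] formsD(2)[OF assms(3)] that)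
  show "at_pt (wedge \<alpha> \<beta>) c z = pull (vec_deriv (trans_map c d) z) (at_pt (wedge \<alpha> \<beta>) d (trans_map c d z))"
    if "c \<in> A" "d \<in> A" "z \<in> cimg c (fst d \<inter> W)" for c d z
    unfolding at_pt_fun by (simp only: formsD(3)[OF assms(2) that] formsD(3)[OF assms(3) that] pull_simps)
qed

lemma forms_minus:
  assumes "open W" "\<alpha> \<in> forms A W"
  shows "form_of (\<lambda>c z. - at_pt \<alpha> c z) \<in> forms A W"
proof (rule formsI)
  show "smooth_field (cimg c W) (at_pt (form_of (\<lambda>c z. - at_pt \<alpha> c z)) c)" if "c \<in> A" for c
    unfolding at_pt_fun by (intro smooth_field_simps open_cimg formsD(1)[OF assms(2)] assms(1) that)
  show "tensor_at (at_pt (form_of (\<lambda>c z. - at_pt \<alpha> c z)) c z)" if "c \<in> A" "z \<in> cimg c W" for c z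
    unfolding at_pt_fun by (intro tensor_at_simps formsD(2)[OF assms(2)] that)
  show "at_pt (form_of (\<lambda>c z. - at_pt \<alpha> c z)) c z = pull (vec_deriv (trans_map c d) z) (at_pt (form_of (\<lambda>c z. - at_pt \<alpha> c z)) d (trans_map c d z))"
    if "c \<in> A" "d \<in> A" "z \<in> cimg c (fst d \<inter> W)" for c d z
    unfolding at_pt_fun by (simp only: formsD(3)[OF assms(2) that] pull_simps)
qed

lemma forms_grade:
  assumes "open W" "\<alpha> \<in> forms A W"
  shows "form_of (\<lambda>c z. grade (at_pt \<alpha> c z)) \<in> forms A W"
proof (rule formsI)
  show "smooth_field (cimg c W) (at_pt (form_of (\<lambda>c z. grade (at_pt \<alpha> c z))) c)" if "c \<in> A" for c
    unfolding at_pt_fun by (intro smooth_field_simps open_cimg formsD(1)[OF assms(2)] assms(1) that)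
  show "tensor_at (at_pt (form_of (\<lambda>c z. grade (at_pt \<alpha> c z))) c z)" if "c \<in> A" "z \<in> cimg c W" for c z
    unfolding at_pt_fun by (intro tensor_at_simps formsD(2)[OF assms(2)] that)
  show "at_pt (form_of (\<lambda>c z. grade (at_pt \<alpha> c z))) c z = pull (vec_deriv (trans_map c d) z) (at_pt (form_of (\<lambda>c z. grade (at_pt \<alpha> c z))) d (trans_map c d z))"
    if "c \<in> A" "d \<in> A" "z \<in> cimg c (fst d \<inter> W)" for c d z
    unfolding at_pt_fun by (simp only: formsD(3)[OF assms(2) that] pull_simps)
qed

lemma forms_zero: "fzero \<in> forms A W"
  by (rule formsI) (simp_all add: at_pt_fzero pull_simps tensor_at_simps smooth_field_def smooth_on_const)

lemma forms_unit: "unit_form \<in> forms A W"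
  by (rule formsI) (simp_all add: at_pt_unit_form pull_simps one_ext_def tensor_at_simps smooth_field_def smooth_on_const)

subsection \<open>The ring of closed forms and the ideal of exact forms\<close>

definition closed_form :: "'a form \<Rightarrow> bool" where
  "closed_form \<omega> \<longleftrightarrow> (\<forall>c\<in>A. \<forall>z\<in>cimg c UNIV. dext (at_pt \<omega> c) z = 0)"

lemma closed_forms_simps:
  "carrier (closed_forms A) = {\<omega> \<in> forms A UNIV. closed_form \<omega>}"
  "monoid.mult (closed_forms A) = wedge" "one (closed_forms A) = unit_form"
  "zero (closed_forms A) = fzero" "add (closed_forms A) = fadd"
  by (simp_all add: closed_forms_def form_eq_iff closed_form_def at_pt_ext_deriv at_pt_fzero)

lemma exact_forms_iff:
  "\<omega> \<in> exact_forms A \<longleftrightarrow> \<omega> \<in> forms A UNIV \<and> (\<exists>\<tau>\<in>forms A UNIV. \<forall>c\<in>A. \<forall>z\<in>cimg c UNIV. at_pt \<omega> c z = dext (at_pt \<tau> c) z)"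
  by (auto simp: exact_forms_def form_eq_iff at_pt_ext_deriv)

lemma forms_diff_at: "\<omega> \<in> forms A W \<Longrightarrow> c \<in> A \<Longrightarrow> z \<in> cimg c W \<Longrightarrow> diff_at (at_pt \<omega> c) z"
  using smooth_field_diff_at formsD(1) by blast

lemma closed_form_wedge:
  "\<alpha> \<in> forms A UNIV \<Longrightarrow> \<beta> \<in> forms A UNIV \<Longrightarrow> closed_form \<alpha> \<Longrightarrow> closed_form \<beta> \<Longrightarrow> closed_form (wedge \<alpha> \<beta>)"
  unfolding closed_form_def at_pt_fun by (simp add: dext_mult forms_diff_at[where W = UNIV])

lemma closed_form_fadd:
  "\<alpha> \<in> forms A UNIV \<Longrightarrow> \<beta> \<in> forms A UNIV \<Longrightarrow> closed_form \<alpha> \<Longrightarrow> closed_form \<beta> \<Longrightarrow> closed_form (fadd \<alpha> \<beta>)"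
  unfolding closed_form_def at_pt_fun by (simp add: dext_add forms_diff_at[where W = UNIV])

lemma closed_form_minus:
  "\<alpha> \<in> forms A UNIV \<Longrightarrow> closed_form \<alpha> \<Longrightarrow> closed_form (form_of (\<lambda>c z. - at_pt \<alpha> c z))"
  unfolding closed_form_def at_pt_fun by (simp add: dext_minus forms_diff_at[where W = UNIV])

lemma ring_closed_forms: "ring (closed_forms A)"
proof (rule ringI)
  have c0: "closed_form fzero"
    unfolding closed_form_def by (simp add: dext_def at_pt_def zero_ext_def)
  show "abelian_group (closed_forms A)"
  proof (rule abelian_groupI; unfold closed_forms_simps)
    show "\<exists>y\<in>{\<omega> \<in> forms A UNIV. closed_form \<omega>}. fadd y x = fzero" if "x \<in> {\<omega> \<in> forms A UNIV. closed_form \<omega>}" for x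
      by (rule bexI[of _ "form_of (\<lambda>c z. - at_pt x c z)"], rule form_eqI')
        (use that in \<open>simp_all add: at_pt_fadd at_pt_fzero forms_minus closed_form_minus\<close>)
  qed (simp_all add: forms_add closed_form_fadd forms_zero c0 add_ac)
  have c1: "closed_form unit_form"
    unfolding closed_form_def by (auto intro!: ext_eqI simp: dext_def at_pt_unit_form)
  show "monoid (closed_forms A)"
    by (rule monoidI; unfold closed_forms_simps)
      (auto simp: forms_wedge closed_form_wedge forms_unit c1 at_pt_wedge at_pt_unit_form mult.assoc intro!: form_eqI')
qed (auto intro!: form_eqI' simp: closed_forms_simps at_pt_wedge at_pt_fadd algebra_simps)

lemma exact_forms_closed: "\<omega> \<in> exact_forms A \<Longrightarrow> closed_form \<omega>"
  unfolding closed_form_def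
proof (intro ballI)
  fix c z assume \<omega>: "\<omega> \<in> exact_forms A" and c: "c \<in> A" and z: "z \<in> cimg c UNIV"
  then obtain \<tau> where \<tau>: "\<tau> \<in> forms A UNIV" "\<And>z. z \<in> cimg c UNIV \<Longrightarrow> at_pt \<omega> c z = dext (at_pt \<tau> c) z"
    unfolding exact_forms_iff by blast
  have o: "open (cimg c UNIV)" by (rule open_cimg[OF c open_UNIV])
  have "dext (at_pt \<omega> c) z = dext (dext (at_pt \<tau> c)) z" by (rule dext_cong[OF o z \<tau>(2)])
  also have "\<dots> = 0" by (rule dext_dext[OF o z formsD(1)[OF \<tau>(1) c]])
  finally show "dext (at_pt \<omega> c) z = 0" .
qed

lemma exact_formsI:
  "\<omega> \<in> forms A UNIV \<Longrightarrow> \<tau> \<in> forms A UNIV \<Longrightarrow> (\<And>c z. c \<in> A \<Longrightarrow> z \<in> cimg c UNIV \<Longrightarrow> at_pt \<omega> c z = dext (at_pt \<tau> c) z)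
     \<Longrightarrow> \<omega> \<in> exact_forms A"
  unfolding exact_forms_iff by blast

lemma ideal_exact_forms: "ideal (exact_forms A) (closed_forms A)"
proof (rule idealI[OF ring_closed_forms])
  interpret R: ring "closed_forms A" by (rule ring_closed_forms)
  have neg: "form_of (\<lambda>c z. - at_pt \<omega> c z) \<in> exact_forms A" if \<omega>: "\<omega> \<in> exact_forms A" for \<omega>
  proof -
    obtain \<tau> where \<tau>: "\<tau> \<in> forms A UNIV" "\<forall>c\<in>A. \<forall>z\<in>cimg c UNIV. at_pt \<omega> c z = dext (at_pt \<tau> c) z"
      and f: "\<omega> \<in> forms A UNIV" using \<omega> unfolding exact_forms_iff by blast
    show ?thesis
      by (rule exact_formsI[OF forms_minus[OF open_UNIV f] forms_minus[OF open_UNIV \<tau>(1)]])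
        (simp only: at_pt_fun \<tau>(2) dext_minus[OF forms_diff_at[OF \<tau>(1)]])
  qed
  show "subgroup (exact_forms A) (add_monoid (closed_forms A))"
  proof (rule group.subgroupI)
    show "Group.group (add_monoid (closed_forms A))" by (rule R.a_group)
    show "exact_forms A \<subseteq> carrier (add_monoid (closed_forms A))"
      using exact_forms_closed by (auto simp: closed_forms_simps exact_forms_iff)
    have "fzero \<in> exact_forms A"
      by (rule exact_formsI[OF forms_zero forms_zero]) (simp add: at_pt_def dext_def zero_ext_def)
    then show "exact_forms A \<noteq> {}" by blast
    show "inv\<^bsub>add_monoid (closed_forms A)\<^esub> \<omega> \<in> exact_forms A" if \<omega>: "\<omega> \<in> exact_forms A" for \<omega>
    proof -
      have "\<ominus>\<^bsub>closed_forms A\<^esub> \<omega> = form_of (\<lambda>c z. - at_pt \<omega> c z)"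
      proof (rule R.minus_equality)
        show "\<omega> \<in> carrier (closed_forms A)" "form_of (\<lambda>c z. - at_pt \<omega> c z) \<in> carrier (closed_forms A)"
          using \<omega> neg[OF \<omega>] exact_forms_closed by (auto simp: closed_forms_simps exact_forms_iff)
        show "form_of (\<lambda>c z. - at_pt \<omega> c z) \<oplus>\<^bsub>closed_forms A\<^esub> \<omega> = \<zero>\<^bsub>closed_forms A\<^esub>"
          unfolding closed_forms_simps by (rule form_eqI') (simp add: at_pt_fadd at_pt_fzero)
      qed
      then show ?thesis using neg[OF \<omega>] by (simp add: a_inv_def)
    qed
    show "\<omega> \<otimes>\<^bsub>add_monoid (closed_forms A)\<^esub> \<omega>' \<in> exact_forms A" if \<omega>: "\<omega> \<in> exact_forms A" "\<omega>' \<in> exact_forms A" for \<omega> \<omega>'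
    proof -
      obtain \<tau> where \<tau>: "\<tau> \<in> forms A UNIV" "\<forall>c\<in>A. \<forall>z\<in>cimg c UNIV. at_pt \<omega> c z = dext (at_pt \<tau> c) z"
        and f: "\<omega> \<in> forms A UNIV" using \<omega> unfolding exact_forms_iff by blast
      obtain \<tau>' where \<tau>': "\<tau>' \<in> forms A UNIV" "\<forall>c\<in>A. \<forall>z\<in>cimg c UNIV. at_pt \<omega>' c z = dext (at_pt \<tau>' c) z"
        and f': "\<omega>' \<in> forms A UNIV" using \<omega> unfolding exact_forms_iff by blast
      show ?thesis unfolding monoid.simps partial_object.simps closed_forms_simps
        by (rule exact_formsI[OF forms_add[OF open_UNIV f f'] forms_add[OF open_UNIV \<tau>(1) \<tau>'(1)]])
          (simp only: at_pt_fun \<tau>(2) \<tau>'(2) dext_add[OF forms_diff_at[OF \<tau>(1)] forms_diff_at[OF \<tau>'(1)]])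
    qed
  qed
  fix \<omega> \<alpha> assume \<omega>: "\<omega> \<in> exact_forms A" and "\<alpha> \<in> carrier (closed_forms A)"
  then have \<alpha>: "\<alpha> \<in> forms A UNIV" "\<And>c z. c \<in> A \<Longrightarrow> z \<in> cimg c UNIV \<Longrightarrow> dext (at_pt \<alpha> c) z = 0"
    unfolding closed_forms_simps closed_form_def by blast+
  obtain \<tau> where \<tau>: "\<tau> \<in> forms A UNIV" "\<forall>c\<in>A. \<forall>z\<in>cimg c UNIV. at_pt \<omega> c z = dext (at_pt \<tau> c) z"
    and f: "\<omega> \<in> forms A UNIV" using \<omega> unfolding exact_forms_iff by blast
  \<comment> \<open>The grading involution compensates the sign of the Leibniz rule: for closed
    \<alpha> the product of \<open>grade \<alpha>\<close> with a primitive \<open>\<tau>\<close> has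
    derivative \<alpha> d\<tau>.\<close>
  note g\<alpha> = forms_grade[OF open_UNIV \<alpha>(1)]
  show "\<alpha> \<otimes>\<^bsub>closed_forms A\<^esub> \<omega> \<in> exact_forms A"
    unfolding closed_forms_simps
  proof (rule exact_formsI[OF forms_wedge[OF open_UNIV \<alpha>(1) f] forms_wedge[OF open_UNIV g\<alpha> \<tau>(1)]])
    fix c z assume cz: "c \<in> A" "z \<in> cimg c UNIV"
    note da = forms_diff_at[OF \<alpha>(1) cz] and dt = forms_diff_at[OF \<tau>(1) cz]
    have "dext (\<lambda>z. grade (at_pt \<alpha> c z) * at_pt \<tau> c z) z = dext (\<lambda>z. grade (at_pt \<alpha> c z)) z * at_pt \<tau> c z + grade (grade (at_pt \<alpha> c z)) * dext (at_pt \<tau> c) z"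
      by (rule dext_mult[OF diff_at_simps(5)[OF da] dt])
    also have "dext (\<lambda>z. grade (at_pt \<alpha> c z)) z = 0" by (simp add: dext_grade[OF da] \<alpha>(2)[OF cz])
    finally show "at_pt (wedge \<alpha> \<omega>) c z = dext (at_pt (wedge (form_of (\<lambda>c z. grade (at_pt \<alpha> c z))) \<tau>) c) z"
      using \<tau>(2)[rule_format, OF cz] by (simp add: at_pt_fun)
  qed
  show "\<omega> \<otimes>\<^bsub>closed_forms A\<^esub> \<alpha> \<in> exact_forms A"
    unfolding closed_forms_simps
  proof (rule exact_formsI[OF forms_wedge[OF open_UNIV f \<alpha>(1)] forms_wedge[OF open_UNIV \<tau>(1) \<alpha>(1)]])
    fix c z assume cz: "c \<in> A" "z \<in> cimg c UNIV"
    note da = forms_diff_at[OF \<alpha>(1) cz] and dt = forms_diff_at[OF \<tau>(1) cz]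
    show "at_pt (wedge \<omega> \<alpha>) c z = dext (at_pt (wedge \<tau> \<alpha>) c) z"
      using \<tau>(2)[rule_format, OF cz] by (simp add: at_pt_fun dext_mult[OF dt da] \<alpha>(2)[OF cz])
  qed
qed

abbreviation coset_of :: "'a form \<Rightarrow> 'a form set" where
  "coset_of \<eta> \<equiv> exact_forms A +>\<^bsub>closed_forms A\<^esub> \<eta>"

lemma ring_hom_coset: "ring_hom_ring (closed_forms A) (deRham A) coset_of"
  unfolding deRham_def by (rule ideal.rcos_ring_hom_ring[OF ideal_exact_forms])

lemma coset_of_iff: "\<omega> \<in> coset_of \<eta> \<longleftrightarrow> (\<exists>h\<in>exact_forms A. \<omega> = fadd h \<eta>)"
  by (simp add: a_r_coset_def' closed_forms_simps)

text \<open>Forms are compared only at points of charts, whereas cosets are sets of total functions.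
  Exactness is itself tested only in charts, so the ideal absorbs differences at all other
  arguments.\<close>

lemma coset_eqI:
  assumes "\<eta> \<in> forms A UNIV" "\<eta>' \<in> forms A UNIV" "\<tau> \<in> forms A UNIV"
    "\<And>c z. c \<in> A \<Longrightarrow> z \<in> cimg c UNIV \<Longrightarrow> at_pt \<eta>' c z - at_pt \<eta> c z = dext (at_pt \<tau> c) z"
  shows "coset_of \<eta> = coset_of \<eta>'"
proof -
  have *: "coset_of \<eta>1 \<subseteq> coset_of \<eta>2"
    if f: "\<eta>1 \<in> forms A UNIV" "\<eta>2 \<in> forms A UNIV" "\<tau> \<in> forms A UNIV"
      and d: "\<And>c z. c \<in> A \<Longrightarrow> z \<in> cimg c UNIV \<Longrightarrow> at_pt \<eta>2 c z - at_pt \<eta>1 c z = dext (at_pt \<tau> c) z" for \<eta>1 \<eta>2 \<tau>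
  proof
    fix \<omega> assume "\<omega> \<in> coset_of \<eta>1"
    then obtain h where h: "h \<in> exact_forms A" "\<omega> = fadd h \<eta>1"
      unfolding coset_of_iff by (elim bexE) (rule that)
    obtain \<sigma> where \<sigma>: "\<sigma> \<in> forms A UNIV" "\<And>c z. c \<in> A \<Longrightarrow> z \<in> cimg c UNIV \<Longrightarrow> at_pt h c z = dext (at_pt \<sigma> c) z" "h \<in> forms A UNIV"
      using h(1) unfolding exact_forms_iff by blast
    \<comment> \<open>The literal difference, so that the equation for \<open>\<omega>\<close> holds
      at all arguments and not only in charts.\<close>
    define h' where "h' = fadd h (fadd \<eta>1 (form_of (\<lambda>c z. - at_pt \<eta>2 c z)))"
    define \<sigma>' where "\<sigma>' = fadd \<sigma> (form_of (\<lambda>c z. - at_pt \<tau> c z))"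
    have "h' \<in> exact_forms A"
    proof (rule exact_formsI)
      show "h' \<in> forms A UNIV" "\<sigma>' \<in> forms A UNIV" unfolding h'_def \<sigma>'_def
        by (intro forms_add forms_minus open_UNIV \<sigma> f)+
      fix c z assume cz: "c \<in> A" "z \<in> cimg c UNIV"
      have "dext (at_pt \<sigma>' c) z = dext (at_pt \<sigma> c) z + (- dext (at_pt \<tau> c) z)"
        unfolding \<sigma>'_def at_pt_fun
        by (subst dext_add[OF forms_diff_at[OF \<sigma>(1) cz] diff_at_simps(3)[OF forms_diff_at[OF f(3) cz]]])
          (simp add: dext_minus[OF forms_diff_at[OF f(3) cz]])
      then show "at_pt h' c z = dext (at_pt \<sigma>' c) z"
        by (simp add: h'_def at_pt_fadd \<sigma>(2)[OF cz] d[OF cz, symmetric])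
    qed
    moreover have "\<omega> = fadd h' \<eta>2"
      by (rule form_eqI') (simp add: h(2) h'_def at_pt_fadd)
    ultimately show "\<omega> \<in> coset_of \<eta>2"
      unfolding coset_of_iff by (intro bexI[of _ h'])
  qed
  have "at_pt \<eta> c z - at_pt \<eta>' c z = dext (at_pt (form_of (\<lambda>c z. - at_pt \<tau> c z)) c) z" if "c \<in> A" "z \<in> cimg c UNIV" for c z
  proof -
    have "at_pt \<eta> c z - at_pt \<eta>' c z = - (at_pt \<eta>' c z - at_pt \<eta> c z)" by simp
    then show ?thesis unfolding assms(4)[OF that] by (simp add: at_pt_fun dext_minus[OF forms_diff_at[OF assms(3) that]])
  qed
  then show ?thesis
    by (intro equalityI *[OF assms] *[OF assms(2,1) forms_minus[OF open_UNIV assms(3)]])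
qed

lemma finsum_closed_forms:
  "finite I \<Longrightarrow> (\<And>i. i \<in> I \<Longrightarrow> \<eta> i \<in> carrier (closed_forms A)) \<Longrightarrow>
     at_pt (finsum (closed_forms A) \<eta> I) c z = (\<Sum>i\<in>I. at_pt (\<eta> i) c z)"
proof (induction I rule: finite_induct)
  interpret R: ring "closed_forms A" by (rule ring_closed_forms)
  case empty
  then show ?case by (simp add: closed_forms_simps at_pt_fzero)
next
  interpret R: ring "closed_forms A" by (rule ring_closed_forms)
  case (insert i I)
  have "finsum (closed_forms A) \<eta> (insert i I) = \<eta> i \<oplus>\<^bsub>closed_forms A\<^esub> finsum (closed_forms A) \<eta> I"
    using insert by (intro R.finsum_insert) auto
  then show ?case using insert by (simp add: closed_forms_simps(5) at_pt_fadd)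
qed

end

context surface
begin

section \<open>Partitions of unity\<close>

lemma bump_at:
  obtains c b K W where "c \<in> A" "smooth_fun UNIV b" "closed K" "K \<subseteq> fst c" "\<And>y. y \<notin> K \<Longrightarrow> b y = 0"
    "open W" "x \<in> W" "\<And>y. y \<in> W \<Longrightarrow> b y = 1"
proof -
  obtain c where c: "c \<in> A" "x \<in> fst c" by (rule chart_at)
  define z0 where "z0 = snd c x"
  have z0: "z0 \<in> snd c ` fst c" using c(2) by (simp add: z0_def)
  obtain e where e: "e > 0" "ball z0 e \<subseteq> snd c ` fst c"
    by (rule openE[OF chart_img_open[OF c(1)] z0])
  \<comment> \<open>The closed ball of radius \<open>2 * d\<close> will contain the support and
    still has to lie in the open ball of radius \<open>e\<close>.\<close>
  define d where "d = e / 3"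
  have d: "d > 0" "cball z0 (2 * d) \<subseteq> snd c ` fst c" using e by (auto simp: d_def intro!: set_mp[OF e(2)])
  obtain B where B: "smooth_on UNIV B" "\<And>z. dist z z0 \<le> d \<Longrightarrow> B z = 1" "\<And>z. dist z z0 \<ge> 2 * d \<Longrightarrow> B z = 0"
    by (rule smooth_on_bump[OF d(1), where a = z0]) (rule that; assumption)
  define b where "b y = (if y \<in> fst c then B (snd c y) else 0)" for y
  define W where "W = fst c \<inter> snd c -` ball z0 d"
  define K where "K = cinv c ` cball z0 (2 * d)"
  \<comment> \<open>Compact sets are closed in a Hausdorff space; the complement of \<open>K\<close>
    is therefore open, and the extension of the bump by 0 is smooth there.\<close>
  have "compact K" unfolding K_def
    by (rule compact_continuous_image[OF continuous_on_subset[OF continuous_on_cinv[OF c(1)] d(2)] compact_cball])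
  then have K: "closed K" by (rule compact_imp_closed)
  have Kc: "K \<subseteq> fst c"
  proof
    fix y assume "y \<in> K"
    then obtain z where z: "z \<in> cball z0 (2 * d)" "y = cinv c z" unfolding K_def by blast
    then have "z \<in> cimg c UNIV" using d(2) by auto
    from cimgD(1)[OF c(1) this] show "y \<in> fst c" by (simp only: z(2))
  qed
  have zero: "b y = 0" if "y \<notin> K" for y
  proof (cases "y \<in> fst c")
    case True
    have "snd c y \<notin> cball z0 (2 * d)"
      using that cinv_coord[OF c(1) True] unfolding K_def by (metis image_eqI)
    then show ?thesis using True by (simp add: b_def B(3) dist_commute)
  qed (simp add: b_def)
  have "smooth_fun UNIV b"
    unfolding smooth_fun_def
  proof
    fix c' assume c': "c' \<in> A"
    show "smooth_on (cimg c' UNIV) (\<lambda>z. b (cinv c' z))"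
    proof (rule smooth_on_locally)
      fix z assume z: "z \<in> cimg c' UNIV"
      show "\<exists>T. z \<in> T \<and> smooth_on T (\<lambda>z. b (cinv c' z))"
      proof (cases "cinv c' z \<in> fst c")
        case True
        have op: "open (cimg c' (fst c))" by (rule open_cimg[OF c' chart_open[OF c(1)]])
        have "smooth_on (cimg c' (fst c)) (\<lambda>z. B (trans_map c' c z))"
          by (rule smooth_on_compose[where F = "trans_map c' c", OF op open_UNIV UNIV_I B(1) trans_map_smooth[OF c' c(1)]])
        then have "smooth_on (cimg c' (fst c)) (\<lambda>z. b (cinv c' z))"
          by (rule smooth_on_cong[OF op, rotated]) (simp add: b_def cimgD(2)[OF c'])
        then show ?thesis using cimg_iff[OF c' z, of "fst c"] True by (intro exI[of _ "cimg c' (fst c)"] conjI) simp_all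
      next
        case False
        then have "cinv c' z \<in> - K" using Kc by blast
        moreover have "smooth_on (cimg c' (- K)) (\<lambda>z. b (cinv c' z))"
          by (rule smooth_on_cong[OF open_cimg[OF c' open_Compl[OF K]] _ smooth_on_const[of _ 0]])
            (simp add: zero[OF cimgD(2)[OF c', of _ "- K", unfolded Compl_iff]])
        ultimately show ?thesis using cimg_iff[OF c' z, of "- K"] by (intro exI[of _ "cimg c' (- K)"] conjI) simp_all
      qed
    qed
  qed
  moreover have "open W" unfolding W_def
    by (rule continuous_open_preimage[OF continuous_on_coord[OF c(1)] chart_open[OF c(1)] open_ball])
  moreover have "x \<in> W" using c(2) d(1) by (simp add: W_def z0_def)
  moreover have "b y = 1" if "y \<in> W" for y
    using that by (simp add: W_def b_def B(2) dist_commute)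
  ultimately show thesis using c(1) K Kc zero by (intro that[of c b K W])
qed

text \<open>Second countability reduces the cover by the sets \<open>W\<close> to a countable one,
  and each member chooses its own chart and bump.\<close>

lemma bump_cover:
  obtains C b K W where "\<And>n::nat. C n \<in> A" "\<And>n. smooth_fun UNIV (b n)" "\<And>n. closed (K n)" "\<And>n. K n \<subseteq> fst (C n)"
    "\<And>n y. y \<notin> K n \<Longrightarrow> b n y = 0" "\<And>n. open (W n)" "(\<Union>n. W n) = UNIV" "\<And>n y. y \<in> W n \<Longrightarrow> b n y = 1"
proof -
  define good where "good W t \<longleftrightarrow> (case t of (c, b, K) \<Rightarrow> c \<in> A \<and> smooth_fun UNIV b \<and> closed K \<and> K \<subseteq> fst c \<and> (\<forall>y. y \<notin> K \<longrightarrow> b y = 0) \<and> (\<forall>y\<in>W. b y = 1))"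
    for W and t :: "'a chart \<times> ('a \<Rightarrow> complex) \<times> 'a set"
  define \<F> where "\<F> = {W. open W \<and> (\<exists>t. good W t)}"
  have "\<exists>W\<in>\<F>. x \<in> W" for x
  proof -
    obtain c b K W where *: "c \<in> A" "smooth_fun UNIV b" "closed K" "K \<subseteq> fst c" "\<And>y. y \<notin> K \<Longrightarrow> b y = 0"
      "open W" "x \<in> W" "\<And>y. y \<in> W \<Longrightarrow> b y = 1" by (rule bump_at[of x]) (rule that; assumption)
    then have "good W (c, b, K)" by (simp add: good_def)
    then have "W \<in> \<F>" using *(6) unfolding \<F>_def by blast
    then show ?thesis using *(7) by blast
  qed
  then have U: "\<Union>\<F> = UNIV" by blast
  obtain \<F>' where F': "\<F>' \<subseteq> \<F>" "countable \<F>'" "\<Union>\<F>' = \<Union>\<F>"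
    by (rule Lindelof[of \<F>]) (auto simp: \<F>_def)
  have ne: "\<F>' \<noteq> {}" using F'(3) U by auto
  \<comment> \<open>Members are repeated if the subcover is finite; the partition of unity built
    from the sequence tolerates repetitions.\<close>
  define W where "W = from_nat_into \<F>'"
  have W: "W n \<in> \<F>" for n using from_nat_into[OF ne] F'(1) by (auto simp: W_def)
  have rW: "range W = \<F>'" unfolding W_def by (rule range_from_nat_into[OF ne F'(2)])
  define t where "t n = (SOME t. good (W n) t)" for n
  have "\<exists>t. good (W n) t" for n using W[of n] by (simp add: \<F>_def)
  then have t: "good (W n) (t n)" for n unfolding t_def by (rule someI_ex)
  have g: "fst (t n) \<in> A \<and> smooth_fun UNIV (fst (snd (t n))) \<and> closed (snd (snd (t n))) \<and> snd (snd (t n)) \<subseteq> fst (fst (t n))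
    \<and> (\<forall>y. y \<notin> snd (snd (t n)) \<longrightarrow> fst (snd (t n)) y = 0) \<and> (\<forall>y\<in>W n. fst (snd (t n)) y = 1)" for n
    using t[of n] by (simp add: good_def case_prod_unfold)
  show thesis
  proof (rule that[of "\<lambda>n. fst (t n)" "\<lambda>n. fst (snd (t n))" "\<lambda>n. snd (snd (t n))" W])
    show "open (W n)" for n using W[of n] by (simp add: \<F>_def)
    show "(\<Union>n. W n) = UNIV" using rW F'(3) U by simp
  qed (use g in simp_all)
qed

end

text \<open>A partition of unity in which the sums are finite for a trivial reason: \<open>\<rho>\<^sub>n = b\<^sub>n \<Prod>\<^sub>m\<^sub><\<^sub>n (1 - b\<^sub>m)\<close>
  for bump functions \<open>b\<^sub>n\<close> that are \<open>1\<close> on the sets \<open>W\<^sub>n\<close> of a cover.\<close>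

locale surface_partition = surface +
  fixes C :: "nat \<Rightarrow> 'a::{t2_space,second_countable_topology} chart" and \<rho> :: "nat \<Rightarrow> 'a \<Rightarrow> complex" and K W :: "nat \<Rightarrow> 'a set"
  assumes C: "C n \<in> A" and rho_smooth: "smooth_fun UNIV (\<rho> n)" and K_closed: "closed (K n)" and K_sub: "K n \<subseteq> fst (C n)"
    and rho_zero: "y \<notin> K n \<Longrightarrow> \<rho> n y = 0" and W_open: "open (W n)" and W_cover: "(\<Union>n. W n) = UNIV"
    and rho_tail: "y \<in> W n \<Longrightarrow> m > n \<Longrightarrow> \<rho> m y = 0" and rho_sum: "y \<in> W n \<Longrightarrow> (\<Sum>m\<le>n. \<rho> m y) = 1"

lemma (in surface) partition_exists: "\<exists>C \<rho> K W. surface_partition A C \<rho> K W"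
proof -
  obtain C b K W where *: "\<And>n::nat. C n \<in> A" "\<And>n. smooth_fun UNIV (b n)" "\<And>n. closed (K n)" "\<And>n. K n \<subseteq> fst (C n)"
    "\<And>n y. y \<notin> K n \<Longrightarrow> b n y = 0" "\<And>n. open (W n)" "(\<Union>n. W n) = UNIV" "\<And>n y. y \<in> W n \<Longrightarrow> b n y = 1"
    by (rule bump_cover) (rule that; assumption)
  define \<rho> where "\<rho> n y = b n y * (\<Prod>m<n. 1 - b m y)" for n y
  \<comment> \<open>Telescoping: each \<open>\<rho> n y\<close> is a difference of two consecutive
    products.\<close>
  have sum: "(\<Sum>m\<le>n. \<rho> m y) = 1 - (\<Prod>m\<le>n. 1 - b m y)" for n y
    by (induction n) (simp_all add: \<rho>_def lessThan_Suc_atMost algebra_simps)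
  have "surface_partition A C \<rho> K W"
  proof
    show "smooth_fun UNIV (\<rho> n)" for n unfolding \<rho>_def
      by (intro smooth_fun_mult smooth_fun_prod smooth_fun_diff smooth_fun_const *(2) open_UNIV)
    show "\<rho> m y = 0" if "y \<in> W n" "m > n" for y n m
    proof -
      have "(\<Prod>m<m. 1 - b m y) = 0" using that *(8)[OF that(1)] by (intro prod_zero) auto
      then show ?thesis by (simp add: \<rho>_def)
    qed
    show "(\<Sum>m\<le>n. \<rho> m y) = 1" if "y \<in> W n" for y n
    proof -
      have "(\<Prod>m\<le>n. 1 - b m y) = 0" using *(8)[OF that] by (intro prod_zero) auto
      then show ?thesis by (simp add: sum)
    qed
  qed (use * in \<open>simp_all add: \<rho>_def\<close>)
  then show ?thesis by (intro exI)
qed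

section \<open>Local frames\<close>

context surface
begin

lemma local_frame_open: "local_frame A F r V e \<Longrightarrow> open V"
  by (simp add: local_frame_def)

definition comb :: "nat \<Rightarrow> ('a, 't) frame \<Rightarrow> 'a set \<Rightarrow> (nat \<Rightarrow> 'a \<Rightarrow> complex) \<Rightarrow> 'a \<Rightarrow> 't \<Rightarrow> complex" where
  "comb r e W h = (\<lambda>x t. if x \<in> W then \<Sum>i<r. h i x * e i x t else 0)"

lemma local_frame_bij:
  "local_frame A F r V e \<Longrightarrow> open W \<Longrightarrow> W \<subseteq> V \<Longrightarrow> bij_betw (comb r e W) (free_sections A r W) (F W)"
  by (simp add: local_frame_def comb_def[abs_def])

text \<open>Only normalised coefficients belong to \<open>free_sections\<close>. The truncation
  makes the frame bijection applicable to arbitrary ones and leaves their combination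
  unchanged.\<close>

definition cut :: "nat \<Rightarrow> 'a set \<Rightarrow> (nat \<Rightarrow> 'a \<Rightarrow> complex) \<Rightarrow> nat \<Rightarrow> 'a \<Rightarrow> complex" where
  "cut r W h = (\<lambda>i x. if i < r \<and> x \<in> W then h i x else 0)"

lemma cut_free_section:
  assumes "open W" "\<And>i. i < r \<Longrightarrow> holo_fun A W (h i)"
  shows "cut r W h \<in> free_sections A r W"
proof -
  have "holo_fun A W (cut r W h i)" if "i < r" for i
    by (rule holo_fun_cong[OF assms(1) _ assms(2)[OF that]]) (simp add: cut_def that)
  then show ?thesis by (simp add: free_sections_def cut_def)
qed

lemma comb_cut: "comb r e W (cut r W h) = comb r e W h"
  by (simp add: comb_def cut_def fun_eq_iff)

lemma frame_comb_in:
  assumes "local_frame A F r V e" "open W" "W \<subseteq> V" "\<And>i. i < r \<Longrightarrow> holo_fun A W (h i)"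
  shows "comb r e W h \<in> F W"
  using bij_betw_apply[OF local_frame_bij[OF assms(1-3)] cut_free_section[where h = h and r = r, OF assms(2,4)]] by (simp add: comb_cut)

lemma frame_expand:
  assumes "local_frame A F r V e" "open W" "W \<subseteq> V" "s \<in> F W"
  obtains h where "\<And>i. i < r \<Longrightarrow> holo_fun A W (h i)" "s = comb r e W h"
proof -
  have "s \<in> comb r e W ` free_sections A r W" using bij_betw_imp_surj_on[OF local_frame_bij[OF assms(1-3)]] assms(4) by simp
  then obtain h where "h \<in> free_sections A r W" "s = comb r e W h" by blast
  then show thesis by (intro that[of h]) (simp_all add: free_sections_def)
qed

lemma frame_unique:
  assumes "local_frame A F r V e" "open W" "W \<subseteq> V"
    and a: "\<And>i. i < r \<Longrightarrow> holo_fun A W (a i)" and b: "\<And>i. i < r \<Longrightarrow> holo_fun A W (b i)"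
    and eq: "\<And>x t. x \<in> W \<Longrightarrow> (\<Sum>i<r. a i x * e i x t) = (\<Sum>i<r. b i x * e i x t)"
    and "i < r" "x \<in> W"
  shows "a i x = b i x"
proof -
  have "comb r e W (cut r W a) = comb r e W (cut r W b)"
    unfolding comb_cut by (simp add: comb_def fun_eq_iff eq)
  then have "cut r W a = cut r W b"
    using bij_betw_imp_inj_on[OF local_frame_bij[OF assms(1-3)]] cut_free_section[OF assms(2), of r a] cut_free_section[OF assms(2), of r b] a b
    by (auto simp: inj_on_eq_iff)
  then have "cut r W a i x = cut r W b i x" by simp
  then show ?thesis using assms(7,8) by (simp add: cut_def)
qed

text \<open>The two ranks are kept apart, so that uniqueness of the rank can be derived from frame
  changes as well.\<close>

definition changes :: "nat \<Rightarrow> 'a set \<Rightarrow> ('a, 't) frame \<Rightarrow> nat \<Rightarrow> 'a set \<Rightarrow> ('a, 't) frame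
    \<Rightarrow> ('a \<Rightarrow> complex) mat \<Rightarrow> bool" where
  "changes r V e r' V' e' g \<longleftrightarrow> (\<forall>i<r. \<forall>j<r'. holo_fun A (V \<inter> V') (g i j)) \<and>
     (\<forall>x\<in>V \<inter> V'. \<forall>j<r'. \<forall>t. e' j x t = (\<Sum>i<r. g i j x * e i x t))"

lemma frame_change:
  assumes "local_frame A F r V e" "local_frame A F r' V' e'"
  shows "\<exists>g. changes r V e r' V' e' g"
proof -
  let ?W = "V \<inter> V'"
  have W: "open ?W" "?W \<subseteq> V" "?W \<subseteq> V'" using local_frame_open[OF assms(1)] local_frame_open[OF assms(2)] by auto
  have "\<exists>h. (\<forall>i<r. holo_fun A ?W (h i)) \<and> (\<forall>x\<in>?W. \<forall>t. e' j x t = (\<Sum>i<r. h i x * e i x t))" if j: "j < r'" for j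
  proof -
    \<comment> \<open>The \<open>j\<close>-th frame element as a section over the intersection: a
      combination with coefficients 0 and 1.\<close>
    have "comb r' e' ?W (\<lambda>i x. if i = j then 1 else 0) \<in> F ?W"
      by (rule frame_comb_in[OF assms(2) W(1,3)]) (rule holo_fun_const)
    then obtain h where h: "\<And>i. i < r \<Longrightarrow> holo_fun A ?W (h i)" "comb r' e' ?W (\<lambda>i x. if i = j then 1 else 0) = comb r e ?W h"
      by (rule frame_expand[OF assms(1) W(1,2)]) (rule that; assumption)
    have "e' j x t = (\<Sum>i<r. h i x * e i x t)" if x: "x \<in> ?W" for x t
    proof -
      have "(\<Sum>i<r'. (if i = j then 1 else 0) * e' i x t) = e' j x t" using j by (simp add: if_distribR sum.delta if_distrib[of "\<lambda>y. y * _"] cong: if_cong)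
      then show ?thesis using fun_cong[OF fun_cong[OF h(2)], of x t] x by (simp add: comb_def)
    qed
    then show ?thesis using h(1) by (intro exI[of _ h]) simp
  qed
  then have "\<exists>H. \<forall>j<r'. (\<forall>i<r. holo_fun A ?W (H j i)) \<and> (\<forall>x\<in>?W. \<forall>t. e' j x t = (\<Sum>i<r. H j i x * e i x t))"
    by (intro choice[of "\<lambda>j h. j < r' \<longrightarrow> (\<forall>i<r. holo_fun A ?W (h i)) \<and> (\<forall>x\<in>?W. \<forall>t. e' j x t = (\<Sum>i<r. h i x * e i x t))"] allI) simp
  then obtain H where "\<forall>j<r'. (\<forall>i<r. holo_fun A ?W (H j i)) \<and> (\<forall>x\<in>?W. \<forall>t. e' j x t = (\<Sum>i<r. H j i x * e i x t))" by (elim exE)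
  then show ?thesis unfolding changes_def by (intro exI[of _ "\<lambda>i j. H j i"]) simp
qed

lemma changes_compose_eq:
  assumes "changes r V e r' V' e' g" "changes r' V' e' r'' V'' e'' g'" "x \<in> V" "x \<in> V'" "x \<in> V''" "j < r''"
  shows "e'' j x t = (\<Sum>i<r. (\<Sum>l<r'. g i l x * g' l j x) * e i x t)"
proof -
  have "e'' j x t = (\<Sum>l<r'. g' l j x * (\<Sum>i<r. g i l x * e i x t))"
    using assms by (simp add: changes_def)
  also have "\<dots> = (\<Sum>l<r'. \<Sum>i<r. g i l x * g' l j x * e i x t)" by (simp add: sum_distrib_left mult_ac)
  also have "\<dots> = (\<Sum>i<r. \<Sum>l<r'. g i l x * g' l j x * e i x t)" by (rule sum.swap)
  finally show ?thesis by (simp add: sum_distrib_right)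
qed

text \<open>Both sides are coefficients of \<open>e''\<close> in the frame \<open>e\<close>, and
  these are unique.\<close>

lemma changes_compose:
  assumes e: "local_frame A F r V e" and "local_frame A F r' V' e'" "local_frame A F r'' V'' e''"
    and g: "changes r V e r' V' e' g" and g': "changes r' V' e' r'' V'' e'' g'" and g'': "changes r V e r'' V'' e'' g''"
    and x: "x \<in> V" "x \<in> V'" "x \<in> V''" and "i < r" "j < r''"
  shows "(\<Sum>l<r'. g i l x * g' l j x) = g'' i j x"
proof -
  let ?W = "V \<inter> V' \<inter> V''"
  have W: "open ?W" "?W \<subseteq> V" using local_frame_open[OF assms(1)] local_frame_open[OF assms(2)] local_frame_open[OF assms(3)] by auto
  have s: "?W \<subseteq> V \<inter> V'" "?W \<subseteq> V' \<inter> V''" "?W \<subseteq> V \<inter> V''" by blast+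
  show ?thesis
  proof (rule frame_unique[OF e W, where a = "\<lambda>i x. \<Sum>l<r'. g i l x * g' l j x" and b = "\<lambda>i. g'' i j"])
    show "holo_fun A ?W (\<lambda>x. \<Sum>l<r'. g i l x * g' l j x)" if "i < r" for i
      using g g' that \<open>j < r''\<close> unfolding changes_def
      by (intro holo_fun_sum holo_fun_mult holo_fun_subset[OF _ s(1)] holo_fun_subset[OF _ s(2)]) simp_all
    show "holo_fun A ?W (g'' i j)" if "i < r" for i
      using g'' that \<open>j < r''\<close> unfolding changes_def by (intro holo_fun_subset[OF _ s(3)]) simp
    show "(\<Sum>i<r. (\<Sum>l<r'. g i l x * g' l j x) * e i x t) = (\<Sum>i<r. g'' i j x * e i x t)" if "x \<in> ?W" for x t
      using changes_compose_eq[OF g g', of x j t] g'' that \<open>j < r''\<close> by (simp add: changes_def)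
  qed (use x \<open>i < r\<close> in simp_all)
qed

lemma changes_refl: "changes r V e r V e (\<lambda>i j x. if i = j then 1 else 0)"
  unfolding changes_def by (simp add: holo_fun_const if_distrib[of "\<lambda>y. y * _"] cong: if_cong)

lemma changes_inverse:
  assumes "local_frame A F r V e" "local_frame A F r' V' e'" "changes r V e r' V' e' g" "changes r' V' e' r V e h"
    "x \<in> V" "x \<in> V'" "i < r" "j < r"
  shows "(\<Sum>l<r'. g i l x * h l j x) = (if i = j then 1 else 0)"
  by (rule changes_compose[OF assms(1,2,1,3,4) changes_refl assms(5,6,5,7,8)])

text \<open>The traces of \<open>g h\<close> and \<open>h g\<close> agree, and they are the two
  ranks as complex numbers.\<close>

lemma rank_unique:
  assumes e: "local_frame A F r V e" and e': "local_frame A F r' V' e'" and x: "x \<in> V" "x \<in> V'"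
  shows "r = r'"
proof -
  obtain g h where gh: "changes r V e r' V' e' g" "changes r' V' e' r V e h"
    using frame_change[OF e e'] frame_change[OF e' e] by (elim exE)
  have "of_nat r = (\<Sum>i<r. \<Sum>l<r'. g i l x * h l i x)"
    using changes_inverse[OF e e' gh x] by simp
  also have "\<dots> = (\<Sum>l<r'. \<Sum>i<r. h l i x * g i l x)" by (subst sum.swap) (simp add: mult.commute)
  also have "\<dots> = of_nat r'"
    using changes_inverse[OF e' e gh(2,1) x(2,1)] by simp
  finally show ?thesis by (simp only: of_nat_eq_iff)
qed

lemma sheaf_rank_eq:
  assumes "\<And>x. \<exists>V e. x \<in> V \<and> local_frame A F r V e"
  shows "sheaf_rank A F = r"
  unfolding sheaf_rank_def
proof (rule the_equality)
  show "\<forall>x. \<exists>V e. x \<in> V \<and> local_frame A F r V e" using assms by simp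
  fix r' assume r': "\<forall>x. \<exists>V e. x \<in> V \<and> local_frame A F r' V e"
  \<comment> \<open>Every type is inhabited, so there is some point at which the two ranks can be
    compared.\<close>
  obtain V e where e: "undefined \<in> V" "local_frame A F r V e" using assms[of undefined] by (elim exE conjE)
  obtain V' e' where e': "undefined \<in> V'" "local_frame A F r' V' e'" using r'[rule_format, of undefined] by (elim exE conjE)
  show "r' = r" by (rule rank_unique[OF e'(2) e(2) e'(1) e(1)])
qed

end

section \<open>One-forms\<close>

definition one_form :: "(complex ^ 2) set \<Rightarrow> (complex ^ 2 \<Rightarrow> (complex ^ 2) ext) \<Rightarrow> bool" where
  "one_form S a \<longleftrightarrow> smooth_field S a \<and> (\<forall>y\<in>S. tensor_at (a y) \<and> (\<forall>vs. length vs \<noteq> 1 \<longrightarrow> app (a y) vs = 0))"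

lemma one_formD:
  assumes "one_form S a"
  shows "smooth_field S a" "y \<in> S \<Longrightarrow> tensor_at (a y)" "y \<in> S \<Longrightarrow> length vs \<noteq> 1 \<Longrightarrow> app (a y) vs = 0"
    "y \<in> S \<Longrightarrow> linear (\<lambda>v. app (a y) [v])" "smooth_on S (\<lambda>y. app (a y) vs)"
proof -
  show "smooth_field S a" "y \<in> S \<Longrightarrow> length vs \<noteq> 1 \<Longrightarrow> app (a y) vs = 0" "smooth_on S (\<lambda>y. app (a y) vs)"
    using assms by (simp_all add: one_form_def smooth_field_def)
  show t: "tensor_at (a y)" if "y \<in> S" using assms that by (simp add: one_form_def)
  show "linear (\<lambda>v. app (a y) [v])" if "y \<in> S"
    using t[OF that, unfolded tensor_at_def multilin_def, THEN conjunct2, rule_format, of "[]" "[]"] by simp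
qed

lemma one_form_grade: "one_form S a \<Longrightarrow> y \<in> S \<Longrightarrow> grade (a y) = - a y"
proof (rule ext_eqI)
  fix vs assume "one_form S a" "y \<in> S"
  then show "app (grade (a y)) vs = app (- a y) vs"
    using one_formD(3)[of S a y vs] by (cases "length vs = 1") auto
qed

lemma app_dext_two: "app (dext a z) [u, v] = dir_deriv (\<lambda>y. app (a y) [v]) u z - dir_deriv (\<lambda>y. app (a y) [u]) v z"
  by (simp add: app_dext_Cons app_dext_Nil app_ddir)

lemma app_dext_one_form_zero:
  assumes "open S" "one_form S a" "z \<in> S" "length vs \<noteq> 2"
  shows "app (dext a z) vs = 0"
proof -
  have "dir_deriv (\<lambda>y. app (a y) (nths vs (- {i}))) w z = 0" if "i < length vs" for i w
  proof -
    have "{j. j < length vs \<and> j \<in> - {i}} = {..<length vs} - {i}" by auto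
    then have "length (nths vs (- {i})) \<noteq> 1" using that assms(4) by (simp add: length_nths)
    then have "frechet_derivative (\<lambda>y. app (a y) (nths vs (- {i}))) (at z) = frechet_derivative (\<lambda>y. 0) (at z)"
      by (intro frechet_derivative_cong_open[OF assms(1,3)] one_formD(3)[OF assms(2)])
    then show ?thesis by simp
  qed
  then show ?thesis by (simp add: dext_def)
qed

text \<open>The derivative of a one-form lives on lists of length two, where alternation and
  bilinearity can be read off from the two-term formula. Connection matrices have only such
  entries.\<close>

lemma tensor_at_dext:
  assumes "open S" "one_form S a" "z \<in> S"
  shows "tensor_at (dext a z)"
  unfolding tensor_at_def
proof
  note zero = app_dext_one_form_zero[OF assms]
  note d = smooth_on_differentiable[OF one_formD(5)[OF assms(2)] assms(3)]
  show "skew (dext a z)"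
  proof (rule skewI)
    fix xs u v ys
    show "app (dext a z) (xs @ u # v # ys) = - app (dext a z) (xs @ v # u # ys)"
    proof (cases "xs = [] \<and> ys = []")
      case True then show ?thesis by (simp add: app_dext_two)
    next
      case False
      then have "length (xs @ u # v # ys) \<noteq> 2" "length (xs @ v # u # ys) \<noteq> 2" by auto
      from zero[OF this(1)] zero[OF this(2)] show ?thesis by simp
    qed
  qed
  have l1: "linear (\<lambda>u. dir_deriv (\<lambda>y. app (a y) [w]) u z)" for w
    by (rule linear_frechet_derivative[OF d])
  have l2: "linear (\<lambda>w. dir_deriv (\<lambda>y. app (a y) [w]) u z)" for u
  proof (rule linearI)
    fix v w :: "complex ^ 2" and r :: real
    have "frechet_derivative (\<lambda>y. app (a y) [v + w]) (at z) = frechet_derivative (\<lambda>y. app (a y) [v] + app (a y) [w]) (at z)"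
      by (rule frechet_derivative_cong_open[OF assms(1,3)]) (rule linear_add[OF one_formD(4)[OF assms(2)]])
    then show "dir_deriv (\<lambda>y. app (a y) [v + w]) u z = dir_deriv (\<lambda>y. app (a y) [v]) u z + dir_deriv (\<lambda>y. app (a y) [w]) u z"
      by (simp add: dir_deriv_add[OF d d])
    have "frechet_derivative (\<lambda>y. app (a y) [r *\<^sub>R v]) (at z) = frechet_derivative (\<lambda>y. of_real r * app (a y) [v]) (at z)"
      by (rule frechet_derivative_cong_open[OF assms(1,3)], subst linear_cmul[OF one_formD(4)[OF assms(2)]], assumption, rule scaleR_conv_of_real)
    then show "dir_deriv (\<lambda>y. app (a y) [r *\<^sub>R v]) u z = r *\<^sub>R dir_deriv (\<lambda>y. app (a y) [v]) u z"
      by (simp add: dir_deriv_cmult[OF d] scaleR_conv_of_real[of r "dir_deriv (\<lambda>y. app (a y) [v]) u z"])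
  qed
  show "multilin (dext a z)"
    unfolding multilin_def
  proof (intro allI)
    fix xs ys :: "(complex ^ 2) list"
    consider w where "xs = []" "ys = [w]" | w where "xs = [w]" "ys = []" | "length xs + length ys \<noteq> 1"
      by (cases xs; cases ys; cases "tl xs"; cases "tl ys") auto
    then show "linear (\<lambda>v. app (dext a z) (xs @ v # ys))"
    proof cases
      case 1 then show ?thesis using l1[of w] l2[of w] by (simp add: app_dext_two linear_compose_sub)
    next
      case 2 then show ?thesis using l1[of w] l2[of w] by (simp add: app_dext_two linear_compose_sub)
    next
      case 3
      then have "app (dext a z) (xs @ v # ys) = 0" for v by (intro zero) simp
      then show ?thesis by (simp add: linear_zero)
    qed
  qed
qed

text \<open>The second derivatives of \<open>F\<close> enter the derivative of the pulled-back form
  through the term \<open>H u v\<close> of the proof, which is symmetric and so drops out of the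
  alternating expression.\<close>

lemma dext_pull_one_form:
  assumes S: "open S" and T: "open T" and a: "one_form T a" and F: "\<And>i. holo_on (\<lambda>z. F z $ i) S"
    and ST: "\<And>y. y \<in> S \<Longrightarrow> F y \<in> T" and a': "\<And>y. y \<in> S \<Longrightarrow> a' y = pull (vec_deriv F y) (a (F y))"
    and one': "one_form S a'" and z: "z \<in> S"
  shows "dext a' z = pull (vec_deriv F z) (dext a (F z))"
proof (rule ext_eqI)
  fix vs
  \<comment> \<open>Both the form and its argument \<open>vec_deriv F y v\<close> vary with the
    point. Expansion along fixed directions separates them, so that the product rule
    applies.\<close>
  have expand: "app (a w) [x] = (\<Sum>i\<in>UNIV. of_real (Re (x $ i)) * app (a w) [axis i 1] + of_real (Im (x $ i)) * app (a w) [axis i \<i>])"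
    if "w \<in> T" for w x
  proof -
    note lin = one_formD(4)[OF a that]
    have "app (a w) [x] = app (a w) [\<Sum>i\<in>UNIV. Re (x $ i) *\<^sub>R axis i 1 + Im (x $ i) *\<^sub>R axis i \<i>]"
      by (simp flip: vec2_expand)
    also have "\<dots> = (\<Sum>i\<in>UNIV. app (a w) [Re (x $ i) *\<^sub>R axis i 1 + Im (x $ i) *\<^sub>R axis i \<i>])"
      by (rule linear_sum[OF lin])
    finally show ?thesis by (simp add: linear_add[OF lin] linear_cmul[OF lin] scaleR_conv_of_real[where 'a = complex])
  qed
  have Fz: "F z \<in> T" by (rule ST[OF z])
  have da: "(\<lambda>w. app (a w) ws) differentiable at (F z)" for ws
    by (rule smooth_on_differentiable[OF one_formD(5)[OF a] Fz])
  have hF: "((\<lambda>y. app (a (F y)) ws) has_derivative (\<lambda>u. dir_deriv (\<lambda>w. app (a w) ws) (vec_deriv F z u) (F z))) (at z)" for ws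
    by (rule has_derivative_compose[OF holo_on_vec(1)[of F, OF F z] frechet_derivative_works'[OF da]])
  have dF: "(\<lambda>y. app (a (F y)) ws) differentiable at z"
    "dir_deriv (\<lambda>y. app (a (F y)) ws) u z = dir_deriv (\<lambda>w. app (a w) ws) (vec_deriv F z u) (F z)" for ws u
    using hF[of ws] by (auto simp: differentiable_def frechet_derivative_eqI[OF hF])
  have sF: "smooth_on S (\<lambda>y. F y $ i)" for i by (rule holo_on_imp_smooth_on[OF S F])
  have sD: "dir_deriv (\<lambda>y. F y $ i) v differentiable at z" for i v
    by (rule smooth_on_differentiable[OF smooth_on_dir_deriv[OF sF] z])
  have RI: "(\<lambda>y. complex_of_real (L (vec_deriv F y v $ i))) differentiable at z"
    "dir_deriv (\<lambda>y. complex_of_real (L (vec_deriv F y v $ i))) u z = of_real (L (dir_deriv (dir_deriv (\<lambda>y. F y $ i) v) u z))"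
    if "bounded_linear L" for L v i u
  proof -
    have "bounded_linear (\<lambda>x. complex_of_real (L x))"
      by (rule bounded_linear_compose[OF bounded_linear_of_real that])
    from bounded_linear.has_derivative[OF this frechet_derivative_works'[OF sD[of i v]]]
    have *: "((\<lambda>y. complex_of_real (L (vec_deriv F y v $ i))) has_derivative (\<lambda>u. complex_of_real (L (dir_deriv (dir_deriv (\<lambda>y. F y $ i) v) u z)))) (at z)"
      by (simp add: vec_deriv_def)
    then show "(\<lambda>y. complex_of_real (L (vec_deriv F y v $ i))) differentiable at z"
      "dir_deriv (\<lambda>y. complex_of_real (L (vec_deriv F y v $ i))) u z = of_real (L (dir_deriv (dir_deriv (\<lambda>y. F y $ i) v) u z))"
      by (auto simp: differentiable_def frechet_derivative_eqI[OF *])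
  qed
  note RI = RI[OF bounded_linear_Re] RI[OF bounded_linear_Im]
  define H where "H u v = (\<Sum>i\<in>UNIV. of_real (Re (dir_deriv (dir_deriv (\<lambda>y. F y $ i) v) u z)) * app (a (F z)) [axis i 1]
      + of_real (Im (dir_deriv (dir_deriv (\<lambda>y. F y $ i) v) u z)) * app (a (F z)) [axis i \<i>])" for u v
  have Hsym: "H u v = H v u" for u v
    unfolding H_def by (simp only: dir_deriv_commute[OF S sF z, of _ u v])
  have main: "dir_deriv (\<lambda>y. app (a' y) [v]) u z = H u v + dir_deriv (\<lambda>w. app (a w) [vec_deriv F z v]) (vec_deriv F z u) (F z)" for u v
  proof -
    let ?f = "\<lambda>i y. of_real (Re (vec_deriv F y v $ i)) * app (a (F y)) [axis i 1] + of_real (Im (vec_deriv F y v $ i)) * app (a (F y)) [axis i \<i>]"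
    let ?g = "\<lambda>i w. of_real (Re (vec_deriv F z v $ i)) * app (a w) [axis i 1] + of_real (Im (vec_deriv F z v $ i)) * app (a w) [axis i \<i>]"
    let ?u = "vec_deriv F z u"
    have f: "dir_deriv (?f i) u z =
        of_real (Re (dir_deriv (dir_deriv (\<lambda>y. F y $ i) v) u z)) * app (a (F z)) [axis i 1]
        + of_real (Re (vec_deriv F z v $ i)) * dir_deriv (\<lambda>w. app (a w) [axis i 1]) ?u (F z)
        + (of_real (Im (dir_deriv (dir_deriv (\<lambda>y. F y $ i) v) u z)) * app (a (F z)) [axis i \<i>]
        + of_real (Im (vec_deriv F z v $ i)) * dir_deriv (\<lambda>w. app (a w) [axis i \<i>]) ?u (F z))" for i
      by (subst dir_deriv_add[OF differentiable_mult[OF RI(1) dF(1)] differentiable_mult[OF RI(3) dF(1)]])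
        (simp only: dir_deriv_mult[OF RI(1) dF(1)] dir_deriv_mult[OF RI(3) dF(1)] RI(2,4) dF(2))
    have g: "dir_deriv (?g i) ?u (F z) =
        of_real (Re (vec_deriv F z v $ i)) * dir_deriv (\<lambda>w. app (a w) [axis i 1]) ?u (F z)
        + of_real (Im (vec_deriv F z v $ i)) * dir_deriv (\<lambda>w. app (a w) [axis i \<i>]) ?u (F z)" for i
      by (subst dir_deriv_add[OF differentiable_mult[OF differentiable_const da] differentiable_mult[OF differentiable_const da]])
        (simp only: dir_deriv_cmult[OF da])
    have "frechet_derivative (\<lambda>y. app (a' y) [v]) (at z) = frechet_derivative (\<lambda>y. \<Sum>i\<in>UNIV. ?f i y) (at z)"
      by (rule frechet_derivative_cong_open[OF S z]) (simp only: a' app_pull list.map, rule expand[OF ST])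
    then have "dir_deriv (\<lambda>y. app (a' y) [v]) u z = dir_deriv (\<lambda>y. \<Sum>i\<in>UNIV. ?f i y) u z" by (rule fun_cong)
    also have "\<dots> = (\<Sum>i\<in>UNIV. dir_deriv (?f i) u z)"
      by (rule dir_deriv_sum) (intro differentiable_add differentiable_mult RI(1) RI(3) dF(1))
    finally have 1: "dir_deriv (\<lambda>y. app (a' y) [v]) u z = (\<Sum>i\<in>UNIV. dir_deriv (?f i) u z)" .
    have "frechet_derivative (\<lambda>w. app (a w) [vec_deriv F z v]) (at (F z)) = frechet_derivative (\<lambda>w. \<Sum>i\<in>UNIV. ?g i w) (at (F z))"
      by (rule frechet_derivative_cong_open[OF T Fz]) (rule expand)
    then have "dir_deriv (\<lambda>w. app (a w) [vec_deriv F z v]) ?u (F z) = dir_deriv (\<lambda>w. \<Sum>i\<in>UNIV. ?g i w) ?u (F z)" by (rule fun_cong)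
    also have "\<dots> = (\<Sum>i\<in>UNIV. dir_deriv (?g i) ?u (F z))"
      by (rule dir_deriv_sum) (intro differentiable_add differentiable_mult differentiable_const da)
    finally have 2: "dir_deriv (\<lambda>w. app (a w) [vec_deriv F z v]) ?u (F z) = (\<Sum>i\<in>UNIV. dir_deriv (?g i) ?u (F z))" .
    show ?thesis unfolding 1 2 f g H_def sum.distrib by simp
  qed
  show "app (dext a' z) vs = app (pull (vec_deriv F z) (dext a (F z))) vs"
  proof (cases "length vs = 2")
    case True
    then obtain u v where vs: "vs = [u, v]" by (cases vs; cases "tl vs") auto
    show ?thesis unfolding vs by (simp add: app_dext_two main Hsym[of u v])
  next
    case False
    then show ?thesis
      using app_dext_one_form_zero[OF S one' z False] app_dext_one_form_zero[OF T a Fz, of "map (vec_deriv F z) vs"] by simp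
  qed
qed

section \<open>Chern forms and transgression forms\<close>

definition chern_val :: "nat \<Rightarrow> nat \<Rightarrow> 'v ext mat \<Rightarrow> 'v ext" where
  "chern_val n r K = (if n = 1 then scal (\<i> / (2 * of_real pi)) * mtr r K
     else scal ((\<i> / (2 * of_real pi))\<^sup>2 / 2) * (mtr r K * mtr r K - mtr r (mmul r K K)))"

text \<open>A primitive for the change of \<open>chern_val\<close>. In degree two the squared trace
  changes by (tr K' - tr K) (tr K' + tr K), where the first factor is the derivative of tr \<alpha>
  and the second is closed; the remaining terms are the transgression of the trace of the
  square.\<close>

definition trans_val :: "nat \<Rightarrow> nat \<Rightarrow> 'v ext mat \<Rightarrow> 'v ext mat \<Rightarrow> 'v ext mat \<Rightarrow> 'v ext" where
  "trans_val n r \<alpha> K K' = (if n = 1 then scal (\<i> / (2 * of_real pi)) * mtr r \<alpha>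
     else scal ((\<i> / (2 * of_real pi))\<^sup>2 / 2) * (mtr r \<alpha> * (mtr r K + mtr r K')
       - (mtr r (mmul r \<alpha> (madd K K')) - scal (1 / 3) * mtr r (mmul r (mmul r \<alpha> \<alpha>) \<alpha>))))"

lemma dext_scal_const_mult:
  assumes "diff_at a z" shows "dext (\<lambda>y. scal k * a y) z = scal k * dext a z"
proof -
  have "dext (\<lambda>y. scal k) z = 0" by (rule ext_eqI) (simp add: dext_def)
  then show ?thesis using dext_mult[OF diff_at_scal[OF differentiable_const] assms, of k] by simp
qed

lemma grade_mtr: "grade (mtr r A) = mtr r (mgrade A)"
  by (simp add: mtr_def mgrade_def)

lemma dext_chern_val:
  assumes "open S" "smooth_mat S \<theta>" "odd_mat S \<theta>" "z \<in> S"
  shows "dext (\<lambda>y. chern_val n r (curv r \<theta> y)) z = 0"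
proof -
  note sK = smooth_mat_curv[OF assms(1,2), of r]
  have s1: "smooth_field S (\<lambda>y. mtr r (curv r \<theta> y))" by (rule smooth_field_mtr[OF assms(1) sK])
  have s2: "smooth_field S (\<lambda>y. mtr r (mmul r (curv r \<theta> y) (curv r \<theta> y)))"
    by (rule smooth_field_mtr[OF assms(1) smooth_mat_simps(3)[OF assms(1) sK sK]])
  note d1 = smooth_field_diff_at[OF s1 assms(4)] and d2 = smooth_field_diff_at[OF s2 assms(4)]
  note z1 = dext_mtr_curv[OF assms] and z2 = dext_mtr_curv_curv[OF assms]
  show ?thesis
  proof (cases "n = 1")
    case True
    then show ?thesis by (simp add: chern_val_def dext_scal_const_mult[OF d1] z1)
  next
    case False
    have "dext (\<lambda>y. mtr r (curv r \<theta> y) * mtr r (curv r \<theta> y) - mtr r (mmul r (curv r \<theta> y) (curv r \<theta> y))) z = 0"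
      by (simp add: dext_diff[OF diff_at_mult[OF d1 d1] d2] dext_mult[OF d1 d1] z1 z2)
    then show ?thesis using False
      by (simp add: chern_val_def dext_scal_const_mult[OF diff_at_simps(2)[OF diff_at_mult[OF d1 d1] d2]])
  qed
qed

lemma chern_val_diff:
  assumes "open S" "smooth_mat S \<theta>" "odd_mat S \<theta>" "smooth_mat S \<theta>'" "odd_mat S \<theta>'" "z \<in> S"
  shows "chern_val n r (curv r \<theta>' z) - chern_val n r (curv r \<theta> z)
    = dext (\<lambda>y. trans_val n r (msub (\<theta>' y) (\<theta> y)) (curv r \<theta> y) (curv r \<theta>' y)) z"
proof -
  let ?K = "curv r \<theta>" and ?K' = "curv r \<theta>'" and ?a = "\<lambda>y. msub (\<theta>' y) (\<theta> y)"
  note sK = smooth_mat_curv[OF assms(1,2), of r] smooth_mat_curv[OF assms(1,4), of r]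
  have sa: "smooth_mat S ?a" by (rule smooth_mat_simps(2)[OF assms(1,4,2)])
  define t1 where "t1 = (\<lambda>y. mtr r (?a y))"
  define p where "p = (\<lambda>y. mtr r (?K y) + mtr r (?K' y))"
  define t2 where "t2 = (\<lambda>y. mtr r (mmul r (?a y) (madd (?K y) (?K' y))) - scal (1 / 3) * mtr r (mmul r (mmul r (?a y) (?a y)) (?a y)))"
  have s: "smooth_field S t1" "smooth_field S p"
    unfolding t1_def p_def by (intro smooth_field_simps smooth_field_mtr assms(1) sa sK)+
  have s': "smooth_field S t2"
    unfolding t2_def by (intro smooth_field_simps smooth_field_mtr smooth_field_mult smooth_field_scal smooth_on_const smooth_mat_simps assms(1) sa sK)
  note d = smooth_field_diff_at[OF s(1) assms(6)] smooth_field_diff_at[OF s(2) assms(6)] smooth_field_diff_at[OF s' assms(6)]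
  have e1: "dext t1 z = mtr r (?K' z) - mtr r (?K z)"
    unfolding t1_def by (rule mtr_curv_diff[OF assms, symmetric])
  have e2: "dext t2 z = mtr r (mmul r (?K' z) (?K' z)) - mtr r (mmul r (?K z) (?K z))"
    unfolding t2_def by (rule mtr_curv_curv_diff[OF assms, symmetric])
  have ep: "dext p z = 0"
    unfolding p_def
    by (subst dext_add) (simp_all add: dext_mtr_curv[OF assms(1-3,6)] dext_mtr_curv[OF assms(1,4,5,6)]
        smooth_field_diff_at[OF smooth_field_mtr[OF assms(1) sK(1)] assms(6)] smooth_field_diff_at[OF smooth_field_mtr[OF assms(1) sK(2)] assms(6)])
  have even: "grade (mtr r (?K z)) = mtr r (?K z)" "grade (mtr r (?K' z)) = mtr r (?K' z)"
    unfolding grade_mtr even_matD(1)[OF even_mat_curv[OF assms(1-3)] assms(6)] even_matD(1)[OF even_mat_curv[OF assms(1,4,5)] assms(6)] by simp_all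
  have comm: "mtr r (?K z) * mtr r (?K' z) = mtr r (?K' z) * mtr r (?K z)" by (rule ext_commute_even[OF even])
  show ?thesis
  proof (cases "n = 1")
    case True
    then show ?thesis using e1 d(1)
      by (simp add: chern_val_def trans_val_def dext_scal_const_mult t1_def right_diff_distrib)
  next
    case False
    have "dext (\<lambda>y. trans_val n r (?a y) (?K y) (?K' y)) z = dext (\<lambda>y. scal ((\<i> / (2 * of_real pi))\<^sup>2 / 2) * (t1 y * p y - t2 y)) z"
      using False by (simp add: trans_val_def t1_def t2_def p_def)
    also have "\<dots> = scal ((\<i> / (2 * of_real pi))\<^sup>2 / 2) * (dext t1 z * p z - dext t2 z)"
      by (simp add: dext_scal_const_mult[OF diff_at_simps(2)[OF diff_at_mult[OF d(1,2)] d(3)]]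
          dext_diff[OF diff_at_mult[OF d(1,2)] d(3)] dext_mult[OF d(1,2)] ep)
    also have "dext t1 z * p z = mtr r (?K' z) * mtr r (?K' z) - mtr r (?K z) * mtr r (?K z)"
      unfolding e1 p_def by (simp add: algebra_simps comm)
    finally show ?thesis using False e2 by (simp add: chern_val_def algebra_simps)
  qed
qed

lemma conjugate_vals:
  assumes "conjugate r g K1 K1'" "conjugate r g K2 K2'" "conjugate r g a a'"
    and gh: "\<And>i j. i < r \<Longrightarrow> j < r \<Longrightarrow> (\<Sum>l<r. g i l * h l j) = (if i = j then 1 else 0)"
    and hg: "\<And>i j. i < r \<Longrightarrow> j < r \<Longrightarrow> (\<Sum>l<r. h i l * g l j) = (if i = j then 1 else 0)"
  shows "chern_val n r K1' = chern_val n r K1" "trans_val n r a' K1' K2' = trans_val n r a K1 K2"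
proof -
  have tr: "mtr r B' = mtr r B" if "conjugate r g B B'" for B B' by (rule conjugate_mtr[OF that gh hg])
  show "chern_val n r K1' = chern_val n r K1"
    unfolding chern_val_def tr[OF assms(1)] tr[OF conjugate_mmul[OF assms(1,1)]] ..
  show "trans_val n r a' K1' K2' = trans_val n r a K1 K2"
    unfolding trans_val_def tr[OF assms(1)] tr[OF assms(2)] tr[OF assms(3)]
      tr[OF conjugate_mmul[OF assms(3) conjugate_madd[OF assms(1,2)]]] tr[OF conjugate_mmul[OF conjugate_mmul[OF assms(3,3)] assms(3)]] ..
qed

definition mpull :: "('v \<Rightarrow> 'w) \<Rightarrow> (nat \<Rightarrow> nat \<Rightarrow> 'w ext) \<Rightarrow> 'v ext mat" where
  "mpull L A = (\<lambda>i j. pull L (A i j))"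

lemma mpull_simps: "mpull L (mmul r A B) = mmul r (mpull L A) (mpull L B)" "mpull L (madd A B) = madd (mpull L A) (mpull L B)"
  "mpull L (msub A B) = msub (mpull L A) (mpull L B)" "pull L (mtr r A) = mtr r (mpull L A)"
  by (simp_all add: mpull_def mmul_def madd_def msub_def mtr_def pull_simps pull_sum)

lemma pull_vals: "pull L (chern_val n r K) = chern_val n r (mpull L K)"
  "pull L (trans_val n r a K K') = trans_val n r (mpull L a) (mpull L K) (mpull L K')"
  by (simp_all add: chern_val_def trans_val_def pull_simps mpull_simps)

definition tensor_mat :: "(nat \<Rightarrow> nat \<Rightarrow> 'v::real_vector ext) \<Rightarrow> bool" where
  "tensor_mat A \<longleftrightarrow> (\<forall>i j. tensor_at (A i j))"

lemma tensor_at_diff: "tensor_at a \<Longrightarrow> tensor_at b \<Longrightarrow> tensor_at (a - b)"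
  using tensor_at_simps(1)[OF _ tensor_at_simps(3), of a b] by simp

lemma tensor_at_sum: "(\<And>i. i \<in> I \<Longrightarrow> tensor_at (f i)) \<Longrightarrow> tensor_at (\<Sum>i\<in>I. f i)"
  by (induction I rule: infinite_finite_induct) (simp_all add: tensor_at_simps)

lemma tensor_mat_simps: "tensor_mat A \<Longrightarrow> tensor_mat B \<Longrightarrow> tensor_mat (mmul r A B)"
  "tensor_mat A \<Longrightarrow> tensor_mat B \<Longrightarrow> tensor_mat (madd A B)" "tensor_mat A \<Longrightarrow> tensor_mat B \<Longrightarrow> tensor_mat (msub A B)"
  "tensor_mat A \<Longrightarrow> tensor_at (mtr r A)"
  by (simp_all add: tensor_mat_def mmul_def madd_def msub_def mtr_def tensor_at_sum tensor_at_simps tensor_at_diff)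

lemma tensor_vals: "tensor_mat K \<Longrightarrow> tensor_at (chern_val n r K)"
  "tensor_mat a \<Longrightarrow> tensor_mat K \<Longrightarrow> tensor_mat K' \<Longrightarrow> tensor_at (trans_val n r a K K')"
  by (simp_all add: chern_val_def trans_val_def tensor_at_simps tensor_mat_simps tensor_at_diff)

lemma smooth_vals:
  assumes "open S" "smooth_mat S K" "smooth_mat S K'" "smooth_mat S a"
  shows "smooth_field S (\<lambda>y. chern_val n r (K y))" "smooth_field S (\<lambda>y. trans_val n r (a y) (K y) (K' y))"
  unfolding chern_val_def trans_val_def
  by (cases "n = 1"; simp, intro smooth_field_simps smooth_field_mtr smooth_field_mult smooth_field_scal smooth_on_const smooth_mat_simps assms)+

section \<open>Chern forms of connections\<close>

context surface
begin

lemma has_degree_iff: "has_degree A W p \<omega> \<longleftrightarrow> (\<forall>c\<in>A. \<forall>z\<in>cimg c W. \<forall>vs. length vs \<noteq> p \<longrightarrow> app (at_pt \<omega> c z) vs = 0)"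
  unfolding has_degree_def case_prod_unfold prod.collapse app_at_pt ..

lemma has_degreeD: "has_degree A W p \<omega> \<Longrightarrow> c \<in> A \<Longrightarrow> z \<in> cimg c W \<Longrightarrow> length vs \<noteq> p \<Longrightarrow> app (at_pt \<omega> c z) vs = 0"
  unfolding has_degree_iff by blast

text \<open>Entries outside the square of size \<open>r\<close> are set to 0, because the conditions
  of smoothness and parity range over all indices.\<close>

definition conn_mat :: "nat \<Rightarrow> ('a, 't) connection_forms \<Rightarrow> 'a set \<Rightarrow> ('a, 't) frame \<Rightarrow> 'a chart
    \<Rightarrow> complex ^ 2 \<Rightarrow> (complex ^ 2) ext mat" where
  "conn_mat r \<theta> V e c z = (\<lambda>i j. if i < r \<and> j < r then at_pt (\<theta> V e i j) c z else 0)"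

definition frame_mat :: "nat \<Rightarrow> ('a \<Rightarrow> complex) mat \<Rightarrow> 'a chart \<Rightarrow> complex ^ 2 \<Rightarrow> (complex ^ 2) ext mat" where
  "frame_mat r g c z = (\<lambda>i j. if i < r \<and> j < r then scal (g i j (cinv c z)) else 0)"

lemma smooth_field_zero: "smooth_field S (\<lambda>y. 0)"
  by (simp add: smooth_field_def smooth_on_const)

lemma dext_zero': "dext (\<lambda>y. 0) z = 0" by (rule dext_zero)

context
  fixes F :: "('a, 't) sheaf" and r :: nat and \<theta> :: "('a, 't) connection_forms"
  assumes conn: "connection A F r \<theta>"
begin

lemma connection_forms:
  assumes "local_frame A F r V e" "i < r" "j < r"
  shows "\<theta> V e i j \<in> forms A V" "has_degree A V 1 (\<theta> V e i j)"
  using conn[unfolded connection_def, THEN conjunct1, rule_format, OF assms] by simp_all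

lemma conn_one_form:
  assumes "local_frame A F r V e" "c \<in> A"
  shows "one_form (cimg c V) (\<lambda>z. conn_mat r \<theta> V e c z i j)"
proof (cases "i < r \<and> j < r")
  case True
  then have ij: "i < r" "j < r" by simp_all
  note f = formsD(1,2)[OF connection_forms(1)[OF assms(1) ij] assms(2)]
  have "conn_mat r \<theta> V e c z i j = at_pt (\<theta> V e i j) c z" for z using ij by (simp add: conn_mat_def)
  then show ?thesis unfolding one_form_def
    using f has_degreeD[OF connection_forms(2)[OF assms(1) ij] assms(2)] by simp
next
  case False
  then have "(\<lambda>z. conn_mat r \<theta> V e c z i j) = (\<lambda>z. 0)" by (auto simp: conn_mat_def)
  then show ?thesis by (simp add: one_form_def smooth_field_zero tensor_at_simps)
qed

lemma conn_smooth_mat: "local_frame A F r V e \<Longrightarrow> c \<in> A \<Longrightarrow> smooth_mat (cimg c V) (conn_mat r \<theta> V e c)"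
  unfolding smooth_mat_def by (intro allI one_formD(1) conn_one_form)

lemma conn_odd_mat: "local_frame A F r V e \<Longrightarrow> c \<in> A \<Longrightarrow> odd_mat (cimg c V) (conn_mat r \<theta> V e c)"
  unfolding odd_mat_def mgrade_def mneg_def
  by (intro ballI HOL.ext, rule one_form_grade[OF conn_one_form]; assumption)

lemma conn_tensor_mat: "local_frame A F r V e \<Longrightarrow> c \<in> A \<Longrightarrow> z \<in> cimg c V \<Longrightarrow> tensor_mat (conn_mat r \<theta> V e c z)"
  unfolding tensor_mat_def by (intro allI one_formD(2)[OF conn_one_form])

lemma conn_pull:
  assumes "local_frame A F r V e" "c \<in> A" "d \<in> A" "z \<in> cimg c (fst d \<inter> V)"
  shows "conn_mat r \<theta> V e c z = mpull (vec_deriv (trans_map c d) z) (conn_mat r \<theta> V e d (trans_map c d z))"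
proof (intro HOL.ext)
  fix i j
  show "conn_mat r \<theta> V e c z i j = mpull (vec_deriv (trans_map c d) z) (conn_mat r \<theta> V e d (trans_map c d z)) i j"
    using formsD(3)[OF connection_forms(1)[OF assms(1), of i j] assms(2-4)]
    by (cases "i < r \<and> j < r") (auto simp: conn_mat_def mpull_def pull_simps)
qed

lemma conn_law:
  assumes "local_frame A F r V e" "local_frame A F r V' e'" "changes r V e r V' e' g" "c \<in> A" "z \<in> cimg c (V \<inter> V')"
  shows "mmul r (frame_mat r g c z) (conn_mat r \<theta> V' e' c z) = madd (dmat (frame_mat r g c) z) (mmul r (conn_mat r \<theta> V e c z) (frame_mat r g c z))"
proof (intro HOL.ext)
  fix i j
  let ?L = "mmul r (frame_mat r g c z) (conn_mat r \<theta> V' e' c z) i j"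
  let ?R = "madd (dmat (frame_mat r g c) z) (mmul r (conn_mat r \<theta> V e c z) (frame_mat r g c z)) i j"
  show "?L = ?R"
  proof (cases "i < r \<and> j < r")
    case False
    then show ?thesis by (auto simp: mmul_def madd_def dmat_def frame_mat_def conn_mat_def dext_zero')
  next
    case True
    then have ij: "i < r" "j < r" by simp_all
    have zV: "z \<in> cimg c V" "z \<in> cimg c V'" using assms(5) by blast+
    have L: "app ?L vs = (\<Sum>l<r. g i l (cinv c z) * app (at_pt (\<theta> V' e' l j) c z) vs)" for vs
      using ij by (simp add: mmul_def frame_mat_def conn_mat_def app_scal_mult)
    have R: "app ?R vs = app (dext (\<lambda>y. scal (g i j (cinv c y))) z) vs + (\<Sum>l<r. app (at_pt (\<theta> V e i l) c z) vs * g l j (cinv c z))" for vs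
      using ij by (simp add: madd_def dmat_def mmul_def frame_mat_def conn_mat_def app_scal_mult mult.commute)
    show ?thesis
    proof (rule ext_eqI)
      fix vs
      show "app ?L vs = app ?R vs"
      proof (cases "length vs = 1")
        case True
        then obtain v where vs: "vs = [v]" by (cases vs) auto
        have "(\<Sum>l<r. g i l (cinv c z) * \<theta> V' e' l j c z [v]) = frechet_derivative (\<lambda>y. g i j (cinv c y)) (at z) v +
             (\<Sum>l<r. \<theta> V e i l c z [v] * g l j (cinv c z))"
          using conn[unfolded connection_def, THEN conjunct2, rule_format, of V e V' e' g c] assms ij
          unfolding changes_def case_prod_unfold prod.collapse Int_assoc by blast
        then show ?thesis unfolding L R vs by (simp add: app_dext_scal(1))
      next
        case False
        have "app (at_pt (\<theta> V' e' l j) c z) vs = 0" "app (at_pt (\<theta> V e i l) c z) vs = 0" if "l < r" for l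
          by (rule has_degreeD[OF connection_forms(2)[OF assms(2) that ij(2)] assms(4) zV(2) False]
              has_degreeD[OF connection_forms(2)[OF assms(1) ij(1) that] assms(4) zV(1) False])+
        then show ?thesis unfolding L R by (simp add: app_dext_scal(2)[OF False])
      qed
    qed
  qed
qed

lemma frame_mat_smooth:
  assumes "open W" "\<And>i j. i < r \<Longrightarrow> j < r \<Longrightarrow> holo_fun A W (g i j)" "c \<in> A"
  shows "smooth_mat (cimg c W) (frame_mat r g c)"
  unfolding smooth_mat_def
proof (intro allI)
  fix i j
  have "smooth_field (cimg c W) (\<lambda>y. scal (g i j (cinv c y)))" if "i < r" "j < r"
    by (rule smooth_field_scal[OF holo_on_imp_smooth_on[OF open_cimg[OF assms(3,1)] holo_funD[OF assms(2)[OF that] assms(3)]]])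
  then show "smooth_field (cimg c W) (\<lambda>y. frame_mat r g c y i j)"
    by (cases "i < r \<and> j < r") (auto simp: frame_mat_def smooth_field_zero)
qed

lemma frame_mat_even: "even_mat S (frame_mat r g c)"
  by (auto simp: even_mat_def mgrade_def frame_mat_def fun_eq_iff)

lemma conjugate_iff_frame_mat:
  "conjugate r (\<lambda>i j. g i j (cinv c z)) B B' \<longleftrightarrow> (\<forall>i<r. \<forall>j<r. mmul r (frame_mat r g c z) B' i j = mmul r B (frame_mat r g c z) i j)"
  by (simp add: conjugate_def mmul_def frame_mat_def)

lemma conn_curv_conjugate:
  assumes "local_frame A F r V e" "local_frame A F r V' e'" "changes r V e r V' e' g" "c \<in> A" "z \<in> cimg c (V \<inter> V')"
  shows "conjugate r (\<lambda>i j. g i j (cinv c z)) (curv r (conn_mat r \<theta> V e c) z) (curv r (conn_mat r \<theta> V' e' c) z)"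
proof -
  let ?S = "cimg c (V \<inter> V')"
  have W: "open (V \<inter> V')" using local_frame_open[OF assms(1)] local_frame_open[OF assms(2)] by (rule open_Int)
  have sub: "?S \<subseteq> cimg c V" "?S \<subseteq> cimg c V'" by blast+
  have sm: "smooth_mat ?S (conn_mat r \<theta> V e c)" "smooth_mat ?S (conn_mat r \<theta> V' e' c)"
    using conn_smooth_mat[OF assms(1,4)] conn_smooth_mat[OF assms(2,4)] sub smooth_field_subset unfolding smooth_mat_def by blast+
  have od: "odd_mat ?S (conn_mat r \<theta> V e c)" "odd_mat ?S (conn_mat r \<theta> V' e' c)"
    using conn_odd_mat[OF assms(1,4)] conn_odd_mat[OF assms(2,4)] sub unfolding odd_mat_def by blast+
  have G: "smooth_mat ?S (frame_mat r g c)"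
    by (rule frame_mat_smooth[OF W _ assms(4)]) (use assms(3) in \<open>simp add: changes_def\<close>)
  have "mmul r (frame_mat r g c z) (curv r (conn_mat r \<theta> V' e' c) z) = mmul r (curv r (conn_mat r \<theta> V e c) z) (frame_mat r g c z)"
    by (rule conjugate_curv[OF open_cimg[OF assms(4) W] sm(1) od(1) sm(2) od(2) G frame_mat_even assms(5)])
      (rule conn_law[OF assms(1-4)])
  then show ?thesis unfolding conjugate_iff_frame_mat by simp
qed

lemma conn_curv_tensor: "local_frame A F r V e \<Longrightarrow> c \<in> A \<Longrightarrow> z \<in> cimg c V \<Longrightarrow> tensor_mat (curv r (conn_mat r \<theta> V e c) z)"
  unfolding curv_def
proof (rule tensor_mat_simps)
  assume *: "local_frame A F r V e" "c \<in> A" "z \<in> cimg c V"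
  show "tensor_mat (dmat (conn_mat r \<theta> V e c) z)"
    unfolding tensor_mat_def dmat_def
    by (intro allI tensor_at_dext[OF open_cimg[OF *(2) local_frame_open[OF *(1)]] conn_one_form[OF *(1,2)] *(3)])
  show "tensor_mat (mmul r (conn_mat r \<theta> V e c z) (conn_mat r \<theta> V e c z))"
    by (rule tensor_mat_simps; rule conn_tensor_mat[OF *])
qed

lemma conn_curv_pull:
  assumes "local_frame A F r V e" "c \<in> A" "d \<in> A" "z \<in> cimg c (fst d \<inter> V)"
  shows "curv r (conn_mat r \<theta> V e c) z = mpull (vec_deriv (trans_map c d) z) (curv r (conn_mat r \<theta> V e d) (trans_map c d z))"
proof -
  let ?S = "cimg c (fst d \<inter> V)" and ?T = "cimg d (fst c \<inter> V)"
  note V = local_frame_open[OF assms(1)]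
  have op: "open ?S" "open ?T" by (intro open_cimg open_Int chart_open V assms)+
  have sub: "?S \<subseteq> cimg c V" "?T \<subseteq> cimg d V" "?S \<subseteq> cimg c (fst d)" by blast+
  have one: "one_form ?S (\<lambda>z. conn_mat r \<theta> V e c z i j)" "one_form ?T (\<lambda>z. conn_mat r \<theta> V e d z i j)" for i j
    using conn_one_form[OF assms(1,2), of i j] conn_one_form[OF assms(1,3), of i j] sub smooth_field_subset
    unfolding one_form_def by blast+
  have "dmat (conn_mat r \<theta> V e c) z = mpull (vec_deriv (trans_map c d) z) (dmat (conn_mat r \<theta> V e d) (trans_map c d z))"
    unfolding dmat_def mpull_def
  proof (intro HOL.ext)
    fix i j
    show "dext (\<lambda>y. conn_mat r \<theta> V e c y i j) z = pull (vec_deriv (trans_map c d) z) (dext (\<lambda>y. conn_mat r \<theta> V e d y i j) (trans_map c d z))"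
    proof (rule dext_pull_one_form[OF op one(2) _ _ _ one(1) assms(4)])
      show "holo_on (\<lambda>z. trans_map c d z $ i) ?S" for i
        by (rule holo_on_subset[OF trans_map_holo[OF assms(2,3)] sub(3)])
      show "trans_map c d y \<in> ?T" if "y \<in> ?S" for y by (rule trans_mapD(1)[OF assms(2,3) that])
      show "conn_mat r \<theta> V e c y i j = pull (vec_deriv (trans_map c d) y) (conn_mat r \<theta> V e d (trans_map c d y) i j)" if "y \<in> ?S" for y
        using fun_cong[OF fun_cong[OF conn_pull[OF assms(1-3) that]], of i j] by (simp add: mpull_def)
    qed
  qed
  then show ?thesis unfolding curv_def mpull_simps by (simp only: conn_pull[OF assms, symmetric])
qed

lemma at_pt_curvature:
  assumes "i < r" "j < r"
  shows "at_pt (curvature r (\<theta> V e) i j) c z = curv r (conn_mat r \<theta> V e c) z i j"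
proof -
  have "at_pt (curvature r (\<theta> V e) i j) c z = at_pt (ext_deriv (\<theta> V e i j)) c z + (\<Sum>l<r. at_pt (wedge (\<theta> V e i l) (\<theta> V e l j)) c z)"
    by (rule ext_eqI) (simp add: curvature_def)
  also have "\<dots> = curv r (conn_mat r \<theta> V e c) z i j"
    using assms by (simp add: curv_def madd_def dmat_def mmul_def conn_mat_def at_pt_ext_deriv at_pt_wedge)
  finally show ?thesis .
qed

lemma at_pt_chern_poly:
  assumes "n = 1 \<or> n = 2" "local_frame A F r V e" "c \<in> A" "z \<in> cimg c V"
  shows "at_pt (chern_poly r n (curvature r (\<theta> V e))) c z = chern_val n r (curv r (conn_mat r \<theta> V e c) z)"
proof -
  let ?\<Omega> = "\<lambda>i j. at_pt (curvature r (\<theta> V e) i j) c z" and ?K = "curv r (conn_mat r \<theta> V e c) z"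
  have tr: "mtr r ?\<Omega> = mtr r ?K" "mtr r (mmul r ?\<Omega> ?\<Omega>) = mtr r (mmul r ?K ?K)"
    by (simp_all add: mtr_def mmul_def at_pt_curvature)
  have "meven r ?K"
    by (rule even_matD(2)[OF even_mat_curv[OF open_cimg[OF assms(3) local_frame_open[OF assms(2)]] conn_smooth_mat[OF assms(2,3)] conn_odd_mat[OF assms(2,3)]] assms(4)])
  then have ev: "meven r ?\<Omega>" by (simp add: meven_def at_pt_curvature)
  show ?thesis
    using assms(1) at_pt_chern_poly_1[of r "curvature r (\<theta> V e)" c z] at_pt_chern_poly_2[OF ev]
    by (auto simp: chern_val_def tr)
qed

end

section \<open>Global forms from expressions in local frames\<close>

lemma glue_form:
  assumes frames: "\<And>c. c \<in> A \<Longrightarrow> local_frame A F r (fst c) (E c)"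
    and smooth: "\<And>c. c \<in> A \<Longrightarrow> smooth_field (cimg c (fst c)) (val (fst c) (E c) c)"
    and tensor: "\<And>c z. c \<in> A \<Longrightarrow> z \<in> cimg c (fst c) \<Longrightarrow> tensor_at (val (fst c) (E c) c z)"
    and inv: "\<And>V e V' e' c z. local_frame A F r V e \<Longrightarrow> local_frame A F r V' e' \<Longrightarrow> c \<in> A \<Longrightarrow> z \<in> cimg c (V \<inter> V')
      \<Longrightarrow> val V e c z = val V' e' c z"
    and pull: "\<And>V e c d z. local_frame A F r V e \<Longrightarrow> c \<in> A \<Longrightarrow> d \<in> A \<Longrightarrow> z \<in> cimg c (fst d \<inter> V)
      \<Longrightarrow> val V e c z = pull (vec_deriv (trans_map c d) z) (val V e d (trans_map c d z))"
  shows "form_of (\<lambda>c z. val (fst c) (E c) c z) \<in> forms A UNIV"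
proof (rule formsI)
  show "smooth_field (cimg c UNIV) (at_pt (form_of (\<lambda>c z. val (fst c) (E c) c z)) c)" if "c \<in> A" for c
    using smooth[OF that] by (simp add: at_pt_fun)
  show "tensor_at (at_pt (form_of (\<lambda>c z. val (fst c) (E c) c z)) c z)" if "c \<in> A" "z \<in> cimg c UNIV" for c z
    using tensor[OF that(1), of z] that(2) by (simp add: at_pt_fun)
  show "at_pt (form_of (\<lambda>c z. val (fst c) (E c) c z)) c z
      = pull (vec_deriv (trans_map c d) z) (at_pt (form_of (\<lambda>c z. val (fst c) (E c) c z)) d (trans_map c d z))"
    if "c \<in> A" "d \<in> A" "z \<in> cimg c (fst d \<inter> UNIV)" for c d z
  proof -
    \<comment> \<open>The frame of \<open>c\<close> is exchanged for that of \<open>d\<close> within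
      the chart \<open>c\<close>; after that the chart is changed with the frame of \<open>d\<close>
      fixed.\<close>
    have z: "z \<in> cimg c (fst c \<inter> fst d)" "z \<in> cimg c (fst d \<inter> fst d)" using that(3) by auto
    show ?thesis unfolding at_pt_fun
      using inv[OF frames[OF that(1)] frames[OF that(2)] that(1) z(1)] pull[OF frames[OF that(2)] that(1,2) z(2)] by simp
  qed
qed

lemma frames_inverse:
  assumes "local_frame A F r V e" "local_frame A F r V' e'"
  obtains g h where "changes r V e r V' e' g"
    "\<And>x i j. x \<in> V \<inter> V' \<Longrightarrow> i < r \<Longrightarrow> j < r \<Longrightarrow> (\<Sum>l<r. g i l x * h l j x) = (if i = j then 1 else 0)"
    "\<And>x i j. x \<in> V \<inter> V' \<Longrightarrow> i < r \<Longrightarrow> j < r \<Longrightarrow> (\<Sum>l<r. h i l x * g l j x) = (if i = j then 1 else 0)"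
proof -
  obtain g where g: "changes r V e r V' e' g" using frame_change[OF assms] by (elim exE)
  obtain h where h: "changes r V' e' r V e h" using frame_change[OF assms(2,1)] by (elim exE)
  show thesis
  proof (rule that[OF g])
    fix x i j assume x: "x \<in> V \<inter> V'" and ij: "i < r" "j < r"
    then have x': "x \<in> V" "x \<in> V'" by simp_all
    show "(\<Sum>l<r. g i l x * h l j x) = (if i = j then 1 else 0)"
      by (rule changes_inverse[OF assms g h x' ij])
    show "(\<Sum>l<r. h i l x * g l j x) = (if i = j then 1 else 0)"
      by (rule changes_inverse[OF assms(2,1) h g x'(2,1) ij])
  qed
qed

lemma conn_vals_inv:
  assumes "connection A F r \<theta>" "connection A F r \<theta>'" "local_frame A F r V e" "local_frame A F r V' e'" "c \<in> A" "z \<in> cimg c (V \<inter> V')"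
  shows "chern_val n r (curv r (conn_mat r \<theta> V e c) z) = chern_val n r (curv r (conn_mat r \<theta> V' e' c) z)"
    "trans_val n r (msub (conn_mat r \<theta>' V e c z) (conn_mat r \<theta> V e c z)) (curv r (conn_mat r \<theta> V e c) z) (curv r (conn_mat r \<theta>' V e c) z)
     = trans_val n r (msub (conn_mat r \<theta>' V' e' c z) (conn_mat r \<theta> V' e' c z)) (curv r (conn_mat r \<theta> V' e' c) z) (curv r (conn_mat r \<theta>' V' e' c) z)"
proof -
  obtain g h where g: "changes r V e r V' e' g"
    and gh: "\<And>x i j. x \<in> V \<inter> V' \<Longrightarrow> i < r \<Longrightarrow> j < r \<Longrightarrow> (\<Sum>l<r. g i l x * h l j x) = (if i = j then 1 else 0)"
    and hg: "\<And>x i j. x \<in> V \<inter> V' \<Longrightarrow> i < r \<Longrightarrow> j < r \<Longrightarrow> (\<Sum>l<r. h i l x * g l j x) = (if i = j then 1 else 0)"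
    by (rule frames_inverse[OF assms(3,4)]) (rule that; assumption)
  let ?g = "\<lambda>i j. g i j (cinv c z)" and ?h = "\<lambda>i j. h i j (cinv c z)"
  have x: "cinv c z \<in> V \<inter> V'" by (rule cimgD(2)[OF assms(5,6)])
  \<comment> \<open>The inhomogeneous term \<open>dG\<close> of the transformation law cancels in
    the difference of two connections.\<close>
  have a: "conjugate r ?g (msub (conn_mat r \<theta>' V e c z) (conn_mat r \<theta> V e c z)) (msub (conn_mat r \<theta>' V' e' c z) (conn_mat r \<theta> V' e' c z))"
    unfolding conjugate_iff_frame_mat[OF assms(1)] mmul_distrib conn_law[OF assms(1,3,4) g assms(5,6)] conn_law[OF assms(2,3,4) g assms(5,6)]
    by (simp add: msub_def madd_def)
  note vals = conjugate_vals[where g = ?g and h = ?h, OF conn_curv_conjugate[OF assms(1,3,4) g assms(5,6)] conn_curv_conjugate[OF assms(2,3,4) g assms(5,6)] a gh[OF x] hg[OF x]]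
  show "chern_val n r (curv r (conn_mat r \<theta> V e c) z) = chern_val n r (curv r (conn_mat r \<theta> V' e' c) z)"
    "trans_val n r (msub (conn_mat r \<theta>' V e c z) (conn_mat r \<theta> V e c z)) (curv r (conn_mat r \<theta> V e c) z) (curv r (conn_mat r \<theta>' V e c) z)
     = trans_val n r (msub (conn_mat r \<theta>' V' e' c z) (conn_mat r \<theta> V' e' c z)) (curv r (conn_mat r \<theta> V' e' c) z) (curv r (conn_mat r \<theta>' V' e' c) z)"
    using vals by simp_all
qed

definition chern_form_of :: "nat \<Rightarrow> nat \<Rightarrow> ('a, 't) connection_forms \<Rightarrow> ('a chart \<Rightarrow> ('a, 't) frame) \<Rightarrow> 'a form" where
  "chern_form_of n r \<theta> E = form_of (\<lambda>c z. chern_val n r (curv r (conn_mat r \<theta> (fst c) (E c) c) z))"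

lemma chern_form_of:
  assumes conn: "connection A F r \<theta>" and frames: "\<And>c. c \<in> A \<Longrightarrow> local_frame A F r (fst c) (E c)" and n: "n = 1 \<or> n = 2"
  shows "chern_form_of n r \<theta> E \<in> carrier (closed_forms A)" "chern_form A F r \<theta> n (chern_form_of n r \<theta> E)"
    "chern_form A F r \<theta> n \<eta> \<Longrightarrow> c \<in> A \<Longrightarrow> z \<in> cimg c UNIV \<Longrightarrow> at_pt \<eta> c z = at_pt (chern_form_of n r \<theta> E) c z"
proof -
  have op: "open (cimg c (fst c))" if "c \<in> A" for c by (rule open_cimg[OF that chart_open[OF that]])
  have f: "chern_form_of n r \<theta> E \<in> forms A UNIV"
    unfolding chern_form_of_def
  proof (rule glue_form[OF frames, where val = "\<lambda>V e c z. chern_val n r (curv r (conn_mat r \<theta> V e c) z)"])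
    fix c assume c: "c \<in> A"
    note s = smooth_mat_curv[OF op[OF c] conn_smooth_mat[OF conn frames[OF c] c]]
    show "smooth_field (cimg c (fst c)) (\<lambda>z. chern_val n r (curv r (conn_mat r \<theta> (fst c) (E c) c) z))"
      by (rule smooth_vals(1)[OF op[OF c] s s s])
    show "tensor_at (chern_val n r (curv r (conn_mat r \<theta> (fst c) (E c) c) z))" if "z \<in> cimg c (fst c)" for z
      by (rule tensor_vals(1)[OF conn_curv_tensor[OF conn frames[OF c] c that]])
  next
    show "chern_val n r (curv r (conn_mat r \<theta> V e c) z) = chern_val n r (curv r (conn_mat r \<theta> V' e' c) z)"
      if "local_frame A F r V e" "local_frame A F r V' e'" "c \<in> A" "z \<in> cimg c (V \<inter> V')" for V e V' e' c z
      by (rule conn_vals_inv(1)[OF conn conn that])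
    show "chern_val n r (curv r (conn_mat r \<theta> V e c) z)
      = pull (vec_deriv (trans_map c d) z) (chern_val n r (curv r (conn_mat r \<theta> V e d) (trans_map c d z)))"
      if "local_frame A F r V e" "c \<in> A" "d \<in> A" "z \<in> cimg c (fst d \<inter> V)" for V e c d z
      unfolding pull_vals conn_curv_pull[OF conn that] ..
  qed
  have val: "at_pt (chern_form_of n r \<theta> E) c z = chern_val n r (curv r (conn_mat r \<theta> V e c) z)"
    if "local_frame A F r V e" "c \<in> A" "z \<in> cimg c V" for V e c z
  proof -
    have "z \<in> cimg c (fst c \<inter> V)" using that(3) by auto
    then show ?thesis unfolding chern_form_of_def at_pt_form_of by (rule conn_vals_inv(1)[OF conn conn frames[OF that(2)] that(1,2)])
  qed
  show cf: "chern_form A F r \<theta> n (chern_form_of n r \<theta> E)"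
    unfolding chern_form_def form_eq_iff by (simp add: f val at_pt_chern_poly[OF conn n])
  have "closed_form (chern_form_of n r \<theta> E)"
    unfolding closed_form_def chern_form_of_def at_pt_fun
  proof (intro ballI)
    fix c z assume c: "c \<in> A" and "z \<in> cimg c UNIV"
    then have z: "z \<in> cimg c (fst c)" by simp
    show "dext (\<lambda>z. chern_val n r (curv r (conn_mat r \<theta> (fst c) (E c) c) z)) z = 0"
      by (rule dext_chern_val[OF op[OF c] conn_smooth_mat[OF conn frames[OF c] c] conn_odd_mat[OF conn frames[OF c] c] z])
  qed
  then show "chern_form_of n r \<theta> E \<in> carrier (closed_forms A)" using f by (simp add: closed_forms_simps)
  show "at_pt \<eta> c z = at_pt (chern_form_of n r \<theta> E) c z" if \<eta>: "chern_form A F r \<theta> n \<eta>" and c: "c \<in> A" and "z \<in> cimg c UNIV"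
  proof -
    have z: "z \<in> cimg c (fst c)" using that(3) by simp
    have "at_pt \<eta> c z = at_pt (chern_poly r n (curvature r (\<theta> (fst c) (E c)))) c z"
      by (rule \<eta>[unfolded chern_form_def form_eq_iff, THEN conjunct2, rule_format, OF frames[OF c] c z])
    then show ?thesis by (simp only: at_pt_chern_poly[OF conn n frames[OF c] c z] val[OF frames[OF c] c z])
  qed
qed

text \<open>The transgression of two connections does not depend on the frame, so it glues to a
  global primitive for the difference of their Chern forms.\<close>

lemma chern_class_unique:
  assumes conn: "connection A F r \<theta>" "connection A F r \<theta>'" and frames: "\<And>c. c \<in> A \<Longrightarrow> local_frame A F r (fst c) (E c)" and n: "n = 1 \<or> n = 2"
    and \<eta>: "chern_form A F r \<theta> n \<eta>" "chern_form A F r \<theta>' n \<eta>'"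
  shows "coset_of \<eta> = coset_of \<eta>'"
proof -
  have op: "open (cimg c (fst c))" if "c \<in> A" for c by (rule open_cimg[OF that chart_open[OF that]])
  let ?K = "\<lambda>\<theta> V e c z. curv r (conn_mat r \<theta> V e c) z" and ?a = "\<lambda>V e c z. msub (conn_mat r \<theta>' V e c z) (conn_mat r \<theta> V e c z)"
  let ?val = "\<lambda>V e c z. trans_val n r (?a V e c z) (?K \<theta> V e c z) (?K \<theta>' V e c z)"
  have \<tau>: "form_of (\<lambda>c z. ?val (fst c) (E c) c z) \<in> forms A UNIV"
  proof (rule glue_form[OF frames, where val = ?val])
    fix c assume c: "c \<in> A"
    note c1 = conn_smooth_mat[OF conn(1) frames[OF c] c] and c2 = conn_smooth_mat[OF conn(2) frames[OF c] c]
    show "smooth_field (cimg c (fst c)) (\<lambda>z. ?val (fst c) (E c) c z)"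
      by (rule smooth_vals(2)[OF op[OF c] smooth_mat_curv[OF op[OF c] c1] smooth_mat_curv[OF op[OF c] c2] smooth_mat_simps(2)[OF op[OF c] c2 c1]])
    show "tensor_at (?val (fst c) (E c) c z)" if z: "z \<in> cimg c (fst c)" for z
      by (intro tensor_vals(2) tensor_mat_simps(3) conn_tensor_mat[OF conn(1) frames[OF c] c z] conn_tensor_mat[OF conn(2) frames[OF c] c z]
          conn_curv_tensor[OF conn(1) frames[OF c] c z] conn_curv_tensor[OF conn(2) frames[OF c] c z])
  next
    show "?val V e c z = ?val V' e' c z"
      if "local_frame A F r V e" "local_frame A F r V' e'" "c \<in> A" "z \<in> cimg c (V \<inter> V')" for V e V' e' c z
      by (rule conn_vals_inv(2)[OF conn that])
    show "?val V e c z = pull (vec_deriv (trans_map c d) z) (?val V e d (trans_map c d z))"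
      if "local_frame A F r V e" "c \<in> A" "d \<in> A" "z \<in> cimg c (fst d \<inter> V)" for V e c d z
      unfolding pull_vals mpull_simps conn_curv_pull[OF conn(1) that] conn_curv_pull[OF conn(2) that] conn_pull[OF conn(1) that] conn_pull[OF conn(2) that] ..
  qed
  have f: "\<eta> \<in> forms A UNIV" "\<eta>' \<in> forms A UNIV" using \<eta> by (simp_all add: chern_form_def)
  show ?thesis
  proof (rule coset_eqI[OF f \<tau>])
    fix c z assume c: "c \<in> A" and z: "z \<in> cimg c UNIV"
    then have z': "z \<in> cimg c (fst c)" by simp
    have "at_pt \<eta>' c z - at_pt \<eta> c z = chern_val n r (?K \<theta>' (fst c) (E c) c z) - chern_val n r (?K \<theta> (fst c) (E c) c z)"
    proof -
      have "at_pt \<eta> c z = at_pt (chern_form_of n r \<theta> E) c z"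
        by (rule chern_form_of(3)[where E = E, OF conn(1) frames n \<eta>(1) c z])
      moreover have "at_pt \<eta>' c z = at_pt (chern_form_of n r \<theta>' E) c z"
        by (rule chern_form_of(3)[where E = E, OF conn(2) frames n \<eta>(2) c z])
      ultimately show ?thesis by (simp add: chern_form_of_def)
    qed
    also have "\<dots> = dext (\<lambda>z. ?val (fst c) (E c) c z) z"
      by (rule chern_val_diff[OF op[OF c] conn_smooth_mat[OF conn(1) frames[OF c] c] conn_odd_mat[OF conn(1) frames[OF c] c]
            conn_smooth_mat[OF conn(2) frames[OF c] c] conn_odd_mat[OF conn(2) frames[OF c] c] z'])
    finally show "at_pt \<eta>' c z - at_pt \<eta> c z = dext (at_pt (form_of (\<lambda>c z. ?val (fst c) (E c) c z)) c) z"
      unfolding at_pt_fun .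
  qed
qed

text \<open>Existence and uniqueness together evaluate the definite descriptions in
  \<open>sheaf_rank\<close> and \<open>chern_class\<close>.\<close>

lemma chern_class_eq:
  assumes conn: "connection A F r \<theta>" and frames: "\<And>c. c \<in> A \<Longrightarrow> local_frame A F r (fst c) (E c)" and n: "n = 1 \<or> n = 2"
  shows "chern_class A n F = coset_of (chern_form_of n r \<theta> E)"
proof -
  have rank: "sheaf_rank A F = r"
  proof (rule sheaf_rank_eq)
    fix x
    obtain c where "c \<in> A" "x \<in> fst c" by (rule chart_at)
    then show "\<exists>V e. x \<in> V \<and> local_frame A F r V e" using frames by (intro exI conjI)
  qed
  note cf = chern_form_of[where E = E, OF conn frames n]
  show ?thesis
    unfolding chern_class_def rank
  proof (rule the_equality)
    show "\<exists>\<theta>' \<eta>. connection A F r \<theta>' \<and> chern_form A F r \<theta>' n \<eta> \<and> coset_of (chern_form_of n r \<theta> E) = coset_of \<eta>"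
      using conn cf(2) by (intro exI conjI) (assumption | rule refl)+
    fix D assume "\<exists>\<theta>' \<eta>. connection A F r \<theta>' \<and> chern_form A F r \<theta>' n \<eta> \<and> D = coset_of \<eta>"
    then obtain \<theta>' \<eta> where *: "connection A F r \<theta>'" "chern_form A F r \<theta>' n \<eta>" "D = coset_of \<eta>" by (elim exE conjE)
    show "D = coset_of (chern_form_of n r \<theta> E)"
      unfolding *(3) by (rule chern_class_unique[OF *(1) conn frames n *(2) cf(2)])
  qed
qed

end

section \<open>Existence of connections\<close>

lemma one_form_dscal:
  assumes "open S" "smooth_on S f"
  shows "one_form S (dext (\<lambda>y. scal (f y)))"
  unfolding one_form_def
proof (intro conjI ballI allI impI)
  show "smooth_field S (dext (\<lambda>y. scal (f y)))"
    by (rule smooth_field_dext[OF assms(1) smooth_field_scal[OF assms(2)]])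
  fix z assume z: "z \<in> S"
  let ?a = "dext (\<lambda>y. scal (f y)) z"
  show zero: "app ?a vs = 0" if "length vs \<noteq> 1" for vs by (rule app_dext_scal(2)[OF that])
  have lin: "linear (\<lambda>v. app ?a [v])"
    unfolding app_dext_scal(1) by (rule linear_frechet_derivative[OF smooth_on_differentiable[OF assms(2) z]])
  show "tensor_at ?a"
    unfolding tensor_at_def
  proof
    show "skew ?a" by (rule skewI) (simp add: zero)
    show "multilin ?a"
      unfolding multilin_def
    proof (intro allI)
      fix xs ys :: "(complex ^ 2) list"
      show "linear (\<lambda>v. app ?a (xs @ v # ys))"
      proof (cases "xs = [] \<and> ys = []")
        case True then show ?thesis using lin by simp
      next
        case False
        then have "app ?a (xs @ v # ys) = 0" for v by (intro zero) auto
        then show ?thesis by (simp add: linear_zero)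
      qed
    qed
  qed
qed

lemma (in surface) dscal_pull:
  assumes "open W" "smooth_fun W h" "c \<in> A" "d \<in> A" "z \<in> cimg c (fst d \<inter> W)"
  shows "dext (\<lambda>y. scal (h (cinv c y))) z = pull (vec_deriv (trans_map c d) z) (dext (\<lambda>y. scal (h (cinv d y))) (trans_map c d z))"
proof (rule ext_eqI)
  fix vs
  let ?T = "trans_map c d"
  have zd: "z \<in> cimg c (fst d)" using assms(5) by blast
  have Tz: "?T z \<in> cimg d W" using trans_mapD(1)[OF assms(3-5)] by blast
  have "smooth_on (cimg d W) (\<lambda>y. h (cinv d y))" using assms(2,4) by (simp add: smooth_fun_def)
  note D = has_derivative_compose[OF trans_map_deriv(1)[OF assms(3,4) zd] smooth_on_has_derivative[OF this Tz]]
  have "frechet_derivative (\<lambda>y. h (cinv c y)) (at z) = frechet_derivative (\<lambda>y. h (cinv d (?T y))) (at z)"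
  proof (rule frechet_derivative_cong_open[OF open_cimg[OF assms(3) chart_open[OF assms(4)]] zd])
    fix y assume "y \<in> cimg c (fst d)"
    then have "y \<in> cimg c (fst d \<inter> UNIV)" by simp
    from trans_mapD(2)[OF assms(3,4) this] show "h (cinv c y) = h (cinv d (?T y))" by simp
  qed
  also have "\<dots> = (\<lambda>v. dir_deriv (\<lambda>y. h (cinv d y)) (vec_deriv ?T z v) (?T z))"
    by (rule frechet_derivative_eqI[OF D])
  finally have eq: "dir_deriv (\<lambda>y. h (cinv c y)) v z = dir_deriv (\<lambda>y. h (cinv d y)) (vec_deriv ?T z v) (?T z)" for v
    by (rule fun_cong)
  show "app (dext (\<lambda>y. scal (h (cinv c y))) z) vs = app (pull (vec_deriv ?T z) (dext (\<lambda>y. scal (h (cinv d y))) (?T z))) vs"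
  proof (cases "length vs = 1")
    case True
    then obtain v where "vs = [v]" by (cases vs) auto
    then show ?thesis by (simp add: app_dext_scal(1) eq)
  next
    case False
    then show ?thesis using app_dext_scal(2)[of "map (vec_deriv ?T z) vs"] by (simp add: app_dext_scal(2))
  qed
qed

context surface_partition
begin

definition lastN :: "'a \<Rightarrow> nat" where "lastN x = (LEAST n. x \<in> W n)"

lemma lastN: "x \<in> W (lastN x)"
proof -
  have "x \<in> (\<Union>n. W n)" by (simp add: W_cover)
  then show ?thesis unfolding lastN_def by (auto intro: LeastI)
qed

text \<open>The bound \<open>lastN x\<close> jumps with \<open>x\<close>. Around a point it can be
  replaced by one fixed bound, because the terms in between vanish; smoothness of the total
  connection rests on this.\<close>

lemma rho_sum_extend:
  assumes "x \<in> W N" "\<And>n. \<rho> n x = 0 \<Longrightarrow> t n = (0 :: 'c::comm_monoid_add)"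
  shows "(\<Sum>n\<le>lastN x. t n) = (\<Sum>n\<le>N. t n)"
proof (rule sum.mono_neutral_left)
  show "{..lastN x} \<subseteq> {..N}" using assms(1) by (auto simp: lastN_def intro: Least_le)
  show "\<forall>n\<in>{..N} - {..lastN x}. t n = 0" using rho_tail[OF lastN[of x]] assms(2) by simp
qed simp

section \<open>Averages of flat connections\<close>

definition trans_to :: "nat \<Rightarrow> ('a chart \<Rightarrow> ('a, 't) frame) \<Rightarrow> 'a set \<Rightarrow> ('a, 't) frame \<Rightarrow> nat \<Rightarrow> nat \<Rightarrow> nat \<Rightarrow> 'a \<Rightarrow> complex" where
  "trans_to r E V e n = (SOME g. changes r V e r (fst (C n)) (E (C n)) g)"

definition trans_from :: "nat \<Rightarrow> ('a chart \<Rightarrow> ('a, 't) frame) \<Rightarrow> 'a set \<Rightarrow> ('a, 't) frame \<Rightarrow> nat \<Rightarrow> nat \<Rightarrow> nat \<Rightarrow> 'a \<Rightarrow> complex" where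
  "trans_from r E V e n = (SOME h. changes r (fst (C n)) (E (C n)) r V e h)"

text \<open>On \<open>V \<inter> U\<^sub>n\<close>, the summand is the matrix \<open>\<rho>\<^sub>n G dG\<^sup>-\<^sup>1\<close> of the flat connection for which the
  frame on the \<open>n\<close>-th chart is parallel.\<close>

definition flat_term :: "nat \<Rightarrow> ('a chart \<Rightarrow> ('a, 't) frame) \<Rightarrow> 'a set \<Rightarrow> ('a, 't) frame
    \<Rightarrow> nat \<Rightarrow> nat \<Rightarrow> nat \<Rightarrow> 'a chart \<Rightarrow> complex ^ 2 \<Rightarrow> (complex ^ 2) ext" where
  "flat_term r E V e n i j c z = (if cinv c z \<in> fst (C n) then scal (\<rho> n (cinv c z)) *
     (\<Sum>l<r. scal (trans_to r E V e n i l (cinv c z)) * dext (\<lambda>y. scal (trans_from r E V e n l j (cinv c y))) z) else 0)"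

definition part_conn :: "nat \<Rightarrow> ('a chart \<Rightarrow> ('a, 't) frame) \<Rightarrow> ('a, 't) connection_forms" where
  "part_conn r E V e i j = form_of (\<lambda>c z. \<Sum>n\<le>lastN (cinv c z). flat_term r E V e n i j c z)"

context
  fixes F :: "('a, 't) sheaf" and r :: nat and E :: "'a chart \<Rightarrow> nat \<Rightarrow> 'a \<Rightarrow> 't \<Rightarrow> complex"
  assumes frames: "\<And>c. c \<in> A \<Longrightarrow> local_frame A F r (fst c) (E c)"
begin

lemma trans_to: "local_frame A F r V e \<Longrightarrow> changes r V e r (fst (C n)) (E (C n)) (trans_to r E V e n)"
  unfolding trans_to_def by (rule someI_ex[OF frame_change[OF _ frames[OF C]]])

lemma trans_from: "local_frame A F r V e \<Longrightarrow> changes r (fst (C n)) (E (C n)) r V e (trans_from r E V e n)"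
  unfolding trans_from_def by (rule someI_ex[OF frame_change[OF frames[OF C]]])

lemma flat_term_zero: "\<rho> n (cinv c z) = 0 \<Longrightarrow> flat_term r E V e n i j c z = 0"
  by (simp add: flat_term_def scal_simps)

lemma flat_term_form:
  assumes e: "local_frame A F r V e" and ij: "i < r" "j < r"
  shows "form_of (flat_term r E V e n i j) \<in> forms A V"
    and "c \<in> A \<Longrightarrow> z \<in> cimg c V \<Longrightarrow> length vs \<noteq> 1 \<Longrightarrow> app (flat_term r E V e n i j c z) vs = 0"
proof -
  let ?U = "fst (C n)" and ?g = "trans_to r E V e n" and ?h = "trans_from r E V e n"
  have V: "open V" and U: "open ?U" by (rule local_frame_open[OF e], rule chart_open[OF C])
  note VU = open_Int[OF V U]
  have g: "smooth_fun (V \<inter> ?U) (?g i l)" and h: "smooth_fun (V \<inter> ?U) (?h l j)" if "l < r" for l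
    using trans_to[OF e, of n] trans_from[OF e, of n] that ij
    by (auto intro!: holo_fun_imp_smooth_fun[OF VU] simp: changes_def Int_commute[of ?U])
  have sm: "smooth_on (cimg c (V \<inter> ?U)) (\<lambda>y. ?g i l (cinv c y))" "smooth_on (cimg c (V \<inter> ?U)) (\<lambda>y. ?h l j (cinv c y))"
    if "l < r" "c \<in> A" for l c
    using g[OF that(1)] h[OF that(1)] that(2) by (simp_all add: smooth_fun_def)
  have one: "one_form (cimg c (V \<inter> ?U)) (dext (\<lambda>y. scal (?h l j (cinv c y))))" if "l < r" "c \<in> A" for l c
    by (rule one_form_dscal[OF open_cimg[OF that(2) VU] sm(2)[OF that]])
  have 1: "smooth_field (cimg c V) (flat_term r E V e n i j c)" if c: "c \<in> A" for c
    unfolding smooth_field_def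
  proof (intro allI smooth_on_locally)
    fix ws z assume z: "z \<in> cimg c V"
    show "\<exists>T. z \<in> T \<and> smooth_on T (\<lambda>y. app (flat_term r E V e n i j c y) ws)"
    proof (cases "cinv c z \<in> ?U")
      case True
      let ?T = "cimg c (V \<inter> ?U)"
      note op = open_cimg[OF c VU]
      have rho: "smooth_on ?T (\<lambda>y. \<rho> n (cinv c y))"
        using rho_smooth[of n] c unfolding smooth_fun_def by (blast intro: smooth_on_subset)
      have "smooth_field ?T (\<lambda>y. scal (\<rho> n (cinv c y)) * (\<Sum>l<r. scal (?g i l (cinv c y)) * dext (\<lambda>y. scal (?h l j (cinv c y))) y))"
        by (intro smooth_field_mult[OF op] smooth_field_scal smooth_field_sum[OF op] rho sm(1)[OF _ c] one_formD(1)[OF one[OF _ c]]; simp)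
      then have "smooth_field ?T (flat_term r E V e n i j c)"
        by (rule smooth_field_cong[OF op, rotated]) (use cimgD(2)[OF c, of _ "V \<inter> ?U"] in \<open>simp add: flat_term_def\<close>)
      then have "smooth_on ?T (\<lambda>y. app (flat_term r E V e n i j c y) ws)" by (simp add: smooth_field_def)
      moreover have "z \<in> ?T" using cimg_iff[OF c z, of "V \<inter> ?U"] cimgD(2)[OF c z] True by simp
          ultimately show ?thesis by (intro exI conjI)
    next
      case False
      \<comment> \<open>Frame changes to the \<open>n\<close>-th chart mean nothing here. But
        \<open>K n\<close> is closed and contained in that chart, and off \<open>K n\<close> the
        summand is identically 0.\<close>
      let ?T = "cimg c (- K n)"
      have "smooth_on ?T (\<lambda>y. app (flat_term r E V e n i j c y) ws)"
      proof (rule smooth_on_cong[OF open_cimg[OF c open_Compl[OF K_closed]] _ smooth_on_const[of _ 0]])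
        fix y assume "y \<in> ?T"
        then have "cinv c y \<notin> K n" using cimgD(2)[OF c, of y "- K n"] by simp
        then show "0 = app (flat_term r E V e n i j c y) ws" by (simp add: flat_term_zero[OF rho_zero])
      qed
      moreover have "z \<in> ?T" using cimg_iff[OF c z, of "- K n"] False K_sub[of n] by blast
      ultimately show ?thesis by (intro exI conjI)
    qed
  qed
  have 2: "tensor_at (flat_term r E V e n i j c z) \<and> (length vs \<noteq> 1 \<longrightarrow> app (flat_term r E V e n i j c z) vs = 0)"
    if c: "c \<in> A" and z: "z \<in> cimg c V" for c z vs
  proof (cases "cinv c z \<in> ?U")
    case True
    have zT: "z \<in> cimg c (V \<inter> ?U)" using cimg_iff[OF c z, of "V \<inter> ?U"] cimgD(2)[OF c z] True by simp
    show ?thesis unfolding flat_term_def using True one_formD(2,3)[OF one[OF _ c] zT]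
      by (auto intro!: tensor_at_simps(2,4) tensor_at_sum simp: app_scal_mult)
  qed (simp add: flat_term_def tensor_at_simps)
  have 3: "flat_term r E V e n i j c z = pull (vec_deriv (trans_map c d) z) (flat_term r E V e n i j d (trans_map c d z))"
    if "c \<in> A" "d \<in> A" "z \<in> cimg c (fst d \<inter> V)" for c d z
  proof (cases "cinv c z \<in> ?U")
    case True
    have zV: "z \<in> cimg c V" using that(3) by blast
    have "z \<in> cimg c (fst d \<inter> (V \<inter> ?U))"
      using cimg_iff[OF that(1,3), of "fst d \<inter> (V \<inter> ?U)"] cimgD(2)[OF that(1,3)] True by simp
    note p = dscal_pull[OF VU h that(1,2) this]
    show ?thesis unfolding flat_term_def trans_mapD(2)[OF that] using True by (simp add: pull_simps pull_sum p)
  qed (simp add: flat_term_def trans_mapD(2)[OF that] pull_simps)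
  show "form_of (flat_term r E V e n i j) \<in> forms A V"
    by (rule formsI; unfold at_pt_fun; (rule 1 2[THEN conjunct1] 3; assumption))
  show "c \<in> A \<Longrightarrow> z \<in> cimg c V \<Longrightarrow> length vs \<noteq> 1 \<Longrightarrow> app (flat_term r E V e n i j c z) vs = 0"
    by (rule 2[THEN conjunct2, rule_format])
qed

lemma part_conn_form:
  assumes e: "local_frame A F r V e" and ij: "i < r" "j < r"
  shows "part_conn r E V e i j \<in> forms A V" "has_degree A V 1 (part_conn r E V e i j)"
proof -
  note t = flat_term_form[OF e ij]
  note f = formsD[OF t(1), unfolded at_pt_fun]
  show "part_conn r E V e i j \<in> forms A V"
    unfolding part_conn_def
  proof (rule formsI; unfold at_pt_fun)
    fix c assume c: "c \<in> A"
    show "smooth_field (cimg c V) (\<lambda>z. \<Sum>n\<le>lastN (cinv c z). flat_term r E V e n i j c z)"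
      unfolding smooth_field_def
    proof (intro allI smooth_on_locally)
      fix ws z assume z: "z \<in> cimg c V"
      let ?N = "lastN (cinv c z)"
      let ?T = "cimg c (V \<inter> W ?N)"
      have op: "open ?T" by (intro open_cimg[OF c] open_Int local_frame_open[OF e] W_open)
      have "smooth_field ?T (\<lambda>z. \<Sum>n\<le>?N. flat_term r E V e n i j c z)"
        by (intro smooth_field_sum[OF op] smooth_field_subset[OF f(1)[OF c]]) blast
      then have "smooth_field ?T (\<lambda>z. \<Sum>n\<le>lastN (cinv c z). flat_term r E V e n i j c z)"
      proof (rule smooth_field_cong[OF op, rotated])
        fix y assume "y \<in> ?T"
        then have "cinv c y \<in> W ?N" using cimgD(2)[OF c, of y "V \<inter> W ?N"] by simp
        from rho_sum_extend[OF this flat_term_zero, symmetric]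
        show "(\<Sum>n\<le>?N. flat_term r E V e n i j c y) = (\<Sum>n\<le>lastN (cinv c y). flat_term r E V e n i j c y)" by simp
      qed
      then have "smooth_on ?T (\<lambda>y. app (\<Sum>n\<le>lastN (cinv c y). flat_term r E V e n i j c y) ws)" by (simp only: smooth_field_def)
      moreover have "z \<in> ?T" using cimg_iff[OF c z, of "V \<inter> W ?N"] cimgD(2)[OF c z] lastN by simp
      ultimately show "\<exists>T. z \<in> T \<and> smooth_on T (\<lambda>y. app (\<Sum>n\<le>lastN (cinv c y). flat_term r E V e n i j c y) ws)" by (intro exI conjI)
    qed
    show "tensor_at (\<Sum>n\<le>lastN (cinv c z). flat_term r E V e n i j c z)" if "z \<in> cimg c V" for z
      by (intro tensor_at_sum f(2)[OF c that])
  next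
    fix c d z assume *: "c \<in> A" "d \<in> A" "z \<in> cimg c (fst d \<inter> V)"
    show "(\<Sum>n\<le>lastN (cinv c z). flat_term r E V e n i j c z)
      = pull (vec_deriv (trans_map c d) z) (\<Sum>n\<le>lastN (cinv d (trans_map c d z)). flat_term r E V e n i j d (trans_map c d z))"
      unfolding pull_sum trans_mapD(2)[OF *] by (intro sum.cong refl f(3)[OF *])
  qed
  show "has_degree A V 1 (part_conn r E V e i j)"
    unfolding has_degree_iff part_conn_def at_pt_fun by (intro ballI allI impI) (simp add: t(2))
qed

text \<open>Each summand obeys the transformation law with \<open>dg\<close> multiplied by
  \<open>\<rho> n\<close>. The factors add up to 1, so the sum obeys the law of a
  connection.\<close>

lemma part_conn_law:
  assumes e: "local_frame A F r V e" and e': "local_frame A F r V' e'" and g: "changes r V e r V' e' g"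
    and c: "c \<in> A" and z: "z \<in> cimg c (V \<inter> V')" and ij: "i < r" "j < r"
  shows "(\<Sum>l<r. g i l (cinv c z) * app (at_pt (part_conn r E V' e' l j) c z) [v]) =
    dir_deriv (\<lambda>y. g i j (cinv c y)) v z + (\<Sum>l<r. app (at_pt (part_conn r E V e i l) c z) [v] * g l j (cinv c z))"
proof -
  let ?x = "cinv c z"
  let ?t = "\<lambda>V e n i j. app (flat_term r E V e n i j c z) [v]"
  have x: "?x \<in> V" "?x \<in> V'" using cimgD(2)[OF c z] by simp_all
  have main: "(\<Sum>l<r. g i l ?x * ?t V' e' n l j) = \<rho> n ?x * dir_deriv (\<lambda>y. g i j (cinv c y)) v z + (\<Sum>l<r. ?t V e n i l * g l j ?x)" for n
  proof (cases "?x \<in> fst (C n)")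
    case False
    then have "\<rho> n ?x = 0" using rho_zero K_sub[of n] by blast
    then show ?thesis by (simp add: flat_term_zero)
  next
    case True
    let ?U = "fst (C n)"
    note En = frames[OF C[of n]]
    let ?G = "trans_to r E V e n" and ?H = "trans_from r E V e n" and ?G' = "trans_to r E V' e' n" and ?H' = "trans_from r E V' e' n"
    let ?D = "\<lambda>f. dir_deriv (\<lambda>y. f (cinv c y)) v z"
    have "open (V \<inter> V' \<inter> ?U)" by (intro open_Int local_frame_open[OF e] local_frame_open[OF e'] local_frame_open[OF En])
    note op = open_cimg[OF c this]
    have zS: "z \<in> cimg c (V \<inter> V' \<inter> ?U)" using cimg_iff[OF c z, of "V \<inter> V' \<inter> ?U"] x True by simp
    have G: "(\<Sum>l<r. g i l ?x * ?G' l m ?x) = ?G i m ?x" if "m < r" for m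
      by (rule changes_compose[OF e e' En g trans_to[OF e'] trans_to[OF e] x True ij(1) that])
    have GH: "(\<Sum>m<r. ?G i m ?x * ?H m p ?x) = (if i = p then 1 else 0)" if "p < r" for p
      by (rule changes_inverse[OF e En trans_to[OF e] trans_from[OF e] x(1) True ij(1) that])
    have H: "?H' m j (cinv c y) = (\<Sum>p<r. ?H m p (cinv c y) * g p j (cinv c y))" if "m < r" "y \<in> cimg c (V \<inter> V' \<inter> ?U)" for m y
    proof -
      have y: "cinv c y \<in> ?U" "cinv c y \<in> V" "cinv c y \<in> V'" using cimgD(2)[OF c that(2)] by simp_all
      show ?thesis by (rule changes_compose[OF En e e' trans_from[OF e] g trans_from[OF e'] y that(1) ij(2), symmetric])
    qed
    have dg: "(\<lambda>y. g p j (cinv c y)) differentiable at z" if "p < r" for p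
    proof (rule holo_onD(1)[OF _ z])
      have "holo_fun A (V \<inter> V') (g p j)" using g that ij unfolding changes_def by simp
      then show "holo_on (\<lambda>y. g p j (cinv c y)) (cimg c (V \<inter> V'))" by (rule holo_funD[OF _ c])
    qed
    have dH: "(\<lambda>y. ?H m p (cinv c y)) differentiable at z" if "m < r" "p < r" for m p
    proof (rule holo_onD(1))
      have "holo_fun A (?U \<inter> V) (?H m p)" using trans_from[OF e, of n] that unfolding changes_def by simp
      then show "holo_on (\<lambda>y. ?H m p (cinv c y)) (cimg c (?U \<inter> V))" by (rule holo_funD[OF _ c])
      show "z \<in> cimg c (?U \<inter> V)" using zS by blast
    qed
    have DH: "?D (?H' m j) = (\<Sum>p<r. ?D (?H m p) * g p j ?x + ?H m p ?x * ?D (g p j))" if "m < r" for m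
    proof -
      have "frechet_derivative (\<lambda>y. ?H' m j (cinv c y)) (at z) = frechet_derivative (\<lambda>y. \<Sum>p<r. ?H m p (cinv c y) * g p j (cinv c y)) (at z)"
        by (rule frechet_derivative_cong_open[OF op zS H[OF that]])
      then have "?D (?H' m j) = dir_deriv (\<lambda>y. \<Sum>p<r. ?H m p (cinv c y) * g p j (cinv c y)) v z" by (rule fun_cong)
      also have "\<dots> = (\<Sum>p<r. dir_deriv (\<lambda>y. ?H m p (cinv c y) * g p j (cinv c y)) v z)"
        by (rule dir_deriv_sum) (simp add: differentiable_mult dH[OF that] dg)
      also have "\<dots> = (\<Sum>p<r. ?D (?H m p) * g p j ?x + ?H m p ?x * ?D (g p j))"
        by (intro sum.cong refl) (simp add: dir_deriv_mult[OF dH[OF that] dg])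
      finally show ?thesis .
    qed
    have t: "?t V e n i j = \<rho> n ?x * (\<Sum>m<r. trans_to r E V e n i m ?x * ?D (trans_from r E V e n m j))" for V e i j
      using True by (simp add: flat_term_def app_scal_mult app_dext_scal(1))
    have "(\<Sum>l<r. g i l ?x * ?t V' e' n l j) = \<rho> n ?x * (\<Sum>l<r. \<Sum>m<r. g i l ?x * ?G' l m ?x * ?D (?H' m j))"
      unfolding t by (simp add: sum_distrib_left mult_ac)
    also have "(\<Sum>l<r. \<Sum>m<r. g i l ?x * ?G' l m ?x * ?D (?H' m j)) = (\<Sum>m<r. \<Sum>l<r. g i l ?x * ?G' l m ?x * ?D (?H' m j))"
      by (rule sum.swap)
    also have "\<dots> = (\<Sum>m<r. ?G i m ?x * ?D (?H' m j))"
      by (simp add: G flip: sum_distrib_right)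
    also have "\<dots> = (\<Sum>m<r. \<Sum>p<r. ?G i m ?x * ?D (?H m p) * g p j ?x + ?G i m ?x * ?H m p ?x * ?D (g p j))"
      by (simp add: DH sum_distrib_left distrib_left mult.assoc)
    also have "\<dots> = (\<Sum>p<r. \<Sum>m<r. ?G i m ?x * ?D (?H m p) * g p j ?x + ?G i m ?x * ?H m p ?x * ?D (g p j))"
      by (rule sum.swap)
    also have "\<dots> = (\<Sum>p<r. (\<Sum>m<r. ?G i m ?x * ?D (?H m p)) * g p j ?x) + (\<Sum>p<r. (\<Sum>m<r. ?G i m ?x * ?H m p ?x) * ?D (g p j))"
      by (simp add: sum.distrib sum_distrib_right)
    also have "(\<Sum>p<r. (\<Sum>m<r. ?G i m ?x * ?H m p ?x) * ?D (g p j)) = (\<Sum>p<r. if i = p then ?D (g p j) else 0)"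
      by (intro sum.cong refl) (simp add: GH)
    also have "\<dots> = ?D (g i j)" using ij(1) by simp
    finally show ?thesis unfolding t by (simp add: sum_distrib_left sum_distrib_right distrib_left mult_ac)
  qed
  have s: "app (at_pt (part_conn r E V e i j) c z) [v] = (\<Sum>n\<le>lastN ?x. ?t V e n i j)" for V e i j
    by (simp add: part_conn_def)
  have "(\<Sum>l<r. g i l ?x * (\<Sum>n\<le>lastN ?x. ?t V' e' n l j)) = (\<Sum>n\<le>lastN ?x. \<Sum>l<r. g i l ?x * ?t V' e' n l j)"
    unfolding sum_distrib_left by (rule sum.swap)
  also have "\<dots> = (\<Sum>n\<le>lastN ?x. \<rho> n ?x) * dir_deriv (\<lambda>y. g i j (cinv c y)) v z + (\<Sum>n\<le>lastN ?x. \<Sum>l<r. ?t V e n i l * g l j ?x)"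
    unfolding main sum.distrib by (simp add: sum_distrib_right)
  also have "(\<Sum>n\<le>lastN ?x. \<Sum>l<r. ?t V e n i l * g l j ?x) = (\<Sum>l<r. (\<Sum>n\<le>lastN ?x. ?t V e n i l) * g l j ?x)"
    unfolding sum_distrib_right by (rule sum.swap)
  finally show ?thesis unfolding s rho_sum[OF lastN] by simp
qed

lemma part_conn: "connection A F r (part_conn r E)"
  unfolding connection_def
proof (intro conjI allI impI)
  fix V e i j assume "local_frame A F r V e" "i < r" "j < r"
  then show "part_conn r E V e i j \<in> forms A V" "has_degree A V 1 (part_conn r E V e i j)" by (rule part_conn_form)+
next
  fix V e V' e' g
  assume *: "local_frame A F r V e \<and> local_frame A F r V' e' \<and> (\<forall>i<r. \<forall>j<r. holo_fun A (V \<inter> V') (g i j)) \<and>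
    (\<forall>x\<in>V \<inter> V'. \<forall>j<r. \<forall>t. e' j x t = (\<Sum>i<r. g i j x * e i x t))"
  then have g: "changes r V e r V' e' g" by (simp add: changes_def)
  show "\<forall>(U, \<phi>)\<in>A. \<forall>z\<in>\<phi> ` (U \<inter> V \<inter> V'). \<forall>v. \<forall>i<r. \<forall>j<r.
      (\<Sum>l<r. g i l (inv_into U \<phi> z) * part_conn r E V' e' l j (U, \<phi>) z [v]) =
      frechet_derivative (\<lambda>y. g i j (inv_into U \<phi> y)) (at z) v + (\<Sum>l<r. part_conn r E V e i l (U, \<phi>) z [v] * g l j (inv_into U \<phi> z))"
    unfolding case_prod_unfold prod.collapse Int_assoc
    using part_conn_law[OF _ _ g] * by (simp only: app_at_pt) blast
qed

end

end

section \<open>Jet polynomials\<close>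

definition jmono :: "nat \<Rightarrow> expo \<Rightarrow> jvec \<Rightarrow> complex" where
  "jmono k K v = (\<Prod>p=1..k. \<Prod>i\<in>UNIV. v p i ^ K p i)"

lemma jmono_cong: "(\<And>p i. p \<in> {1..k} \<Longrightarrow> v p i = w p i) \<Longrightarrow> jmono k K v = jmono k K w"
  unfolding jmono_def by (intro prod.cong refl) simp

lemma jmono_add: "jmono k (\<lambda>p i. K p i + L p i) v = jmono k K v * jmono k L v"
  by (simp add: jmono_def power_add prod.distrib)

definition wt :: "nat \<Rightarrow> expo \<Rightarrow> nat" where
  "wt k K = (\<Sum>p=1..k. p * (\<Sum>i\<in>UNIV. K p i))"

definition sq :: "nat \<Rightarrow> expo \<Rightarrow> int" where
  "sq k K = (\<Sum>p=1..k. int (p * p) * (\<Sum>i\<in>UNIV. int (K p i)))"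

lemma wt_sq_add: "wt k (\<lambda>p i. K p i + L p i) = wt k K + wt k L" "sq k (\<lambda>p i. K p i + L p i) = sq k K + sq k L"
  by (simp_all add: wt_def sq_def sum.distrib distrib_left)

lemma jet_exponents_iff: "K \<in> jet_exponents k m \<longleftrightarrow> (\<forall>p. p \<notin> {1..k} \<longrightarrow> K p = (\<lambda>i. 0)) \<and> wt k K = m"
  by (simp add: jet_exponents_def wt_def)

lemma le_wt: "p \<in> {1..k} \<Longrightarrow> K p i \<le> wt k K"
proof -
  assume p: "p \<in> {1..k}"
  have "K p i \<le> (\<Sum>i\<in>UNIV. K p i)" by (rule member_le_sum) simp_all
  also have "\<dots> \<le> p * (\<Sum>i\<in>UNIV. K p i)" using p by simp
  also have "\<dots> \<le> wt k K" unfolding wt_def by (rule member_le_sum[of p "{1..k}" "\<lambda>p. p * (\<Sum>i\<in>UNIV. K p i)"]) (use p in simp_all)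
  finally show ?thesis .
qed

lemma finite_jet_exponents: "finite (jet_exponents k m)"
proof -
  define B where "B = {f :: 2 \<Rightarrow> nat. \<forall>i. (i \<in> UNIV \<longrightarrow> f i \<in> {..m}) \<and> (i \<notin> UNIV \<longrightarrow> f i = 0)}"
  have "finite B" unfolding B_def by (rule finite_set_of_finite_funs) simp_all
  then have "finite {K. \<forall>p. (p \<in> {1..k} \<longrightarrow> K p \<in> B) \<and> (p \<notin> {1..k} \<longrightarrow> K p = (\<lambda>i. 0))}"
    by (intro finite_set_of_finite_funs) simp_all
  moreover have "jet_exponents k m \<subseteq> {K. \<forall>p. (p \<in> {1..k} \<longrightarrow> K p \<in> B) \<and> (p \<notin> {1..k} \<longrightarrow> K p = (\<lambda>i. 0))}"
    using le_wt[of _ k] by (auto simp: jet_exponents_iff B_def)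
  ultimately show ?thesis by (rule rev_finite_subset)
qed

section \<open>Linear independence of jet monomials\<close>

lemma digits_unique:
  fixes c :: "nat \<Rightarrow> nat"
  assumes "\<And>j. c j < B" "\<And>j. d j < B" "(\<Sum>j<n. c j * B ^ j) = (\<Sum>j<n. d j * B ^ j)" "j < n"
  shows "c j = d j"
  using assms
proof (induction n arbitrary: c d j)
  case (Suc n)
  have e: "(\<Sum>j<Suc n. c j * B ^ j) = c 0 + B * (\<Sum>j<n. c (Suc j) * B ^ j)" for c
    by (simp add: sum.lessThan_Suc_shift sum_distrib_left mult_ac del: sum.lessThan_Suc)
  have *: "c 0 + B * (\<Sum>j<n. c (Suc j) * B ^ j) = d 0 + B * (\<Sum>j<n. d (Suc j) * B ^ j)"
    using Suc.prems(3) unfolding e .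
  have B: "B > 0" using Suc.prems(1)[of 0] by simp
  have 0: "c 0 = d 0"
    using arg_cong[OF *, of "\<lambda>x. x mod B"] by (simp only: mod_mult_self2 mod_less[OF Suc.prems(1)] mod_less[OF Suc.prems(2)])
  have S: "(\<Sum>j<n. c (Suc j) * B ^ j) = (\<Sum>j<n. d (Suc j) * B ^ j)" using * B unfolding 0 by simp
  have "c (Suc j) = d (Suc j)" if "j < n" for j
    by (rule Suc.IH[of "\<lambda>j. c (Suc j)" "\<lambda>j. d (Suc j)", OF Suc.prems(1,2) S that])
  then show ?case using 0 Suc.prems(4) by (cases j) simp_all
qed simp

text \<open>Kronecker substitution: for a large base \<open>B\<close> the monomials become distinct powers of one variable.\<close>

lemma jmono_independent:
  assumes "\<And>v. (\<Sum>K\<in>jet_exponents k m. a K * jmono k K v) = 0" and K: "K \<in> jet_exponents k m"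
  shows "a K = 0"
proof -
  \<comment> \<open>An exponent is at most the weight, hence a digit in base \<open>m + 1\<close>.
    The exponents of the two coordinates form a pair of digits, and the order of the derivative
    selects the power of \<open>B * B\<close>.\<close>
  define B where "B = Suc m"
  define \<beta> :: "2 \<Rightarrow> nat" where "\<beta> i = (if i = 1 then 1 else B)" for i
  define N where "N K = (\<Sum>p=1..k. \<Sum>i\<in>UNIV. \<beta> i * (B * B) ^ (p - 1) * K p i)" for K :: "nat \<Rightarrow> 2 \<Rightarrow> nat"
  have lt: "K p i < B" if "K \<in> jet_exponents k m" for K p i
  proof (cases "p \<in> {1..k}")
    case True
    then show ?thesis using le_wt[of p k K i] that by (simp add: jet_exponents_iff B_def)
  qed (use that in \<open>simp add: jet_exponents_iff B_def\<close>)
  have N: "N K = (\<Sum>j<k. (K (Suc j) 1 + K (Suc j) 2 * B) * (B * B) ^ j)" for K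
  proof -
    have "N K = (\<Sum>j<k. \<Sum>i\<in>UNIV. \<beta> i * (B * B) ^ j * K (Suc j) i)"
      unfolding N_def by (rule sum.reindex_bij_witness[of _ Suc "\<lambda>p. p - 1"]) auto
    then show ?thesis by (simp add: UNIV_2 \<beta>_def algebra_simps)
  qed
  have inj: "inj_on N (jet_exponents k m)"
  proof (rule inj_onI)
    fix K L assume *: "K \<in> jet_exponents k m" "L \<in> jet_exponents k m" "N K = N L"
    have bd: "K (Suc j) 1 + K (Suc j) 2 * B < B * B" if "K \<in> jet_exponents k m" for K j
    proof -
      have "K (Suc j) 1 + K (Suc j) 2 * B < B + K (Suc j) 2 * B" using lt[OF that] by simp
      also have "\<dots> = Suc (K (Suc j) 2) * B" by simp
      also have "\<dots> \<le> B * B" using lt[OF that, of "Suc j" 2] by (intro mult_right_mono) simp_all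
      finally show ?thesis .
    qed
    have e: "K (Suc j) 1 + K (Suc j) 2 * B = L (Suc j) 1 + L (Suc j) 2 * B" if "j < k" for j
      
      using *(3) unfolding N
      by (intro digits_unique[where n = k and c = "\<lambda>j. K (Suc j) 1 + K (Suc j) 2 * B" and d = "\<lambda>j. L (Suc j) 1 + L (Suc j) 2 * B" and B = "B * B",
            OF _ _ _ that]) (rule bd *(1,2) | assumption)+
    have 1: "K (Suc j) i = L (Suc j) i" if "j < k" for i j
    proof -
      have "K (Suc j) 1 = L (Suc j) 1"
        using arg_cong[OF e[OF that], of "\<lambda>x. x mod B"] lt[OF *(1)] lt[OF *(2)] by simp
      moreover from this have "K (Suc j) 2 = L (Suc j) 2" using e[OF that] lt[OF *(1), of 0 1] by simp
      ultimately show ?thesis by (metis exhaust_2)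
    qed
    have 2: "K p = L p" if "p \<notin> {1..k}" for p using *(1,2) that by (simp add: jet_exponents_iff)
    show "K = L"
    proof (intro ext)
      fix p i show "K p i = L p i"
      proof (cases "p \<in> {1..k}")
        case True
        then obtain j where "p = Suc j" "j < k" by (cases p) auto
        then show ?thesis using 1 by simp
      qed (simp add: 2)
    qed
  qed
  define M where "M = Max (N ` jet_exponents k m)"
  have NM: "N K \<le> M" if "K \<in> jet_exponents k m" for K
    unfolding M_def using finite_jet_exponents that by (intro Max_ge) simp_all
  define c where "c n = (\<Sum>K | K \<in> jet_exponents k m \<and> N K = n. a K)" for n
  have zero: "(\<Sum>n\<le>M. c n * t ^ n) = 0" for t :: complex
  proof -
    have "(\<Sum>n\<le>M. c n * t ^ n) = (\<Sum>n\<le>M. \<Sum>K | K \<in> jet_exponents k m \<and> N K = n. a K * t ^ N K)"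
      by (simp add: c_def sum_distrib_right)
    also have "\<dots> = (\<Sum>K\<in>jet_exponents k m. a K * t ^ N K)"
      by (rule sum.group) (use NM in \<open>auto simp: finite_jet_exponents\<close>)
    also have "\<dots> = (\<Sum>K\<in>jet_exponents k m. a K * jmono k K (\<lambda>p i. t ^ (\<beta> i * (B * B) ^ (p - 1))))"
      by (simp only: jmono_def N_def power_sum power_mult)
    finally show ?thesis by (simp only: assms(1))
  qed
  have "\<forall>n\<le>M. c n = 0" by (rule iffD1[OF polyfun_eq_0], rule allI, rule zero)
  from this[rule_format, OF NM[OF K]] have "c (N K) = 0" .
  moreover have "{L. L \<in> jet_exponents k m \<and> N L = N K} = {K}" using inj_on_eq_iff[OF inj _ K] K by blast
  ultimately show ?thesis by (simp add: c_def)
qed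


subsection \<open>Polynomials in the jet coordinates with holomorphic coefficients\<close>

text \<open>Weighted homogeneous of weight \<open>m\<close>; the last index bounds \<^const>\<open>sq\<close> on the monomials that occur. It is
  an integer so that the zero polynomial is the only one of negative bound.\<close>

inductive jpoly :: "(complex ^ 2) set \<Rightarrow> nat \<Rightarrow> nat \<Rightarrow> int \<Rightarrow> (complex ^ 2 \<Rightarrow> jvec \<Rightarrow> complex) \<Rightarrow> bool"
  for S k where
  jpoly_zero: "jpoly S k m w (\<lambda>z v. 0)"
| jpoly_coeff: "holo_on a S \<Longrightarrow> jpoly S k 0 0 (\<lambda>z v. a z)"
| jpoly_var: "p \<in> {1..k} \<Longrightarrow> jpoly S k p (int (p * p)) (\<lambda>z v. v p i)"
| jpoly_add: "jpoly S k m w \<Phi> \<Longrightarrow> jpoly S k m w \<Psi> \<Longrightarrow> jpoly S k m w (\<lambda>z v. \<Phi> z v + \<Psi> z v)"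
| jpoly_mult: "jpoly S k m w \<Phi> \<Longrightarrow> jpoly S k n u \<Psi> \<Longrightarrow> jpoly S k (m + n) (w + u) (\<lambda>z v. \<Phi> z v * \<Psi> z v)"
| jpoly_weaken: "jpoly S k m w \<Phi> \<Longrightarrow> w \<le> u \<Longrightarrow> jpoly S k m u \<Phi>"

lemma jpoly_mono: "jpoly S k m w \<Phi> \<Longrightarrow> k \<le> l \<Longrightarrow> jpoly S l m w \<Phi>"
proof (induction rule: jpoly.induct)
  case (jpoly_var p i) then show ?case by (intro jpoly.jpoly_var) simp
next
  case (jpoly_weaken m w \<Phi> u) show ?case by (rule jpoly.jpoly_weaken[OF jpoly_weaken.IH[OF jpoly_weaken.prems] jpoly_weaken.hyps(2)])
next
  case (jpoly_add m w \<Phi> \<Psi>) show ?case by (rule jpoly.jpoly_add) (rule jpoly_add)+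
next
  case (jpoly_mult m w \<Phi> n u \<Psi>) show ?case by (rule jpoly.jpoly_mult) (rule jpoly_mult)+
qed (rule jpoly.jpoly_zero jpoly.jpoly_coeff; assumption?)+

lemma jpoly_scale: "holo_on a S \<Longrightarrow> jpoly S k m w \<Phi> \<Longrightarrow> jpoly S k m w (\<lambda>z v. a z * \<Phi> z v)"
  using jpoly_mult[OF jpoly_coeff, of a S k m w \<Phi>] by simp

lemma jpoly_sum: "(\<And>i. i \<in> I \<Longrightarrow> jpoly S k m w (\<Phi> i)) \<Longrightarrow> jpoly S k m w (\<lambda>z v. \<Sum>i\<in>I. \<Phi> i z v)"
  by (induction I rule: infinite_finite_induct) (simp_all add: jpoly_zero jpoly_add)

text \<open>The inductive rules serve to build polynomials. The normal form exposes the
  coefficients, with weight and bound turned into conditions on the monomials that occur.\<close>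

lemma jpoly_expand:
  assumes "jpoly S k m w \<Phi>"
  shows "\<exists>a. (\<forall>K. holo_on (a K) S) \<and> (\<forall>z v. \<Phi> z v = (\<Sum>K | K \<in> jet_exponents k m \<and> sq k K \<le> w. a K z * jmono k K v))"
    (is "?P m w \<Phi>")
  using assms
proof (induction rule: jpoly.induct)
  case (jpoly_zero m w)
  show ?case by (intro exI[of _ "\<lambda>K z. 0"] conjI allI holo_on_const) simp
next
  case (jpoly_coeff a)
  have "{K. K \<in> jet_exponents k 0 \<and> sq k K \<le> 0} = {\<lambda>p i. 0}"
  proof (intro equalityI subsetI)
    fix K assume "K \<in> {K. K \<in> jet_exponents k 0 \<and> sq k K \<le> 0}"
    then have K: "K \<in> jet_exponents k 0" by simp
    have "K p i = 0" for p i
      using le_wt[of p k K i] K by (cases "p \<in> {1..k}") (simp_all add: jet_exponents_iff)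
    then show "K \<in> {\<lambda>p i. 0}" by auto
  qed (simp add: jet_exponents_iff wt_def sq_def)
  then show ?case using jpoly_coeff by (intro exI[of _ "\<lambda>K. a"]) (simp add: jmono_def)
next
  case (jpoly_var p i)
  define L where "L q j = (if q = p \<and> j = i then 1 else 0 :: nat)" for q j
  have s: "(\<Sum>j\<in>UNIV. L q j) = (if q = p then 1 else 0)" for q by (simp add: L_def)
  then have s': "(\<Sum>j\<in>UNIV. int (L q j)) = (if q = p then 1 else 0)" for q using s[of q] by (simp flip: of_nat_sum)
  have L: "L \<in> {K. K \<in> jet_exponents k p \<and> sq k K \<le> int (p * p)}"
    unfolding jet_exponents_iff wt_def sq_def mem_Collect_eq s s' using jpoly_var
    by (auto simp: L_def if_distrib[of "\<lambda>x. _ * x"] cong: if_cong)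
  have "jmono k L v = v p i" for v
  proof -
    have "(\<Prod>j\<in>UNIV. v q j ^ L q j) = (if q = p then v p i else 1)" for q
      by (simp add: L_def if_distrib[of "\<lambda>x. _ ^ x"] cong: if_cong)
    then show ?thesis using jpoly_var by (simp add: jmono_def)
  qed
  moreover have "finite {K. K \<in> jet_exponents k p \<and> sq k K \<le> int (p * p)}" using finite_jet_exponents by simp
  ultimately have "v p i = (\<Sum>K | K \<in> jet_exponents k p \<and> sq k K \<le> int (p * p). (if K = L then 1 else 0) * jmono k K v)" for v
    using L by (simp add: if_distrib[of "\<lambda>x. x * _"] cong: if_cong)
  then show ?case by (intro exI[of _ "\<lambda>K z. if K = L then 1 else 0"] conjI allI holo_on_const)
next
  case (jpoly_add m w \<Phi> \<Psi>)
  obtain a where a: "\<forall>K. holo_on (a K) S" "\<forall>z v. \<Phi> z v = (\<Sum>K | K \<in> jet_exponents k m \<and> sq k K \<le> w. a K z * jmono k K v)"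
    using jpoly_add.IH(1) by (elim exE conjE)
  obtain b where b: "\<forall>K. holo_on (b K) S" "\<forall>z v. \<Psi> z v = (\<Sum>K | K \<in> jet_exponents k m \<and> sq k K \<le> w. b K z * jmono k K v)"
    using jpoly_add.IH(2) by (elim exE conjE)
  show ?case
  proof (intro exI[of _ "\<lambda>K z. a K z + b K z"] conjI allI)
    show "holo_on (\<lambda>z. a K z + b K z) S" for K by (rule holo_on_add) (rule a(1)[rule_format] b(1)[rule_format])+
    show "\<Phi> z v + \<Psi> z v = (\<Sum>K | K \<in> jet_exponents k m \<and> sq k K \<le> w. (a K z + b K z) * jmono k K v)" for z v
      unfolding a(2)[rule_format] b(2)[rule_format] by (simp only: distrib_right sum.distrib)
  qed
next
  case (jpoly_mult m w \<Phi> n u \<Psi>)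
  let ?E = "\<lambda>m w. {K. K \<in> jet_exponents k m \<and> sq k K \<le> w}"
  obtain a where a: "\<forall>K. holo_on (a K) S" "\<forall>z v. \<Phi> z v = (\<Sum>K\<in>?E m w. a K z * jmono k K v)"
    using jpoly_mult.IH(1) by (elim exE conjE)
  obtain b where b: "\<forall>K. holo_on (b K) S" "\<forall>z v. \<Psi> z v = (\<Sum>K\<in>?E n u. b K z * jmono k K v)"
    using jpoly_mult.IH(2) by (elim exE conjE)
  \<comment> \<open>Different pairs may have the same product, so the coefficient of a monomial
    collects all pairs with the given sum of exponents.\<close>
  define pl where "pl P = (\<lambda>p i. fst P p i + snd P p i)" for P :: "expo \<times> expo"
  have fin: "finite (?E m w)" for m w using finite_jet_exponents by simp
  have pl: "pl ` (?E m w \<times> ?E n u) \<subseteq> ?E (m + n) (w + u)"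
  proof
    fix x assume "x \<in> pl ` (?E m w \<times> ?E n u)"
    then obtain K L where x: "x = pl (K, L)" "K \<in> ?E m w" "L \<in> ?E n u" by blast
    have "wt k x = m + n" "sq k x \<le> w + u" unfolding x(1) pl_def fst_conv snd_conv wt_sq_add
      using x(2,3) by (simp_all add: jet_exponents_iff)
    moreover have "x p = (\<lambda>i. 0)" if "p \<notin> {1..k}" for p
      using x that by (simp add: pl_def jet_exponents_iff)
    ultimately show "x \<in> ?E (m + n) (w + u)" by (simp add: jet_exponents_iff)
  qed
  show ?case
  proof (intro exI[of _ "\<lambda>N z. \<Sum>P | P \<in> ?E m w \<times> ?E n u \<and> pl P = N. a (fst P) z * b (snd P) z"] conjI allI)
    show "holo_on (\<lambda>z. \<Sum>P | P \<in> ?E m w \<times> ?E n u \<and> pl P = N. a (fst P) z * b (snd P) z) S" for N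
      by (intro holo_on_sum holo_on_mult) (rule a(1)[rule_format] b(1)[rule_format])+
    fix z v
    have "\<Phi> z v * \<Psi> z v = (\<Sum>P\<in>?E m w \<times> ?E n u. a (fst P) z * b (snd P) z * jmono k (pl P) v)"
      unfolding a(2)[rule_format] b(2)[rule_format] sum_product sum.cartesian_product
      by (intro sum.cong refl) (simp add: pl_def jmono_add mult_ac case_prod_unfold)
    also have "\<dots> = (\<Sum>N\<in>?E (m + n) (w + u). \<Sum>P | P \<in> ?E m w \<times> ?E n u \<and> pl P = N. a (fst P) z * b (snd P) z * jmono k (pl P) v)"
      by (rule sum.group[symmetric, OF finite_cartesian_product[OF fin fin] fin pl])
    also have "\<dots> = (\<Sum>N\<in>?E (m + n) (w + u). (\<Sum>P | P \<in> ?E m w \<times> ?E n u \<and> pl P = N. a (fst P) z * b (snd P) z) * jmono k N v)"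
      unfolding sum_distrib_right by (intro sum.cong refl) simp
    finally show "\<Phi> z v * \<Psi> z v = (\<Sum>N\<in>?E (m + n) (w + u). (\<Sum>P | P \<in> ?E m w \<times> ?E n u \<and> pl P = N. a (fst P) z * b (snd P) z) * jmono k N v)" .
  qed
next
  case (jpoly_weaken m w \<Phi> u)
  obtain a where a: "\<forall>K. holo_on (a K) S" "\<forall>z v. \<Phi> z v = (\<Sum>K | K \<in> jet_exponents k m \<and> sq k K \<le> w. a K z * jmono k K v)"
    using jpoly_weaken.IH by (elim exE conjE)
  show ?case
  proof (intro exI[of _ "\<lambda>K z. if sq k K \<le> w then a K z else 0"] conjI allI)
    show "holo_on (\<lambda>z. if sq k K \<le> w then a K z else 0) S" for K
      by (cases "sq k K \<le> w") (simp_all only: if_True if_False a(1)[rule_format] holo_on_const)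
    show "\<Phi> z v = (\<Sum>K | K \<in> jet_exponents k m \<and> sq k K \<le> u. (if sq k K \<le> w then a K z else 0) * jmono k K v)" for z v
      unfolding a(2)[rule_format]
      by (rule sum.mono_neutral_cong_left) (use finite_jet_exponents jpoly_weaken.hyps in auto)
  qed
qed

subsection \<open>Derivatives along curves\<close>

definition jet_of :: "(complex \<Rightarrow> complex ^ 2) \<Rightarrow> complex \<Rightarrow> nat \<Rightarrow> 2 \<Rightarrow> complex" where
  "jet_of \<gamma> t p i = (deriv ^^ p) (\<lambda>t. \<gamma> t $ i) t"

definition curve_in :: "(complex ^ 2) set \<Rightarrow> complex set \<Rightarrow> (complex \<Rightarrow> complex ^ 2) \<Rightarrow> bool" where
  "curve_in S T \<gamma> \<longleftrightarrow> open T \<and> (\<forall>i. (\<lambda>t. \<gamma> t $ i) holomorphic_on T) \<and> (\<forall>t\<in>T. \<gamma> t \<in> S)"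

lemma jet_of_deriv:
  assumes "curve_in S T \<gamma>" "t \<in> T"
  shows "((\<lambda>t. jet_of \<gamma> t p i) has_field_derivative jet_of \<gamma> t (Suc p) i) (at t)"
proof -
  have "open T" "(\<lambda>t. \<gamma> t $ i) holomorphic_on T" using assms(1) by (simp_all add: curve_in_def)
  then have "(deriv ^^ p) (\<lambda>t. \<gamma> t $ i) holomorphic_on T" by (intro holomorphic_higher_deriv)
  from holomorphic_derivI[OF this \<open>open T\<close> assms(2)] show ?thesis by (simp add: jet_of_def)
qed

lemma holo_chain:
  assumes "holo_on f S" "\<gamma> t \<in> S" "\<And>i. ((\<lambda>t. \<gamma> t $ i) has_field_derivative v i) (at t)"
  shows "((\<lambda>t. f (\<gamma> t)) has_field_derivative (\<Sum>i\<in>UNIV. dir_deriv f (axis i 1) (\<gamma> t) * v i)) (at t)"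
proof -
  have "(\<gamma> has_derivative (\<lambda>h. \<chi> i. v i * h)) (at t)"
    by (rule has_derivative_vec) (use assms(3) in \<open>simp add: has_field_derivative_def\<close>)
  from diff_chain_at[OF this holo_onD(2)[OF assms(1,2)]]
  have "((\<lambda>t. f (\<gamma> t)) has_derivative (\<lambda>h. dir_deriv f (\<chi> i. v i * h) (\<gamma> t))) (at t)"
    by (simp add: o_def)
  moreover have "dir_deriv f (\<chi> i. v i * h) (\<gamma> t) = (\<Sum>i\<in>UNIV. dir_deriv f (axis i 1) (\<gamma> t) * v i) * h" for h
  proof -
    have lin: "linear (frechet_derivative f (at (\<gamma> t)))" by (rule linear_frechet_derivative[OF holo_onD(1)[OF assms(1,2)]])
    have "(\<chi> i. v i * h) = (\<Sum>i\<in>UNIV. (v i * h) *s axis i 1)"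
      by (simp add: vec_eq_iff axis_def if_distrib[of "\<lambda>x. _ * x"] cong: if_cong)
    also have "dir_deriv f \<dots> (\<gamma> t) = (\<Sum>i\<in>UNIV. (v i * h) * dir_deriv f (axis i 1) (\<gamma> t))"
      unfolding linear_sum[OF lin] holo_onD(3)[OF assms(1,2)] ..
    finally show ?thesis by (simp add: sum_distrib_left mult_ac)
  qed
  ultimately show ?thesis by (simp add: has_field_derivative_def)
qed

lemma curve_deriv:
  assumes "holo_on f S" "curve_in S T \<gamma>" "t \<in> T"
  shows "((\<lambda>t. f (\<gamma> t)) has_field_derivative (\<Sum>i\<in>UNIV. dir_deriv f (axis i 1) (\<gamma> t) * jet_of \<gamma> t 1 i)) (at t)"
proof (rule holo_chain[OF assms(1)])
  show "\<gamma> t \<in> S" using assms(2,3) by (simp add: curve_in_def)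
  show "((\<lambda>t. \<gamma> t $ i) has_field_derivative jet_of \<gamma> t 1 i) (at t)" for i
    using jet_of_deriv[OF assms(2,3), of 0 i] by (simp add: jet_of_def)
qed

text \<open>Raising a derivative of order \<open>p\<close> changes its square by
  \<open>2 * p + 1\<close>, and \<open>p\<close> is at most the weight \<open>m\<close>;
  differentiating a coefficient brings in a first derivative, which counts 1. Hence the increment
  \<open>2 * m + 1\<close>.\<close>

lemma jpoly_deriv:
  assumes "jpoly S k m w \<Phi>" "open S"
  shows "\<exists>\<Psi>. jpoly S (Suc k) (Suc m) (w + 2 * int m + 1) \<Psi> \<and>
    (\<forall>\<gamma> T t. curve_in S T \<gamma> \<longrightarrow> t \<in> T \<longrightarrow> ((\<lambda>t. \<Phi> (\<gamma> t) (jet_of \<gamma> t)) has_field_derivative \<Psi> (\<gamma> t) (jet_of \<gamma> t)) (at t))"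
    (is "\<exists>\<Psi>. _ \<and> ?D \<Phi> \<Psi>")
  using assms(1)
proof (induction rule: jpoly.induct)
  case (jpoly_zero m w)
  show ?case by (intro exI[of _ "\<lambda>z v. 0"] conjI allI impI jpoly.jpoly_zero DERIV_const)
next
  case (jpoly_coeff a)
  show ?case
  proof (intro exI[of _ "\<lambda>z v. \<Sum>i\<in>UNIV. dir_deriv a (axis i 1) z * v 1 i"] conjI allI impI)
    have "jpoly S (Suc k) 1 (int (1 * 1)) (\<lambda>z v. \<Sum>i\<in>UNIV. dir_deriv a (axis i 1) z * v 1 i)"
      by (intro jpoly_sum jpoly_scale holo_on_dir_deriv[OF assms(2) jpoly_coeff] jpoly_var) simp
    then show "jpoly S (Suc k) (Suc 0) (0 + 2 * int 0 + 1) (\<lambda>z v. \<Sum>i\<in>UNIV. dir_deriv a (axis i 1) z * v 1 i)" by simp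
  qed (rule curve_deriv[OF jpoly_coeff])
next
  case (jpoly_var p i)
  show ?case
  proof (intro exI[of _ "\<lambda>z v. v (Suc p) i"] conjI allI impI)
    have "jpoly S (Suc k) (Suc p) (int (Suc p * Suc p)) (\<lambda>z v. v (Suc p) i)" using jpoly_var by (intro jpoly.jpoly_var) simp
    then show "jpoly S (Suc k) (Suc p) (int (p * p) + 2 * int p + 1) (\<lambda>z v. v (Suc p) i)"
      by (rule jpoly_weaken) (simp add: algebra_simps)
  qed (rule jet_of_deriv)
next
  case (jpoly_add m w \<Phi> \<Psi>)
  obtain \<Phi>' where 1: "jpoly S (Suc k) (Suc m) (w + 2 * int m + 1) \<Phi>'" "?D \<Phi> \<Phi>'" using jpoly_add.IH(1) by (elim exE conjE)
  obtain \<Psi>' where 2: "jpoly S (Suc k) (Suc m) (w + 2 * int m + 1) \<Psi>'" "?D \<Psi> \<Psi>'" using jpoly_add.IH(2) by (elim exE conjE)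
  show ?case
    by (intro exI[of _ "\<lambda>z v. \<Phi>' z v + \<Psi>' z v"] conjI allI impI jpoly.jpoly_add[OF 1(1) 2(1)] DERIV_add)
      (rule 1(2)[rule_format] 2(2)[rule_format]; assumption)+
next
  case (jpoly_mult m w \<Phi> n u \<Psi>)
  obtain \<Phi>' where 1: "jpoly S (Suc k) (Suc m) (w + 2 * int m + 1) \<Phi>'" "?D \<Phi> \<Phi>'" using jpoly_mult.IH(1) by (elim exE conjE)
  obtain \<Psi>' where 2: "jpoly S (Suc k) (Suc n) (u + 2 * int n + 1) \<Psi>'" "?D \<Psi> \<Psi>'" using jpoly_mult.IH(2) by (elim exE conjE)
  note up = jpoly_mono[OF jpoly_mult.hyps(1), of "Suc k", simplified] jpoly_mono[OF jpoly_mult.hyps(2), of "Suc k", simplified]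
  show ?case
  proof (intro exI[of _ "\<lambda>z v. \<Phi>' z v * \<Psi> z v + \<Psi>' z v * \<Phi> z v"] conjI allI impI)
    have a: "jpoly S (Suc k) (Suc m + n) (w + u + 2 * int (m + n) + 1) (\<lambda>z v. \<Phi>' z v * \<Psi> z v)"
      by (rule jpoly_weaken[OF jpoly.jpoly_mult[OF 1(1) up(2)]]) simp
    have b: "jpoly S (Suc k) (Suc n + m) (w + u + 2 * int (m + n) + 1) (\<lambda>z v. \<Psi>' z v * \<Phi> z v)"
      by (rule jpoly_weaken[OF jpoly.jpoly_mult[OF 2(1) up(1)]]) simp
    show "jpoly S (Suc k) (Suc (m + n)) (w + u + 2 * int (m + n) + 1) (\<lambda>z v. \<Phi>' z v * \<Psi> z v + \<Psi>' z v * \<Phi> z v)"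
      by (rule jpoly.jpoly_add) (use a b in \<open>simp_all only: add.commute[of n m] add_Suc\<close>)
    show "((\<lambda>t. \<Phi> (\<gamma> t) (jet_of \<gamma> t) * \<Psi> (\<gamma> t) (jet_of \<gamma> t)) has_field_derivative
        \<Phi>' (\<gamma> t) (jet_of \<gamma> t) * \<Psi> (\<gamma> t) (jet_of \<gamma> t) + \<Psi>' (\<gamma> t) (jet_of \<gamma> t) * \<Phi> (\<gamma> t) (jet_of \<gamma> t)) (at t)"
      if "curve_in S T \<gamma>" "t \<in> T" for \<gamma> T t
      by (intro DERIV_mult 1(2)[rule_format, OF that] 2(2)[rule_format, OF that])
  qed
next
  case (jpoly_weaken m w \<Phi> u)
  obtain \<Phi>' where 1: "jpoly S (Suc k) (Suc m) (w + 2 * int m + 1) \<Phi>'" "?D \<Phi> \<Phi>'" using jpoly_weaken.IH by (elim exE conjE)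
  show ?case
    by (rule exI[of _ \<Phi>'], rule conjI[OF jpoly.jpoly_weaken[OF 1(1)] 1(2)]) (use jpoly_weaken.hyps in simp)
qed

text \<open>The highest derivative of the curve enters the \<open>p\<close>-th derivative of \<open>f \<circ> \<gamma>\<close> linearly; every other monomial
  has a smaller value of \<^const>\<open>sq\<close>.\<close>

lemma higher_chain:
  assumes f: "holo_on f S" and S: "open S"
  shows "\<exists>Q. jpoly S (Suc p) (Suc p) (int (Suc p * Suc p) - 1) Q \<and>
    (\<forall>\<gamma> T t. curve_in S T \<gamma> \<longrightarrow> t \<in> T \<longrightarrow>
      (deriv ^^ Suc p) (\<lambda>t. f (\<gamma> t)) t = (\<Sum>l\<in>UNIV. dir_deriv f (axis l 1) (\<gamma> t) * jet_of \<gamma> t (Suc p) l) + Q (\<gamma> t) (jet_of \<gamma> t))"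
proof (induction p)
  case 0
  show ?case
    by (intro exI[of _ "\<lambda>z v. 0"] conjI allI impI jpoly_zero)
      (simp add: DERIV_imp_deriv[OF curve_deriv[OF f]])
next
  case (Suc p)
  obtain Q where Q: "jpoly S (Suc p) (Suc p) (int (Suc p * Suc p) - 1) Q"
    and eq: "\<And>\<gamma> T t. curve_in S T \<gamma> \<Longrightarrow> t \<in> T \<Longrightarrow> (deriv ^^ Suc p) (\<lambda>t. f (\<gamma> t)) t
      = (\<Sum>l\<in>UNIV. dir_deriv f (axis l 1) (\<gamma> t) * jet_of \<gamma> t (Suc p) l) + Q (\<gamma> t) (jet_of \<gamma> t)"
    using Suc.IH by (elim exE conjE) (rule that, assumption, blast)
  obtain Q' where Q': "jpoly S (Suc (Suc p)) (Suc (Suc p)) (int (Suc p * Suc p) - 1 + 2 * int (Suc p) + 1) Q'"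
    and D: "\<And>\<gamma> T t. curve_in S T \<gamma> \<Longrightarrow> t \<in> T \<Longrightarrow>
      ((\<lambda>t. Q (\<gamma> t) (jet_of \<gamma> t)) has_field_derivative Q' (\<gamma> t) (jet_of \<gamma> t)) (at t)"
    using jpoly_deriv[OF Q S] by (elim exE conjE) (rule that, assumption, blast)
  \<comment> \<open>The terms in which the coefficient of the leading derivative is differentiated:
    a first derivative times one of order \<open>Suc p\<close>.\<close>
  define R where "R z v = (\<Sum>l\<in>UNIV. \<Sum>i\<in>UNIV. dir_deriv (dir_deriv f (axis l 1)) (axis i 1) z * (v 1 i * v (Suc p) l))"
    for z and v :: "nat \<Rightarrow> 2 \<Rightarrow> complex"
  \<comment> \<open>The second line is an equality, by the formula for consecutive squares; the
    first holds because these squares differ by at least 3.\<close>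
  have b: "int (1 * 1) + int (Suc p * Suc p) \<le> int (Suc (Suc p) * Suc (Suc p)) - 1"
    "int (Suc p * Suc p) - 1 + 2 * int (Suc p) + 1 \<le> int (Suc (Suc p) * Suc (Suc p)) - 1"
    by (simp_all add: algebra_simps)
  have "jpoly S (Suc (Suc p)) (1 + Suc p) (int (1 * 1) + int (Suc p * Suc p)) R"
    unfolding R_def[abs_def]
    by (intro jpoly_sum jpoly_scale jpoly_mult jpoly_var holo_on_dir_deriv S f) simp_all
  then have R: "jpoly S (Suc (Suc p)) (Suc (Suc p)) (int (Suc (Suc p) * Suc (Suc p)) - 1) R"
    unfolding plus_1_eq_Suc by (rule jpoly_weaken) (rule b(1))
  show ?case
  proof (intro exI[of _ "\<lambda>z v. R z v + Q' z v"] conjI allI impI jpoly_add R jpoly_weaken[OF Q' b(2)])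
    fix \<gamma> T t assume c: "curve_in S T \<gamma>" "t \<in> T"
    have T: "open T" using c(1) by (simp add: curve_in_def)
    have "((\<lambda>t. (\<Sum>l\<in>UNIV. dir_deriv f (axis l 1) (\<gamma> t) * jet_of \<gamma> t (Suc p) l) + Q (\<gamma> t) (jet_of \<gamma> t)) has_field_derivative
      (\<Sum>l\<in>UNIV. (\<Sum>i\<in>UNIV. dir_deriv (dir_deriv f (axis l 1)) (axis i 1) (\<gamma> t) * jet_of \<gamma> t 1 i) * jet_of \<gamma> t (Suc p) l
         + jet_of \<gamma> t (Suc (Suc p)) l * dir_deriv f (axis l 1) (\<gamma> t)) + Q' (\<gamma> t) (jet_of \<gamma> t)) (at t)"
      by (intro DERIV_add DERIV_sum DERIV_mult jet_of_deriv[OF c] curve_deriv[OF holo_on_dir_deriv[OF S f] c] D[OF c])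
    from DERIV_imp_deriv[OF has_field_derivative_transform_within_open[OF this T c(2), where g = "(deriv ^^ Suc p) (\<lambda>t. f (\<gamma> t))"]]
    have "deriv ((deriv ^^ Suc p) (\<lambda>t. f (\<gamma> t))) t = (\<Sum>l\<in>UNIV. (\<Sum>i\<in>UNIV. dir_deriv (dir_deriv f (axis l 1)) (axis i 1) (\<gamma> t) * jet_of \<gamma> t 1 i) * jet_of \<gamma> t (Suc p) l
         + jet_of \<gamma> t (Suc (Suc p)) l * dir_deriv f (axis l 1) (\<gamma> t)) + Q' (\<gamma> t) (jet_of \<gamma> t)"
      using eq[OF c(1)] by simp
    then show "(deriv ^^ Suc (Suc p)) (\<lambda>t. f (\<gamma> t)) t
        = (\<Sum>l\<in>UNIV. dir_deriv f (axis l 1) (\<gamma> t) * jet_of \<gamma> t (Suc (Suc p)) l) + (R (\<gamma> t) (jet_of \<gamma> t) + Q' (\<gamma> t) (jet_of \<gamma> t))"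
      unfolding R_def by (simp add: sum.distrib sum_distrib_left mult_ac)
  qed
qed

subsection \<open>Leading parts\<close>

text \<open>Equality up to a polynomial of smaller bound. The leading part must itself obey the
  bound \<open>w\<close>, so that its product with a remainder stays strictly below the sum of the
  bounds.\<close>

definition jlead :: "(complex ^ 2) set \<Rightarrow> nat \<Rightarrow> nat \<Rightarrow> int \<Rightarrow> (complex ^ 2 \<Rightarrow> jvec \<Rightarrow> complex)
    \<Rightarrow> (complex ^ 2 \<Rightarrow> jvec \<Rightarrow> complex) \<Rightarrow> bool" where
  "jlead S k m w \<Phi> \<Lambda> \<longleftrightarrow> jpoly S k m w \<Lambda> \<and> (\<exists>R. jpoly S k m (w - 1) R \<and> (\<forall>z v. \<Phi> z v = \<Lambda> z v + R z v))"

lemma jlead_one: "jlead S k 0 0 (\<lambda>z v. 1) (\<lambda>z v. 1)"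
  unfolding jlead_def by (intro conjI exI[of _ "\<lambda>z v. 0"] jpoly_zero jpoly_coeff[of "\<lambda>z. 1"] holo_on_const) simp

lemma jlead_mult:
  assumes "jlead S k m w \<Phi> \<Lambda>" "jlead S k n u \<Psi> M"
  shows "jlead S k (m + n) (w + u) (\<lambda>z v. \<Phi> z v * \<Psi> z v) (\<lambda>z v. \<Lambda> z v * M z v)"
proof -
  obtain R where R: "jpoly S k m (w - 1) R" "\<And>z v. \<Phi> z v = \<Lambda> z v + R z v" using assms(1) unfolding jlead_def by blast
  obtain R' where R': "jpoly S k n (u - 1) R'" "\<And>z v. \<Psi> z v = M z v + R' z v" using assms(2) unfolding jlead_def by blast
  have L: "jpoly S k m w \<Lambda>" "jpoly S k n u M" using assms by (simp_all add: jlead_def)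
  have "jpoly S k (m + n) (w + u - 1) (\<lambda>z v. \<Lambda> z v * R' z v)" "jpoly S k (m + n) (w + u - 1) (\<lambda>z v. R z v * M z v)"
    "jpoly S k (m + n) (w + u - 1) (\<lambda>z v. R z v * R' z v)"
    by (rule jpoly_weaken[OF jpoly_mult[OF L(1) R'(1)]] jpoly_weaken[OF jpoly_mult[OF R(1) L(2)]] jpoly_weaken[OF jpoly_mult[OF R(1) R'(1)]]; simp)+
  then have "jpoly S k (m + n) (w + u - 1) (\<lambda>z v. \<Lambda> z v * R' z v + R z v * M z v + R z v * R' z v)"
    by (intro jpoly_add)
  then show ?thesis unfolding jlead_def
    by (intro conjI exI[of _ "\<lambda>z v. \<Lambda> z v * R' z v + R z v * M z v + R z v * R' z v"] jpoly_mult L)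
      (simp_all add: R(2) R'(2) algebra_simps)
qed

lemma jlead_power: "jlead S k m w \<Phi> \<Lambda> \<Longrightarrow> jlead S k (n * m) (int n * w) (\<lambda>z v. \<Phi> z v ^ n) (\<lambda>z v. \<Lambda> z v ^ n)"
proof (induction n)
  case (Suc n)
  from jlead_mult[OF Suc.prems Suc.IH[OF Suc.prems]] show ?case by (simp add: algebra_simps)
qed (simp add: jlead_one)

lemma jlead_prod:
  assumes "finite I" "\<And>i. i \<in> I \<Longrightarrow> jlead S k (m i) (w i) (\<Phi> i) (\<Lambda> i)"
  shows "jlead S k (\<Sum>i\<in>I. m i) (\<Sum>i\<in>I. w i) (\<lambda>z v. \<Prod>i\<in>I. \<Phi> i z v) (\<lambda>z v. \<Prod>i\<in>I. \<Lambda> i z v)"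
  using assms by (induction I rule: finite_induct) (simp_all add: jlead_one jlead_mult)

lemma jlead_jmono:
  assumes "\<And>p i. p \<in> {1..k} \<Longrightarrow> jlead S k p (int (p * p)) (\<lambda>z v. \<Phi> z v p i) (\<lambda>z v. \<Lambda> z v p i)"
  shows "jlead S k (wt k K) (sq k K) (\<lambda>z v. jmono k K (\<Phi> z v)) (\<lambda>z v. jmono k K (\<Lambda> z v))"
proof -
  have "jlead S k (\<Sum>p=1..k. \<Sum>i\<in>UNIV. K p i * p) (\<Sum>p=1..k. \<Sum>i\<in>UNIV. int (K p i) * int (p * p))
    (\<lambda>z v. \<Prod>p=1..k. \<Prod>i\<in>UNIV. \<Phi> z v p i ^ K p i) (\<lambda>z v. \<Prod>p=1..k. \<Prod>i\<in>UNIV. \<Lambda> z v p i ^ K p i)"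
    by (intro jlead_prod jlead_power assms finite) simp_all
  then show ?thesis by (simp add: jmono_def wt_def sq_def sum_distrib_left mult_ac)
qed

section \<open>Frames from bases of the fibres\<close>

text \<open>Frames are indexed by numbers but bases by exponents. An arbitrary numbering mediates
  between them, and \<open>ix\<close> below inverts it.\<close>

definition enum :: "'b set \<Rightarrow> nat \<Rightarrow> 'b" where
  "enum T = (SOME h. bij_betw h {..<card T} T)"

lemma enum: "finite T \<Longrightarrow> bij_betw (enum T) {..<card T} T"
proof -
  assume "finite T"
  then have "\<exists>h. bij_betw h {..<card T} T" using ex_bij_betw_nat_finite[of T] by (simp add: atLeast0LessThan)
  then show ?thesis unfolding enum_def by (rule someI_ex)
qed

lemma sum_enum: "finite T \<Longrightarrow> (\<Sum>i<card T. f (enum T i)) = (\<Sum>K\<in>T. f K)"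
  by (rule sum.reindex_bij_betw[OF enum])

definition ix :: "'b set \<Rightarrow> 'b \<Rightarrow> nat" where
  "ix T K = the_inv_into {..<card T} (enum T) K"

lemma
  assumes "finite T"
  shows ix: "K \<in> T \<Longrightarrow> ix T K < card T" "K \<in> T \<Longrightarrow> enum T (ix T K) = K"
    and ix_enum: "i < card T \<Longrightarrow> ix T (enum T i) = i"
    and sum_ix: "(\<Sum>i<card T. f i) = (\<Sum>K\<in>T. f (ix T K))"
proof -
  have inj: "inj_on (enum T) {..<card T}" by (rule bij_betw_imp_inj_on[OF enum[OF assms]])
  show ix_enum: "ix T (enum T i) = i" if "i < card T" for i
    unfolding ix_def by (rule the_inv_into_f_f[OF inj]) (simp add: that)
  show "ix T K < card T" "enum T (ix T K) = K" if "K \<in> T"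
  proof -
    have "K \<in> enum T ` {..<card T}" unfolding bij_betw_imp_surj_on[OF enum[OF assms]] by (rule that)
    then obtain i where i: "i < card T" "K = enum T i" by (elim imageE) (rule that, simp_all)
    show "ix T K < card T" "enum T (ix T K) = K" unfolding i(2) ix_enum[OF i(1)] by (rule i refl)+
  qed
  have "(\<Sum>i<card T. f i) = (\<Sum>i<card T. f (ix T (enum T i)))" by (intro sum.cong refl) (simp add: ix_enum)
  also have "\<dots> = (\<Sum>K\<in>T. f (ix T K))" by (rule sum_enum[OF assms])
  finally show "(\<Sum>i<card T. f i) = (\<Sum>K\<in>T. f (ix T K))" .
qed

context surface
begin

text \<open>Independence in every fibre determines the coefficients of a section point by point.
  Local holomorphic expansions therefore agree where they overlap and glue to one over
  \<open>W\<close>.\<close>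

lemma local_frameI:
  assumes T: "finite T" and V: "open V"
    and mem: "\<And>W h. open W \<Longrightarrow> W \<subseteq> V \<Longrightarrow> (\<And>K. K \<in> T \<Longrightarrow> holo_fun A W (h K)) \<Longrightarrow>
      (\<lambda>x t. if x \<in> W then \<Sum>K\<in>T. h K x * b K x t else 0) \<in> F W"
    and zero: "\<And>W s x t. s \<in> F W \<Longrightarrow> x \<notin> W \<Longrightarrow> s x t = 0"
    and gen: "\<And>W s x. open W \<Longrightarrow> W \<subseteq> V \<Longrightarrow> s \<in> F W \<Longrightarrow> x \<in> W \<Longrightarrow> \<exists>U h. open U \<and> x \<in> U \<and> U \<subseteq> W \<and>
      (\<forall>K\<in>T. holo_fun A U (h K)) \<and> (\<forall>y\<in>U. \<forall>t. s y t = (\<Sum>K\<in>T. h K y * b K y t))"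
    and indep: "\<And>x c K. x \<in> V \<Longrightarrow> (\<And>t. (\<Sum>K\<in>T. c K * b K x t) = 0) \<Longrightarrow> K \<in> T \<Longrightarrow> c K = 0"
  shows "local_frame A F (card T) V (\<lambda>i. b (enum T i))"
  unfolding local_frame_def
proof (intro conjI V allI impI, elim conjE)
  fix W assume W: "open W" "W \<subseteq> V"
  let ?r = "card T"
  let ?comb = "\<lambda>h x t. if x \<in> W then \<Sum>i<?r. h i x * b (enum T i) x t else 0"
  have uniq: "c K = d K" if "x \<in> V" "\<And>t. (\<Sum>K\<in>T. c K * b K x t) = (\<Sum>K\<in>T. d K * b K x t)" "K \<in> T"
    for x and c d :: "'b \<Rightarrow> complex" and K
  proof -
    have "(\<Sum>K\<in>T. (c K - d K) * b K x t) = 0" for t by (simp only: left_diff_distrib sum_subtractf that(2) diff_self)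
    from indep[of x "\<lambda>K. c K - d K", OF that(1) this that(3)] show ?thesis by (rule right_minus_eq[THEN iffD1])
  qed
  have enum_T: "enum T i \<in> T" if "i < ?r" for i by (rule bij_betw_apply[OF enum[OF T]]) (simp add: that)
  have comb: "(\<Sum>i<?r. h i x * b (enum T i) x t) = (\<Sum>K\<in>T. h (ix T K) x * b K x t)" for h x t
    unfolding sum_ix[OF T] by (intro sum.cong refl) (simp only: ix(2)[OF T])
  have out: "h i x = 0" if "h \<in> free_sections A ?r W" "\<not> (i < ?r \<and> x \<in> W)" for h i x
  proof -
    have "\<forall>i x. ?r \<le> i \<or> x \<notin> W \<longrightarrow> h i x = 0" using that(1) by (simp add: free_sections_def)
    moreover have "?r \<le> i \<or> x \<notin> W" using that(2) by (simp add: not_less de_Morgan_conj)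
    ultimately show ?thesis by (elim allE impE)
  qed
  show "bij_betw ?comb (free_sections A ?r W) (F W)"
  proof (rule bij_betw_imageI)
    show "inj_on ?comb (free_sections A ?r W)"
    proof (rule inj_onI)
      fix h h' assume h: "h \<in> free_sections A ?r W" "h' \<in> free_sections A ?r W" "?comb h = ?comb h'"
      show "h = h'"
      proof (intro ext)
        fix i x show "h i x = h' i x"
        proof (cases "i < ?r \<and> x \<in> W")
          case True
          have "h (ix T (enum T i)) x = h' (ix T (enum T i)) x"
          proof (rule uniq[of x "\<lambda>K. h (ix T K) x" "\<lambda>K. h' (ix T K) x"])
            show "(\<Sum>K\<in>T. h (ix T K) x * b K x t) = (\<Sum>K\<in>T. h' (ix T K) x * b K x t)" for t
              using fun_cong[OF fun_cong[OF h(3)], of x t] True unfolding comb by (simp only: if_True)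
            show "x \<in> V" using True W(2) by blast
            show "enum T i \<in> T" using True enum_T by blast
          qed
          then show ?thesis using True by (simp add: ix_enum[OF T])
        next
          case False
          show ?thesis by (rule trans[OF out[OF h(1) False] out[OF h(2) False, symmetric]])
        qed
      qed
    qed
    show "?comb ` free_sections A ?r W = F W"
    proof (intro equalityI subsetI)
      fix s assume "s \<in> ?comb ` free_sections A ?r W"
      then obtain h where h: "h \<in> free_sections A ?r W" "s = ?comb h" by blast
      have "(\<lambda>x t. if x \<in> W then \<Sum>K\<in>T. h (ix T K) x * b K x t else 0) \<in> F W"
        by (rule mem[OF W]) (use h(1) ix[OF T] in \<open>simp add: free_sections_def\<close>)
      then show "s \<in> F W" by (simp only: h(2) comb)
    next
      fix s assume s: "s \<in> F W"
      \<comment> \<open>Coefficients picked separately at each point. By independence they coincide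
        with every local holomorphic choice, so they are holomorphic.\<close>
      define H where "H x = (SOME c. \<forall>t. s x t = (\<Sum>K\<in>T. c K * b K x t))" for x
      have H: "s x t = (\<Sum>K\<in>T. H x K * b K x t)" if x: "x \<in> W" for x t
      proof -
        obtain U h where U: "open U" "x \<in> U" "U \<subseteq> W" "\<forall>K\<in>T. holo_fun A U (h K)" "\<forall>y\<in>U. \<forall>t. s y t = (\<Sum>K\<in>T. h K y * b K y t)"
          using gen[OF W s x] by (elim exE conjE) (rule that; assumption)
        have "\<exists>c. \<forall>t. s x t = (\<Sum>K\<in>T. c K * b K x t)" by (rule exI[of _ "\<lambda>K. h K x"]) (rule bspec[OF U(5,2)])
        from someI_ex[OF this, rule_format, of t] show ?thesis unfolding H_def .
      qed
      have holo: "holo_fun A W (\<lambda>x. H x K)" if K: "K \<in> T" for K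
      proof (rule holo_fun_locally)
        fix x assume x: "x \<in> W"
        obtain U h where U: "open U" "x \<in> U" "U \<subseteq> W" "\<forall>K\<in>T. holo_fun A U (h K)" "\<forall>y\<in>U. \<forall>t. s y t = (\<Sum>K\<in>T. h K y * b K y t)"
          using gen[OF W s x] by (elim exE conjE) (rule that; assumption)
        have "h K y = H y K" if y: "y \<in> U" for y
        proof (rule uniq[of y "\<lambda>K. h K y" "H y", OF _ _ K])
          show "y \<in> V" using y U(3) W(2) by blast
          show "(\<Sum>K\<in>T. h K y * b K y t) = (\<Sum>K\<in>T. H y K * b K y t)" for t
            using U(5)[rule_format, OF y, of t] H[OF set_mp[OF U(3) y], of t] by (rule trans[OF sym])
        qed
        from holo_fun_cong[OF U(1) this bspec[OF U(4) K]] show "\<exists>U. x \<in> U \<and> holo_fun A U (\<lambda>x. H x K)"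
          using U(2) by (intro exI[of _ U] conjI)
      qed
      have m: "cut ?r W (\<lambda>i x. H x (enum T i)) \<in> free_sections A ?r W"
        by (rule cut_free_section[OF W(1)]) (rule holo[OF enum_T])
      moreover have "s = ?comb (cut ?r W (\<lambda>i x. H x (enum T i)))"
      proof (intro ext)
        fix x t show "s x t = ?comb (cut ?r W (\<lambda>i x. H x (enum T i))) x t"
          using zero[OF s] sum_enum[OF T, of "\<lambda>K. H x K * b K x t"] by (cases "x \<in> W") (simp_all add: cut_def H)
      qed
      ultimately show "s \<in> ?comb ` free_sections A ?r W"
        unfolding image_iff by (intro bexI[OF _ m])
    qed
  qed
qed

section \<open>Jets\<close>

lemma germ_curve:
  assumes c: "c \<in> A" "d \<in> A" and f: "holo_germ A f" "f 0 \<in> fst c" "f 0 \<in> fst d"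
  shows "\<exists>T. 0 \<in> T \<and> curve_in (cimg c (fst d)) T (\<lambda>t. snd c (f t)) \<and> (\<forall>t\<in>T. f t \<in> fst c)"
proof -
  note g = f(1)[unfolded holo_germ_def case_prod_unfold, rule_format]
  have ev: "\<forall>\<^sub>F t in nhds 0. f t \<in> fst c \<and> f t \<in> fst d" by (intro eventually_conj g[THEN conjunct1] c f)
  obtain T0 where T0: "open T0" "0 \<in> T0" "\<And>t. t \<in> T0 \<Longrightarrow> f t \<in> fst c \<and> f t \<in> fst d"
    using ev unfolding eventually_nhds by blast
  have "\<forall>i. \<exists>s. open s \<and> 0 \<in> s \<and> (\<lambda>t. snd c (f t) $ i) holomorphic_on s"
    using g[THEN conjunct2, rule_format, OF c(1) f(2)] by (simp add: analytic_at)
  then obtain s where s: "\<And>i::2. open (s i)" "\<And>i. 0 \<in> s i" "\<And>i. (\<lambda>t. snd c (f t) $ i) holomorphic_on s i"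
    unfolding choice_iff by blast
  have op: "open (T0 \<inter> (\<Inter>i. s i))" using s(1) T0(1) by (intro open_Int open_INT) simp_all
  have "(\<lambda>t. snd c (f t) $ i) holomorphic_on T0 \<inter> (\<Inter>i. s i)" for i
    by (rule holomorphic_on_subset[OF s(3)]) blast
  then show ?thesis using T0 s(2) op
    by (intro exI[of _ "T0 \<inter> (\<Inter>i. s i)"]) (auto simp: curve_in_def)
qed

abbreviation jc :: "'a chart \<Rightarrow> (complex \<Rightarrow> 'a) \<Rightarrow> nat \<Rightarrow> 2 \<Rightarrow> complex" where
  "jc c f \<equiv> (\<lambda>p i. jet_coord (snd c) p i f)"

text \<open>The Jacobian matrix applied to each derivative separately: the coordinate change of a
  \<open>k\<close>-tuple of tangent vectors, and therefore the one that governs the bundles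
  S_I.\<close>

definition jlin :: "'a chart \<Rightarrow> 'a chart \<Rightarrow> complex ^ 2 \<Rightarrow> jvec \<Rightarrow> nat \<Rightarrow> 2 \<Rightarrow> complex" where
  "jlin c d z v p i = (\<Sum>l\<in>UNIV. dir_deriv (\<lambda>z. trans_map c d z $ i) (axis l 1) z * v p l)"

lemma jet_coord_trans:
  assumes c: "c \<in> A" "d \<in> A" and f: "holo_germ A f" "f 0 \<in> fst c" "f 0 \<in> fst d"
  shows "\<exists>T. 0 \<in> T \<and> curve_in (cimg c (fst d)) T (\<lambda>t. snd c (f t)) \<and>
    (\<forall>p i. (deriv ^^ p) (\<lambda>t. trans_map c d (snd c (f t)) $ i) 0 = jc d f p i)"
proof -
  obtain T where T: "0 \<in> T" "curve_in (cimg c (fst d)) T (\<lambda>t. snd c (f t))" "\<forall>t\<in>T. f t \<in> fst c"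
    using germ_curve[OF c f] by (elim exE conjE)
  have ev: "\<forall>\<^sub>F t in nhds 0. trans_map c d (snd c (f t)) $ i = snd d (f t) $ i" for i
    unfolding eventually_nhds by (rule exI[of _ T]) (use T in \<open>simp add: curve_in_def cinv_coord[OF c(1)]\<close>)
  show ?thesis unfolding jet_coord_def
    by (intro exI[of _ T] conjI T(1,2) allI higher_deriv_cong_ev[OF ev refl])
qed

lemma jet_coord_change:
  assumes c: "c \<in> A" "d \<in> A"
  shows "\<exists>Q. jpoly (cimg c (fst d)) (Suc q) (Suc q) (int (Suc q * Suc q) - 1) Q \<and>
    (\<forall>f. holo_germ A f \<longrightarrow> f 0 \<in> fst c \<longrightarrow> f 0 \<in> fst d \<longrightarrow>
      jc d f (Suc q) i = jlin c d (snd c (f 0)) (jc c f) (Suc q) i + Q (snd c (f 0)) (jc c f))"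
proof -
  obtain Q where Q: "jpoly (cimg c (fst d)) (Suc q) (Suc q) (int (Suc q * Suc q) - 1) Q"
    and eq: "\<And>\<gamma> T t. curve_in (cimg c (fst d)) T \<gamma> \<Longrightarrow> t \<in> T \<Longrightarrow> (deriv ^^ Suc q) (\<lambda>t. trans_map c d (\<gamma> t) $ i) t
      = (\<Sum>l\<in>UNIV. dir_deriv (\<lambda>z. trans_map c d z $ i) (axis l 1) (\<gamma> t) * jet_of \<gamma> t (Suc q) l) + Q (\<gamma> t) (jet_of \<gamma> t)"
    using higher_chain[OF trans_map_holo[OF c] open_cimg[OF c(1) chart_open[OF c(2)]], of q i] by (elim exE conjE) (rule that, assumption, blast)
  have "jc d f (Suc q) i = jlin c d (snd c (f 0)) (jc c f) (Suc q) i + Q (snd c (f 0)) (jc c f)"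
    if f: "holo_germ A f" "f 0 \<in> fst c" "f 0 \<in> fst d" for f
  proof -
    obtain T where T: "0 \<in> T" "curve_in (cimg c (fst d)) T (\<lambda>t. snd c (f t))"
      and tr: "(deriv ^^ Suc q) (\<lambda>t. trans_map c d (snd c (f t)) $ i) 0 = jc d f (Suc q) i"
      using jet_coord_trans[OF c f] by (elim exE conjE) (rule that, assumption+, blast)
    have "jc d f (Suc q) i = (deriv ^^ Suc q) (\<lambda>t. trans_map c d (snd c (f t)) $ i) 0" by (rule tr[symmetric])
    also have "\<dots> = jlin c d (snd c (f 0)) (jc c f) (Suc q) i + Q (snd c (f 0)) (jc c f)"
      unfolding eq[OF T(2,1)] by (simp add: jlin_def jet_of_def[abs_def] jet_coord_def[abs_def])
    finally show ?thesis .
  qed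
  then show ?thesis using Q by (intro exI[of _ Q] conjI allI impI)
qed

text \<open>In order one the chain rule has no lower terms, so on tangent vectors the linear part is
  the whole coordinate change.\<close>

lemma jlin_1:
  assumes c: "c \<in> A" "d \<in> A" and f: "holo_germ A f" "f 0 \<in> fst c" "f 0 \<in> fst d"
  shows "jc d f 1 i = jlin c d (snd c (f 0)) (jc c f) 1 i"
proof -
  obtain T where T: "0 \<in> T" "curve_in (cimg c (fst d)) T (\<lambda>t. snd c (f t))"
    and eq: "(deriv ^^ 1) (\<lambda>t. trans_map c d (snd c (f t)) $ i) 0 = jc d f 1 i"
    using jet_coord_trans[OF c f] by (elim exE conjE) (rule that, assumption+, blast)
  show ?thesis using DERIV_imp_deriv[OF curve_deriv[OF trans_map_holo[OF c] T(2,1)]]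
    unfolding eq[symmetric] by (simp add: jlin_def jet_of_def jet_coord_def)
qed

text \<open>Leading parts are multiplicative, so the statement for single coordinates extends to
  monomials. The remainder has smaller \<open>sq\<close>, although it has the same weight.\<close>

lemma jmono_change:
  assumes c: "c \<in> A" "d \<in> A"
  shows "\<exists>R. jpoly (cimg c (fst d)) k (wt k K) (sq k K - 1) R \<and>
    (\<forall>f. holo_germ A f \<longrightarrow> f 0 \<in> fst c \<longrightarrow> f 0 \<in> fst d \<longrightarrow>
      jmono k K (jc d f) = jmono k K (jlin c d (snd c (f 0)) (jc c f)) + R (snd c (f 0)) (jc c f))"
    and "jpoly (cimg c (fst d)) k (wt k K) (sq k K) (\<lambda>z v. jmono k K (jlin c d z v))"
proof -
  let ?S = "cimg c (fst d)"
  have op: "open ?S" by (rule open_cimg[OF c(1) chart_open[OF c(2)]])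
  \<comment> \<open>\<open>Q q\<close> is the correction in order \<open>Suc q\<close>; orders start
    at 1, whence the shift by one in \<open>\<Phi>\<close>.\<close>
  define Q where "Q q i = (SOME Q. jpoly ?S (Suc q) (Suc q) (int (Suc q * Suc q) - 1) Q \<and>
    (\<forall>f. holo_germ A f \<longrightarrow> f 0 \<in> fst c \<longrightarrow> f 0 \<in> fst d \<longrightarrow>
      jc d f (Suc q) i = jlin c d (snd c (f 0)) (jc c f) (Suc q) i + Q (snd c (f 0)) (jc c f)))" for q i
  note Q' = someI_ex[OF jet_coord_change[OF c], folded Q_def]
  have Q: "jpoly ?S (Suc q) (Suc q) (int (Suc q * Suc q) - 1) (Q q i)" for q i by (rule Q'[THEN conjunct1])
  have eq: "jc d f (Suc q) i = jlin c d (snd c (f 0)) (jc c f) (Suc q) i + Q q i (snd c (f 0)) (jc c f)"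
    if "holo_germ A f" "f 0 \<in> fst c" "f 0 \<in> fst d" for q i f
    by (rule Q'[THEN conjunct2, rule_format, OF that])
  define \<Phi> where "\<Phi> z v p i = jlin c d z v p i + Q (p - 1) i z v" for z v p i
  have lin: "jpoly ?S k p (int (p * p)) (\<lambda>z v. jlin c d z v p i)" if "p \<in> {1..k}" for p i
    unfolding jlin_def by (intro jpoly_sum jpoly_scale holo_on_dir_deriv op trans_map_holo c jpoly_var that)
  have "jlead ?S k p (int (p * p)) (\<lambda>z v. \<Phi> z v p i) (\<lambda>z v. jlin c d z v p i)" if p: "p \<in> {1..k}" for p i
    unfolding jlead_def
  proof (intro conjI lin p exI[of _ "Q (p - 1) i"] allI)
    have s: "Suc (p - 1) = p" using p by simp
    show "jpoly ?S k p (int (p * p) - 1) (Q (p - 1) i)"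
      by (rule jpoly_mono[OF Q[of "p - 1" i, unfolded s]]) (use p in simp)
  qed (simp add: \<Phi>_def)
  then have L: "jlead ?S k (wt k K) (sq k K) (\<lambda>z v. jmono k K (\<Phi> z v)) (\<lambda>z v. jmono k K (jlin c d z v))"
    by (rule jlead_jmono)
  then show "jpoly ?S k (wt k K) (sq k K) (\<lambda>z v. jmono k K (jlin c d z v))" by (simp add: jlead_def)
  obtain R where R: "jpoly ?S k (wt k K) (sq k K - 1) R" "\<And>z v. jmono k K (\<Phi> z v) = jmono k K (jlin c d z v) + R z v"
    using L unfolding jlead_def by blast
  show "\<exists>R. jpoly ?S k (wt k K) (sq k K - 1) R \<and>
    (\<forall>f. holo_germ A f \<longrightarrow> f 0 \<in> fst c \<longrightarrow> f 0 \<in> fst d \<longrightarrow>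
      jmono k K (jc d f) = jmono k K (jlin c d (snd c (f 0)) (jc c f)) + R (snd c (f 0)) (jc c f))"
  proof (intro exI[of _ R] conjI R(1) allI impI)
    fix f assume f: "holo_germ A f" "f 0 \<in> fst c" "f 0 \<in> fst d"
    have "jmono k K (jc d f) = jmono k K (\<Phi> (snd c (f 0)) (jc c f))"
    proof (rule jmono_cong)
      fix p i assume "p \<in> {1..k}"
      then have "Suc (p - 1) = p" by simp
      then show "jc d f p i = \<Phi> (snd c (f 0)) (jc c f) p i" using eq[OF f, of "p - 1" i] by (simp add: \<Phi>_def)
    qed
    then show "jmono k K (jc d f) = jmono k K (jlin c d (snd c (f 0)) (jc c f)) + R (snd c (f 0)) (jc c f)"
      by (simp only: R(2))
  qed
qed

end

section \<open>Germs with prescribed jets\<close>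

lemma higher_deriv_taylor:
  fixes a :: "nat \<Rightarrow> complex"
  shows "(deriv ^^ p) (\<lambda>t. \<Sum>q<n. a q * (t ^ q / fact q)) = (\<lambda>t. \<Sum>q<n - p. a (q + p) * (t ^ q / fact q))"
proof (induction p arbitrary: a n)
  case (Suc p)
  have "((\<lambda>t. \<Sum>q<n. a q * (t ^ q / fact q)) has_field_derivative (\<Sum>q<n - 1. a (Suc q) * (t ^ q / fact q))) (at t)" for t
  proof -
    have 1: "((\<lambda>t. a q * (t ^ q / fact q)) has_field_derivative a q * (of_nat q * t ^ (q - 1) / fact q)) (at t)" for q
      by (intro DERIV_cmult DERIV_cdivide) (rule derivative_eq_intros | simp)+
    have 2: "(\<Sum>q<n. a q * (of_nat q * t ^ (q - 1) / fact q)) = (\<Sum>q<n - 1. a (Suc q) * (t ^ q / fact q))"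
    proof (cases n)
      case (Suc l)
      have "of_nat (Suc q) * t ^ (Suc q - 1) / fact (Suc q) = t ^ q / (fact q :: complex)" for q
        unfolding fact_Suc by (simp del: of_nat_Suc)
      then show ?thesis unfolding Suc sum.lessThan_Suc_shift by simp
    qed simp
    show ?thesis by (rule DERIV_cong[OF DERIV_sum[OF 1] 2])
  qed
  then have D: "deriv (\<lambda>t. \<Sum>q<n. a q * (t ^ q / fact q)) = (\<lambda>t. \<Sum>q<n - 1. a (Suc q) * (t ^ q / fact q))"
    by (intro ext DERIV_imp_deriv)
  have "(deriv ^^ Suc p) (\<lambda>t. \<Sum>q<n. a q * (t ^ q / fact q)) = (\<lambda>t. \<Sum>q<n - 1 - p. a (Suc (q + p)) * (t ^ q / fact q))"
    unfolding funpow_Suc_right o_def D by (rule Suc.IH)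
  then show ?case by (simp only: add_Suc_right diff_diff_left plus_1_eq_Suc)
qed simp

context surface
begin

text \<open>A Taylor polynomial read through the chart. Since all values of the coordinates occur,
  an identity on jets is one of polynomials in free variables, and \<open>jmono_independent\<close>
  applies.\<close>

lemma jets_attained:
  assumes c: "c \<in> A" and x: "x \<in> fst c"
  shows "\<exists>f. holo_germ A f \<and> f 0 = x \<and> (\<forall>p\<in>{1..k}. \<forall>i. jc c f p i = v p i)"
proof -
  define a where "a i q = (if q = 0 then snd c x $ i else v q i)" for i and q :: nat
  define \<gamma> where "\<gamma> t = (\<chi> i. \<Sum>q<Suc k. a i q * (t ^ q / fact q))" for t :: complex
  have hol: "(\<lambda>t. \<gamma> t $ i) holomorphic_on UNIV" for i
    unfolding \<gamma>_def vec_lambda_beta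
    by (intro holomorphic_on_sum holomorphic_on_mult holomorphic_on_divide holomorphic_on_power holomorphic_on_const holomorphic_on_ident fact_nonzero)
  have 0: "\<gamma> 0 = snd c x"
    unfolding vec_eq_iff \<gamma>_def by (simp add: sum.lessThan_Suc_shift a_def del: sum.lessThan_Suc)
  have cont: "continuous_on UNIV \<gamma>"
    using continuous_on_vec_lambda[of UNIV "\<lambda>i t. \<gamma> t $ i", OF holomorphic_on_imp_continuous_on[OF hol]] by (simp only: vec_nth_inverse)
  define f where "f t = cinv c (\<gamma> t)" for t
  \<comment> \<open>The polynomial curve may leave the image of the chart. If \<open>d\<close>
    contains \<open>x\<close>, the curve stays near 0 in the part that also belongs to
    \<open>d\<close>.\<close>
  define T where "T d = \<gamma> -` cimg c (fst d)" for d :: "'a chart"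
  have T: "open (T d)" if "d \<in> A" for d
    unfolding T_def by (rule open_vimage[OF open_cimg[OF c chart_open[OF that]] cont])
  have cur: "curve_in (cimg c (fst d)) (T d) \<gamma>" if "d \<in> A" for d
    unfolding curve_in_def using T[OF that] holomorphic_on_subset[OF hol] by (simp add: T_def)
  have in_T: "0 \<in> T d" if "x \<in> fst d" for d using x that by (simp add: T_def 0)
  have f0: "f 0 = x" by (simp add: f_def 0 cinv_coord[OF c x])
  have "holo_germ A f"
    unfolding holo_germ_def case_prod_unfold f0
  proof (intro ballI impI conjI allI)
    fix d assume d: "d \<in> A" "x \<in> fst d"
    show "\<forall>\<^sub>F t in nhds 0. f t \<in> fst d"
      unfolding eventually_nhds f_def
      by (intro exI[of _ "T d"] conjI T d in_T ballI) (simp add: T_def cimgD(2)[OF c])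
    show "(\<lambda>t. snd d (f t) $ i) analytic_on {0}" for i
      unfolding analytic_at
    proof (intro exI[of _ "T d"] conjI T d in_T)
      show "(\<lambda>t. snd d (f t) $ i) holomorphic_on T d"
        unfolding holomorphic_on_open[OF T[OF d(1)]] f_def
        by (intro ballI) (rule exI, rule curve_deriv[OF trans_map_holo[OF c d(1), of i] cur[OF d(1)]])
    qed
  qed
  moreover have "jc c f p i = v p i" if p: "p \<in> {1..k}" for p i
  proof -
    have ev: "\<forall>\<^sub>F t in nhds 0. snd c (f t) $ i = (\<Sum>q<Suc k. a i q * (t ^ q / fact q))"
      unfolding eventually_nhds f_def
    proof (intro exI[of _ "T c"] conjI T c in_T x ballI)
      fix t assume "t \<in> T c"
      then have "\<gamma> t \<in> cimg c (fst c)" by (simp only: T_def vimage_eq)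
      from cimgD(3)[OF c this] show "trans_map c c (\<gamma> t) $ i = (\<Sum>q<Suc k. a i q * (t ^ q / fact q))"
        by (simp only: \<gamma>_def vec_lambda_beta)
    qed
    have "jc c f p i = (\<Sum>q<Suc k - p. a i (q + p) * (0 ^ q / fact q))"
      unfolding jet_coord_def higher_deriv_cong_ev[OF ev refl] higher_deriv_taylor ..
    also have "\<dots> = a i p"
    proof -
      obtain l where "Suc k - p = Suc l" using p by (cases "Suc k - p") auto
      then show ?thesis by (simp add: sum.lessThan_Suc_shift del: sum.lessThan_Suc)
    qed
    finally show ?thesis using p by (simp add: a_def)
  qed
  ultimately show ?thesis using f0 by (intro exI[of _ f]) simp
qed

lemma jet_rel_refl: "holo_germ A f \<Longrightarrow> (f, f) \<in> jet_rel A k"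
  by (simp add: jet_rel_def)

lemma jet_mem: "holo_germ A f \<Longrightarrow> jet A k f \<in> jets_at A k (f 0)"
  unfolding jets_at_def jet_def by (rule quotientI) simp

lemma jets_atE:
  assumes "j \<in> jets_at A k x"
  obtains f where "holo_germ A f" "f 0 = x" "j = jet A k f"
proof -
  obtain f where "f \<in> {f. holo_germ A f \<and> f 0 = x}" "j = jet_rel A k `` {f}"
    using assms unfolding jets_at_def by (rule quotientE)
  then show thesis by (intro that[of f]) (simp_all add: jet_def)
qed

text \<open>Read off from a chosen representative; in orders from 1 to \<open>k\<close> all members
  of the class agree.\<close>

definition jval :: "'a chart \<Rightarrow> nat \<Rightarrow> 'a \<Rightarrow> (complex \<Rightarrow> 'a) set \<Rightarrow> nat \<Rightarrow> 2 \<Rightarrow> complex" where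
  "jval c k x j p i = (if x \<in> fst c \<and> j \<in> jets_at A k x then jc c (SOME g. g \<in> j) p i else 0)"

lemma jval_jet:
  assumes "holo_germ A f" "c \<in> A" "f 0 \<in> fst c" "p \<in> {1..k}"
  shows "jval c k (f 0) (jet A k f) p i = jc c f p i"
proof -
  have "f \<in> jet A k f" unfolding jet_def using jet_rel_refl[OF assms(1)] by simp
  then have "(SOME g. g \<in> jet A k f) \<in> jet A k f" by (rule someI[of "\<lambda>g. g \<in> jet A k f"])
  then have "(f, SOME g. g \<in> jet A k f) \<in> jet_rel A k" unfolding jet_def by simp
  then have "jc c f p i = jc c (SOME g. g \<in> jet A k f) p i"
    using assms(2-4) unfolding jet_rel_def case_prod_unfold by simp
  then show ?thesis using assms(3) jet_mem[OF assms(1)] by (simp add: jval_def)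
qed

end

context surface
begin

subsection \<open>The frames of the sheaf of jet differentials\<close>

lemma holo_fun_coord:
  assumes "d \<in> A" "open W" "holo_on g (cimg d W)"
  shows "holo_fun A (fst d \<inter> W) (\<lambda>x. g (snd d x))"
proof (rule holo_fun_chart[OF assms(1)])
  show "holo_on (\<lambda>z. g (trans_map d d z)) (cimg d W)"
    by (rule holo_on_cong[OF open_cimg[OF assms(1,2)] _ assms(3)]) (simp only: cimgD(3)[OF assms(1)])
qed simp

lemma jet_differentials_iff:
  "s \<in> jet_differentials A k m W \<longleftrightarrow> (\<forall>x j. x \<notin> W \<or> j \<notin> jets_at A k x \<longrightarrow> s x j = 0) \<and>
    (\<forall>c\<in>A. \<exists>a. (\<forall>K\<in>jet_exponents k m. holo_fun A (fst c \<inter> W) (a K)) \<and>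
      (\<forall>f. holo_germ A f \<and> f 0 \<in> fst c \<inter> W \<longrightarrow>
        s (f 0) (jet A k f) = (\<Sum>K\<in>jet_exponents k m. a K (f 0) * jmono k K (jc c f))))"
  unfolding jet_differentials_def case_prod_unfold mem_Collect_eq jmono_def ..

lemma jmono_coords:
  assumes c: "c \<in> A" "d \<in> A" and K: "K \<in> jet_exponents k m"
  shows "\<exists>g. (\<forall>L. holo_on (g L) (cimg d (fst c))) \<and>
    (\<forall>f. holo_germ A f \<longrightarrow> f 0 \<in> fst d \<longrightarrow> f 0 \<in> fst c \<longrightarrow>
      jmono k K (jc c f) = (\<Sum>L\<in>jet_exponents k m. g L (snd d (f 0)) * jmono k L (jc d f)))"
proof -
  let ?S = "cimg d (fst c)"
  obtain R where R: "jpoly ?S k (wt k K) (sq k K - 1) R"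
    and eq: "\<forall>f. holo_germ A f \<longrightarrow> f 0 \<in> fst d \<longrightarrow> f 0 \<in> fst c \<longrightarrow>
      jmono k K (jc c f) = jmono k K (jlin d c (snd d (f 0)) (jc d f)) + R (snd d (f 0)) (jc d f)"
    using jmono_change(1)[OF c(2,1), of k K] by (elim exE conjE)
  have wt: "wt k K = m" using K by (simp add: jet_exponents_iff)
  have "jpoly ?S k m (sq k K) (\<lambda>z v. jmono k K (jlin d c z v) + R z v)"
    using jpoly_add[OF jmono_change(2)[OF c(2,1)] jpoly_weaken[OF R, of "sq k K"]] unfolding wt by simp
  from jpoly_expand[OF this] obtain a where a: "\<forall>L. holo_on (a L) ?S"
    "\<forall>z v. jmono k K (jlin d c z v) + R z v = (\<Sum>L | L \<in> jet_exponents k m \<and> sq k L \<le> sq k K. a L z * jmono k L v)"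
    by (elim exE conjE)
  show ?thesis
  proof (intro exI[of _ "\<lambda>L z. if sq k L \<le> sq k K then a L z else 0"] conjI allI impI)
    show "holo_on (\<lambda>z. if sq k L \<le> sq k K then a L z else 0) ?S" for L
      by (cases "sq k L \<le> sq k K") (simp_all only: if_True if_False a(1)[rule_format] holo_on_const)
    fix f assume f: "holo_germ A f" "f 0 \<in> fst d" "f 0 \<in> fst c"
    show "jmono k K (jc c f) = (\<Sum>L\<in>jet_exponents k m. (if sq k L \<le> sq k K then a L (snd d (f 0)) else 0) * jmono k L (jc d f))"
      unfolding eq[rule_format, OF f] a(2)[rule_format]
      by (rule sum.mono_neutral_cong_left[OF finite_jet_exponents]) auto
  qed
qed

definition jframe :: "nat \<Rightarrow> 'a chart \<Rightarrow> expo \<Rightarrow> 'a \<Rightarrow> (complex \<Rightarrow> 'a) set \<Rightarrow> complex" where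
  "jframe k c K x j = (if x \<in> fst c \<and> j \<in> jets_at A k x then jmono k K (jval c k x j) else 0)"

lemma jframe_jet:
  assumes "holo_germ A f" "c \<in> A" "f 0 \<in> fst c"
  shows "jframe k c K (f 0) (jet A k f) = jmono k K (jc c f)"
proof -
  have "jframe k c K (f 0) (jet A k f) = jmono k K (jval c k (f 0) (jet A k f))"
    using assms(3) jet_mem[OF assms(1)] by (simp add: jframe_def)
  also have "\<dots> = jmono k K (jc c f)" by (rule jmono_cong) (rule jval_jet[OF assms])
  finally show ?thesis .
qed

text \<open>By definition a section has an expansion in every chart; rewriting the monomials in
  other coordinates converts an expansion in \<open>c\<close> into one in \<open>d\<close>.
  Independence in a fibre holds because jets realise all coordinate values.\<close>

theorem local_frame_jets:
  assumes c: "c \<in> A"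
  shows "local_frame A (jet_differentials A k m) (card (jet_exponents k m)) (fst c) (\<lambda>i. jframe k c (enum (jet_exponents k m) i))"
proof (rule local_frameI[OF finite_jet_exponents chart_open[OF c]])
  let ?E = "jet_exponents k m"
  fix W h assume W: "open W" "W \<subseteq> fst c" and h: "\<And>K. K \<in> ?E \<Longrightarrow> holo_fun A W (h K)"
  let ?s = "\<lambda>x t. if x \<in> W then \<Sum>K\<in>?E. h K x * jframe k c K x t else 0"
  have z: "?s x j = 0" if "x \<notin> W \<or> j \<notin> jets_at A k x" for x j using that by (auto simp: jframe_def)
  have "\<exists>a. (\<forall>K\<in>?E. holo_fun A (fst d \<inter> W) (a K)) \<and> (\<forall>f. holo_germ A f \<and> f 0 \<in> fst d \<inter> W \<longrightarrow>
    ?s (f 0) (jet A k f) = (\<Sum>K\<in>?E. a K (f 0) * jmono k K (jc d f)))" if d: "d \<in> A" for d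
  proof -
    have "\<forall>K\<in>?E. \<exists>g. (\<forall>L. holo_on (g L) (cimg d (fst c))) \<and>
      (\<forall>f. holo_germ A f \<longrightarrow> f 0 \<in> fst d \<longrightarrow> f 0 \<in> fst c \<longrightarrow>
        jmono k K (jc c f) = (\<Sum>L\<in>?E. g L (snd d (f 0)) * jmono k L (jc d f)))"
      by (rule ballI, rule jmono_coords[OF c d])
    from bchoice[OF this] obtain g where g: "\<forall>K\<in>?E. (\<forall>L. holo_on (g K L) (cimg d (fst c))) \<and>
      (\<forall>f. holo_germ A f \<longrightarrow> f 0 \<in> fst d \<longrightarrow> f 0 \<in> fst c \<longrightarrow>
        jmono k K (jc c f) = (\<Sum>L\<in>?E. g K L (snd d (f 0)) * jmono k L (jc d f)))" by (elim exE)
    note g1 = g[rule_format, THEN conjunct1, rule_format] and g2 = g[rule_format, THEN conjunct2, rule_format]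
    show ?thesis
    proof (intro exI[of _ "\<lambda>L x. \<Sum>K\<in>?E. h K x * g K L (snd d x)"] conjI ballI allI impI)
      show "holo_fun A (fst d \<inter> W) (\<lambda>x. \<Sum>K\<in>?E. h K x * g K L (snd d x))" for L
      proof (intro holo_fun_sum holo_fun_mult)
        fix K assume K: "K \<in> ?E"
        show "holo_fun A (fst d \<inter> W) (h K)" by (rule holo_fun_subset[OF h[OF K]]) simp
        show "holo_fun A (fst d \<inter> W) (\<lambda>x. g K L (snd d x))"
          by (rule holo_fun_coord[OF d W(1)], rule holo_on_subset[OF g1[OF K]]) (use W(2) in blast)
      qed
      fix f assume "holo_germ A f \<and> f 0 \<in> fst d \<inter> W"
      then have f: "holo_germ A f" "f 0 \<in> fst d" "f 0 \<in> W" "f 0 \<in> fst c" using W(2) by auto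
      have "?s (f 0) (jet A k f) = (\<Sum>K\<in>?E. h K (f 0) * (\<Sum>L\<in>?E. g K L (snd d (f 0)) * jmono k L (jc d f)))"
        using f(3) by (simp only: if_True jframe_jet[OF f(1) c f(4)] g2[OF _ f(1,2,4)] cong: sum.cong)
      also have "\<dots> = (\<Sum>K\<in>?E. \<Sum>L\<in>?E. h K (f 0) * g K L (snd d (f 0)) * jmono k L (jc d f))"
        by (simp only: sum_distrib_left mult.assoc)
      also have "\<dots> = (\<Sum>L\<in>?E. \<Sum>K\<in>?E. h K (f 0) * g K L (snd d (f 0)) * jmono k L (jc d f))" by (rule sum.swap)
      finally show "?s (f 0) (jet A k f) = (\<Sum>L\<in>?E. (\<Sum>K\<in>?E. h K (f 0) * g K L (snd d (f 0))) * jmono k L (jc d f))"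
        by (simp only: sum_distrib_right)
    qed
  qed
  then show "?s \<in> jet_differentials A k m W" unfolding jet_differentials_iff using z by (intro conjI allI impI ballI)
next
  show "s x t = 0" if "s \<in> jet_differentials A k m W" "x \<notin> W" for W s x t
    using that unfolding jet_differentials_iff by blast
next
  let ?E = "jet_exponents k m"
  fix W s x assume W: "open W" "W \<subseteq> fst c" and s: "s \<in> jet_differentials A k m W" and x: "x \<in> W"
  obtain a where a: "\<forall>K\<in>?E. holo_fun A (fst c \<inter> W) (a K)" "\<forall>f. holo_germ A f \<and> f 0 \<in> fst c \<inter> W \<longrightarrow>
    s (f 0) (jet A k f) = (\<Sum>K\<in>?E. a K (f 0) * jmono k K (jc c f))"
    using s[unfolded jet_differentials_iff, THEN conjunct2, rule_format, OF c] by (elim exE conjE)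
  have cW: "fst c \<inter> W = W" using W(2) by blast
  have "s y t = (\<Sum>K\<in>?E. a K y * jframe k c K y t)" if y: "y \<in> W" for y t
  proof (cases "t \<in> jets_at A k y")
    case True
    then obtain f where f: "holo_germ A f" "f 0 = y" "t = jet A k f" by (rule jets_atE)
    have "s (f 0) (jet A k f) = (\<Sum>K\<in>?E. a K (f 0) * jmono k K (jc c f))"
      using a(2)[rule_format, of f] f y by (simp only: cW simp_thms)
    moreover have "f 0 \<in> fst c" using W(2) y f(2) by blast
    ultimately show ?thesis unfolding f(3) f(2)[symmetric] by (simp only: jframe_jet[OF f(1) c])
  next
    case False
    then have "s y t = 0" using s unfolding jet_differentials_iff by blast
    then show ?thesis using False by (simp add: jframe_def)
  qed
  then show "\<exists>U h. open U \<and> x \<in> U \<and> U \<subseteq> W \<and> (\<forall>K\<in>?E. holo_fun A U (h K)) \<and> (\<forall>y\<in>U. \<forall>t. s y t = (\<Sum>K\<in>?E. h K y * jframe k c K y t))"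
    using W(1) x a(1)[unfolded cW] by (intro exI[of _ W] exI[of _ a] conjI ballI allI order.refl) simp_all
next
  fix x :: 'a and b :: "expo \<Rightarrow> complex" and K
  assume x: "x \<in> fst c" and z: "\<And>t. (\<Sum>K\<in>jet_exponents k m. b K * jframe k c K x t) = 0" and K: "K \<in> jet_exponents k m"
  show "b K = 0"
  proof (rule jmono_independent[OF _ K])
    fix v
    obtain f where f: "holo_germ A f" "f 0 = x" "\<forall>p\<in>{1..k}. \<forall>i. jc c f p i = v p i"
      using jets_attained[OF c x, of k v] by (elim exE conjE)
    have "jframe k c K x (jet A k f) = jmono k K v" for K
    proof -
      have "jframe k c K (f 0) (jet A k f) = jmono k K (jc c f)" by (rule jframe_jet[OF f(1) c]) (simp only: f(2) x)
      also have "\<dots> = jmono k K v" by (rule jmono_cong) (simp only: f(3)[rule_format])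
      finally show ?thesis by (simp only: f(2))
    qed
    then show "(\<Sum>K\<in>jet_exponents k m. b K * jmono k K v) = 0" using z[of "jet A k f"] by (simp only:)
  qed
qed

subsection \<open>Local spans\<close>

text \<open>Generation near a point. The neighbourhood is hidden behind a quantifier, because every
  expansion may shrink it.\<close>

definition lspan :: "'i set \<Rightarrow> ('i \<Rightarrow> 'a \<Rightarrow> 't \<Rightarrow> complex) \<Rightarrow> 'a \<Rightarrow> ('a \<Rightarrow> 't \<Rightarrow> complex) \<Rightarrow> bool" where
  "lspan T b x s \<longleftrightarrow> (\<exists>V a. open V \<and> x \<in> V \<and> (\<forall>K\<in>T. holo_fun A V (a K)) \<and> (\<forall>y\<in>V. \<forall>t. s y t = (\<Sum>K\<in>T. a K y * b K y t)))"

lemma lspan_mem: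
  assumes "finite T" "K \<in> T"
  shows "lspan T b x (b K)"
  unfolding lspan_def
proof (intro exI[of _ UNIV] exI[of _ "\<lambda>L y. if L = K then 1 else 0"] conjI ballI allI open_UNIV UNIV_I holo_fun_const)
  show "b K y t = (\<Sum>L\<in>T. (if L = K then 1 else 0) * b L y t)" for y t
    using assms by (simp add: if_distrib[of "\<lambda>x. x * _"] cong: if_cong)
qed

lemma lspan_comb:
  assumes I: "finite I" and V: "open V" "x \<in> V" and h: "\<And>i. i \<in> I \<Longrightarrow> holo_fun A V (h i)"
    and eq: "\<And>y t. y \<in> V \<Longrightarrow> s y t = (\<Sum>i\<in>I. h i y * g i y t)" and g: "\<And>i. i \<in> I \<Longrightarrow> lspan T b x (g i)"
  shows "lspan T b x s"
proof -
  have "\<forall>i\<in>I. \<exists>U a. open U \<and> x \<in> U \<and> (\<forall>K\<in>T. holo_fun A U (a K)) \<and> (\<forall>y\<in>U. \<forall>t. g i y t = (\<Sum>K\<in>T. a K y * b K y t))"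
    by (rule ballI, rule g[unfolded lspan_def])
  from bchoice[OF this] obtain U where "\<forall>i\<in>I. \<exists>a. open (U i) \<and> x \<in> U i \<and> (\<forall>K\<in>T. holo_fun A (U i) (a K)) \<and>
    (\<forall>y\<in>U i. \<forall>t. g i y t = (\<Sum>K\<in>T. a K y * b K y t))" by (elim exE)
  from bchoice[OF this] obtain a where P: "\<forall>i\<in>I. open (U i) \<and> x \<in> U i \<and> (\<forall>K\<in>T. holo_fun A (U i) (a i K)) \<and>
    (\<forall>y\<in>U i. \<forall>t. g i y t = (\<Sum>K\<in>T. a i K y * b K y t))" by (elim exE)
  note P = P[rule_format]
  let ?U = "V \<inter> (\<Inter>i\<in>I. U i)"
  show ?thesis
    unfolding lspan_def
  proof (intro exI[of _ ?U] exI[of _ "\<lambda>K y. \<Sum>i\<in>I. h i y * a i K y"] conjI ballI allI)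
    show "open ?U" using P[THEN conjunct1] I V(1) by (intro open_Int open_INT ballI) simp_all
    show "x \<in> ?U" using V(2) P[THEN conjunct2, THEN conjunct1] by simp
    show "holo_fun A ?U (\<lambda>y. \<Sum>i\<in>I. h i y * a i K y)" if "K \<in> T" for K
    proof (intro holo_fun_sum holo_fun_mult)
      fix i assume i: "i \<in> I"
      show "holo_fun A ?U (h i)" by (rule holo_fun_subset[OF h[OF i]]) simp
      show "holo_fun A ?U (a i K)"
        by (rule holo_fun_subset[OF P[OF i, THEN conjunct2, THEN conjunct2, THEN conjunct1, rule_format, OF that]]) (use i in auto)
    qed
    fix y t assume y: "y \<in> ?U"
    have "g i y t = (\<Sum>K\<in>T. a i K y * b K y t)" if "i \<in> I" for i
      using P[OF that, THEN conjunct2, THEN conjunct2, THEN conjunct2, rule_format, of y t] y that by blast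
    then have "s y t = (\<Sum>i\<in>I. h i y * (\<Sum>K\<in>T. a i K y * b K y t))"
      using eq[of y t] y by simp
    also have "\<dots> = (\<Sum>i\<in>I. \<Sum>K\<in>T. h i y * a i K y * b K y t)" by (simp only: sum_distrib_left mult.assoc)
    also have "\<dots> = (\<Sum>K\<in>T. \<Sum>i\<in>I. h i y * a i K y * b K y t)" by (rule sum.swap)
    finally show "s y t = (\<Sum>K\<in>T. (\<Sum>i\<in>I. h i y * a i K y) * b K y t)" by (simp only: sum_distrib_right)
  qed
qed

end

section \<open>Symmetric and tensor products\<close>

lemma sym_product_cong:
  assumes "length ss = length ss'" "\<And>l. l < length ss \<Longrightarrow> (ss ! l) y = (ss' ! l) y"
  shows "sym_product ss y = sym_product ss' y"
proof
  fix ts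
  have "(\<Prod>l<length ss. (ss ! \<sigma> l) y (ts ! l)) = (\<Prod>l<length ss. (ss' ! \<sigma> l) y (ts ! l))" if "\<sigma> permutes {..<length ss}" for \<sigma>
  proof (rule prod.cong[OF refl])
    fix l assume "l \<in> {..<length ss}"
    then have "\<sigma> l < length ss" using permutes_in_image[OF that, of l] by simp
    from assms(2)[OF this] show "(ss ! \<sigma> l) y (ts ! l) = (ss' ! \<sigma> l) y (ts ! l)" by (rule arg_cong)
  qed
  then show "sym_product ss y ts = sym_product ss' y ts"
    unfolding sym_product_def assms(1)[symmetric] by (intro if_cong refl sum.cong) simp
qed

lemma tensor_product_cong:
  assumes "length ss = length ss'" "\<And>l. l < length ss \<Longrightarrow> (ss ! l) y = (ss' ! l) y"
  shows "tensor_product ss y = tensor_product ss' y"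
  unfolding tensor_product_def using assms by (intro ext) simp

text \<open>With the permutation moved to the arguments, each factor keeps its place in the list, so
  that a single factor can be exchanged.\<close>

lemma sym_product_alt:
  assumes "length ts = length ss"
  shows "sym_product ss x ts = (\<Sum>\<sigma> | \<sigma> permutes {..<length ss}. \<Prod>l<length ss. (ss ! l) x (ts ! \<sigma> l))"
proof -
  let ?n = "length ss"
  have "sym_product ss x ts = (\<Sum>\<sigma> | \<sigma> permutes {..<?n}. \<Prod>l<?n. (ss ! inv_into UNIV \<sigma> l) x (ts ! l))"
    using assms sum_permutations_inverse[of "\<lambda>\<sigma>. \<Prod>l<?n. (ss ! \<sigma> l) x (ts ! l)" "{..<?n}"] by (simp add: sym_product_def)
  also have "\<dots> = (\<Sum>\<sigma> | \<sigma> permutes {..<?n}. \<Prod>l<?n. (ss ! l) x (ts ! \<sigma> l))"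
  proof (rule sum.cong[OF refl])
    fix \<sigma> assume "\<sigma> \<in> {\<sigma>. \<sigma> permutes {..<?n}}"
    then have \<sigma>: "\<sigma> permutes {..<?n}" by simp
    show "(\<Prod>l<?n. (ss ! inv_into UNIV \<sigma> l) x (ts ! l)) = (\<Prod>l<?n. (ss ! l) x (ts ! \<sigma> l))"
      by (subst prod.permute[OF \<sigma>]) (simp add: permutes_inverses[OF \<sigma>])
  qed
  finally show ?thesis .
qed

text \<open>The other slots do not see what stands in slot \<open>length xs\<close>, so any
  \<open>q\<close> may be written there. This gives one common cofactor for all
  \<open>z\<close>.\<close>

lemma prod_slot:
  "(\<Prod>l<length xs + Suc (length ys). ((xs @ z # ys) ! l) x (f l)) =
    z x (f (length xs)) * (\<Prod>l\<in>{..<length xs + Suc (length ys)} - {length xs}. ((xs @ q # ys) ! l) x (f l))"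
proof -
  have "(\<Prod>l\<in>{..<length xs + Suc (length ys)} - {length xs}. ((xs @ z # ys) ! l) x (f l)) =
      (\<Prod>l\<in>{..<length xs + Suc (length ys)} - {length xs}. ((xs @ q # ys) ! l) x (f l))"
    by (rule prod.cong[OF refl]) (auto simp: nth_append nth_Cons')
  then show ?thesis by (subst prod.remove[of _ "length xs"]) simp_all
qed

lemma sym_product_slot:
  assumes "\<And>t. q y t = (\<Sum>i\<in>I. a i * g i y t)"
  shows "sym_product (xs @ q # ys) y ts = (\<Sum>i\<in>I. a i * sym_product (xs @ g i # ys) y ts)"
proof (cases "length ts = length xs + Suc (length ys)")
  case True
  let ?P = "{\<sigma>. \<sigma> permutes {..<length xs + Suc (length ys)}}"
  let ?R = "\<lambda>\<sigma>. \<Prod>l\<in>{..<length xs + Suc (length ys)} - {length xs}. ((xs @ q # ys) ! l) y (ts ! \<sigma> l)"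
  have alt: "sym_product (xs @ z # ys) y ts = (\<Sum>\<sigma>\<in>?P. z y (ts ! \<sigma> (length xs)) * ?R \<sigma>)" for z
  proof -
    have len: "length (xs @ z # ys) = length xs + Suc (length ys)" by simp
    show ?thesis unfolding sym_product_alt[of ts "xs @ z # ys" y, unfolded len, OF True] by (intro sum.cong refl prod_slot)
  qed
  have "sym_product (xs @ q # ys) y ts = (\<Sum>\<sigma>\<in>?P. \<Sum>i\<in>I. a i * (g i y (ts ! \<sigma> (length xs)) * ?R \<sigma>))"
    unfolding alt assms by (simp only: sum_distrib_right mult.assoc)
  also have "\<dots> = (\<Sum>i\<in>I. \<Sum>\<sigma>\<in>?P. a i * (g i y (ts ! \<sigma> (length xs)) * ?R \<sigma>))" by (rule sum.swap)
  finally show ?thesis by (simp only: alt sum_distrib_left)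
qed (simp add: sym_product_def)

lemma tensor_product_slot:
  assumes "\<And>t. q y t = (\<Sum>i\<in>I. a i * g i y t)"
  shows "tensor_product (xs @ q # ys) y ts = (\<Sum>i\<in>I. a i * tensor_product (xs @ g i # ys) y ts)"
proof (cases "length ts = length xs + Suc (length ys)")
  case True
  let ?R = "\<Prod>l\<in>{..<length xs + Suc (length ys)} - {length xs}. ((xs @ q # ys) ! l) y (ts ! l)"
  have alt: "tensor_product (xs @ z # ys) y ts = z y (ts ! length xs) * ?R" for z
  proof -
    have len: "length (xs @ z # ys) = length xs + Suc (length ys)" by simp
    show ?thesis unfolding tensor_product_def len using True by (simp only: if_True prod_slot[where q = q] simp_thms)
  qed
  show ?thesis unfolding alt assms by (simp only: sum_distrib_right mult.assoc)
qed (simp add: tensor_product_def)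

lemma sym_product_perm:
  assumes "mset ss = mset ss'"
  shows "sym_product ss = sym_product ss'"
proof (intro ext)
  fix x ts
  obtain p where p: "p permutes {..<length ss'}" "permute_list p ss' = ss" by (rule mset_eq_permutation[OF assms])
  have len: "length ss = length ss'" using p(2) by auto
  have "(\<Sum>\<sigma> | \<sigma> permutes {..<length ss'}. \<Prod>l<length ss'. (ss ! \<sigma> l) x (ts ! l)) =
    (\<Sum>\<sigma> | \<sigma> permutes {..<length ss'}. \<Prod>l<length ss'. (ss' ! (p \<circ> \<sigma>) l) x (ts ! l))"
  proof (intro sum.cong prod.cong refl)
    fix \<sigma> l assume "\<sigma> \<in> {\<sigma>. \<sigma> permutes {..<length ss'}}" "l \<in> {..<length ss'}"
    then have "\<sigma> l < length ss'" using permutes_in_image[of \<sigma> "{..<length ss'}" l] by simp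
    then show "(ss ! \<sigma> l) x (ts ! l) = (ss' ! (p \<circ> \<sigma>) l) x (ts ! l)"
      unfolding p(2)[symmetric] by (simp add: permute_list_nth[OF p(1)])
  qed
  also have "\<dots> = (\<Sum>\<sigma> | \<sigma> permutes {..<length ss'}. \<Prod>l<length ss'. (ss' ! \<sigma> l) x (ts ! l))"
    by (rule setum_permutations_compose_left[OF p(1), symmetric])
  finally show "sym_product ss x ts = sym_product ss' x ts" by (simp add: sym_product_def len)
qed

text \<open>On equal arguments all permutations contribute the same term. Symmetric products thus
  become ordinary monomials, up to a nonzero factorial.\<close>

lemma sym_product_diag: "sym_product ss x (replicate (length ss) j) = fact (length ss) * prod_list (map (\<lambda>s. s x j) ss)"
proof -
  let ?n = "length ss"
  have "sym_product ss x (replicate ?n j) = (\<Sum>\<sigma> | \<sigma> permutes {..<?n}. \<Prod>l<?n. (ss ! l) x (replicate ?n j ! \<sigma> l))"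
    by (rule sym_product_alt) simp
  also have "\<dots> = (\<Sum>\<sigma> | \<sigma> permutes {..<?n}. \<Prod>l<?n. (ss ! l) x j)"
  proof (intro sum.cong prod.cong refl)
    fix \<sigma> l assume "\<sigma> \<in> {\<sigma>. \<sigma> permutes {..<?n}}" "l \<in> {..<?n}"
    then have "\<sigma> l < ?n" using permutes_in_image[of \<sigma> "{..<?n}" l] by simp
    then show "(ss ! l) x (replicate ?n j ! \<sigma> l) = (ss ! l) x j" by simp
  qed
  also have "\<dots> = fact ?n * (\<Prod>l<?n. (ss ! l) x j)" by (simp add: card_permutations)
  also have "(\<Prod>l<?n. (ss ! l) x j) = prod_list (map (\<lambda>s. s x j) ss)"
    by (simp add: prod.list_conv_set_nth atLeast0LessThan)
  finally show ?thesis .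
qed

section \<open>Coordinate bases of the bundles S_I\<close>

definition typed :: "nat \<Rightarrow> nat \<Rightarrow> nat list \<Rightarrow> expo set" where
  "typed k m I = {K \<in> jet_exponents k m. \<forall>p<k. K (Suc p) 1 + K (Suc p) 2 = I ! p}"

lemma finite_typed: "finite (typed k m I)"
  unfolding typed_def using finite_jet_exponents by simp

text \<open>Lists count positions from 0, while orders of derivatives start at 1; this is the weight
  in the convention of \<open>weighted_indices\<close>.\<close>

lemma wt_Suc: "wt k K = (\<Sum>p<k. Suc p * (K (Suc p) 1 + K (Suc p) 2))"
  unfolding wt_def by (rule sum.reindex_bij_witness[of _ Suc "\<lambda>p. p - 1"]) (auto simp: UNIV_2)

lemma count_list_12: "count_list ds 1 + count_list ds (2::2) = length ds"
proof (induction ds)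
  case (Cons d ds)
  from exhaust_2[of d] show ?case by (elim disjE) (simp_all add: Cons[symmetric])
qed simp

lemma finite_pairs: "finite {N :: 2 \<Rightarrow> nat. N 1 + N 2 = n}"
proof (rule finite_subset)
  show "finite {N :: 2 \<Rightarrow> nat. \<forall>i. (i \<in> UNIV \<longrightarrow> N i \<in> {..n}) \<and> (i \<notin> UNIV \<longrightarrow> N i = 0)}"
    by (rule finite_set_of_finite_funs) simp_all
  show "{N :: 2 \<Rightarrow> nat. N 1 + N 2 = n} \<subseteq> {N. \<forall>i. (i \<in> UNIV \<longrightarrow> N i \<in> {..n}) \<and> (i \<notin> UNIV \<longrightarrow> N i = 0)}"
    by (simp add: subset_iff forall_2)
qed

context surface
begin

text \<open>The differential of the \<open>i\<close>-th coordinate, as a function on tangent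
  vectors, which are jets of order 1 here.\<close>

definition dcoord :: "'a chart \<Rightarrow> 2 \<Rightarrow> 'a \<Rightarrow> (complex \<Rightarrow> 'a) set \<Rightarrow> complex" where
  "dcoord c i x j = jval c 1 x j 1 i"

lemma dcoord_jet: "holo_germ A f \<Longrightarrow> c \<in> A \<Longrightarrow> f 0 \<in> fst c \<Longrightarrow> dcoord c i (f 0) (jet A 1 f) = jc c f 1 i"
  unfolding dcoord_def by (rule jval_jet) simp_all

lemma cotangent_iff:
  "s \<in> cotangent A W \<longleftrightarrow> (\<forall>x v. x \<notin> W \<or> v \<notin> jets_at A 1 x \<longrightarrow> s x v = 0) \<and>
    (\<forall>c\<in>A. \<exists>a. (\<forall>i. holo_fun A (fst c \<inter> W) (a i)) \<and>
      (\<forall>f. holo_germ A f \<and> f 0 \<in> fst c \<inter> W \<longrightarrow> s (f 0) (jet A 1 f) = (\<Sum>i\<in>UNIV. a i (f 0) * jc c f 1 i)))"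
  unfolding cotangent_def case_prod_unfold mem_Collect_eq ..

text \<open>Basis elements live on a whole chart domain. Sections over \<open>W\<close> are
  normalised to be 0 elsewhere, so they are obtained by this restriction.\<close>

definition rst :: "'a set \<Rightarrow> ('a \<Rightarrow> 't \<Rightarrow> complex) \<Rightarrow> 'a \<Rightarrow> 't \<Rightarrow> complex" where
  "rst W s = (\<lambda>x t. if x \<in> W then s x t else 0)"

lemma dcoord_cotangent:
  assumes c: "c \<in> A" and W: "open W" "W \<subseteq> fst c"
  shows "rst W (dcoord c i) \<in> cotangent A W"
  unfolding cotangent_iff
proof (intro conjI allI impI ballI)
  show "rst W (dcoord c i) x v = 0" if "x \<notin> W \<or> v \<notin> jets_at A 1 x" for x v
    using that by (auto simp: rst_def dcoord_def jval_def)
  fix d assume d: "d \<in> A"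
  show "\<exists>a. (\<forall>i. holo_fun A (fst d \<inter> W) (a i)) \<and>
      (\<forall>f. holo_germ A f \<and> f 0 \<in> fst d \<inter> W \<longrightarrow> rst W (dcoord c i) (f 0) (jet A 1 f) = (\<Sum>i\<in>UNIV. a i (f 0) * jc d f 1 i))"
  proof (intro exI[of _ "\<lambda>l x. dir_deriv (\<lambda>z. trans_map d c z $ i) (axis l 1) (snd d x)"] conjI allI impI)
    show "holo_fun A (fst d \<inter> W) (\<lambda>x. dir_deriv (\<lambda>z. trans_map d c z $ i) (axis l 1) (snd d x))" for l
      by (rule holo_fun_coord[OF d W(1)], rule holo_on_subset[OF holo_on_dir_deriv[OF open_cimg[OF d chart_open[OF c]] trans_map_holo[OF d c]]])
        (use W(2) in blast)
    fix f assume "holo_germ A f \<and> f 0 \<in> fst d \<inter> W"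
    then have f: "holo_germ A f" "f 0 \<in> fst d" "f 0 \<in> W" "f 0 \<in> fst c" using W(2) by auto
    show "rst W (dcoord c i) (f 0) (jet A 1 f) =
        (\<Sum>l\<in>UNIV. dir_deriv (\<lambda>z. trans_map d c z $ i) (axis l 1) (snd d (f 0)) * jc d f 1 l)"
      unfolding rst_def using f(3) by (simp only: if_True dcoord_jet[OF f(1) c f(4)] jlin_1[OF d c f(1,2,4)] jlin_def)
  qed
qed

lemma cotangent_local:
  assumes c: "c \<in> A" and V: "V \<subseteq> fst c" and q: "q \<in> cotangent A V"
  shows "\<exists>a. (\<forall>i. holo_fun A V (a i)) \<and> (\<forall>y\<in>V. \<forall>t. q y t = (\<Sum>i\<in>UNIV. a i y * dcoord c i y t))"
proof -
  obtain a where a: "\<forall>i. holo_fun A (fst c \<inter> V) (a i)"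
    "\<forall>f. holo_germ A f \<and> f 0 \<in> fst c \<inter> V \<longrightarrow> q (f 0) (jet A 1 f) = (\<Sum>i\<in>UNIV. a i (f 0) * jc c f 1 i)"
    using q[unfolded cotangent_iff, THEN conjunct2, rule_format, OF c] by (elim exE conjE)
  have cV: "fst c \<inter> V = V" using V by blast
  have "q y t = (\<Sum>i\<in>UNIV. a i y * dcoord c i y t)" if y: "y \<in> V" for y t
  proof (cases "t \<in> jets_at A 1 y")
    case True
    then obtain f where f: "holo_germ A f" "f 0 = y" "t = jet A 1 f" by (rule jets_atE)
    have "q (f 0) (jet A 1 f) = (\<Sum>i\<in>UNIV. a i (f 0) * jc c f 1 i)"
      using a(2)[rule_format, of f] f(1,2) y by (simp only: cV simp_thms)
    moreover have "f 0 \<in> fst c" using V y f(2) by blast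
    ultimately show ?thesis unfolding f(3) f(2)[symmetric] by (simp only: dcoord_jet[OF f(1) c])
  next
    case False
    then have "q y t = 0" using q unfolding cotangent_iff by blast
    then show ?thesis using False by (simp add: dcoord_def jval_def)
  qed
  then show ?thesis using a(1)[unfolded cV] by (intro exI[of _ a] conjI ballI allI) simp_all
qed

text \<open>The monomial in the two coordinate differentials with exponents \<open>N\<close>. Fixing
  an order of the factors makes it a normal form for symmetric products.\<close>

definition sb :: "'a chart \<Rightarrow> (2 \<Rightarrow> nat) \<Rightarrow> 'a \<Rightarrow> (complex \<Rightarrow> 'a) set list \<Rightarrow> complex" where
  "sb c N = sym_product (replicate (N 1) (dcoord c 1) @ replicate (N 2) (dcoord c 2))"

lemma sb_list: "sym_product (map (dcoord c) ds) = sb c (\<lambda>i. count_list ds i)"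
  unfolding sb_def
proof (rule sym_product_perm)
  show "mset (map (dcoord c) ds) = mset (replicate (count_list ds 1) (dcoord c 1) @ replicate (count_list ds 2) (dcoord c 2))"
  proof (induction ds)
    case (Cons d ds)
    from exhaust_2[of d] show ?case by (elim disjE) (simp_all add: Cons[simplified])
  qed simp
qed

text \<open>Factors are replaced by coordinate differentials one at a time: \<open>ds\<close> lists
  those already treated, and multilinearity expands the next one.\<close>

lemma sym_lspan:
  assumes c: "c \<in> A" and V: "open V" "x \<in> V" "V \<subseteq> fst c"
  shows "set qs \<subseteq> cotangent A V \<Longrightarrow> length ds + length qs = n \<Longrightarrow>
    lspan {N. N 1 + N 2 = n} (sb c) x (sym_product (map (dcoord c) ds @ qs))"
proof (induction qs arbitrary: ds)
  case Nil
  then show ?case unfolding append_Nil2 sb_list by (intro lspan_mem finite_pairs) (simp add: count_list_12)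
next
  case (Cons q qs)
  obtain a where a: "\<forall>i. holo_fun A V (a i)" "\<forall>y\<in>V. \<forall>t. q y t = (\<Sum>i\<in>UNIV. a i y * dcoord c i y t)"
    using cotangent_local[OF c V(3) subsetD[OF Cons.prems(1) list.set_intros(1)]] by (elim exE conjE)
  show ?case
  proof (rule lspan_comb[where I = UNIV and h = a and g = "\<lambda>i. sym_product (map (dcoord c) ds @ dcoord c i # qs)", OF finite V(1,2)])
    show "holo_fun A V (a i)" for i by (rule a(1)[rule_format])
    show "sym_product (map (dcoord c) ds @ q # qs) y t = (\<Sum>i\<in>UNIV. a i y * sym_product (map (dcoord c) ds @ dcoord c i # qs) y t)"
      if "y \<in> V" for y t
      by (rule sym_product_slot) (rule a(2)[rule_format, OF that])
    show "lspan {N. N 1 + N 2 = n} (sb c) x (sym_product (map (dcoord c) ds @ dcoord c i # qs))" for i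
      using Cons.IH[of "ds @ [i]"] Cons.prems by simp
  qed
qed

definition tb :: "nat \<Rightarrow> 'a chart \<Rightarrow> expo \<Rightarrow> 'a \<Rightarrow> (complex \<Rightarrow> 'a) set list list \<Rightarrow> complex" where
  "tb k c K = tensor_product (map (\<lambda>p. sb c (K (Suc p))) [0..<k])"

text \<open>The same scheme for tensor slots: the first \<open>j\<close> slots already hold basis
  elements with exponents \<open>N\<close>, and the next slot is expanded on a neighbourhood of its
  own.\<close>

lemma tensor_lspan:
  assumes I: "I \<in> weighted_indices k m" and c: "c \<in> A"
  shows "(\<And>p. p < j \<Longrightarrow> N p 1 + N p 2 = I ! p) \<Longrightarrow> j + length qs = k \<Longrightarrow>
    (\<And>l. l < length qs \<Longrightarrow> lspan {N. N 1 + N 2 = I ! (j + l)} (sb c) x (qs ! l)) \<Longrightarrow>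
    lspan (typed k m I) (tb k c) x (tensor_product (map (\<lambda>p. sb c (N p)) [0..<j] @ qs))"
proof (induction qs arbitrary: j N)
  case Nil
  \<comment> \<open>Slot \<open>p\<close> belongs to derivative order \<open>Suc p\<close>, hence
    the shift; outside \<open>{1..k}\<close> the exponents are 0, as \<open>jet_exponents\<close>
    demands.\<close>
  define K where "K p = (if p \<in> {1..k} then N (p - 1) else (\<lambda>i. 0))" for p
  have j: "j = k" using Nil.prems(2) by simp
  have KS: "K (Suc p) = N p" if "p < k" for p using that by (simp add: K_def)
  have "wt k K = m" unfolding wt_Suc using I KS Nil.prems(1) by (simp add: weighted_indices_def j)
  then have K: "K \<in> typed k m I" unfolding typed_def jet_exponents_iff using KS Nil.prems(1) by (simp add: K_def j)
  have "tb k c K = tensor_product (map (\<lambda>p. sb c (N p)) [0..<j] @ [])"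
    unfolding tb_def j append_Nil2 by (intro arg_cong[where f = tensor_product] map_cong refl) (simp add: KS)
  then show ?case using lspan_mem[OF finite_typed K, of "tb k c" x] by (simp only:)
next
  case (Cons q qs)
  let ?T = "{N. N 1 + N 2 = I ! j}"
  obtain V a where a: "open V" "x \<in> V" "\<forall>L\<in>?T. holo_fun A V (a L)" "\<forall>y\<in>V. \<forall>t. q y t = (\<Sum>L\<in>?T. a L y * sb c L y t)"
  proof -
    have "lspan ?T (sb c) x q" using Cons.prems(3)[of 0] by simp
    then show thesis unfolding lspan_def by (elim exE conjE) (rule that)
  qed
  show ?case
  proof (rule lspan_comb[where I = ?T and h = a and g = "\<lambda>L. tensor_product (map (\<lambda>p. sb c (N p)) [0..<j] @ sb c L # qs)", OF finite_pairs a(1,2)])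
    show "holo_fun A V (a L)" if "L \<in> ?T" for L by (rule bspec[OF a(3) that])
    show "tensor_product (map (\<lambda>p. sb c (N p)) [0..<j] @ q # qs) y t
        = (\<Sum>L\<in>?T. a L y * tensor_product (map (\<lambda>p. sb c (N p)) [0..<j] @ sb c L # qs) y t)" if "y \<in> V" for y t
      by (rule tensor_product_slot) (rule a(4)[rule_format, OF that])
    fix L :: "2 \<Rightarrow> nat" assume L: "L \<in> ?T"
    have "lspan (typed k m I) (tb k c) x (tensor_product (map (\<lambda>p. sb c ((N(j := L)) p)) [0..<Suc j] @ qs))"
    proof (rule Cons.IH)
      show "(N(j := L)) p 1 + (N(j := L)) p 2 = I ! p" if "p < Suc j" for p
        using that L Cons.prems(1)[of p] by (cases "p = j") simp_all
      show "Suc j + length qs = k" using Cons.prems(2) by simp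
      show "lspan {N. N 1 + N 2 = I ! (Suc j + l)} (sb c) x (qs ! l)" if "l < length qs" for l
        using Cons.prems(3)[of "Suc l"] that by (simp only: list.size(4) add_Suc_right add_0_right Suc_less_eq nth_Cons_Suc add_Suc simp_thms)
    qed
    moreover have "map (\<lambda>p. sb c ((N(j := L)) p)) [0..<Suc j] @ qs = map (\<lambda>p. sb c (N p)) [0..<j] @ sb c L # qs"
      by simp
    ultimately show "lspan (typed k m I) (tb k c) x (tensor_product (map (\<lambda>p. sb c (N p)) [0..<j] @ sb c L # qs))"
      by (simp only:)
  qed
qed

end

lemma generated_sheafI:
  fixes n :: nat
  assumes "open W" "\<And>x. x \<notin> W \<Longrightarrow> s x = (\<lambda>t. 0)" "\<And>l. l < n \<Longrightarrow> holo_fun A W (h l)" "\<And>l. l < n \<Longrightarrow> g l \<in> G W"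
    "\<And>y t. y \<in> W \<Longrightarrow> s y t = (\<Sum>l<n. h l y * g l y t)"
  shows "s \<in> generated_sheaf A G W"
  unfolding generated_sheaf_def mem_Collect_eq
proof (intro conjI allI impI ballI)
  fix x assume "x \<in> W"
  then show "\<exists>V. open V \<and> x \<in> V \<and> V \<subseteq> W \<and> (\<exists>(n::nat) h g. (\<forall>l<n. holo_fun A V (h l) \<and> g l \<in> G V) \<and> (\<forall>y\<in>V. \<forall>t. s y t = (\<Sum>l<n. h l y * g l y t)))"
    by (intro exI[of _ W] conjI exI[of _ n] exI[of _ h] exI[of _ g] allI impI ballI assms order.refl)
qed (rule assms(2))

lemma generated_sheafD:
  assumes "s \<in> generated_sheaf A G W" "x \<in> W"
  shows "\<exists>V (n::nat) h g. open V \<and> x \<in> V \<and> V \<subseteq> W \<and> (\<forall>l<n. holo_fun A V (h l) \<and> g l \<in> G V) \<and>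
    (\<forall>y\<in>V. \<forall>t. s y t = (\<Sum>l<n. h l y * g l y t))"
  using assms(1)[unfolded generated_sheaf_def mem_Collect_eq, THEN conjunct2, rule_format, OF assms(2)]
  by (elim exE conjE) (intro exI conjI; assumption)

context surface
begin

section \<open>Evaluation of tensors on diagonals\<close>

lemma sb_diag:
  assumes "N 1 + N 2 = n"
  shows "sb c N x (replicate n j) = fact n * (\<Prod>i\<in>UNIV. dcoord c i x j ^ N i)"
proof -
  let ?ss = "replicate (N 1) (dcoord c 1) @ replicate (N 2) (dcoord c 2)"
  have len: "length ?ss = n" using assms by simp
  have "sb c N x (replicate n j) = fact n * prod_list (map (\<lambda>s. s x j) ?ss)"
    unfolding sb_def using sym_product_diag[of ?ss x j] by (simp only: len)
  then show ?thesis by (simp add: map_replicate_const UNIV_2 prod_list_replicate)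
qed

text \<open>Slot \<open>p\<close> receives equal copies of one vector \<open>j (Suc p)\<close>. An
  element of S_I turns into a polynomial in \<open>k\<close> independent vectors, formally a
  combination of jet monomials.\<close>

definition diag :: "nat list \<Rightarrow> (nat \<Rightarrow> 't) \<Rightarrow> 't list list" where
  "diag I j = map (\<lambda>p. replicate (I ! p) (j (Suc p))) [0..<length I]"

lemma tb_diag:
  assumes I: "I \<in> weighted_indices k m" and K: "K \<in> typed k m I"
  shows "tb k c K x (diag I j) = (\<Prod>p<k. fact (I ! p)) * jmono k K (\<lambda>p i. dcoord c i x (j p))"
proof -
  have len: "length I = k" using I by (simp add: weighted_indices_def)
  have "tb k c K x (diag I j) = (\<Prod>p<k. sb c (K (Suc p)) x (replicate (I ! p) (j (Suc p))))"
    by (simp add: tb_def tensor_product_def diag_def len)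
  also have "\<dots> = (\<Prod>p<k. fact (I ! p) * (\<Prod>i\<in>UNIV. dcoord c i x (j (Suc p)) ^ K (Suc p) i))"
    using K by (intro prod.cong refl sb_diag) (simp add: typed_def)
  also have "\<dots> = (\<Prod>p<k. fact (I ! p)) * (\<Prod>p<k. \<Prod>i\<in>UNIV. dcoord c i x (j (Suc p)) ^ K (Suc p) i)"
    by (rule prod.distrib)
  also have "(\<Prod>p<k. \<Prod>i\<in>UNIV. dcoord c i x (j (Suc p)) ^ K (Suc p) i) = jmono k K (\<lambda>p i. dcoord c i x (j p))"
    unfolding jmono_def by (rule prod.reindex_bij_witness[of _ "\<lambda>p. p - 1" Suc]) auto
  finally show ?thesis .
qed

text \<open>One germ for each order: the first derivative of \<open>f p\<close> plays the part of
  the \<open>p\<close>-th derivative of a single curve.\<close>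

lemma tangents_attained:
  assumes c: "c \<in> A" and x: "x \<in> fst c"
  obtains f where "\<And>p. holo_germ A (f p)" "\<And>p. f p 0 = x" "\<And>p i. jc c (f p) 1 i = v p i"
proof -
  have "\<forall>p. \<exists>f. holo_germ A f \<and> f 0 = x \<and> (\<forall>i. jc c f 1 i = v p i)"
  proof
    fix p
    obtain f where f: "holo_germ A f" "f 0 = x" "\<forall>q\<in>{1..1}. \<forall>i. jc c f q i = v p i"
      using jets_attained[OF c x, of 1 "\<lambda>q. v p"] by (elim exE conjE)
    show "\<exists>f. holo_germ A f \<and> f 0 = x \<and> (\<forall>i. jc c f 1 i = v p i)"
      by (rule exI[of _ f], intro conjI f(1,2)) (use f(3) in simp)
  qed
  from choice[OF this] obtain f where "\<forall>p. holo_germ A (f p) \<and> f p 0 = x \<and> (\<forall>i. jc c (f p) 1 i = v p i)" by (elim exE)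
  then show thesis by (intro that[of f]) simp_all
qed

lemma tb_diag_germs:
  assumes I: "I \<in> weighted_indices k m" and K: "K \<in> typed k m I" and c: "c \<in> A" "x \<in> fst c"
    and f: "\<And>p. holo_germ A (f p)" "\<And>p. f p 0 = x"
  shows "tb k c K x (diag I (\<lambda>p. jet A 1 (f p))) = (\<Prod>p<k. fact (I ! p)) * jmono k K (\<lambda>p i. jc c (f p) 1 i)"
proof -
  have "dcoord c i x (jet A 1 (f p)) = jc c (f p) 1 i" for i p
    using dcoord_jet[OF f(1) c(1), of p i] c(2) by (simp only: f(2))
  then show ?thesis unfolding tb_diag[OF I K] by simp
qed

lemma fact_prod_nonzero: "(\<Prod>p<k. fact (I ! p)) \<noteq> (0 :: complex)"
  by simp

lemma sb_mem:
  assumes c: "c \<in> A" and W: "open W" "W \<subseteq> fst c" and N: "N 1 + N 2 = n"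
  shows "rst W (sb c N) \<in> sym_power A n (cotangent A) W"
proof -
  let ?ss = "replicate (N 1) (rst W (dcoord c 1)) @ replicate (N 2) (rst W (dcoord c 2))"
  have cong: "sb c N y = sym_product ?ss y" if "y \<in> W" for y
    unfolding sb_def by (rule sym_product_cong) (auto simp: nth_append rst_def that)
  have G: "sym_product ?ss \<in> {sym_product ss |ss. length ss = n \<and> set ss \<subseteq> cotangent A W}"
  proof (intro CollectI exI[of _ ?ss] conjI refl)
    show "set ?ss \<subseteq> cotangent A W" using dcoord_cotangent[OF c W] by (auto simp: set_replicate_conv_if)
  qed (use N in simp)
  show ?thesis
    unfolding sym_power_def
  proof (rule generated_sheafI[where n = 1 and h = "\<lambda>l y. 1" and g = "\<lambda>l. sym_product ?ss", OF W(1)])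
    show "rst W (sb c N) x = (\<lambda>t. 0)" if "x \<notin> W" for x using that by (simp add: rst_def)
    show "rst W (sb c N) y t = (\<Sum>l<1::nat. 1 * sym_product ?ss y t)" if "y \<in> W" for y t
      using that by (simp add: rst_def cong)
  qed (rule holo_fun_const G)+
qed

lemma tb_mem:
  assumes I: "I \<in> weighted_indices k m" and c: "c \<in> A" and W: "open W" "W \<subseteq> fst c" and h: "\<And>K. K \<in> typed k m I \<Longrightarrow> holo_fun A W (h K)"
  shows "(\<lambda>x t. if x \<in> W then \<Sum>K\<in>typed k m I. h K x * tb k c K x t else 0) \<in> S_sheaf A I W"
proof -
  let ?T = "typed k m I" and ?Fs = "map (\<lambda>i. sym_power A i (cotangent A)) I"
  let ?G = "\<lambda>V. {tensor_product ss |ss. length ss = length ?Fs \<and> (\<forall>l<length ?Fs. ss ! l \<in> (?Fs ! l) V)}"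
  have len: "length I = k" using I by (simp add: weighted_indices_def)
  define g where "g K = tensor_product (map (\<lambda>p. rst W (sb c (K (Suc p)))) [0..<k])" for K :: "nat \<Rightarrow> 2 \<Rightarrow> nat"
  have cong: "tb k c K y = g K y" if "y \<in> W" for y K
    unfolding tb_def g_def by (rule tensor_product_cong) (simp_all add: rst_def that)
  have G: "g K \<in> ?G W" if K: "K \<in> ?T" for K
    unfolding g_def
  proof (intro CollectI exI[of _ "map (\<lambda>p. rst W (sb c (K (Suc p)))) [0..<k]"] conjI refl allI impI)
    fix l assume l: "l < length ?Fs"
    then have l: "l < k" by (simp add: len)
    have "rst W (sb c (K (Suc l))) \<in> sym_power A (I ! l) (cotangent A) W"
      by (rule sb_mem[OF c W]) (use K l in \<open>simp add: typed_def\<close>)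
    then show "map (\<lambda>p. rst W (sb c (K (Suc p)))) [0..<k] ! l \<in> (?Fs ! l) W" using l by (simp add: len)
  qed (simp add: len)
  have en: "enum ?T l \<in> ?T" if "l < card ?T" for l
    by (rule bij_betw_apply[OF enum[OF finite_typed]]) (simp add: that)
  let ?s = "\<lambda>x t. if x \<in> W then \<Sum>K\<in>?T. h K x * tb k c K x t else 0"
  have "?s \<in> generated_sheaf A ?G W"
  proof (rule generated_sheafI[where n = "card ?T" and h = "\<lambda>l. h (enum ?T l)" and g = "\<lambda>l. g (enum ?T l)", OF W(1)])
    show "?s x = (\<lambda>t. 0)" if "x \<notin> W" for x using that by simp
    show "holo_fun A W (h (enum ?T l))" if "l < card ?T" for l by (rule h[OF en[OF that]])
    show "g (enum ?T l) \<in> ?G W" if "l < card ?T" for l by (rule G[OF en[OF that]])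
    show "?s y t = (\<Sum>l<card ?T. h (enum ?T l) y * g (enum ?T l) y t)" if y: "y \<in> W" for y t
      using y unfolding sum_enum[OF finite_typed, of "\<lambda>K. h K y * g K y t"] by (simp only: if_True cong)
  qed
  then show ?thesis unfolding S_sheaf_def tensor_sheaf_def .
qed

lemma sym_power_lspan:
  assumes c: "c \<in> A" and V: "open V" "x \<in> V" "V \<subseteq> fst c" and s: "s \<in> sym_power A n (cotangent A) V"
  shows "lspan {N. N 1 + N 2 = n} (sb c) x s"
proof -
  obtain V' and n' :: nat and h g where *: "open V'" "x \<in> V'" "V' \<subseteq> V"
    "\<forall>l<n'. holo_fun A V' (h l) \<and> g l \<in> {sym_product ss |ss. length ss = n \<and> set ss \<subseteq> cotangent A V'}"
    "\<forall>y\<in>V'. \<forall>t. s y t = (\<Sum>l<n'. h l y * g l y t)"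
    using generated_sheafD[OF s[unfolded sym_power_def] V(2)] by (elim exE conjE) (rule that; assumption)
  have V': "V' \<subseteq> fst c" using *(3) V(3) by (rule order.trans)
  show ?thesis
  proof (rule lspan_comb[where I = "{..<n'}" and h = h and g = g, OF finite_lessThan *(1,2)])
    show "holo_fun A V' (h l)" if "l \<in> {..<n'}" for l using *(4) that by simp
    show "s y t = (\<Sum>l<n'. h l y * g l y t)" if "y \<in> V'" for y t by (rule *(5)[rule_format, OF that])
    fix l assume "l \<in> {..<n'}"
    then have "g l \<in> {sym_product ss |ss. length ss = n \<and> set ss \<subseteq> cotangent A V'}" using *(4) by simp
    then obtain ss where ss: "g l = sym_product ss" "length ss = n" "set ss \<subseteq> cotangent A V'" by (elim CollectE exE conjE)
    show "lspan {N. N 1 + N 2 = n} (sb c) x (g l)"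
      unfolding ss(1) using sym_lspan[OF c *(1,2) V' ss(3), of "[]" n] ss(2) by simp
  qed
qed

lemma S_sheaf_lspan:
  assumes I: "I \<in> weighted_indices k m" and c: "c \<in> A" and W: "x \<in> W" "W \<subseteq> fst c" and s: "s \<in> S_sheaf A I W"
  shows "lspan (typed k m I) (tb k c) x s"
proof -
  let ?Fs = "map (\<lambda>i. sym_power A i (cotangent A)) I"
  have len: "length I = k" using I by (simp add: weighted_indices_def)
  obtain V and n :: nat and h g where *: "open V" "x \<in> V" "V \<subseteq> W"
    "\<forall>l<n. holo_fun A V (h l) \<and> g l \<in> {tensor_product ss |ss. length ss = length ?Fs \<and> (\<forall>l<length ?Fs. ss ! l \<in> (?Fs ! l) V)}"
    "\<forall>y\<in>V. \<forall>t. s y t = (\<Sum>l<n. h l y * g l y t)"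
    using generated_sheafD[OF s[unfolded S_sheaf_def tensor_sheaf_def] W(1)]
    by (elim exE conjE) (rule that; assumption)
  have V: "V \<subseteq> fst c" using *(3) W(2) by (rule order.trans)
  show ?thesis
  proof (rule lspan_comb[where I = "{..<n}" and h = h and g = g, OF finite_lessThan *(1,2)])
    show "holo_fun A V (h l)" if "l \<in> {..<n}" for l using *(4) that by simp
    show "s y t = (\<Sum>l<n. h l y * g l y t)" if "y \<in> V" for y t by (rule *(5)[rule_format, OF that])
    fix l assume "l \<in> {..<n}"
    then have "g l \<in> {tensor_product ss |ss. length ss = length ?Fs \<and> (\<forall>l<length ?Fs. ss ! l \<in> (?Fs ! l) V)}" using *(4) by simp
    then obtain ss where ss: "g l = tensor_product ss" "length ss = length ?Fs" "\<forall>l<length ?Fs. ss ! l \<in> (?Fs ! l) V" by (elim CollectE exE conjE)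
    have "lspan (typed k m I) (tb k c) x (tensor_product (map (\<lambda>p. sb c ((\<lambda>p i. 0) p)) [0..<0] @ ss))"
    proof (rule tensor_lspan[OF I c])
      show "0 + length ss = k" using ss(2) len by simp
      fix p assume p: "p < length ss"
      then have "ss ! p \<in> sym_power A (I ! p) (cotangent A) V" using ss(3)[rule_format, of p] ss(2) by simp
      then show "lspan {N. N 1 + N 2 = I ! (0 + p)} (sb c) x (ss ! p)"
        unfolding add_0 by (rule sym_power_lspan[OF c *(1,2) V])
    qed simp
    then show "lspan (typed k m I) (tb k c) x (g l)" unfolding ss(1) by simp
  qed
qed

text \<open>Generation comes from expanding symmetric and then tensor products near a point.
  Independence holds because evaluation on diagonals turns the basis into jet monomials, up to a
  common nonzero factor.\<close>

theorem local_frame_S: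
  assumes I: "I \<in> weighted_indices k m" and c: "c \<in> A"
  shows "local_frame A (S_sheaf A I) (card (typed k m I)) (fst c) (\<lambda>i. tb k c (enum (typed k m I) i))"
proof (rule local_frameI[OF finite_typed chart_open[OF c]])
  show "(\<lambda>x t. if x \<in> W then \<Sum>K\<in>typed k m I. h K x * tb k c K x t else 0) \<in> S_sheaf A I W"
    if "open W" "W \<subseteq> fst c" "\<And>K. K \<in> typed k m I \<Longrightarrow> holo_fun A W (h K)" for W h by (rule tb_mem[OF I c that])
  show "s x t = 0" if "s \<in> S_sheaf A I W" "x \<notin> W" for W s x t
  proof -
    have "s x = (\<lambda>t. 0)"
      using that(1)[unfolded S_sheaf_def tensor_sheaf_def generated_sheaf_def mem_Collect_eq, THEN conjunct1, rule_format, OF that(2)] .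
    then show ?thesis by simp
  qed
next
  fix W s x assume W: "open W" "W \<subseteq> fst c" and s: "s \<in> S_sheaf A I W" and x: "x \<in> W"
  from S_sheaf_lspan[OF I c x W(2) s] obtain V a where V: "open V" "x \<in> V" "\<forall>K\<in>typed k m I. holo_fun A V (a K)"
    "\<forall>y\<in>V. \<forall>t. s y t = (\<Sum>K\<in>typed k m I. a K y * tb k c K y t)" unfolding lspan_def by (elim exE conjE)
  show "\<exists>U h. open U \<and> x \<in> U \<and> U \<subseteq> W \<and> (\<forall>K\<in>typed k m I. holo_fun A U (h K)) \<and>
      (\<forall>y\<in>U. \<forall>t. s y t = (\<Sum>K\<in>typed k m I. h K y * tb k c K y t))"
  proof (intro exI[of _ "V \<inter> W"] exI[of _ a] conjI ballI allI)
    show "holo_fun A (V \<inter> W) (a K)" if "K \<in> typed k m I" for K by (rule holo_fun_subset[OF bspec[OF V(3) that]]) simp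
    show "s y t = (\<Sum>K\<in>typed k m I. a K y * tb k c K y t)" if "y \<in> V \<inter> W" for y t
      by (rule V(4)[rule_format]) (use that in blast)
  qed (use V(1,2) W(1) x in auto)
next
  fix x :: 'a and b :: "expo \<Rightarrow> complex" and K
  assume x: "x \<in> fst c" and z: "\<And>t. (\<Sum>K\<in>typed k m I. b K * tb k c K x t) = 0" and K: "K \<in> typed k m I"
  \<comment> \<open>Extended by 0 to all exponents of weight \<open>m\<close>, where independence of
    the monomials is known.\<close>
  let ?b = "\<lambda>K. if K \<in> typed k m I then b K else 0"
  have "?b K = 0"
  proof (rule jmono_independent[where a = ?b and k = k and m = m])
    show "K \<in> jet_exponents k m" using K by (simp add: typed_def)
    fix v :: "nat \<Rightarrow> 2 \<Rightarrow> complex"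
    obtain f where f: "\<And>p. holo_germ A (f p)" "\<And>p. f p 0 = x" "\<And>p i. jc c (f p) 1 i = v p i"
      by (rule tangents_attained[OF c x, of v]) (rule that; assumption)
    have e: "tb k c L x (diag I (\<lambda>p. jet A 1 (f p))) = (\<Prod>p<k. fact (I ! p)) * jmono k L v" if "L \<in> typed k m I" for L
      unfolding tb_diag_germs[OF I that c x f(1,2)] f(3) ..
    have "(\<Prod>p<k. fact (I ! p)) * (\<Sum>L\<in>typed k m I. b L * jmono k L v) = (\<Sum>L\<in>typed k m I. b L * tb k c L x (diag I (\<lambda>p. jet A 1 (f p))))"
      unfolding sum_distrib_left by (intro sum.cong refl) (simp only: e mult_ac)
    then have "(\<Sum>L\<in>typed k m I. b L * jmono k L v) = 0" using fact_prod_nonzero[of I k] by (simp only: z mult_eq_0_iff simp_thms)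
    moreover have "(\<Sum>L\<in>jet_exponents k m. ?b L * jmono k L v) = (\<Sum>L\<in>typed k m I. b L * jmono k L v)"
      by (rule sum.mono_neutral_cong_right[OF finite_jet_exponents]) (auto simp: typed_def)
    ultimately show "(\<Sum>L\<in>jet_exponents k m. ?b L * jmono k L v) = 0" by (rule trans[rotated])
  qed
  then show "b K = 0" using K by simp
qed

end

section \<open>Block triangular matrices\<close>

abbreviation jrank :: "nat \<Rightarrow> nat \<Rightarrow> nat" where "jrank k m \<equiv> card (jet_exponents k m)"
abbreviation srank :: "nat \<Rightarrow> nat \<Rightarrow> nat list \<Rightarrow> nat" where "srank k m I \<equiv> card (typed k m I)"
abbreviation jix :: "nat \<Rightarrow> nat \<Rightarrow> expo \<Rightarrow> nat" where "jix k m \<equiv> ix (jet_exponents k m)"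
abbreviation six :: "nat \<Rightarrow> nat \<Rightarrow> nat list \<Rightarrow> expo \<Rightarrow> nat" where "six k m I \<equiv> ix (typed k m I)"

definition tp :: "nat \<Rightarrow> expo \<Rightarrow> nat list" where
  "tp k K = map (\<lambda>p. K (Suc p) 1 + K (Suc p) 2) [0..<k]"

lemma typed_iff: "I \<in> weighted_indices k m \<Longrightarrow> K \<in> typed k m I \<longleftrightarrow> K \<in> jet_exponents k m \<and> tp k K = I"
  by (simp add: typed_def tp_def weighted_indices_def list_eq_iff_nth_eq)

lemma tp_weighted: "K \<in> jet_exponents k m \<Longrightarrow> tp k K \<in> weighted_indices k m"
  by (simp add: jet_exponents_iff wt_Suc tp_def weighted_indices_def)

text \<open>Blocks can be compared by \<open>sq\<close>, because it is constant on each of them.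
  Distinct types may share a value; the definition of \<open>bt\<close> below then decouples them in
  both directions.\<close>

lemma sq_tp: "tp k K = tp k L \<Longrightarrow> sq k K = sq k L"
proof -
  assume "tp k K = tp k L"
  then have "K (Suc p) 1 + K (Suc p) 2 = L (Suc p) 1 + L (Suc p) 2" if "p < k" for p
    using arg_cong[of "tp k K" "tp k L" "\<lambda>I. I ! p"] that by (simp add: tp_def)
  then have "(\<Sum>i\<in>UNIV. int (K p i)) = (\<Sum>i\<in>UNIV. int (L p i))" if "p \<in> {1..k}" for p
  proof -
    assume *: "\<And>p. p < k \<Longrightarrow> K (Suc p) 1 + K (Suc p) 2 = L (Suc p) 1 + L (Suc p) 2"
    have p: "Suc (p - 1) = p" "p - 1 < k" using that by auto
    have "K p 1 + K p 2 = L p 1 + L p 2" using *[OF p(2)] by (simp only: p(1))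
    then show ?thesis by (simp add: UNIV_2 flip: of_nat_add)
  qed
  then show ?thesis unfolding sq_def by (intro sum.cong refl) simp
qed

lemma finite_weighted: "finite (weighted_indices k m)"
proof (rule finite_subset)
  show "finite {xs. set xs \<subseteq> {..m} \<and> length xs = k}" by (rule finite_lists_length_eq) simp
  show "weighted_indices k m \<subseteq> {xs. set xs \<subseteq> {..m} \<and> length xs = k}"
  proof
    fix I assume I: "I \<in> weighted_indices k m"
    have "I ! j \<le> m" if "j < k" for j
    proof -
      have "I ! j \<le> Suc j * I ! j" by simp
      also have "\<dots> \<le> (\<Sum>j<k. Suc j * I ! j)" by (rule member_le_sum[of j "{..<k}" "\<lambda>j. Suc j * I ! j"]) (use that in simp_all)
      also have "\<dots> = m" using I by (simp add: weighted_indices_def)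
      finally show ?thesis .
    qed
    then show "I \<in> {xs. set xs \<subseteq> {..m} \<and> length xs = k}" using I by (auto simp: weighted_indices_def in_set_conv_nth)
  qed
qed

text \<open>The monomials are ordered by \<^const>\<open>sq\<close>; monomials of one type form a block, and the diagonal blocks
  of \<open>M\<close> are the matrices \<open>N I\<close>.\<close>

definition bt :: "nat \<Rightarrow> nat \<Rightarrow> (nat \<Rightarrow> nat \<Rightarrow> 'r::ring) \<Rightarrow> (nat list \<Rightarrow> nat \<Rightarrow> nat \<Rightarrow> 'r) \<Rightarrow> bool" where
  "bt k m M N \<longleftrightarrow> (\<forall>K\<in>jet_exponents k m. \<forall>L\<in>jet_exponents k m.
    (tp k K = tp k L \<longrightarrow> M (jix k m K) (jix k m L)
      = N (tp k K) (six k m (tp k K) K) (six k m (tp k K) L)) \<and>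
    (tp k K \<noteq> tp k L \<longrightarrow> sq k L \<le> sq k K \<longrightarrow> M (jix k m K) (jix k m L) = 0))"

lemma btI:
  assumes "\<And>K L. K \<in> jet_exponents k m \<Longrightarrow> L \<in> jet_exponents k m \<Longrightarrow> tp k K = tp k L \<Longrightarrow>
      M (jix k m K) (jix k m L) = N (tp k K) (six k m (tp k K) K) (six k m (tp k K) L)"
    "\<And>K L. K \<in> jet_exponents k m \<Longrightarrow> L \<in> jet_exponents k m \<Longrightarrow> tp k K \<noteq> tp k L \<Longrightarrow> sq k L \<le> sq k K \<Longrightarrow>
      M (jix k m K) (jix k m L) = 0"
  shows "bt k m M N"
  unfolding bt_def by (intro ballI conjI impI assms)

lemma btD:
  assumes "bt k m M N" "K \<in> jet_exponents k m" "L \<in> jet_exponents k m"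
  shows "tp k K = tp k L \<Longrightarrow> M (jix k m K) (jix k m L) = N (tp k K) (six k m (tp k K) K) (six k m (tp k K) L)"
    "tp k K \<noteq> tp k L \<Longrightarrow> sq k L \<le> sq k K \<Longrightarrow> M (jix k m K) (jix k m L) = 0"
  by (rule assms(1)[unfolded bt_def, rule_format, OF assms(2,3), THEN conjunct1, rule_format]
      assms(1)[unfolded bt_def, rule_format, OF assms(2,3), THEN conjunct2, rule_format]; assumption)+

lemma bt_map: "bt k m M N \<Longrightarrow> f 0 = 0 \<Longrightarrow> bt k m (\<lambda>i j. f (M i j)) (\<lambda>I i j. f (N I i j))"
  by (rule btI) (simp_all add: btD)

lemma bt_add: "bt k m M N \<Longrightarrow> bt k m M' N' \<Longrightarrow> bt k m (\<lambda>i j. M i j + M' i j) (\<lambda>I i j. N I i j + N' I i j)"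
  by (rule btI) (simp_all add: btD)

lemma bt_zero: "bt k m (\<lambda>i j. 0) (\<lambda>I i j. 0)"
  by (rule btI) simp_all

lemma bt_sum: "(\<And>n. n \<in> S \<Longrightarrow> bt k m (M n) (N n)) \<Longrightarrow> bt k m (\<lambda>i j. \<Sum>n\<in>S. M n i j) (\<lambda>I i j. \<Sum>n\<in>S. N n I i j)"
  by (induction S rule: infinite_finite_induct) (simp_all add: bt_zero bt_add)

text \<open>From row to column, a nonzero entry keeps the type or strictly raises \<open>sq\<close>.
  A path from \<open>K\<close> over \<open>P\<close> to \<open>L\<close> that does not raise
  \<open>sq\<close> in total keeps the type at both steps, so the diagonal blocks multiply
  separately.\<close>

lemma bt_mmul:
  assumes M: "bt k m M N" and M': "bt k m M' N'"
  shows "bt k m (mmul (jrank k m) M M') (\<lambda>I. mmul (srank k m I) (N I) (N' I))"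
proof -
  let ?E = "jet_exponents k m"
  have e: "mmul (card ?E) M M' i j = (\<Sum>P\<in>?E. M i (ix ?E P) * M' (ix ?E P) j)" for i j
    unfolding mmul_def by (rule sum_ix[OF finite_jet_exponents])
  have z: "M (ix ?E K) (ix ?E P) * M' (ix ?E P) (ix ?E L) = 0"
    if K: "K \<in> ?E" and L: "L \<in> ?E" and P: "P \<in> ?E" and s: "sq k L \<le> sq k K" and t: "\<not> (tp k K = tp k P \<and> tp k P = tp k L)" for K L P
  proof (cases "tp k K \<noteq> tp k P \<and> sq k P \<le> sq k K")
    case True
    then have "M (ix ?E K) (ix ?E P) = 0" by (intro btD(2)[OF M K P]) simp_all
    then show ?thesis by simp
  next
    case False
    have "tp k P \<noteq> tp k L \<and> sq k L \<le> sq k P"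
      using False s t sq_tp[of k K P] sq_tp[of k P L] by (cases "tp k K = tp k P") force+
    then have "M' (ix ?E P) (ix ?E L) = 0" by (intro btD(2)[OF M' P L]) simp_all
    then show ?thesis by simp
  qed
  show ?thesis
  proof (rule btI)
    fix K L assume K: "K \<in> ?E" and L: "L \<in> ?E" and t: "tp k K = tp k L"
    let ?I = "tp k K"
    have I: "?I \<in> weighted_indices k m" by (rule tp_weighted[OF K])
    have "mmul (card ?E) M M' (ix ?E K) (ix ?E L) = (\<Sum>P\<in>typed k m ?I. N ?I (six k m ?I K) (six k m ?I P) * N' ?I (six k m ?I P) (six k m ?I L))"
      unfolding e
    proof (rule sum.mono_neutral_cong_right[OF finite_jet_exponents])
      show "typed k m ?I \<subseteq> ?E" using typed_iff[OF I] by blast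
      show "\<forall>P\<in>?E - typed k m ?I. M (ix ?E K) (ix ?E P) * M' (ix ?E P) (ix ?E L) = 0"
      proof
        fix P assume "P \<in> ?E - typed k m ?I"
        then show "M (ix ?E K) (ix ?E P) * M' (ix ?E P) (ix ?E L) = 0"
          by (intro z[OF K L]) (simp_all add: typed_iff[OF I] sq_tp[OF t] eq_commute[of ?I])
      qed
      fix P assume "P \<in> typed k m ?I"
      then have P: "P \<in> ?E" "tp k P = ?I" by (simp_all add: typed_iff[OF I])
      show "M (ix ?E K) (ix ?E P) * M' (ix ?E P) (ix ?E L) = N ?I (six k m ?I K) (six k m ?I P) * N' ?I (six k m ?I P) (six k m ?I L)"
        using btD(1)[OF M K P(1)] btD(1)[OF M' P(1) L] P(2) t by simp
    qed
    then show "mmul (card ?E) M M' (ix ?E K) (ix ?E L) = mmul (srank k m ?I) (N ?I) (N' ?I) (six k m ?I K) (six k m ?I L)"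
      unfolding mmul_def[of "srank k m ?I"] by (simp only: sum_ix[OF finite_typed])
  next
    fix K L assume K: "K \<in> ?E" and L: "L \<in> ?E" and t: "tp k K \<noteq> tp k L" "sq k L \<le> sq k K"
    show "mmul (card ?E) M M' (ix ?E K) (ix ?E L) = 0"
      unfolding e
    proof (rule sum.neutral, rule ballI)
      fix P assume P: "P \<in> ?E"
      have "\<not> (tp k K = tp k P \<and> tp k P = tp k L)" using t(1) by metis
      from z[OF K L P t(2) this] show "M (ix ?E K) (ix ?E P) * M' (ix ?E P) (ix ?E L) = 0" .
    qed
  qed
qed

lemma bt_mtr:
  assumes M: "bt k m M N"
  shows "mtr (jrank k m) M = (\<Sum>I\<in>weighted_indices k m. mtr (srank k m I) (N I))"
proof -
  let ?E = "jet_exponents k m"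
  have "mtr (card ?E) M = (\<Sum>K\<in>?E. M (ix ?E K) (ix ?E K))"
    unfolding mtr_def by (rule sum_ix[OF finite_jet_exponents])
  also have "\<dots> = (\<Sum>I\<in>weighted_indices k m. \<Sum>K | K \<in> ?E \<and> tp k K = I. M (ix ?E K) (ix ?E K))"
    by (rule sum.group[symmetric, OF finite_jet_exponents finite_weighted]) (auto simp: tp_weighted)
  also have "\<dots> = (\<Sum>I\<in>weighted_indices k m. mtr (srank k m I) (N I))"
  proof (rule sum.cong[OF refl])
    fix I assume I: "I \<in> weighted_indices k m"
    have "(\<Sum>K | K \<in> ?E \<and> tp k K = I. M (ix ?E K) (ix ?E K)) = (\<Sum>K\<in>typed k m I. N I (ix (typed k m I) K) (ix (typed k m I) K))"
    proof (rule sum.cong)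
      show "{K. K \<in> ?E \<and> tp k K = I} = typed k m I" using typed_iff[OF I] by blast
      show "M (ix ?E K) (ix ?E K) = N I (ix (typed k m I) K) (ix (typed k m I) K)" if "K \<in> typed k m I" for K
        using btD(1)[OF M, of K K] that[unfolded typed_iff[OF I]] by simp
    qed
    also have "\<dots> = mtr (srank k m I) (N I)" unfolding mtr_def by (simp only: sum_ix[OF finite_typed])
    finally show "(\<Sum>K | K \<in> ?E \<and> tp k K = I. M (ix ?E K) (ix ?E K)) = mtr (srank k m I) (N I)" .
  qed
  finally show ?thesis .
qed

context surface
begin

section \<open>Comparison of frame changes\<close>

definition frames_J :: "nat \<Rightarrow> nat \<Rightarrow> 'a chart \<Rightarrow> nat \<Rightarrow> 'a \<Rightarrow> (complex \<Rightarrow> 'a) set \<Rightarrow> complex" where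
  "frames_J k m c i = jframe k c (enum (jet_exponents k m) i)"

definition frames_S :: "nat \<Rightarrow> nat \<Rightarrow> nat list \<Rightarrow> 'a chart \<Rightarrow> nat \<Rightarrow> 'a \<Rightarrow> (complex \<Rightarrow> 'a) set list list \<Rightarrow> complex" where
  "frames_S k m I c i = tb k c (enum (typed k m I) i)"

text \<open>Evaluating the change of frames on diagonals gives the same product of factorials on
  both sides; cancelling it leaves an identity of polynomials in the free variables
  \<open>v\<close>.\<close>

lemma frames_S_change:
  assumes I: "I \<in> weighted_indices k m" and c: "c \<in> A" "d \<in> A" and x: "x \<in> fst c" "x \<in> fst d"
    and g: "changes (srank k m I) (fst c) (frames_S k m I c) (srank k m I) (fst d) (frames_S k m I d) g"
    and K: "K \<in> typed k m I"
  shows "(\<Sum>L\<in>typed k m I. g (ix (typed k m I) L) (ix (typed k m I) K) x * jmono k L v) = jmono k K (jlin c d (snd c x) v)"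
proof -
  let ?T = "typed k m I"
  have fin: "finite ?T" by (rule finite_typed)
  obtain f where f: "\<And>p. holo_germ A (f p)" "\<And>p. f p 0 = x" "\<And>p i. jc c (f p) 1 i = v p i"
    by (rule tangents_attained[OF c(1) x(1), of v]) (rule that; assumption)
  let ?t = "diag I (\<lambda>p. jet A 1 (f p))" and ?F = "\<Prod>p<k. fact (I ! p) :: complex"
  have d: "jc d (f p) 1 i = jlin c d (snd c x) v p i" for p i
    using jlin_1[OF c f(1), of p i] x by (simp add: f(2) jlin_def f(3)[unfolded One_nat_def])
  have "?F * jmono k K (jlin c d (snd c x) v) = frames_S k m I d (ix ?T K) x ?t"
    unfolding frames_S_def ix(2)[OF fin K] tb_diag_germs[OF I K c(2) x(2) f(1,2)] d ..
  also have "\<dots> = (\<Sum>i<card ?T. g i (ix ?T K) x * frames_S k m I c i x ?t)"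
    using g[unfolded changes_def, THEN conjunct2, rule_format, of x "ix ?T K" ?t] x ix(1)[OF fin K] by simp
  also have "\<dots> = (\<Sum>L\<in>?T. g (ix ?T L) (ix ?T K) x * frames_S k m I c (ix ?T L) x ?t)" by (rule sum_ix[OF fin])
  also have "\<dots> = (\<Sum>L\<in>?T. ?F * (g (ix ?T L) (ix ?T K) x * jmono k L v))"
  proof (rule sum.cong[OF refl])
    fix L assume L: "L \<in> ?T"
    show "g (ix ?T L) (ix ?T K) x * frames_S k m I c (ix ?T L) x ?t = ?F * (g (ix ?T L) (ix ?T K) x * jmono k L v)"
      unfolding frames_S_def ix(2)[OF fin L] tb_diag_germs[OF I L c(1) x(1) f(1,2)] f(3) by (rule mult.left_commute)
  qed
  also have "\<dots> = ?F * (\<Sum>L\<in>?T. g (ix ?T L) (ix ?T K) x * jmono k L v)" by (rule sum_distrib_left[symmetric])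
  finally show ?thesis using fact_prod_nonzero[of I k] by (simp only: mult_cancel_left simp_thms)
qed

text \<open>Evaluated on jets with arbitrary coordinates \<open>v\<close>, the change of frames is
  the coordinate change of a monomial, whose corrections have strictly smaller
  \<open>sq\<close>.\<close>

lemma frames_J_change:
  assumes c: "c \<in> A" "d \<in> A" and x: "x \<in> fst c" "x \<in> fst d"
    and g: "changes (jrank k m) (fst c) (frames_J k m c) (jrank k m) (fst d) (frames_J k m d) g"
    and K: "K \<in> jet_exponents k m"
  shows "\<exists>a. \<forall>v. (\<Sum>L\<in>jet_exponents k m. g (jix k m L) (jix k m K) x * jmono k L v)
    = jmono k K (jlin c d (snd c x) v) + (\<Sum>L | L \<in> jet_exponents k m \<and> sq k L \<le> sq k K - 1. a L * jmono k L v)"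
proof -
  let ?T = "jet_exponents k m"
  have fin: "finite ?T" by (rule finite_jet_exponents)
  have wt: "wt k K = m" using K by (simp add: jet_exponents_iff)
  obtain R where R: "jpoly (cimg c (fst d)) k m (sq k K - 1) R"
    and eq: "\<forall>f. holo_germ A f \<longrightarrow> f 0 \<in> fst c \<longrightarrow> f 0 \<in> fst d \<longrightarrow>
      jmono k K (jc d f) = jmono k K (jlin c d (snd c (f 0)) (jc c f)) + R (snd c (f 0)) (jc c f)"
    using jmono_change(1)[OF c, of k K] unfolding wt by (elim exE conjE)
  obtain a where a: "\<forall>z v. R z v = (\<Sum>L | L \<in> ?T \<and> sq k L \<le> sq k K - 1. a L z * jmono k L v)"
    using jpoly_expand[OF R] by (elim exE conjE)
  show ?thesis
  proof (intro exI[of _ "\<lambda>L. a L (snd c x)"] allI)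
    fix v
    obtain f where f: "holo_germ A f" "f 0 = x" "\<forall>p\<in>{1..k}. \<forall>i. jc c f p i = v p i"
      using jets_attained[OF c(1) x(1), of k v] by (elim exE conjE)
    have cong: "jmono k L (jc c f) = jmono k L v" for L by (rule jmono_cong) (simp only: f(3)[rule_format])
    have congl: "jmono k K (jlin c d z (jc c f)) = jmono k K (jlin c d z v)" for z
      by (rule jmono_cong) (simp only: jlin_def f(3)[rule_format])
    have fc: "f 0 \<in> fst c" "f 0 \<in> fst d" using x by (simp_all only: f(2))
    have jf: "jframe k c' L x (jet A k f) = jmono k L (jc c' f)" if "c' \<in> A" "x \<in> fst c'" for c' L
      using jframe_jet[OF f(1) that(1), of k L] that(2) by (simp only: f(2))
    have "jmono k K (jc d f) = frames_J k m d (ix ?T K) x (jet A k f)"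
      unfolding frames_J_def ix(2)[OF fin K] by (rule jf[OF c(2) x(2), symmetric])
    also have "\<dots> = (\<Sum>i<card ?T. g i (ix ?T K) x * frames_J k m c i x (jet A k f))"
      using g[unfolded changes_def, THEN conjunct2, rule_format, of x "ix ?T K" "jet A k f"] x ix(1)[OF fin K] by simp
    also have "\<dots> = (\<Sum>L\<in>?T. g (ix ?T L) (ix ?T K) x * frames_J k m c (ix ?T L) x (jet A k f))" by (rule sum_ix[OF fin])
    also have "\<dots> = (\<Sum>L\<in>?T. g (ix ?T L) (ix ?T K) x * jmono k L v)"
      by (intro sum.cong refl) (simp only: frames_J_def ix(2)[OF fin] jf[OF c(1) x(1)] cong)
    finally show "(\<Sum>L\<in>?T. g (ix ?T L) (ix ?T K) x * jmono k L v)
        = jmono k K (jlin c d (snd c x) v) + (\<Sum>L | L \<in> ?T \<and> sq k L \<le> sq k K - 1. a L (snd c x) * jmono k L v)"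
      using eq[rule_format, OF f(1) fc] unfolding a[rule_format] f(2) cong congl by (rule trans[OF sym])
  qed
qed

text \<open>Both kinds of frame change expand the same leading polynomial, one exactly and the other
  up to smaller \<open>sq\<close>. Comparing coefficients identifies the diagonal blocks and
  annihilates the entries on one side of them.\<close>

lemma bt_changes:
  assumes c: "c \<in> A" "d \<in> A" and x: "x \<in> fst c" "x \<in> fst d"
    and g: "changes (jrank k m) (fst c) (frames_J k m c) (jrank k m) (fst d) (frames_J k m d) g"
    and h: "\<And>I. I \<in> weighted_indices k m \<Longrightarrow>
      changes (srank k m I) (fst c) (frames_S k m I c) (srank k m I) (fst d) (frames_S k m I d) (h I)"
  shows "bt k m (\<lambda>i j. g i j x) (\<lambda>I i j. h I i j x)"
proof -
  let ?E = "jet_exponents k m"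
  have coeff: "g (ix ?E L) (ix ?E K) x = (if tp k L = tp k K then h (tp k K) (six k m (tp k K) L) (six k m (tp k K) K) x else 0)"
    if K: "K \<in> ?E" and L: "L \<in> ?E" and s: "sq k K \<le> sq k L" for K L
  proof -
    let ?I = "tp k K"
    have I: "?I \<in> weighted_indices k m" by (rule tp_weighted[OF K])
    have KI: "K \<in> typed k m ?I" using K by (simp add: typed_iff[OF I])
    obtain a where a: "\<forall>v. (\<Sum>L\<in>?E. g (ix ?E L) (ix ?E K) x * jmono k L v)
      = jmono k K (jlin c d (snd c x) v) + (\<Sum>L | L \<in> ?E \<and> sq k L \<le> sq k K - 1. a L * jmono k L v)"
      using frames_J_change[OF c x g K] by (elim exE)
    \<comment> \<open>The difference of the two expansions. By independence each coefficient
      vanishes, and for \<open>sq k K \<le> sq k L\<close> the last term is absent.\<close>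
    define b where "b L = g (ix ?E L) (ix ?E K) x - (if tp k L = ?I then h ?I (six k m ?I L) (six k m ?I K) x else 0)
      - (if sq k L \<le> sq k K - 1 then a L else 0)" for L
    have "b L = 0"
    proof (rule jmono_independent[where a = b and k = k and m = m, OF _ L])
      fix v
      have 1: "(\<Sum>L\<in>?E. (if tp k L = ?I then h ?I (six k m ?I L) (six k m ?I K) x else 0) * jmono k L v)
          = (\<Sum>L\<in>typed k m ?I. h ?I (six k m ?I L) (six k m ?I K) x * jmono k L v)"
        by (rule sum.mono_neutral_cong_right[OF finite_jet_exponents]) (auto simp: typed_iff[OF I])
      have 2: "(\<Sum>L\<in>?E. (if sq k L \<le> sq k K - 1 then a L else 0) * jmono k L v) = (\<Sum>L | L \<in> ?E \<and> sq k L \<le> sq k K - 1. a L * jmono k L v)"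
        by (rule sum.mono_neutral_cong_right[OF finite_jet_exponents]) auto
      show "(\<Sum>L\<in>?E. b L * jmono k L v) = 0"
        unfolding b_def left_diff_distrib sum_subtractf 1 2 a[rule_format] frames_S_change[OF I c x h[OF I] KI] by simp
    qed
    then show ?thesis using s by (simp add: b_def)
  qed
  show ?thesis
  proof (rule btI)
    show "g (ix ?E K) (ix ?E L) x = h (tp k K) (six k m (tp k K) K) (six k m (tp k K) L) x"
      if "K \<in> ?E" "L \<in> ?E" "tp k K = tp k L" for K L
      using coeff[OF that(2,1)] sq_tp[OF that(3)] that(3) by simp
    show "g (ix ?E K) (ix ?E L) x = 0" if "K \<in> ?E" "L \<in> ?E" "tp k K \<noteq> tp k L" "sq k L \<le> sq k K" for K L
      using coeff[OF that(2,1,4)] that(3) by simp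
  qed
qed

end

section \<open>Chern forms of block triangular curvature\<close>

lemma bt_cong:
  assumes "bt k m M N" "\<And>i j. i < jrank k m \<Longrightarrow> j < jrank k m \<Longrightarrow> M' i j = M i j"
    "\<And>I i j. I \<in> weighted_indices k m \<Longrightarrow> i < srank k m I \<Longrightarrow> j < srank k m I \<Longrightarrow> N' I i j = N I i j"
  shows "bt k m M' N'"
proof (rule btI)
  note lt = ix(1)[OF finite_jet_exponents]
  fix K L assume K: "K \<in> jet_exponents k m" and L: "L \<in> jet_exponents k m"
  show "M' (jix k m K) (jix k m L) = N' (tp k K) (six k m (tp k K) K) (six k m (tp k K) L)"
    if t: "tp k K = tp k L"
  proof -
    note I = tp_weighted[OF K]
    have "K \<in> typed k m (tp k K)" by (rule iffD2[OF typed_iff[OF I]]) (simp add: K)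
    moreover have "L \<in> typed k m (tp k K)" by (rule iffD2[OF typed_iff[OF I]]) (simp add: L t)
    ultimately show ?thesis unfolding assms(2)[OF lt[OF K] lt[OF L]] btD(1)[OF assms(1) K L t]
      by (intro assms(3)[OF I, symmetric] ix(1)[OF finite_typed])
  qed
  show "M' (jix k m K) (jix k m L) = 0" if "tp k K \<noteq> tp k L" "sq k L \<le> sq k K"
    unfolding assms(2)[OF lt[OF K] lt[OF L]] by (rule btD(2)[OF assms(1) K L that])
qed

text \<open>A derivative at \<open>z\<close> depends on a neighbourhood, so the block shape is
  assumed on an open set and not just at \<open>z\<close>.\<close>

lemma bt_dext:
  assumes "open S" "z \<in> S" "\<And>y. y \<in> S \<Longrightarrow> bt k m (M y) (N y)"
  shows "bt k m (\<lambda>i j. dext (\<lambda>y. M y i j) z) (\<lambda>I i j. dext (\<lambda>y. N y I i j) z)"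
proof (rule btI)
  fix K L assume K: "K \<in> jet_exponents k m" and L: "L \<in> jet_exponents k m"
  show "dext (\<lambda>y. M y (jix k m K) (jix k m L)) z
      = dext (\<lambda>y. N y (tp k K) (six k m (tp k K) K) (six k m (tp k K) L)) z" if "tp k K = tp k L"
    by (rule dext_cong[OF assms(1,2)]) (rule btD(1)[OF assms(3) K L that])
  have "dext (\<lambda>y. M y (jix k m K) (jix k m L)) z = dext (\<lambda>y. 0) z" if "tp k K \<noteq> tp k L" "sq k L \<le> sq k K"
    by (rule dext_cong[OF assms(1,2)]) (rule btD(2)[OF assms(3) K L that])
  then show "dext (\<lambda>y. M y (jix k m K) (jix k m L)) z = 0" if "tp k K \<noteq> tp k L" "sq k L \<le> sq k K"
    using that by (simp add: dext_zero)
qed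

lemma bt_curv:
  assumes "open S" "z \<in> S" "\<And>y. y \<in> S \<Longrightarrow> bt k m (M y) (\<lambda>I. N I y)"
  shows "bt k m (curv (jrank k m) M z) (\<lambda>I. curv (srank k m I) (N I) z)"
  unfolding curv_def madd_def dmat_def
  by (rule bt_add[OF bt_dext[OF assms(1,2), of k m M "\<lambda>y I. N I y"] bt_mmul]) (rule assms(2) assms(3)| assumption)+

text \<open>Off the diagonal, the pairs of indices form the strict part of the order and its mirror
  image, and commutation makes both parts contribute equally.\<close>

lemma square_sum_order:
  fixes a :: "'b \<Rightarrow> 'r::ring"
  assumes "finite W" "linear_order_on W ord" "\<And>I J. I \<in> W \<Longrightarrow> J \<in> W \<Longrightarrow> a I * a J = a J * a I"
  shows "(\<Sum>I\<in>W. a I) * (\<Sum>I\<in>W. a I) = (\<Sum>I\<in>W. a I * a I) + (\<Sum>p\<in>{(I, J) \<in> ord. I \<noteq> J}. a (fst p) * a (snd p))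
    + (\<Sum>p\<in>{(I, J) \<in> ord. I \<noteq> J}. a (fst p) * a (snd p))"
proof -
  let ?P = "{(I, J) \<in> ord. I \<noteq> J}" and ?D = "(\<lambda>I. (I, I)) ` W" and ?f = "\<lambda>p. a (fst p) * a (snd p)"
  have ord: "ord \<subseteq> W \<times> W" "antisym ord" "total_on W ord"
    using assms(2) by (auto simp: linear_order_on_def partial_order_on_def preorder_on_def)
  have fin: "finite ?P" "finite (prod.swap ` ?P)" "finite ?D"
    using finite_subset[OF ord(1)] assms(1) by (auto intro: finite_subset[of _ ord])
  have W: "W \<times> W = ?D \<union> (?P \<union> prod.swap ` ?P)"
  proof (intro equalityI subsetI)
    fix p assume p: "p \<in> W \<times> W"
    then obtain I J where IJ: "p = (I, J)" "I \<in> W" "J \<in> W" by (elim SigmaE)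
    show "p \<in> ?D \<union> (?P \<union> prod.swap ` ?P)"
    proof (cases "I = J")
      case False
      then have "(I, J) \<in> ord \<or> (J, I) \<in> ord" using ord(3) IJ(2,3) by (simp add: total_on_def)
      then show ?thesis using False IJ(1) by (auto simp: image_iff)
    qed (use IJ in simp)
  qed (use ord(1) in auto)
  have d: "?D \<inter> (?P \<union> prod.swap ` ?P) = {}" "?P \<inter> prod.swap ` ?P = {}"
    using ord(2) by (auto simp: antisym_def)
  have "(\<Sum>I\<in>W. a I) * (\<Sum>I\<in>W. a I) = sum ?f (W \<times> W)"
    by (simp add: sum_product sum.cartesian_product case_prod_unfold)
  also have "\<dots> = sum ?f ?D + (sum ?f ?P + sum ?f (prod.swap ` ?P))"
    unfolding W using fin d by (simp add: sum.union_disjoint)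
  also have "sum ?f ?D = (\<Sum>I\<in>W. a I * a I)" by (subst sum.reindex) (simp_all add: inj_on_def)
  also have "sum ?f (prod.swap ` ?P) = sum ?f ?P"
  proof -
    have "sum ?f (prod.swap ` ?P) = (\<Sum>p\<in>?P. ?f (prod.swap p))" by (subst sum.reindex) (simp_all add: o_def)
    also have "\<dots> = sum ?f ?P" by (rule sum.cong[OF refl]) (use assms(3) ord(1) in auto)
    finally show ?thesis .
  qed
  finally show ?thesis by (simp only: add.assoc)
qed

text \<open>Traces are sums over the blocks. The square of the total trace exceeds the sum of the
  squares by the products over pairs, and these become the mixed terms of the second
  formula.\<close>

lemma bt_chern_val:
  assumes M: "bt k m M N" and even: "\<And>I. I \<in> weighted_indices k m \<Longrightarrow> grade (mtr (srank k m I) (N I)) = mtr (srank k m I) (N I)"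
    and ord: "linear_order_on (weighted_indices k m) ord"
  shows "chern_val 1 (jrank k m) M = (\<Sum>I\<in>weighted_indices k m. chern_val 1 (srank k m I) (N I))"
    and "chern_val 2 (jrank k m) M = (\<Sum>I\<in>weighted_indices k m. chern_val 2 (srank k m I) (N I)) +
      (\<Sum>p\<in>{(I, J) \<in> ord. I \<noteq> J}. chern_val 1 (srank k m (fst p)) (N (fst p)) * chern_val 1 (srank k m (snd p)) (N (snd p)))"
proof -
  let ?W = "weighted_indices k m" and ?P = "{(I, J) \<in> ord. I \<noteq> J}"
  define t where "t I = mtr (srank k m I) (N I)" for I
  define s where "s I = mtr (srank k m I) (mmul (srank k m I) (N I) (N I))" for I
  define q :: complex where "q = \<i> / (2 * of_real pi)"
  have tr: "mtr (jrank k m) M = (\<Sum>I\<in>?W. t I)" unfolding t_def by (rule bt_mtr[OF M])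
  have tr2: "mtr (jrank k m) (mmul (jrank k m) M M) = (\<Sum>I\<in>?W. s I)"
    unfolding s_def by (rule bt_mtr[OF bt_mmul[OF M M]])
  have v1: "chern_val 1 (srank k m I) (N I) = scal q * t I" for I by (simp add: chern_val_def q_def t_def)
  have v2: "chern_val 2 (srank k m I) (N I) = scal (q\<^sup>2 / 2) * (t I * t I - s I)" for I
    by (simp add: chern_val_def q_def t_def s_def)
  show "chern_val 1 (jrank k m) M = (\<Sum>I\<in>?W. chern_val 1 (srank k m I) (N I))"
    unfolding v1 by (simp add: chern_val_def tr q_def sum_distrib_left)
  have t: "grade (t I) = t I" if "I \<in> ?W" for I unfolding t_def by (rule even[OF that])
  have ord': "ord \<subseteq> ?W \<times> ?W" using ord by (auto simp: linear_order_on_def partial_order_on_def preorder_on_def)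
  have sqr: "(\<Sum>I\<in>?W. t I) * (\<Sum>I\<in>?W. t I) = (\<Sum>I\<in>?W. t I * t I) + (\<Sum>p\<in>?P. t (fst p) * t (snd p)) + (\<Sum>p\<in>?P. t (fst p) * t (snd p))"
    by (rule square_sum_order[OF finite_weighted ord]) (intro ext_commute_even t; assumption)
  \<comment> \<open>Each pair occurs twice, which cancels the 2 in the denominator of the second
    Chern form.\<close>
  have half: "scal (q\<^sup>2 / 2) * a + scal (q\<^sup>2 / 2) * a = scal (q\<^sup>2) * a" for a :: "'a ext"
    unfolding distrib_right[symmetric] scal_simps(1)[symmetric] by simp
  have mix: "scal (q\<^sup>2) * (t (fst p) * t (snd p)) = scal q * t (fst p) * (scal q * t (snd p))" if "p \<in> ?P" for p
  proof -
    have "fst p \<in> ?W" using that ord' by auto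
    then have "t (fst p) * scal q = scal q * t (fst p)" by (intro ext_commute_even t grade_scal)
    then show ?thesis using scal_simps(2)[of q q] by (metis mult.assoc power2_eq_square)
  qed
  have "chern_val 2 (jrank k m) M = scal (q\<^sup>2 / 2) * ((\<Sum>I\<in>?W. t I) * (\<Sum>I\<in>?W. t I) - (\<Sum>I\<in>?W. s I))"
    by (simp add: chern_val_def tr tr2 q_def)
  also have "\<dots> = scal (q\<^sup>2 / 2) * (\<Sum>I\<in>?W. t I * t I - s I) + scal (q\<^sup>2) * (\<Sum>p\<in>?P. t (fst p) * t (snd p))"
    unfolding sqr half[symmetric] sum_subtractf by (simp only: distrib_left right_diff_distrib) (simp only: diff_conv_add_uminus add_ac)
  also have "\<dots> = (\<Sum>I\<in>?W. scal (q\<^sup>2 / 2) * (t I * t I - s I)) + (\<Sum>p\<in>?P. scal (q\<^sup>2) * (t (fst p) * t (snd p)))"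
    by (simp only: sum_distrib_left)
  also have "(\<Sum>p\<in>?P. scal (q\<^sup>2) * (t (fst p) * t (snd p))) = (\<Sum>p\<in>?P. scal q * t (fst p) * (scal q * t (snd p)))"
    by (rule sum.cong[OF refl mix])
  finally show "chern_val 2 (jrank k m) M = (\<Sum>I\<in>?W. chern_val 2 (srank k m I) (N I)) +
      (\<Sum>p\<in>?P. chern_val 1 (srank k m (fst p)) (N (fst p)) * chern_val 1 (srank k m (snd p)) (N (snd p)))"
    unfolding v1 v2 .
qed

context surface_partition
begin

section \<open>Connections on the jet differentials and on the bundles S_I\<close>

lemma frame_J: "c \<in> A \<Longrightarrow> local_frame A (jet_differentials A k m) (jrank k m) (fst c) (frames_J k m c)"
  unfolding frames_J_def[abs_def] by (rule local_frame_jets)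

lemma frame_S: "I \<in> weighted_indices k m \<Longrightarrow> c \<in> A \<Longrightarrow> local_frame A (S_sheaf A I) (srank k m I) (fst c) (frames_S k m I c)"
  unfolding frames_S_def[abs_def] by (rule local_frame_S)

abbreviation conn_J :: "nat \<Rightarrow> nat \<Rightarrow> ('a, (complex \<Rightarrow> 'a) set) connection_forms" where
  "conn_J k m \<equiv> part_conn (jrank k m) (frames_J k m)"

abbreviation conn_S :: "nat \<Rightarrow> nat \<Rightarrow> nat list \<Rightarrow> ('a, (complex \<Rightarrow> 'a) set list list) connection_forms" where
  "conn_S k m I \<equiv> part_conn (srank k m I) (frames_S k m I)"

abbreviation "cmat_J k m c \<equiv> conn_mat (jrank k m) (conn_J k m) (fst c) (frames_J k m c) c"
abbreviation "cmat_S k m I c \<equiv> conn_mat (srank k m I) (conn_S k m I) (fst c) (frames_S k m I c) c"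
abbreviation "cform_J k m n \<equiv> chern_form_of n (jrank k m) (conn_J k m) (frames_J k m)"
abbreviation "cform_S k m I n \<equiv> chern_form_of n (srank k m I) (conn_S k m I) (frames_S k m I)"

text \<open>All sheaves use the same charts \<open>C n\<close> and the same functions
  \<open>\<rho> n\<close>, so the summands of their connections correspond block by block.\<close>

lemma bt_flat_term:
  assumes c: "c \<in> A" and z: "z \<in> cimg c (fst c)"
  shows "bt k m (\<lambda>i j. flat_term (jrank k m) (frames_J k m) (fst c) (frames_J k m c) n i j c z)
    (\<lambda>I i j. flat_term (srank k m I) (frames_S k m I) (fst c) (frames_S k m I c) n i j c z)"
proof (cases "cinv c z \<in> fst (C n)")
  case True
  let ?S = "cimg c (fst (C n))"
  have zS: "z \<in> ?S" using True cimg_iff[OF c z, of "fst (C n)"] by simp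
  let ?G = "trans_to (jrank k m) (frames_J k m) (fst c) (frames_J k m c) n"
  let ?H = "trans_from (jrank k m) (frames_J k m) (fst c) (frames_J k m c) n"
  let ?GS = "\<lambda>I. trans_to (srank k m I) (frames_S k m I) (fst c) (frames_S k m I c) n"
  let ?HS = "\<lambda>I. trans_from (srank k m I) (frames_S k m I) (fst c) (frames_S k m I c) n"
  note to = trans_to[OF frame_J frame_J[OF c], of k m n] and from' = trans_from[OF frame_J frame_J[OF c], of k m n]
  have toS: "changes (srank k m I) (fst c) (frames_S k m I c) (srank k m I) (fst (C n)) (frames_S k m I (C n)) (?GS I)"
    "changes (srank k m I) (fst (C n)) (frames_S k m I (C n)) (srank k m I) (fst c) (frames_S k m I c) (?HS I)"
    if I: "I \<in> weighted_indices k m" for I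
    by (rule trans_to[OF frame_S[OF I] frame_S[OF I c]] trans_from[OF frame_S[OF I] frame_S[OF I c]]; assumption)+
  have 1: "bt k m (\<lambda>i l. scal (?G i l (cinv c z))) (\<lambda>I i l. scal (?GS I i l (cinv c z)))"
    by (rule bt_map[where f = scal, OF bt_changes[OF c C cimgD(1)[OF c z] True to toS(1)]]) (simp_all add: scal_simps)
  \<comment> \<open>The inverse matrix is itself a frame change, so its block shape follows in the
    same way with the two charts exchanged.\<close>
  have 2: "bt k m (\<lambda>l j. scal (?H l j (cinv c y))) (\<lambda>I l j. scal (?HS I l j (cinv c y)))" if "y \<in> ?S" for y
    by (rule bt_map[where f = scal, OF bt_changes[OF C c cimgD(2)[OF c that] cimgD(1)[OF c that] from' toS(2)]]) (simp_all add: scal_simps)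
  have 3: "bt k m (\<lambda>l j. dext (\<lambda>y. scal (?H l j (cinv c y))) z) (\<lambda>I l j. dext (\<lambda>y. scal (?HS I l j (cinv c y))) z)"
    by (rule bt_dext[OF open_cimg[OF c chart_open[OF C]] zS]) (rule 2)
  have 4: "bt k m (\<lambda>i j. scal (\<rho> n (cinv c z)) * mmul (jrank k m) (\<lambda>i l. scal (?G i l (cinv c z))) (\<lambda>l j. dext (\<lambda>y. scal (?H l j (cinv c y))) z) i j)
    (\<lambda>I i j. scal (\<rho> n (cinv c z)) * mmul (srank k m I) (\<lambda>i l. scal (?GS I i l (cinv c z))) (\<lambda>l j. dext (\<lambda>y. scal (?HS I l j (cinv c y))) z) i j)"
    by (rule bt_map[where f = "\<lambda>a. scal (\<rho> n (cinv c z)) * a", OF bt_mmul[OF 1 3]]) simp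
  show ?thesis
    by (rule bt_cong[OF 4]) (simp_all add: flat_term_def mmul_def True)
next
  case False
  then show ?thesis by (simp add: flat_term_def bt_zero)
qed

lemma bt_conn_mat:
  assumes c: "c \<in> A" and z: "z \<in> cimg c (fst c)"
  shows "bt k m (cmat_J k m c z)
    (\<lambda>I. cmat_S k m I c z)"
  by (rule bt_cong[OF bt_sum[where S = "{..lastN (cinv c z)}", OF bt_flat_term[OF c z]]]) (simp_all add: conn_mat_def part_conn_def)

lemma chern_forms_J:
  assumes c: "c \<in> A" and z: "z \<in> cimg c UNIV" and ord: "linear_order_on (weighted_indices k m) ord"
  shows "at_pt (cform_J k m 1) c z
      = (\<Sum>I\<in>weighted_indices k m. at_pt (cform_S k m I 1) c z)"
    and "at_pt (cform_J k m 2) c z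
      = (\<Sum>I\<in>weighted_indices k m. at_pt (cform_S k m I 2) c z) +
        (\<Sum>p\<in>{(I, J) \<in> ord. I \<noteq> J}. at_pt (cform_S k m (fst p) 1) c z *
          at_pt (cform_S k m (snd p) 1) c z)"
proof -
  let ?S = "cimg c (fst c)"
  have z: "z \<in> ?S" using z by simp
  have op: "open ?S" by (rule open_cimg[OF c chart_open[OF c]])
  have B: "bt k m (curv (jrank k m) (cmat_J k m c) z)
    (\<lambda>I. curv (srank k m I) (cmat_S k m I c) z)"
    by (rule bt_curv[OF op z]) (rule bt_conn_mat[OF c])
  have even: "grade (mtr (srank k m I) (curv (srank k m I) (cmat_S k m I c) z))
      = mtr (srank k m I) (curv (srank k m I) (cmat_S k m I c) z)"
    if I: "I \<in> weighted_indices k m" for I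
  proof -
    note conn = part_conn[of "S_sheaf A I", OF frame_S[OF I]]
    have "even_mat ?S (curv (srank k m I) (cmat_S k m I c))"
      by (rule even_mat_curv[OF op conn_smooth_mat[OF conn frame_S[OF I c] c] conn_odd_mat[OF conn frame_S[OF I c] c]])
    from this[unfolded even_mat_def, rule_format, OF z] show ?thesis
      unfolding mtr_def grade_sum mgrade_def by (intro sum.cong refl) (drule fun_cong, drule fun_cong, assumption)
  qed
  note val = bt_chern_val[OF B even ord]
  show "at_pt (cform_J k m 1) c z
      = (\<Sum>I\<in>weighted_indices k m. at_pt (cform_S k m I 1) c z)"
    "at_pt (cform_J k m 2) c z
      = (\<Sum>I\<in>weighted_indices k m. at_pt (cform_S k m I 2) c z) +
        (\<Sum>p\<in>{(I, J) \<in> ord. I \<noteq> J}. at_pt (cform_S k m (fst p) 1) c z *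
          at_pt (cform_S k m (snd p) 1) c z)"
    unfolding chern_form_of_def at_pt_form_of by (rule val; assumption)+
qed

lemma chern_class_J: "n = 1 \<or> n = 2 \<Longrightarrow>
    chern_class A n (jet_differentials A k m) = coset_of (cform_J k m n)"
  and chern_form_J: "n = 1 \<or> n = 2 \<Longrightarrow> cform_J k m n \<in> carrier (closed_forms A)"
  by (rule chern_class_eq[OF part_conn[OF frame_J] frame_J] chern_form_of(1)[OF part_conn[OF frame_J] frame_J]; assumption)+

lemma chern_class_S: "I \<in> weighted_indices k m \<Longrightarrow> n = 1 \<or> n = 2 \<Longrightarrow>
    chern_class A n (S_sheaf A I) = coset_of (cform_S k m I n)"
  and chern_form_S: "I \<in> weighted_indices k m \<Longrightarrow> n = 1 \<or> n = 2 \<Longrightarrow>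
    cform_S k m I n \<in> carrier (closed_forms A)"
  by (rule chern_class_eq[OF part_conn[OF frame_S] frame_S] chern_form_of(1)[OF part_conn[OF frame_S] frame_S]; assumption)+

section \<open>Passage to cohomology classes\<close>

lemma coset_cong:
  assumes "\<eta> \<in> carrier (closed_forms A)" "\<eta>' \<in> carrier (closed_forms A)"
    "\<And>c z. c \<in> A \<Longrightarrow> z \<in> cimg c UNIV \<Longrightarrow> at_pt \<eta> c z = at_pt \<eta>' c z"
  shows "coset_of \<eta> = coset_of \<eta>'"
proof (rule coset_eqI)
  show "\<eta> \<in> forms A UNIV" "\<eta>' \<in> forms A UNIV" using assms(1,2) by (simp_all add: closed_forms_simps)
  show "fzero \<in> forms A UNIV" by (rule forms_zero)
  show "at_pt \<eta>' c z - at_pt \<eta> c z = dext (at_pt fzero c) z" if "c \<in> A" "z \<in> cimg c UNIV" for c z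
    using assms(3)[OF that] by (simp add: at_pt_fzero[abs_def] dext_zero)
qed

text \<open>The identities hold between closed forms at every point of every chart. The quotient map
  is a ring homomorphism, so it carries the sums and products to \<open>deRham A\<close>, and
  \<open>coset_cong\<close> ignores values outside the charts.\<close>

theorem chern_classes_jets:
  assumes ord: "linear_order_on (weighted_indices k m) ord"
  shows "chern_class A 1 (jet_differentials A k m) = (\<Oplus>\<^bsub>deRham A\<^esub>I\<in>weighted_indices k m. chern_class A 1 (S_sheaf A I))"
    and "chern_class A 2 (jet_differentials A k m) = (\<Oplus>\<^bsub>deRham A\<^esub>I\<in>weighted_indices k m. chern_class A 2 (S_sheaf A I))
      \<oplus>\<^bsub>deRham A\<^esub> finsum (deRham A) (\<lambda>(I, J). chern_class A 1 (S_sheaf A I) \<otimes>\<^bsub>deRham A\<^esub> chern_class A 1 (S_sheaf A J))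
        {(I, J) \<in> ord. I \<noteq> J}"
proof -
  let ?W = "weighted_indices k m" and ?P = "{(I, J) \<in> ord. I \<noteq> J}"
  interpret H: ring_hom_ring "closed_forms A" "deRham A" coset_of by (rule ring_hom_coset)
  define s where "s n I = cform_S k m I n" for n I
  define t where "t n = cform_J k m n" for n
  have s: "s n I \<in> carrier (closed_forms A)" if "I \<in> ?W" "n = 1 \<or> n = 2" for n I unfolding s_def by (rule chern_form_S[OF that])
  have t: "t n \<in> carrier (closed_forms A)" if "n = 1 \<or> n = 2" for n unfolding t_def by (rule chern_form_J[OF that])
  have ord': "ord \<subseteq> ?W \<times> ?W" using ord by (auto simp: linear_order_on_def partial_order_on_def preorder_on_def)
  have P: "fst p \<in> ?W" "snd p \<in> ?W" if "p \<in> ?P" for p using that ord' by auto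
  have finP: "finite ?P" by (rule finite_subset[of _ "?W \<times> ?W"]) (use ord' finite_weighted in auto)
  have n: "1 = (1::nat) \<or> 1 = (2::nat)" "2 = (1::nat) \<or> 2 = (2::nat)" by simp_all
  define w where "w p = s 1 (fst p) \<otimes>\<^bsub>closed_forms A\<^esub> s 1 (snd p)" for p
  have w: "w p \<in> carrier (closed_forms A)" if "p \<in> ?P" for p
    unfolding w_def by (intro H.R.m_closed s P that n)
  have S: "finsum (closed_forms A) (s n) ?W \<in> carrier (closed_forms A)" if "n = 1 \<or> n = 2" for n
    by (rule H.R.finsum_closed) (use s that in blast)
  have Pw: "finsum (closed_forms A) w ?P \<in> carrier (closed_forms A)"
    by (rule H.R.finsum_closed) (use w in blast)
  have fin_s: "at_pt (finsum (closed_forms A) (s n) ?W) c z = (\<Sum>I\<in>?W. at_pt (s n I) c z)" if "n = 1 \<or> n = 2" for n c z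
    by (rule finsum_closed_forms[OF finite_weighted]) (rule s[OF _ that])
  have fin_w: "at_pt (finsum (closed_forms A) w ?P) c z = (\<Sum>p\<in>?P. at_pt (w p) c z)" for c z
    by (rule finsum_closed_forms[OF finP]) (rule w)
  have homS: "coset_of (finsum (closed_forms A) (s n) ?W) = (\<Oplus>\<^bsub>deRham A\<^esub>I\<in>?W. chern_class A n (S_sheaf A I))" if "n = 1 \<or> n = 2" for n
  proof -
    have "coset_of (finsum (closed_forms A) (s n) ?W) = finsum (deRham A) (coset_of \<circ> s n) ?W"
      by (rule H.hom_finsum) (use s that in blast)
    also have "\<dots> = (\<Oplus>\<^bsub>deRham A\<^esub>I\<in>?W. chern_class A n (S_sheaf A I))"
    proof (rule H.S.finsum_cong')
      show "(\<lambda>I. chern_class A n (S_sheaf A I)) \<in> ?W \<rightarrow> carrier (deRham A)"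
        using H.hom_closed[OF s[OF _ that]] by (intro funcsetI) (simp only: chern_class_S[OF _ that] s_def)
    qed (simp_all add: chern_class_S[OF _ that] s_def)
    finally show ?thesis .
  qed
  have homP: "coset_of (finsum (closed_forms A) w ?P)
    = finsum (deRham A) (\<lambda>(I, J). chern_class A 1 (S_sheaf A I) \<otimes>\<^bsub>deRham A\<^esub> chern_class A 1 (S_sheaf A J)) ?P"
  proof -
    have eq: "coset_of (w p) = chern_class A 1 (S_sheaf A (fst p)) \<otimes>\<^bsub>deRham A\<^esub> chern_class A 1 (S_sheaf A (snd p))" if "p \<in> ?P" for p
      unfolding w_def H.hom_mult[OF s[OF P(1)[OF that] n(1)] s[OF P(2)[OF that] n(1)]]
      by (simp only: chern_class_S[OF P(1)[OF that] n(1)] chern_class_S[OF P(2)[OF that] n(1)] s_def)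
    have "coset_of (finsum (closed_forms A) w ?P) = finsum (deRham A) (coset_of \<circ> w) ?P"
      by (rule H.hom_finsum) (use w in blast)
    also have "\<dots> = finsum (deRham A) (\<lambda>p. chern_class A 1 (S_sheaf A (fst p)) \<otimes>\<^bsub>deRham A\<^esub> chern_class A 1 (S_sheaf A (snd p))) ?P"
    proof (rule H.S.finsum_cong')
      show "(\<lambda>p. chern_class A 1 (S_sheaf A (fst p)) \<otimes>\<^bsub>deRham A\<^esub> chern_class A 1 (S_sheaf A (snd p))) \<in> ?P \<rightarrow> carrier (deRham A)"
        using H.hom_closed[OF w] by (intro funcsetI) (simp only: eq)
    qed (simp_all only: o_apply eq)
    finally show ?thesis by (simp only: case_prod_unfold)
  qed
  have "coset_of (t 1) = coset_of (finsum (closed_forms A) (s 1) ?W)"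
  proof (rule coset_cong[OF t[OF n(1)] S[OF n(1)]])
    show "at_pt (t 1) c z = at_pt (finsum (closed_forms A) (s 1) ?W) c z" if "c \<in> A" "z \<in> cimg c UNIV" for c z
      unfolding fin_s[OF n(1)] unfolding s_def t_def by (rule chern_forms_J(1)[OF that ord])
  qed
  then show "chern_class A 1 (jet_differentials A k m) = (\<Oplus>\<^bsub>deRham A\<^esub>I\<in>?W. chern_class A 1 (S_sheaf A I))"
    unfolding chern_class_J[OF n(1)] homS[OF n(1)] t_def .
  have "coset_of (t 2) = coset_of (finsum (closed_forms A) (s 2) ?W \<oplus>\<^bsub>closed_forms A\<^esub> finsum (closed_forms A) w ?P)"
  proof (rule coset_cong[OF t[OF n(2)] H.R.a_closed[OF S[OF n(2)] Pw]])
    fix c z assume cz: "c \<in> A" "z \<in> cimg c UNIV"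
    have "at_pt (finsum (closed_forms A) (s 2) ?W \<oplus>\<^bsub>closed_forms A\<^esub> finsum (closed_forms A) w ?P) c z
      = (\<Sum>I\<in>?W. at_pt (s 2 I) c z) + (\<Sum>p\<in>?P. at_pt (w p) c z)"
      unfolding closed_forms_simps(5) at_pt_fadd fin_s[OF n(2)] fin_w ..
    also have "\<dots> = (\<Sum>I\<in>?W. at_pt (s 2 I) c z) + (\<Sum>p\<in>?P. at_pt (s 1 (fst p)) c z * at_pt (s 1 (snd p)) c z)"
      by (simp only: w_def closed_forms_simps at_pt_wedge)
    finally show "at_pt (t 2) c z = at_pt (finsum (closed_forms A) (s 2) ?W \<oplus>\<^bsub>closed_forms A\<^esub> finsum (closed_forms A) w ?P) c z"
      unfolding s_def t_def using chern_forms_J(2)[OF cz ord] by (rule trans[OF _ sym, rotated])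
  qed
  then show "chern_class A 2 (jet_differentials A k m) = (\<Oplus>\<^bsub>deRham A\<^esub>I\<in>?W. chern_class A 2 (S_sheaf A I))
      \<oplus>\<^bsub>deRham A\<^esub> finsum (deRham A) (\<lambda>(I, J). chern_class A 1 (S_sheaf A I) \<otimes>\<^bsub>deRham A\<^esub> chern_class A 1 (S_sheaf A J)) ?P"
    unfolding chern_class_J[OF n(2)] H.hom_add[OF S[OF n(2)] Pw] homS[OF n(2)] homP t_def .
qed

end

theorem lemma2p6:
  fixes A :: "('a::{t2_space,second_countable_topology}) chart set"
    and k m :: nat
    and ord :: "nat list rel"
  assumes "complex_surface A"
    and "k > 0" and "m > 0"
    and "linear_order_on (weighted_indices k m) ord"
  shows "chern_class A 1 (jet_differentials A k m) =
           (\<Oplus>\<^bsub>deRham A\<^esub>I\<in>weighted_indices k m. chern_class A 1 (S_sheaf A I)) \<and>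
         chern_class A 2 (jet_differentials A k m) =
           (\<Oplus>\<^bsub>deRham A\<^esub>I\<in>weighted_indices k m. chern_class A 2 (S_sheaf A I))
           \<oplus>\<^bsub>deRham A\<^esub>
           finsum (deRham A)
             (\<lambda>(I, J). chern_class A 1 (S_sheaf A I) \<otimes>\<^bsub>deRham A\<^esub> chern_class A 1 (S_sheaf A J))
             {(I, J) \<in> ord. I \<noteq> J}"
proof -
  interpret surface A by (rule surface.intro[OF assms(1)])
  obtain C \<rho> K W where "surface_partition A C \<rho> K W" using partition_exists by (elim exE)
  then interpret surface_partition A C \<rho> K W .
  show ?thesis using chern_classes_jets[OF assms(4)] by (rule conjI)
qed

end
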